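(* Let $(K,d_K)$ be a compact metric space and let $(K^{\mathbb Z},d,\sigma)$ be the full shift over $(K,d_K)$. Then for any $\mu\in M_\sigma(K^{\mathbb Z})$, $$\overline{\rm mdim}_M^{UC}(\sigma,G_\mu,d)=\overline{\rm dim}_B(K,d_K),$$ $$\overline{\rm mdim}_M^B(\sigma,G_\mu,d)=\overline{\rm mdim}_M^P(\sigma,G_\mu,d)=\limsup_{\epsilon\to0}\frac{1}{|\log\epsilon|}\inf_{{\rm diam}(\xi)<\epsilon}h_\mu(\sigma,\xi).$$
   Context: $\sigma:K^{\mathbb Z}\to K^{\mathbb Z}$ is the left shift $\sigma((x_n)_{n})=(x_{n+1})_{n}$, and $K^{\mathbb Z}$ carries the metric $d((x_n)_n,(y_n)_n)=\sum_{n\in\mathbb Z}\frac{d_K(x_n,y_n)}{2^{|n|}}$. $\overline{\rm dim}_B(K,d_K)$ is the upper box dimension of $K$ in the metric $d_K$. Write $X=K^{\mathbb Z}$, $f=\sigma$. $M_\sigma(K^{\mathbb Z})$ is the set of $\sigma$-invariant Borel probability measures on $K^{\mathbb Z}$. Generic points: $\mathcal E_n(x)=\frac1n\sum_{i=0}^{n-1}\delta_{f^ix}$; $V_f(x)$ is the set of weak$^*$ limit points of $\{\mathcal E_n(x)\}_{n\ge1}$; $G_\mu=\{x\in X: V_f(x)=\{\mu\}\}$. Kolmogorov–Sinai $\epsilon$-entropy: for a finite Borel partition $\xi$ of $X$, $h_\mu(f,\xi)=\lim_{n\to\infty}\frac1nH_\mu(\bigvee_{i=0}^{n-1}f^{-i}\xi)$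 with $H_\mu(\eta)=-\sum_{C\in\eta}\mu(C)\log\mu(C)$. $\inf_{{\rm diam}(\xi)<\epsilon}$ is over all finite Borel partitions $\xi$ of $X$ whose elements all have $d$-diameter less than $\epsilon$. Metric mean dimensions: $d_n(x,y)=\max_{0\le i\le n-1}d(f^ix,f^iy)$, $B_n(x,\epsilon)=\{y: d_n(x,y)<\epsilon\}$, $\overline B_n(x,\epsilon)=\{y: d_n(x,y)\le\epsilon\}$; $Z\subset X$, $s>0$, $N\in\mathbb N$, $\epsilon>0$. (UC) For non-empty $Z$, $E\subset Z$ is $(n,\epsilon)$-separated if $d_n(x,y)>\epsilon$ for all distinct $x,y\in E$; $s_n(Z,\epsilon)$ is the largest cardinality of such sets; $h^{UC}_{top}(f,Z,\epsilon)=\limsup_{n\to\infty}\frac1n\log s_n(Z,\epsilon)$. (B) $M(Z,s,N,\epsilon)=\inf\sum_{i\in I}e^{-n_is}$ over all finite or countable families $\{B_{n_i}(x_i,\epsilon)\}_{i\in I}$ covering $Z$ with $x_i\in X$, $n_i\ge N$; $M(Z,s,\epsilon)=\lim_{N\to\infty}M(Z,s,N,\epsilon)$; $h^B_{top}(f,Z,\epsilon)=\inf\{s>0:M(Z,s,\epsilon)=0\}$. (P) $P(Z,s,N,\epsilon)=\sup\sum_{i\in I}e^{-sn_i}$ over all finite or countable pairwise disjoint families $\{\overline B_{n_i}(x_i,\epsilon)\}_{i\in I}$ with $x_i\in Z$, $n_i\ge N$; $P(Z,s,\epsilon)=\lim_{N\to\infty}P(Z,s,N,\epsilon)$; $\mathcal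 P(Z,s,\epsilon)=\inf\{\sum_{i=1}^\infty P(Z_i,s,\epsilon):\bigcup_{i\ge1}Z_i\supseteq Z\}$; $h^P_{top}(f,Z,\epsilon)=\inf\{s>0:\mathcal P(Z,s,\epsilon)=0\}$. For $S\in\{UC,B,P\}$, $\overline{\rm mdim}_M^S(f,Z,d)=\limsup_{\epsilon\to0}h^S_{top}(f,Z,\epsilon)/|\log\epsilon|$. *)

theory Defs
  imports "HOL-Probability.Probability"
begin

section \<open>The full shift\<close>

definition shift :: "(int \<Rightarrow> 'k) \<Rightarrow> int \<Rightarrow> 'k" where
  "shift x = (\<lambda>n. x (n + 1))"

text \<open>
  This is not the library's instance \<open>dist\<close> on \<open>int \<Rightarrow> 'k\<close>. For compact \<open>'k\<close> the family below is
  summable and the metric induces the product topology, which is the topology of the library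
  instance; hence \<open>borel\<close> and \<open>continuous_on\<close> on \<open>int \<Rightarrow> 'k\<close> have their intended meaning.
\<close>

definition shift_dist :: "(int \<Rightarrow> 'k::metric_space) \<Rightarrow> (int \<Rightarrow> 'k) \<Rightarrow> real" where
  "shift_dist x y = (\<Sum>\<^sub>\<infinity>n\<in>UNIV. dist (x n) (y n) / 2 ^ nat \<bar>n\<bar>)"


section \<open>Invariant measures and generic points\<close>

definition borel_probs :: "'a::topological_space measure set" where
  "borel_probs = {\<mu>. prob_space \<mu> \<and> sets \<mu> = sets borel}"

definition invariant_probs :: "('a::topological_space \<Rightarrow> 'a) \<Rightarrow> 'a measure set" where
  "invariant_probs f = {\<mu> \<in> borel_probs. distr \<mu> borel f = \<mu>}"

definition empirical_measure ::
    "('a::topological_space \<Rightarrow> 'a) \<Rightarrow> nat \<Rightarrow> 'a \<Rightarrow> 'a measure" where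
  "empirical_measure f n x =
     measure_of UNIV (sets borel)
       (\<lambda>A. ennreal (1 / real n) * (\<Sum>i<n. emeasure (return borel ((f ^^ i) x)) A))"

text \<open>
  \<open>measure_of\<close> defaults to the zero measure if its argument is not countably additive; it is here.
\<close>

lemma sets_empirical_measure [simp, measurable_cong]:
  "sets (empirical_measure f n x) = sets borel"
  unfolding empirical_measure_def
  by (metis sets.sigma_sets_eq sets_measure_of space_borel sets.space_closed)

lemma emeasure_empirical_measure:
  fixes f :: "'a::topological_space \<Rightarrow> 'a"
  assumes A: "A \<in> sets borel"
  shows "emeasure (empirical_measure f n x) A =
    ennreal (1 / real n) * (\<Sum>i<n. emeasure (return borel ((f ^^ i) x)) A)"
proof (rule emeasure_measure_of[OF empirical_measure_def])
  show "sets borel \<subseteq> Pow (UNIV :: 'a set)"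
    by simp
  show "A \<in> sets (empirical_measure f n x)"
    using A by simp
  show "positive (sets (empirical_measure f n x))
      (\<lambda>A. ennreal (1 / real n) * (\<Sum>i<n. emeasure (return borel ((f ^^ i) x)) A))"
    by (simp add: positive_def)
  show "countably_additive (sets (empirical_measure f n x))
      (\<lambda>A. ennreal (1 / real n) * (\<Sum>i<n. emeasure (return borel ((f ^^ i) x)) A))"
  proof (rule countably_additiveI)
    fix B :: "nat \<Rightarrow> 'a set"
    assume B: "range B \<subseteq> sets (empirical_measure f n x)" and disj: "disjoint_family B"
    have "(\<Sum>k. emeasure (return borel y) (B k)) = emeasure (return borel y) (\<Union>k. B k)"
      for y :: 'a
      using B disj by (intro suminf_emeasure) auto
    then show "(\<Sum>k. ennreal (1 / real n) * (\<Sum>i<n. emeasure (return borel ((f ^^ i) x)) (B k)))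
      = ennreal (1 / real n) * (\<Sum>i<n. emeasure (return borel ((f ^^ i) x)) (\<Union>k. B k))"
      by (subst ennreal_suminf_cmult, subst suminf_sum) auto
  qed
qed

text \<open>
  Weak-* convergence is tested against all continuous real functions, which is appropriate for a
  compact space. A limit point of a sequence is the limit of one of its subsequences; on a compact
  metric space the weak-* topology on Borel probability measures is metrizable.
\<close>

definition weak_star_limit ::
    "(nat \<Rightarrow> 'a::topological_space measure) \<Rightarrow> 'a measure \<Rightarrow> bool" where
  "weak_star_limit m \<nu> \<longleftrightarrow>
     (\<forall>\<phi>::'a \<Rightarrow> real. continuous_on UNIV \<phi> \<longrightarrow>
        (\<lambda>n. integral\<^sup>L (m n) \<phi>) \<longlonglongrightarrow> integral\<^sup>L \<nu> \<phi>)"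

definition limit_measures ::
    "('a::topological_space \<Rightarrow> 'a) \<Rightarrow> 'a \<Rightarrow> 'a measure set" where
  "limit_measures f x =
     {\<nu> \<in> borel_probs.
        \<exists>r. strict_mono r \<and> weak_star_limit (\<lambda>k. empirical_measure f (r k) x) \<nu>}"

definition generic_points ::
    "('a::topological_space \<Rightarrow> 'a) \<Rightarrow> 'a measure \<Rightarrow> 'a set" where
  "generic_points f \<mu> = {x. limit_measures f x = {\<mu>}}"


section \<open>Kolmogorov--Sinai entropy at scale \<open>\<epsilon>\<close>\<close>

definition partition_entropy :: "'a measure \<Rightarrow> 'a set set \<Rightarrow> real" where
  "partition_entropy \<mu> \<eta> = - (\<Sum>C\<in>\<eta>. measure \<mu> C * ln (measure \<mu> C))"

definition dyn_refinement :: "('a \<Rightarrow> 'a) \<Rightarrow> 'a set set \<Rightarrow> nat \<Rightarrow> 'a set set" where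
  "dyn_refinement f \<xi> n =
     common_refinement ((\<lambda>i. (\<lambda>C. (f ^^ i) -` C) ` \<xi>) ` {..<n})"

definition ks_entropy :: "('a \<Rightarrow> 'a) \<Rightarrow> 'a measure \<Rightarrow> 'a set set \<Rightarrow> real" where
  "ks_entropy f \<mu> \<xi> = lim (\<lambda>n. partition_entropy \<mu> (dyn_refinement f \<xi> n) / real n)"

text \<open>The library's \<open>diameter\<close> is tied to the type class metric.\<close>

definition diam_wrt :: "('a \<Rightarrow> 'a \<Rightarrow> real) \<Rightarrow> 'a set \<Rightarrow> ereal" where
  "diam_wrt d A = (SUP (x, y)\<in>A \<times> A. ereal (d x y))"

definition fine_partitions ::
    "('a::topological_space \<Rightarrow> 'a \<Rightarrow> real) \<Rightarrow> real \<Rightarrow> 'a set set set" where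
  "fine_partitions d \<epsilon> =
     {\<xi>. finite \<xi> \<and> partition_on UNIV \<xi> \<and> \<xi> \<subseteq> sets borel \<and> (\<forall>C\<in>\<xi>. diam_wrt d C < ereal \<epsilon>)}"


section \<open>Bowen metrics\<close>

text \<open>
  At \<open>n = 0\<close> the maximum is unspecified. This affects none of the entropies below, since \<open>n = 0\<close>
  enters only for \<open>N = 0\<close>, or as a single term of a sequence, before a limit is taken.
\<close>

definition bowen_dist ::
    "('a \<Rightarrow> 'a) \<Rightarrow> ('a \<Rightarrow> 'a \<Rightarrow> real) \<Rightarrow> nat \<Rightarrow> 'a \<Rightarrow> 'a \<Rightarrow> real" where
  "bowen_dist f d n x y = Max ((\<lambda>i. d ((f ^^ i) x) ((f ^^ i) y)) ` {..<n})"

definition bowen_ball ::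
    "('a \<Rightarrow> 'a) \<Rightarrow> ('a \<Rightarrow> 'a \<Rightarrow> real) \<Rightarrow> nat \<Rightarrow> 'a \<Rightarrow> real \<Rightarrow> 'a set" where
  "bowen_ball f d n x \<epsilon> = {y. bowen_dist f d n x y < \<epsilon>}"

definition bowen_cball ::
    "('a \<Rightarrow> 'a) \<Rightarrow> ('a \<Rightarrow> 'a \<Rightarrow> real) \<Rightarrow> nat \<Rightarrow> 'a \<Rightarrow> real \<Rightarrow> 'a set" where
  "bowen_cball f d n x \<epsilon> = {y. bowen_dist f d n x y \<le> \<epsilon>}"


section \<open>Topological entropies of subsets at scale \<open>\<epsilon>\<close>\<close>

subsection \<open>Upper capacity entropy\<close>

definition separated ::
    "('a \<Rightarrow> 'a) \<Rightarrow> ('a \<Rightarrow> 'a \<Rightarrow> real) \<Rightarrow> nat \<Rightarrow> real \<Rightarrow> 'a set \<Rightarrow> bool" where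
  "separated f d n \<epsilon> E \<longleftrightarrow> (\<forall>x\<in>E. \<forall>y\<in>E. x \<noteq> y \<longrightarrow> bowen_dist f d n x y > \<epsilon>)"

text \<open>
  For a continuous map of a compact metric space, \<open>n \<ge> 1\<close> and \<open>\<epsilon> > 0\<close>, separated sets are finite of
  bounded cardinality, so the maximum exists.
\<close>

definition sep_number ::
    "('a \<Rightarrow> 'a) \<Rightarrow> ('a \<Rightarrow> 'a \<Rightarrow> real) \<Rightarrow> 'a set \<Rightarrow> nat \<Rightarrow> real \<Rightarrow> nat" where
  "sep_number f d Z n \<epsilon> = Max (card ` {E. E \<subseteq> Z \<and> finite E \<and> separated f d n \<epsilon> E})"

definition h_UC ::
    "('a \<Rightarrow> 'a) \<Rightarrow> ('a \<Rightarrow> 'a \<Rightarrow> real) \<Rightarrow> 'a set \<Rightarrow> real \<Rightarrow> ereal" where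
  "h_UC f d Z \<epsilon> = limsup (\<lambda>n. ereal (ln (real (sep_number f d Z n \<epsilon>)) / real n))"

subsection \<open>Bowen entropy\<close>

text \<open>Finite and countable families are indexed by arbitrary sets \<open>I\<close> of natural numbers.\<close>

definition bowen_covers ::
    "('a \<Rightarrow> 'a) \<Rightarrow> ('a \<Rightarrow> 'a \<Rightarrow> real) \<Rightarrow> 'a set \<Rightarrow> nat \<Rightarrow> real \<Rightarrow>
      (nat set \<times> (nat \<Rightarrow> 'a) \<times> (nat \<Rightarrow> nat)) set" where
  "bowen_covers f d Z N \<epsilon> =
     {(I, x, n). (\<forall>i\<in>I. N \<le> n i) \<and> Z \<subseteq> (\<Union>i\<in>I. bowen_ball f d (n i) (x i) \<epsilon>)}"

definition bowen_M_at ::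
    "('a \<Rightarrow> 'a) \<Rightarrow> ('a \<Rightarrow> 'a \<Rightarrow> real) \<Rightarrow> 'a set \<Rightarrow> real \<Rightarrow> nat \<Rightarrow> real \<Rightarrow> ennreal" where
  "bowen_M_at f d Z s N \<epsilon> =
     (INF (I, x, n)\<in>bowen_covers f d Z N \<epsilon>. \<Sum>\<^sub>\<infinity>i\<in>I. ennreal (exp (- real (n i) * s)))"

definition bowen_M ::
    "('a \<Rightarrow> 'a) \<Rightarrow> ('a \<Rightarrow> 'a \<Rightarrow> real) \<Rightarrow> 'a set \<Rightarrow> real \<Rightarrow> real \<Rightarrow> ennreal" where
  "bowen_M f d Z s \<epsilon> = lim (\<lambda>N. bowen_M_at f d Z s N \<epsilon>)"

definition h_B ::
    "('a \<Rightarrow> 'a) \<Rightarrow> ('a \<Rightarrow> 'a \<Rightarrow> real) \<Rightarrow> 'a set \<Rightarrow> real \<Rightarrow> ereal" where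
  "h_B f d Z \<epsilon> = (INF s\<in>{s. 0 < s \<and> bowen_M f d Z s \<epsilon> = 0}. ereal s)"

subsection \<open>Packing entropy\<close>

definition bowen_packings ::
    "('a \<Rightarrow> 'a) \<Rightarrow> ('a \<Rightarrow> 'a \<Rightarrow> real) \<Rightarrow> 'a set \<Rightarrow> nat \<Rightarrow> real \<Rightarrow>
      (nat set \<times> (nat \<Rightarrow> 'a) \<times> (nat \<Rightarrow> nat)) set" where
  "bowen_packings f d Z N \<epsilon> =
     {(I, x, n). (\<forall>i\<in>I. x i \<in> Z \<and> N \<le> n i) \<and>
        disjoint_family_on (\<lambda>i. bowen_cball f d (n i) (x i) \<epsilon>) I}"

definition packing_P_at ::
    "('a \<Rightarrow> 'a) \<Rightarrow> ('a \<Rightarrow> 'a \<Rightarrow> real) \<Rightarrow> 'a set \<Rightarrow> real \<Rightarrow> nat \<Rightarrow> real \<Rightarrow> ennreal" where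
  "packing_P_at f d Z s N \<epsilon> =
     (SUP (I, x, n)\<in>bowen_packings f d Z N \<epsilon>. \<Sum>\<^sub>\<infinity>i\<in>I. ennreal (exp (- s * real (n i))))"

definition packing_P ::
    "('a \<Rightarrow> 'a) \<Rightarrow> ('a \<Rightarrow> 'a \<Rightarrow> real) \<Rightarrow> 'a set \<Rightarrow> real \<Rightarrow> real \<Rightarrow> ennreal" where
  "packing_P f d Z s \<epsilon> = lim (\<lambda>N. packing_P_at f d Z s N \<epsilon>)"

definition packing_outer ::
    "('a \<Rightarrow> 'a) \<Rightarrow> ('a \<Rightarrow> 'a \<Rightarrow> real) \<Rightarrow> 'a set \<Rightarrow> real \<Rightarrow> real \<Rightarrow> ennreal" where
  "packing_outer f d Z s \<epsilon> =
     (INF Y\<in>{Y :: nat \<Rightarrow> 'a set. Z \<subseteq> (\<Union>i. Y i)}. \<Sum>i. packing_P f d (Y i) s \<epsilon>)"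

definition h_P ::
    "('a \<Rightarrow> 'a) \<Rightarrow> ('a \<Rightarrow> 'a \<Rightarrow> real) \<Rightarrow> 'a set \<Rightarrow> real \<Rightarrow> ereal" where
  "h_P f d Z \<epsilon> = (INF s\<in>{s. 0 < s \<and> packing_outer f d Z s \<epsilon> = 0}. ereal s)"


section \<open>Upper metric mean dimensions and upper box dimension\<close>

definition upper_mdim_UC ::
    "('a \<Rightarrow> 'a) \<Rightarrow> 'a set \<Rightarrow> ('a \<Rightarrow> 'a \<Rightarrow> real) \<Rightarrow> ereal" where
  "upper_mdim_UC f Z d = Limsup (at_right 0) (\<lambda>\<epsilon>. h_UC f d Z \<epsilon> / ereal \<bar>ln \<epsilon>\<bar>)"

definition upper_mdim_B ::
    "('a \<Rightarrow> 'a) \<Rightarrow> 'a set \<Rightarrow> ('a \<Rightarrow> 'a \<Rightarrow> real) \<Rightarrow> ereal" where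
  "upper_mdim_B f Z d = Limsup (at_right 0) (\<lambda>\<epsilon>. h_B f d Z \<epsilon> / ereal \<bar>ln \<epsilon>\<bar>)"

definition upper_mdim_P ::
    "('a \<Rightarrow> 'a) \<Rightarrow> 'a set \<Rightarrow> ('a \<Rightarrow> 'a \<Rightarrow> real) \<Rightarrow> ereal" where
  "upper_mdim_P f Z d = Limsup (at_right 0) (\<lambda>\<epsilon>. h_P f d Z \<epsilon> / ereal \<bar>ln \<epsilon>\<bar>)"

definition covering_number :: "'k::metric_space set \<Rightarrow> real \<Rightarrow> nat" where
  "covering_number A \<epsilon> =
     (LEAST m. \<exists>C. C \<subseteq> A \<and> finite C \<and> card C = m \<and> A \<subseteq> (\<Union>c\<in>C. ball c \<epsilon>))"

definition upper_box_dim :: "'k::metric_space set \<Rightarrow> ereal" where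
  "upper_box_dim A =
     Limsup (at_right 0) (\<lambda>\<epsilon>. ereal (ln (real (covering_number A \<epsilon>))) / ereal \<bar>ln \<epsilon>\<bar>)"

end

(*
  Upper capacity: changing finitely many coordinates of a generic point keeps it generic, so the
  coordinates in {0..<n} of points of G may be prescribed freely, and separated sets of G grow like
  powers of the covering numbers of K.

  Packing and Bowen entropy of G at scale \<epsilon> are at most h(\<xi>) for every partition \<xi> of mesh below \<epsilon>:
  long orbit segments of generic points are, up to \<epsilon>, labelled by words with the right empirical
  statistics, and there are about exp(n h(\<xi>)) of these.

  Conversely, let c(n) be the expectation of -ln of the \<mu>-measure of the neighbourhood, at a scale
  proportional to \<epsilon>, of a random word of length n. Selecting disjoint neighbourhoods of words greedily
  gives a block code of expected length about c(n); reading it along Rokhlin towers gives a partition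
  of mesh comparable to \<epsilon> and entropy at most (c(n) + ln 2) / n. So c(n) / n is bounded below by
  the infimum of h over fine partitions. Concatenating independent \<mu>-distributed blocks of lengths
  1, 2, 3, ... gives a random point which is almost surely generic and whose Bowen balls have
  probability about exp(-(c(1) + ... + c(j))) at time 1 + ... + j; the mass distribution principle turns
  this into lower bounds for both entropies. The constant factors between the scales disappear after
  division by the logarithm of \<epsilon>.
*)
theory Submission
  imports Defs
begin

section \<open>The shift space\<close>

text \<open>Nothing is known about \<open>\<mu>\<close> beyond invariance, and this shapes the
  proof. If \<open>\<mu>\<close> is not ergodic, its generic points form a \<open>\<mu>\<close>-null
  set, so the mass distribution for the lower bounds cannot be \<open>\<mu>\<close> itself; and
  local entropies need not be constant, so no pointwise entropy theorem yields the right number.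
  Independent blocks repair both: each block contributes its expected cost, and the costs add up by
  a law of large numbers. If \<open>\<mu>\<close> charges periodic orbits, Rokhlin towers fail
  there; on such points a label that records a whole period determines the next label and costs no
  entropy. A Bowen ball meets many words of any partition, so the lower bound has to produce a
  partition from the measures of neighbourhoods of words. Comparing two letters with the same code
  then takes four neighbour steps, hence the loss of a constant factor in the scale.
  Subprobabilities on words serve throughout as codes: they bound entropies by Gibbs' inequality and
  the number of words of large weight by counting.\<close>

definition sh :: "int \<Rightarrow> (int \<Rightarrow> 'k) \<Rightarrow> (int \<Rightarrow> 'k)" where
  "sh j x = (\<lambda>n. x (n + j))"

lemma sh_apply [simp]: "sh j x n = x (n + j)"
  by (simp add: sh_def)

lemma sh_sh [simp]: "sh i (sh j x) = sh (i + j) x"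
  by (simp add: sh_def fun_eq_iff add_ac)

lemma sh_comp: "sh i \<circ> sh j = sh (i + j)"
  by (simp add: fun_eq_iff add_ac)

lemma sh_0 [simp]: "sh 0 x = x"
  by (simp add: sh_def)

lemma shift_eq_sh: "shift = sh 1"
  by (simp add: shift_def sh_def fun_eq_iff)

lemma funpow_shift: "(shift ^^ i) = sh (int i)"
  by (induction i) (auto simp: shift_eq_sh fun_eq_iff add_ac)

lemma continuous_sh: "continuous_on S (sh j :: (int \<Rightarrow> 'k::topological_space) \<Rightarrow> _)"
  unfolding sh_def
  by (intro continuous_on_coordinatewise_then_product continuous_on_subset[OF continuous_on_product_coordinates]) auto

lemma measurable_sh: "sh j \<in> borel_measurable (borel :: (int \<Rightarrow> 'k::topological_space) measure)"
  by (intro borel_measurable_continuous_onI continuous_sh)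

lemma measurable_coord:
  "(\<lambda>x :: int \<Rightarrow> 'k::topological_space. x j) \<in> borel_measurable borel"
  by (intro borel_measurable_continuous_onI continuous_on_product_coordinates)

lemma compact_fun_UNIV:
  assumes "compact (UNIV :: 'k::topological_space set)"
  shows "compact (UNIV :: ('i \<Rightarrow> 'k) set)"
proof -
  have "compact_space (product_topology (\<lambda>_. euclidean) (UNIV :: 'i set) :: ('i \<Rightarrow> 'k) topology)"
    unfolding compact_space_product_topology using assms by (auto simp: compact_space_def)
  then show ?thesis
    unfolding compact_space_def by (simp add: euclidean_product_topology)
qed

section \<open>Comparison of \<open>shift_dist\<close> with coordinates and with the product
  topology\<close>

definition wt :: "int \<Rightarrow> real" where
  "wt n = 1 / 2 ^ nat \<bar>n\<bar>"

lemma wt_nonneg [simp]: "0 \<le> wt n" and wt_0 [simp]: "wt 0 = 1"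
  by (auto simp: wt_def)

lemma wt_summable: "wt summable_on UNIV"
proof -
  have g: "(\<lambda>n::nat. (1/2::real) ^ n) summable_on UNIV"
    by (subst summable_on_UNIV_nonneg_real_iff) (auto intro: summable_geometric)
  have 1: "wt summable_on range int"
    by (subst summable_on_reindex) (use g in \<open>auto simp: wt_def o_def power_one_over\<close>)
  have 2: "wt summable_on range (\<lambda>n. - int n)"
    by (subst summable_on_reindex) (use g in \<open>auto simp: wt_def o_def power_one_over inj_on_def\<close>)
  have "x \<in> range int \<union> range (\<lambda>n. - int n)" for x
    by (cases x rule: int_cases2) auto
  then have "UNIV = range int \<union> range (\<lambda>n. - int n)" by blast
  then show ?thesis using summable_on_union[OF 1 2] by simp
qed

text \<open>The value is 3; here it is just a constant by which scales may change.\<close>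

definition wt_sum :: real where "wt_sum = infsum wt UNIV"

lemma wt_sum_nonneg: "0 \<le> wt_sum"
  unfolding wt_sum_def by (rule infsum_nonneg) auto

lemma compact_dist_bound:
  assumes "compact (UNIV :: 'k::metric_space set)"
  obtains D where "D > 0" "\<And>x y :: 'k. dist x y \<le> D"
proof -
  obtain c D0 where D0: "\<And>x :: 'k. dist c x \<le> D0"
    using compact_imp_bounded[OF assms] unfolding bounded_def by blast
  have "dist x y \<le> 2 * \<bar>D0\<bar> + 1" for x y :: 'k
    using dist_triangle3[of x y c] D0[of x] D0[of y] by linarith
  then show ?thesis by (intro that[of "2 * \<bar>D0\<bar> + 1"]) auto
qed

lemma summable_shift_dist:
  fixes x y :: "int \<Rightarrow> 'k::metric_space"
  assumes "compact (UNIV :: 'k set)"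
  shows "(\<lambda>n. dist (x n) (y n) / 2 ^ nat \<bar>n\<bar>) summable_on A"
proof -
  obtain D where D: "D > 0" "\<And>x y :: 'k. dist x y \<le> D"
    using compact_dist_bound[OF assms] by blast
  have "(\<lambda>n. D * wt n) summable_on UNIV"
    by (intro summable_on_cmult_right wt_summable)
  then have "(\<lambda>n. dist (x n) (y n) / 2 ^ nat \<bar>n\<bar>) summable_on UNIV"
    by (rule summable_on_comparison_test) (use D in \<open>auto simp: wt_def divide_simps\<close>)
  then show ?thesis by (rule summable_on_subset) auto
qed

lemma shift_dist_self [simp]: "shift_dist x x = 0"
  by (simp add: shift_dist_def)

lemma shift_dist_commute: "shift_dist x y = shift_dist y x"
  by (simp add: shift_dist_def dist_commute)

lemma shift_dist_triangle:
  fixes x y z :: "int \<Rightarrow> 'k::metric_space"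
  assumes "compact (UNIV :: 'k set)"
  shows "shift_dist x z \<le> shift_dist x y + shift_dist y z"
  unfolding shift_dist_def
proof (subst infsum_add[symmetric], goal_cases)
  case 3
  show ?case
  proof (rule infsum_mono)
    fix n
    show "dist (x n) (z n) / 2 ^ nat \<bar>n\<bar> \<le> dist (x n) (y n) / 2 ^ nat \<bar>n\<bar> + dist (y n) (z n) / 2 ^ nat \<bar>n\<bar>"
      unfolding add_divide_distrib[symmetric] by (intro divide_right_mono dist_triangle) auto
  qed (intro summable_on_add summable_shift_dist assms)+
qed (intro summable_shift_dist assms)+

lemma dist_coord_le_shift_dist:
  fixes x y :: "int \<Rightarrow> 'k::metric_space"
  assumes "compact (UNIV :: 'k set)"
  shows "dist (x 0) (y 0) \<le> shift_dist x y"
  using finite_sum_le_infsum[OF summable_shift_dist[OF assms, of x y UNIV], of "{0}"]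
  by (simp add: shift_dist_def)

text \<open>A finite set of coordinates carries all but \<open>r / D\<close> of the total weight,
  \<open>D\<close> being a bound for distances in the alphabet. These coordinates contribute at most
  \<open>wt_sum * r\<close>, the tail at most \<open>D * (r / D)\<close>. Only the window radius
  \<open>m\<close> depends on \<open>r\<close>; the factor \<open>wt_sum + 1\<close> does not, so
  passing from coordinates to \<open>shift_dist\<close> costs a fixed factor of scale.\<close>

lemma shift_dist_le_coords:
  assumes K: "compact (UNIV :: 'k::metric_space set)" and r: "r > 0"
  shows "\<exists>m::nat. \<forall>x y :: int \<Rightarrow> 'k. (\<forall>j. \<bar>j\<bar> \<le> int m \<longrightarrow> dist (x j) (y j) \<le> r)
           \<longrightarrow> shift_dist x y \<le> (wt_sum + 1) * r"
proof -
  obtain D where D: "D > 0" "\<And>x y :: 'k. dist x y \<le> D"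
    using compact_dist_bound[OF K] by blast
  obtain F where F: "finite F" "dist (sum wt F) wt_sum \<le> r / D"
    using infsum_finite_approximation[OF wt_summable, of "r / D"] r D(1) unfolding wt_sum_def by auto
  obtain m where m: "\<And>j. j \<in> F \<Longrightarrow> \<bar>j\<bar> \<le> int m"
  proof
    fix j assume "j \<in> F"
    then have "nat \<bar>j\<bar> \<le> Max ((\<lambda>j. nat \<bar>j\<bar>) ` F)" using F(1) by (intro Max_ge) auto
    then show "\<bar>j\<bar> \<le> int (Max ((\<lambda>j. nat \<bar>j\<bar>) ` F))" by linarith
  qed
  have tail: "infsum wt (- F) = wt_sum - sum wt F"
  proof -
    have "wt_sum = infsum wt (F \<union> - F)" unfolding wt_sum_def by simp
    also have "\<dots> = infsum wt F + infsum wt (- F)"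
      by (rule infsum_Un_disjoint) (auto intro: summable_on_subset[OF wt_summable] F)
    finally show ?thesis using F by simp
  qed
  show ?thesis
  proof (intro exI[of _ m] allI impI)
    fix x y :: "int \<Rightarrow> 'k" assume xy: "\<forall>j. \<bar>j\<bar> \<le> int m \<longrightarrow> dist (x j) (y j) \<le> r"
    let ?t = "\<lambda>n. dist (x n) (y n) / 2 ^ nat \<bar>n\<bar>"
    have "shift_dist x y = infsum ?t (F \<union> - F)"
      by (simp add: shift_dist_def)
    also have "\<dots> = sum ?t F + infsum ?t (- F)"
      using F(1) by (subst infsum_Un_disjoint) (auto intro: summable_shift_dist[OF K])
    also have "sum ?t F \<le> (\<Sum>n\<in>F. r * wt n)"
      by (rule sum_mono) (use xy m in \<open>auto simp: wt_def divide_simps\<close>)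
    also have "infsum ?t (- F) \<le> infsum (\<lambda>n. D * wt n) (- F)"
    proof (rule infsum_mono)
      show "(\<lambda>n. D * wt n) summable_on - F"
        by (intro summable_on_cmult_right summable_on_subset[OF wt_summable]) auto
    qed (use D in \<open>auto simp: wt_def divide_simps intro: summable_shift_dist[OF K]\<close>)
    also have "infsum (\<lambda>n. D * wt n) (- F) = D * (wt_sum - sum wt F)"
      using tail by (simp add: infsum_cmult_right')
    also have "(\<Sum>n\<in>F. r * wt n) = r * sum wt F" by (simp add: sum_distrib_left)
    also have "r * sum wt F \<le> r * wt_sum"
      using r finite_sum_le_infsum[OF wt_summable F(1)] unfolding wt_sum_def by auto
    also have "D * (wt_sum - sum wt F) \<le> r"
    proof -
      have "wt_sum - sum wt F \<le> r / D" using F(2) by (auto simp: dist_real_def)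
      then show ?thesis using D(1) by (simp add: field_simps)
    qed
    finally show "shift_dist x y \<le> (wt_sum + 1) * r" by (simp add: algebra_simps)
  qed
qed

lemma uniform_coords:
  assumes K: "compact (UNIV :: 'k::metric_space set)" and e: "e > 0"
  shows "\<exists>\<delta>>0. \<forall>x y :: int \<Rightarrow> 'k. dist x y < \<delta> \<longrightarrow> (\<forall>j. \<bar>j\<bar> \<le> int m \<longrightarrow> dist (x j) (y j) < e)"
proof -
  have "\<exists>\<delta>>0. \<forall>x y :: int \<Rightarrow> 'k. dist x y < \<delta> \<longrightarrow> dist (x j) (y j) < e" for j
  proof -
    have "uniformly_continuous_on UNIV (\<lambda>x :: int \<Rightarrow> 'k. x j)"
      by (intro compact_uniformly_continuous continuous_on_product_coordinates compact_fun_UNIV K)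
    then obtain d where "d > 0" "\<forall>x\<in>UNIV. \<forall>x'\<in>UNIV. dist x' x < d \<longrightarrow> dist ((x' :: int \<Rightarrow> 'k) j) (x j) < e"
      using e unfolding uniformly_continuous_on_def by blast
    then show ?thesis by (intro exI[of _ d]) simp
  qed
  then obtain d where d: "\<And>j. d j > 0" "\<And>j x y :: int \<Rightarrow> 'k. dist x y < d j \<Longrightarrow> dist (x j) (y j) < e"
    by metis
  let ?J = "{- int m..int m}"
  have pos: "Min (d ` ?J) > 0" using d(1) by (subst Min_gr_iff) auto
  have le: "Min (d ` ?J) \<le> d j" if "\<bar>j\<bar> \<le> int m" for j
    using that by (intro Min_le) (auto intro!: imageI)
  show ?thesis
    by (intro exI[of _ "Min (d ` ?J)"] conjI allI impI pos) (rule d(2), erule less_le_trans, erule le)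
qed

text \<open>Topological arguments produce neighbourhoods in the library metric \<open>dist\<close>,
  while entropies are measured in \<open>shift_dist\<close>. Uniform continuity of finitely many
  coordinates links the two.\<close>

lemma shift_dist_uniform:
  assumes K: "compact (UNIV :: 'k::metric_space set)" and e: "e > 0"
  shows "\<exists>\<delta>>0. \<forall>x y :: int \<Rightarrow> 'k. dist x y < \<delta> \<longrightarrow> shift_dist x y < e"
proof -
  define r where "r = e / (2 * (wt_sum + 1))"
  have r: "r > 0" "(wt_sum + 1) * r < e"
    using e wt_sum_nonneg by (auto simp: r_def field_simps add_pos_nonneg)
  obtain m where m: "\<And>x y :: int \<Rightarrow> 'k. (\<forall>j. \<bar>j\<bar> \<le> int m \<longrightarrow> dist (x j) (y j) \<le> r)
      \<Longrightarrow> shift_dist x y \<le> (wt_sum + 1) * r"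
    using shift_dist_le_coords[OF K r(1)] by blast
  obtain d where "d > 0"
    "\<And>x y :: int \<Rightarrow> 'k. dist x y < d \<Longrightarrow> (\<forall>j. \<bar>j\<bar> \<le> int m \<longrightarrow> dist (x j) (y j) < r)"
    using uniform_coords[OF K r(1), of m] by blast
  then show ?thesis using r(2) by (intro exI[of _ d]) (auto intro!: le_less_trans[OF m] less_imp_le)
qed

text \<open>Uniform continuity on the compact product, together with the fact that finitely many
  coordinates control the library metric up to a small error.\<close>

lemma continuous_window:
  fixes \<phi> :: "(int \<Rightarrow> 'k::metric_space) \<Rightarrow> real"
  assumes K: "compact (UNIV :: 'k set)" and \<phi>: "continuous_on UNIV \<phi>" and e: "e > 0"
  shows "\<exists>r>0. \<exists>m::nat. \<forall>x y. (\<forall>j. \<bar>j\<bar> \<le> int m \<longrightarrow> dist (x j) (y j) < r) \<longrightarrow> \<bar>\<phi> x - \<phi> y\<bar> < e"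
proof -
  have "uniformly_continuous_on UNIV \<phi>"
    by (intro compact_uniformly_continuous \<phi> compact_fun_UNIV K)
  then obtain d where d: "d > 0" "\<And>x y. dist x y < d \<Longrightarrow> \<bar>\<phi> x - \<phi> y\<bar> < e"
  proof -
    obtain d where "d > 0" "\<forall>x\<in>UNIV. \<forall>x'\<in>UNIV. dist x' x < d \<longrightarrow> dist (\<phi> x') (\<phi> x) < e"
      using \<open>uniformly_continuous_on UNIV \<phi>\<close> e unfolding uniformly_continuous_on_def by blast
    then show ?thesis by (intro that[of d]) (auto simp: dist_real_def)
  qed
  obtain N where N: "(1/2::real) ^ N < d / 2"
    using real_arch_pow_inv[of "d/2" "1/2"] d(1) by fastforce
  let ?I = "(from_nat :: nat \<Rightarrow> int) ` {..N}"
  obtain m :: nat where m: "\<And>j. j \<in> ?I \<Longrightarrow> \<bar>j\<bar> \<le> int m"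
  proof
    fix j assume "j \<in> ?I"
    then have "nat \<bar>j\<bar> \<le> Max ((\<lambda>j. nat \<bar>j\<bar>) ` ?I)" by (intro Max_ge) auto
    then show "\<bar>j\<bar> \<le> int (Max ((\<lambda>j. nat \<bar>j\<bar>) ` ?I))" by linarith
  qed
  show ?thesis
  proof (intro exI[of _ "d / 4"] conjI exI[of _ m] allI impI)
    show "d / 4 > 0" using d by auto
    fix x y :: "int \<Rightarrow> 'k" assume xy: "\<forall>j. \<bar>j\<bar> \<le> int m \<longrightarrow> dist (x j) (y j) < d / 4"
    have "{dist (x (from_nat n)) (y (from_nat n))|n. n \<le> N} =
        (\<lambda>n. dist (x (from_nat n)) (y (from_nat n))) ` {..N}" by auto
    then have "Max {dist (x (from_nat n)) (y (from_nat n))|n. n \<le> N} < d / 4"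
      using xy m by (subst Max_less_iff) auto
    \<comment> \<open>The distance is at most twice the maximum over the listed coordinates, which
      is below \<open>d / 2\<close>, plus the tail \<open>(1/2) ^ N\<close>, which is below
      \<open>d / 2\<close> as well.\<close>
    then have "dist x y < d" using dist_fun_le_dist_first_terms[of x y N] N by linarith
    then show "\<bar>\<phi> x - \<phi> y\<bar> < e" by (rule d)
  qed
qed

section \<open>Finite Borel labellings of the alphabet\<close>

lemma measurable_finite_range:
  assumes "finite (range f)" and meas: "\<And>a. f -` {a} \<inter> space M \<in> sets M"
  shows "f \<in> M \<rightarrow>\<^sub>M count_space UNIV"
proof (rule measurableI)
  fix A
  have "f -` A \<inter> space M = (\<Union>a\<in>A \<inter> range f. f -` {a} \<inter> space M)" by auto
  then show "f -` A \<inter> space M \<in> sets M"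
    using assms by (simp only:) (intro sets.finite_UN, auto)
qed auto

text \<open>A point is labelled by the index of the first ball that contains it. The alphabet has
  exactly \<open>card C\<close> letters, which is what later ties word counts to covering
  numbers.\<close>

lemma ball_labelling:
  fixes C :: "'k::metric_space set"
  assumes C: "finite C" "UNIV = (\<Union>c\<in>C. ball c r)"
  shows "\<exists>a :: 'k \<Rightarrow> nat. range a \<subseteq> {..<card C} \<and> a \<in> borel \<rightarrow>\<^sub>M count_space UNIV
           \<and> (\<forall>x y. a x = a y \<longrightarrow> dist x y < 2 * r)"
proof -
  obtain e where e: "bij_betw e {..<card C} C"
    using ex_bij_betw_nat_finite[OF C(1)] by (auto simp: atLeast0LessThan)
  define a where "a x = (LEAST i. i < card C \<and> dist (e i) x < r)" for x
  have ex: "\<exists>i. i < card C \<and> dist (e i) x < r" for x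
  proof -
    obtain c where "c \<in> C" "dist c x < r" using C(2) by (auto simp: set_eq_iff)
    moreover have "c \<in> e ` {..<card C}" using e \<open>c \<in> C\<close> by (simp add: bij_betw_def)
    then obtain i where "i < card C" "c = e i" by blast
    ultimately show ?thesis by blast
  qed
  have a: "a x < card C" "dist (e (a x)) x < r" for x
    using LeastI_ex[OF ex[of x]] unfolding a_def by auto
  have "a \<in> borel \<rightarrow>\<^sub>M count_space UNIV"
  proof (rule measurable_finite_range)
    show "finite (range a)" using a(1) by (auto intro: finite_subset[of _ "{..<card C}"])
    fix n :: nat
    have *: "x \<in> a -` {n} \<longleftrightarrow> (n < card C \<and> dist (e n) x < r) \<and> (\<forall>i<n. \<not> (i < card C \<and> dist (e i) x < r))" for x
    proof
      assume "x \<in> a -` {n}"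
      then show "(n < card C \<and> dist (e n) x < r) \<and> (\<forall>i<n. \<not> (i < card C \<and> dist (e i) x < r))"
        using a[of x] not_less_Least[of _ "\<lambda>i. i < card C \<and> dist (e i) x < r"] unfolding a_def by blast
    next
      assume "(n < card C \<and> dist (e n) x < r) \<and> (\<forall>i<n. \<not> (i < card C \<and> dist (e i) x < r))"
      then have "a x = n" unfolding a_def by (intro Least_equality) (auto simp: not_less[symmetric])
      then show "x \<in> a -` {n}" by simp
    qed
    define B where "B i = (if i < card C then ball (e i) r else {})" for i
    have "a -` {n} = B n - (\<Union>i\<in>{..<n}. B i)"
      by (rule set_eqI, subst *) (auto simp: B_def split: if_splits)
    moreover have "B i \<in> sets borel" for i by (simp add: B_def)
    ultimately show "a -` {n} \<inter> space borel \<in> sets borel" by simp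
  qed
  moreover have "dist x y < 2 * r" if "a x = a y" for x y
    using a(2)[of x] a(2)[of y] that dist_triangle3[of x y "e (a x)"] by simp
  moreover have "range a \<subseteq> {..<card C}" using a(1) by auto
  ultimately show ?thesis by blast
qed

lemma compact_labelling:
  fixes r :: real
  assumes K: "compact (UNIV :: 'k::metric_space set)" and r: "r > 0"
  obtains N and a :: "'k::metric_space \<Rightarrow> nat" where "N > 0" "range a \<subseteq> {..<N}" "a \<in> borel \<rightarrow>\<^sub>M count_space UNIV"
    "\<And>x y. a x = a y \<Longrightarrow> dist x y < r"
proof -
  obtain C where C: "finite C" "UNIV \<subseteq> (\<Union>c\<in>C. ball (c::'k) (r/2))"
    using K r unfolding compact_eq_totally_bounded by (auto dest: spec[of _ "r/2"])
  then have C': "UNIV = (\<Union>c\<in>C. ball (c::'k) (r/2))" by auto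
  obtain a :: "'k \<Rightarrow> nat" where a: "range a \<subseteq> {..<card C}" "a \<in> borel \<rightarrow>\<^sub>M count_space UNIV"
    "\<forall>x y. a x = a y \<longrightarrow> dist x y < 2 * (r/2)"
    using ball_labelling[OF C(1) C'] by blast
  moreover have "card C > 0" using a(1) by (auto simp: image_subset_iff)
  ultimately show ?thesis by (intro that[of "card C" a]) auto
qed

section \<open>Invariance under all integer powers of the shift\<close>

locale invariant_measure =
  fixes \<mu> :: "(int \<Rightarrow> 'k::metric_space) measure"
  assumes K_compact: "compact (UNIV :: 'k set)" and invariant: "\<mu> \<in> invariant_probs shift"
begin

sublocale prob_space \<mu>
  using invariant by (simp add: invariant_probs_def borel_probs_def)

lemma sets_mu [simp, measurable_cong]: "sets \<mu> = sets borel"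
  using invariant by (simp add: invariant_probs_def borel_probs_def)

lemma space_mu [simp]: "space \<mu> = UNIV"
  using sets_eq_imp_space_eq[OF sets_mu] by simp

lemma measurable_sh_mu: "sh j \<in> borel_measurable \<mu>"
  using measurable_sh by (simp add: measurable_cong_sets[OF sets_mu refl])

lemma distr_distr_sh: "distr (distr \<mu> borel (sh i)) borel (sh j) = distr \<mu> borel (sh (i + j))"
proof -
  have "distr (distr \<mu> borel (sh i)) borel (sh j) = distr \<mu> borel (sh j \<circ> sh i)"
    by (rule distr_distr[OF measurable_sh measurable_sh_mu])
  then show ?thesis by (simp only: sh_comp add.commute)
qed

text \<open>Negative powers come from pushing forward by \<open>sh 1\<close> and then by
  \<open>sh (-1)\<close>, which together is the identity.\<close>

lemma distr_sh: "distr \<mu> borel (sh j) = \<mu>"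
proof -
  have 1: "distr \<mu> borel (sh 1) = \<mu>"
    using invariant by (simp add: invariant_probs_def shift_eq_sh)
  have "distr \<mu> borel (sh 0) = distr \<mu> \<mu> (\<lambda>x. x)" by (rule distr_cong) simp_all
  then have 0: "distr \<mu> borel (sh 0) = \<mu>" by (simp only: distr_id)
  have m1: "distr \<mu> borel (sh (-1)) = \<mu>"
    using distr_distr_sh[of 1 "-1"] by (simp only: 1 0 add.right_inverse)
  show ?thesis
  proof (induction j rule: int_induct[of _ 0])
    case base
    show ?case by (rule 0)
  next
    case (step1 i)
    show ?case using distr_distr_sh[of i 1] by (simp only: step1 1)
  next
    case (step2 i)
    show ?case using distr_distr_sh[of i "-1"] by (simp only: step2 m1 diff_conv_add_uminus)
  qed
qed

lemma measure_sh:
  assumes "A \<in> sets borel"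
  shows "measure \<mu> (sh j -` A) = measure \<mu> A"
proof -
  have "measure \<mu> A = measure (distr \<mu> borel (sh j)) A" by (simp add: distr_sh)
  also have "\<dots> = measure \<mu> (sh j -` A)" using measure_distr[OF measurable_sh_mu assms, of j] by simp
  finally show ?thesis by simp
qed

lemma integral_sh:
  fixes g :: "_ \<Rightarrow> real"
  assumes "g \<in> borel_measurable borel"
  shows "(\<integral>x. g (sh j x) \<partial>\<mu>) = (\<integral>x. g x \<partial>\<mu>)"
proof -
  have "(\<integral>x. g x \<partial>\<mu>) = (\<integral>x. g x \<partial>distr \<mu> borel (sh j))" by (simp add: distr_sh)
  also have "\<dots> = (\<integral>x. g (sh j x) \<partial>\<mu>)" by (rule integral_distr[OF measurable_sh_mu assms])
  finally show ?thesis by simp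
qed

end

section \<open>Entropy of finite labellings\<close>

text \<open>Labellings replace partitions throughout: joins become tuples of labels, refinement
  becomes factorization, and empty cells cannot occur because only labels in the range
  count.\<close>

definition fib :: "('a \<Rightarrow> 'l) \<Rightarrow> 'a set set" where
  "fib u = (\<lambda>a. u -` {a}) ` range u"

definition ent :: "'a measure \<Rightarrow> ('a \<Rightarrow> 'l) \<Rightarrow> real" where
  "ent M u = (\<Sum>a\<in>range u. - (measure M (u -` {a}) * ln (measure M (u -` {a}))))"

lemma partition_entropy_fib: "partition_entropy M (fib u) = ent M u"
proof -
  have "inj_on (\<lambda>a. u -` {a}) (range u)"
    by (rule inj_onI) blast
  then show ?thesis
    by (simp add: partition_entropy_def fib_def ent_def sum.reindex sum_negf)
qed

definition word :: "('a \<Rightarrow> 'a) \<Rightarrow> ('a \<Rightarrow> 'l) \<Rightarrow> nat \<Rightarrow> 'a \<Rightarrow> 'l list" where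
  "word f u n x = map (\<lambda>i. u ((f ^^ i) x)) [0..<n]"

lemma word_eq_iff: "word f u n x = word f u n y \<longleftrightarrow> (\<forall>i<n. u ((f ^^ i) x) = u ((f ^^ i) y))"
  by (auto simp: word_def)

lemma length_word [simp]: "length (word f u n x) = n"
  by (simp add: word_def)

lemma nth_word [simp]: "i < n \<Longrightarrow> word f u n x ! i = u ((f ^^ i) x)"
  by (simp add: word_def)

lemma set_word: "set (word f u n x) \<subseteq> range u"
  by (auto simp: word_def)

lemma word_add: "word f u (m + n) x = word f u m x @ word f u n ((f ^^ m) x)"
  by (rule nth_equalityI) (auto simp: nth_append funpow_add[symmetric, THEN fun_cong, unfolded o_def]
      add.commute simp del: funpow.simps)

lemma finite_range_word:
  assumes "finite (range u)"
  shows "finite (range (word f u n))"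
proof (rule finite_subset)
  show "range (word f u n) \<subseteq> {w. set w \<subseteq> range u \<and> length w = n}"
    using set_word by fastforce
  show "finite {w. set w \<subseteq> range u \<and> length w = n}"
    by (rule finite_lists_length_eq[OF assms])
qed

text \<open>A nonempty intersection of preimages of cells is determined by any one of its points,
  namely as the set of points with the same word. This carries the definition of entropy by
  partitions over to words.\<close>

lemma dyn_refinement_fib: "dyn_refinement f (fib u) n = fib (word f u n)"
proof -
  define P where "P i = (\<lambda>C. (f ^^ i) -` C) ` fib u" for i
  have PI: "C = {y. u ((f ^^ i) y) = u ((f ^^ i) x)}" if "C \<in> P i" "x \<in> C" for C i x
    using that by (auto simp: P_def fib_def)
  have mem: "{y. u ((f ^^ i) y) = u ((f ^^ i) x)} \<in> P i" for i x
    unfolding P_def fib_def image_image by (rule range_eqI[of _ _ "(f ^^ i) x"]) auto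
  have "common_refinement (P ` {..<n}) = fib (word f u n)"
  proof (intro equalityI subsetI)
    fix C assume "C \<in> common_refinement (P ` {..<n})"
    then obtain g where g: "g \<in> (\<Pi> Q\<in>P ` {..<n}. Q)" "C = \<Inter> (g ` P ` {..<n})" "C \<noteq> {}"
      unfolding common_refinement by blast
    then obtain x where x: "x \<in> C" by blast
    have "g (P i) = {y. u ((f ^^ i) y) = u ((f ^^ i) x)}" if "i < n" for i
    proof (rule PI)
      show "g (P i) \<in> P i" using g(1) that by (auto simp: Pi_iff)
      show "x \<in> g (P i)" using x g(2) that by auto
    qed
    then have "C = word f u n -` {word f u n x}"
      unfolding g(2) by (auto simp: word_eq_iff)
    then show "C \<in> fib (word f u n)" unfolding fib_def by blast
  next
    fix C assume "C \<in> fib (word f u n)"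
    then obtain x where C: "C = word f u n -` {word f u n x}"
      unfolding fib_def by blast
    \<comment> \<open>\<open>common_refinement\<close> is indexed by the set of partitions, in which
      equal \<open>P i\<close> and \<open>P j\<close> coincide; so the chosen cell may depend on the
      partition but not on the time.\<close>
    define g where "g Q = (SOME C. C \<in> Q \<and> x \<in> C)" for Q
    have g: "g (P i) \<in> P i \<and> x \<in> g (P i)" for i
      unfolding g_def by (rule someI[of _ "{y. u ((f ^^ i) y) = u ((f ^^ i) x)}"]) (use mem in auto)
    then have g': "g (P i) = {y. u ((f ^^ i) y) = u ((f ^^ i) x)}" for i
      by (intro PI) auto
    have "C = \<Inter> (g ` P ` {..<n})"
      unfolding C by (auto simp: word_eq_iff g')
    moreover have "g \<in> (\<Pi> Q\<in>P ` {..<n}. Q)" using g by auto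
    moreover have "x \<in> C" by (simp add: C)
    ultimately show "C \<in> common_refinement (P ` {..<n})"
      unfolding common_refinement by blast
  qed
  then show ?thesis by (simp add: dyn_refinement_def P_def)
qed

lemma partition_as_fib:
  assumes "partition_on UNIV \<xi>"
  obtains u where "fib u = \<xi>" "range u = \<xi>" "\<And>C. C \<in> \<xi> \<Longrightarrow> u -` {C} = C"
proof -
  have ex: "\<exists>!C. C \<in> \<xi> \<and> x \<in> C" for x
  proof (rule ex_ex1I)
    show "\<exists>C. C \<in> \<xi> \<and> x \<in> C"
      using assms unfolding partition_on_def by (metis UNIV_I UnionE)
    fix C D assume "C \<in> \<xi> \<and> x \<in> C" "D \<in> \<xi> \<and> x \<in> D"
    then show "C = D" using assms unfolding partition_on_def disjoint_def by blast
  qed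
  define u where "u x = (THE C. C \<in> \<xi> \<and> x \<in> C)" for x
  have u: "u x \<in> \<xi>" "x \<in> u x" for x using theI'[OF ex[of x]] by (auto simp: u_def)
  have eq: "u x = C" if "C \<in> \<xi>" "x \<in> C" for x C using ex[of x] u[of x] that by blast
  have fibre: "u -` {C} = C" if "C \<in> \<xi>" for C using u eq that by auto
  have "C \<in> range u" if "C \<in> \<xi>" for C
  proof -
    have "C \<noteq> {}" using assms that by (auto simp: partition_on_def)
    then show ?thesis using eq[OF that] by blast
  qed
  then have "range u = \<xi>" using u by auto
  moreover have "fib u = \<xi>" unfolding fib_def \<open>range u = \<xi>\<close> using fibre by auto
  ultimately show ?thesis using that fibre by blast
qed

locale full_prob = prob_space +
  assumes space_full: "space M = UNIV"
begin

lemma fibre_sets: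
  assumes "u \<in> M \<rightarrow>\<^sub>M count_space UNIV"
  shows "u -` A \<in> sets M"
  using measurable_sets[OF assms, of A] by (simp add: space_full)

lemma label_integral:
  fixes g :: "'l \<Rightarrow> real"
  assumes u: "u \<in> M \<rightarrow>\<^sub>M count_space UNIV" "finite (range u)"
  shows label_integrable: "integrable M (\<lambda>x. g (u x))"
    and label_integral_eq: "(\<integral>x. g (u x) \<partial>M) = (\<Sum>a\<in>range u. measure M (u -` {a}) * g a)"
proof -
  have eq: "(\<lambda>x. g (u x)) = (\<lambda>x. \<Sum>a\<in>range u. g a * indicator (u -` {a}) x)"
  proof
    fix x
    have "(\<Sum>a\<in>range u. g a * indicator (u -` {a}) x) = (\<Sum>a\<in>range u. if a = u x then g a else 0)"
      by (rule sum.cong) (auto simp: indicator_def)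
    also have "\<dots> = g (u x)" using u(2) by (subst sum.delta) auto
    finally show "g (u x) = (\<Sum>a\<in>range u. g a * indicator (u -` {a}) x)" by simp
  qed
  have ind: "integrable M (\<lambda>x. g a * indicator (u -` {a}) x)" for a
    by (intro integrable_mult_right integrable_real_indicator fibre_sets[OF u(1)])
       (simp add: emeasure_eq_measure)
  show "integrable M (\<lambda>x. g (u x))"
    unfolding eq by (rule Bochner_Integration.integrable_sum) (rule ind)
  show "(\<integral>x. g (u x) \<partial>M) = (\<Sum>a\<in>range u. measure M (u -` {a}) * g a)"
    unfolding eq by (subst Bochner_Integration.integral_sum[OF ind])
      (simp add: fibre_sets[OF u(1)] Int_absorb1 space_full mult.commute)
qed

lemma sum_fibres:
  assumes u: "u \<in> M \<rightarrow>\<^sub>M count_space UNIV" "finite (range u)"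
  shows "(\<Sum>a\<in>range u. measure M (u -` {a})) = 1"
  using label_integral_eq[OF u, of "\<lambda>_. 1"] by (simp add: prob_space)

lemma ent_integral:
  assumes u: "u \<in> M \<rightarrow>\<^sub>M count_space UNIV" "finite (range u)"
  shows "ent M u = (\<integral>x. - ln (measure M (u -` {u x})) \<partial>M)"
  using label_integral_eq[OF u, of "\<lambda>a. - ln (measure M (u -` {a}))"] by (simp add: ent_def)

lemma ent_nonneg: "0 \<le> ent M u"
proof -
  have "measure M (u -` {a}) * ln (measure M (u -` {a})) \<le> 0" for a
  proof (cases "measure M (u -` {a}) = 0")
    case False
    then have "measure M (u -` {a}) > 0" by (simp add: order.strict_iff_order)
    then show ?thesis by (intro mult_nonneg_nonpos) (auto simp: ln_le_zero_iff)
  qed auto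
  then show ?thesis unfolding ent_def by (intro sum_nonneg) (simp add: minus_mult_right[symmetric] del: minus_mult_right)
qed

text \<open>Every subprobability \<open>q\<close> on the labels is a code whose expected length
  bounds the entropy. Subadditivity, the Markov bound and the word count all rest on this.\<close>

lemma gibbs:
  assumes u: "u \<in> M \<rightarrow>\<^sub>M count_space UNIV" "finite (range u)"
    and pos: "\<And>a. measure M (u -` {a}) > 0 \<Longrightarrow> q a > 0"
    and nonneg: "\<And>a. a \<in> range u \<Longrightarrow> q a \<ge> 0"
    and le1: "(\<Sum>a\<in>range u. q a) \<le> 1"
  shows "ent M u \<le> (\<integral>x. - ln (q (u x)) \<partial>M)"
proof -
  let ?P = "\<lambda>a. measure M (u -` {a})"
  \<comment> \<open>The tangent bound \<open>ln t \<le> t - 1\<close> at the quotient of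
    \<open>q a\<close> by the measure of the fibre. The corrections \<open>q a - ?P a\<close> add up
    to at most 0.\<close>
  have "- (?P a * ln (?P a)) \<le> ?P a * - ln (q a) + (q a - ?P a)" if "a \<in> range u" for a
  proof (cases "?P a = 0")
    case True then show ?thesis using nonneg[OF that] by simp
  next
    case False
    then have P: "?P a > 0" by (simp add: order.strict_iff_order)
    have "ln (q a / ?P a) \<le> q a / ?P a - 1" using P pos[OF P] by (intro ln_le_minus_one) auto
    then have "?P a * (ln (q a) - ln (?P a)) \<le> ?P a * (q a / ?P a - 1)"
      using P pos[OF P] by (intro mult_left_mono) (auto simp: ln_div)
    then show ?thesis using P by (simp add: algebra_simps)
  qed
  then have "ent M u \<le> (\<Sum>a\<in>range u. ?P a * - ln (q a) + (q a - ?P a))"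
    unfolding ent_def by (rule sum_mono)
  also have "\<dots> = (\<integral>x. - ln (q (u x)) \<partial>M) + ((\<Sum>a\<in>range u. q a) - 1)"
    by (simp only: sum.distrib sum_subtractf sum_fibres[OF u] label_integral_eq[OF u, of "\<lambda>a. - ln (q a)"])
  finally show ?thesis using le1 by linarith
qed

text \<open>If \<open>u\<close> determines \<open>v\<close>, each fibre of \<open>u\<close> lies in
  a fibre of \<open>v\<close>, so minus the logarithm of the measure of the fibre can only grow in
  passing from \<open>v\<close> to \<open>u\<close>.\<close>

lemma ent_mono:
  assumes u: "u \<in> M \<rightarrow>\<^sub>M count_space UNIV" "finite (range u)"
    and v: "v \<in> M \<rightarrow>\<^sub>M count_space UNIV" "finite (range v)"
    and fac: "\<And>x y. u x = u y \<Longrightarrow> v x = v y"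
  shows "ent M v \<le> ent M u"
proof -
  define h where "h a = v (SOME x. u x = a)" for a
  have h: "v x = h (u x)" for x
    unfolding h_def by (rule fac) (metis (mono_tags, lifting) someI)
  have "ent M v = (\<integral>x. - ln (measure M (v -` {h (u x)})) \<partial>M)"
    using ent_integral[OF v] by (simp add: h)
  also have "\<dots> = (\<Sum>a\<in>range u. measure M (u -` {a}) * - ln (measure M (v -` {h a})))"
    by (rule label_integral_eq[OF u])
  also have "\<dots> \<le> (\<Sum>a\<in>range u. - (measure M (u -` {a}) * ln (measure M (u -` {a}))))"
  proof (rule sum_mono)
    fix a assume "a \<in> range u"
    have le: "measure M (u -` {a}) \<le> measure M (v -` {h a})"
      by (intro finite_measure_mono fibre_sets[OF v(1)]) (auto simp: h)
    show "measure M (u -` {a}) * - ln (measure M (v -` {h a})) \<le> - (measure M (u -` {a}) * ln (measure M (u -` {a})))"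
    proof (cases "measure M (u -` {a}) = 0")
      case False
      then have "measure M (u -` {a}) > 0" by (simp add: order.strict_iff_order)
      then show ?thesis using le by simp
    qed auto
  qed
  finally show ?thesis by (simp add: ent_def)
qed

end

section \<open>Subadditivity and the entropy rate of a labelling\<close>

text \<open>Fekete's lemma; the limit is the infimum of \<open>a n / n\<close> over
  \<open>n \<ge> 1\<close>. Division with remainder by a near-optimal \<open>m\<close> gives the
  upper estimate.\<close>

lemma fekete:
  fixes a :: "nat \<Rightarrow> real"
  assumes sub: "\<And>m n. a (m + n) \<le> a m + a n" and nonneg: "\<And>n. 0 \<le> a n"
  shows "convergent (\<lambda>n. a n / real n)"
proof -
  define L where "L = (INF n\<in>{1..}. a n / real n)"
  have bdd: "bdd_below ((\<lambda>n. a n / real n) ` {1..})"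
    using nonneg by (intro bdd_belowI[of _ 0]) auto
  have "(\<lambda>n. a n / real n) \<longlonglongrightarrow> L"
  proof (rule LIMSEQ_I)
    fix e :: real assume "e > 0"
    then have "L < L + e / 2" by simp
    then obtain m where m: "m \<ge> 1" "a m / real m < L + e / 2"
      unfolding L_def by (subst (asm) cINF_less_iff[OF _ bdd]) auto
    \<comment> \<open>Bounds \<open>a r\<close> for all possible remainders \<open>r\<close> modulo
      \<open>m\<close> at once, since the terms are nonnegative.\<close>
    define B where "B = (\<Sum>r<m. a r)"
    have mult: "a (k * m + r) \<le> real k * a m + a r" for k r
    proof (induction k)
      case (Suc k)
      have "a (Suc k * m + r) \<le> a m + a (k * m + r)"
        using sub[of m "k * m + r"] by (simp add: add_ac)
      then show ?case using Suc by (simp add: algebra_simps)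
    qed simp
    have upper: "a n / real n \<le> a m / real m + B / real n" if "n \<ge> 1" for n
    proof -
      have "a n \<le> real (n div m) * a m + a (n mod m)"
        using mult[of "n div m" "n mod m"] by simp
      also have "a (n mod m) \<le> B"
        unfolding B_def using m by (intro member_le_sum) (auto simp: nonneg)
      also have "real (n div m) * a m \<le> (real n / real m) * a m"
        by (intro mult_right_mono nonneg) (rule of_nat_div_le_of_nat)
      finally have "a n / real n \<le> ((real n / real m) * a m + B) / real n"
        using that by (intro divide_right_mono) auto
      then show ?thesis using that by (simp add: add_divide_distrib)
    qed
    obtain N :: nat where N: "B / (e / 2) < real N" using reals_Archimedean2 by blast
    show "\<exists>no. \<forall>n\<ge>no. norm (a n / real n - L) < e"
    proof (intro exI[of _ "max N 1"] allI impI)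
      fix n assume n: "n \<ge> max N 1"
      have "L \<le> a n / real n" unfolding L_def using n by (intro cINF_lower[OF bdd]) auto
      moreover have "B / real n < e / 2"
      proof -
        have "B / (e / 2) < real n" using N n by linarith
        then show ?thesis using n \<open>e > 0\<close> by (simp add: field_simps)
      qed
      moreover have "a n / real n \<le> a m / real m + B / real n" using upper[of n] n by auto
      ultimately have "a n / real n - L < e" "0 \<le> a n / real n - L" using m(2) by linarith+
      then show "norm (a n / real n - L) < e" by simp
    qed
  qed
  then show ?thesis by (auto simp: convergent_def)
qed

context invariant_measure
begin

sublocale full_prob \<mu>
  by unfold_locales simp

abbreviation labels :: "((int \<Rightarrow> 'k) \<Rightarrow> 'l) \<Rightarrow> bool" where
  "labels u \<equiv> u \<in> borel \<rightarrow>\<^sub>M count_space UNIV \<and> finite (range u)"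

lemma labels_mu:
  assumes "labels u"
  shows "u \<in> \<mu> \<rightarrow>\<^sub>M count_space UNIV" "finite (range u)"
  using assms by (auto simp: measurable_cong_sets[OF sets_mu refl])

lemma labels_sh: 
  assumes "labels u"
  shows "labels (\<lambda>x. u (sh j x))"
  using measurable_compose[OF measurable_sh, of u "count_space UNIV" j] assms
  by (auto intro: finite_subset[of _ "range u"])

lemma labels_I:
  assumes "finite (range u)" "\<And>a. u -` {a} \<in> sets borel"
  shows "labels u"
  using assms by (auto intro: measurable_finite_range)

lemma labels_sets:
  assumes "labels u"
  shows "u -` A \<in> sets borel"
  using measurable_sets[of u borel "count_space UNIV" A] assms by simp

lemma labels_map:
  assumes "\<And>i. i \<in> set is \<Longrightarrow> labels (v i)"
  shows "labels (\<lambda>x. map (\<lambda>i. v i x) is)"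
proof (rule labels_I)
  have "finite {w. set w \<subseteq> (\<Union>i\<in>set is. range (v i)) \<and> length w = length is}"
    using assms by (intro finite_lists_length_eq) auto
  moreover have "range (\<lambda>x. map (\<lambda>i. v i x) is) \<subseteq> {w. set w \<subseteq> (\<Union>i\<in>set is. range (v i)) \<and> length w = length is}"
    by (auto intro!: bexI rangeI)
  ultimately show "finite (range (\<lambda>x. map (\<lambda>i. v i x) is))" by (rule rev_finite_subset)
  fix w
  have "(\<lambda>x. map (\<lambda>i. v i x) is) -` {w} =
    (if length w = length is then (\<Inter>k\<in>{..<length is}. v (is ! k) -` {w ! k}) else {})"
    by (auto simp: list_eq_iff_nth_eq)
  also have "\<dots> \<in> sets borel"
  proof (cases "is = []")
    case False
    then show ?thesis using assms by (auto intro!: sets.finite_INT labels_sets)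
  qed auto
  finally show "(\<lambda>x. map (\<lambda>i. v i x) is) -` {w} \<in> sets borel" .
qed

lemma labels_compose:
  assumes "labels u"
  shows "labels (\<lambda>x. h (u x))"
proof (rule labels_I)
  have "range (\<lambda>x. h (u x)) = h ` range u" by auto
  then show "finite (range (\<lambda>x. h (u x)))" using assms by simp
  have "(\<lambda>x. h (u x)) -` {a} = u -` (h -` {a})" for a by auto
  then show "(\<lambda>x. h (u x)) -` {a} \<in> sets borel" for a using labels_sets[OF assms] by simp
qed

lemma word_shift: "word shift u n x = map (\<lambda>i. u (sh (int i) x)) [0..<n]"
  by (simp add: word_def funpow_shift)

lemma labels_word:
  assumes "labels u"
  shows "labels (word shift u n)"
  unfolding word_shift[abs_def] by (rule labels_map) (rule labels_sh[OF assms])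

text \<open>Gibbs' inequality for the product of the distributions of the first \<open>m\<close> and
  the last \<open>n\<close> letters; by invariance the second factor has the distribution of an
  initial word.\<close>

lemma ent_word_subadd:
  assumes u: "labels u"
  shows "ent \<mu> (word shift u (m + n)) \<le> ent \<mu> (word shift u m) + ent \<mu> (word shift u n)"
proof -
  let ?P = "\<lambda>k w. measure \<mu> (word shift u k -` {w})"
  define q where "q w = ?P m (take m w) * ?P n (drop m w)" for w
  have split: "word shift u (m + n) x = word shift u m x @ word shift u n (sh (int m) x)" for x
    by (simp add: word_add funpow_shift)
  have L: "labels (word shift u k)" for k by (rule labels_word[OF u])
  note Lm = labels_mu[OF L]
  have "ent \<mu> (word shift u (m + n)) \<le> (\<integral>x. - ln (q (word shift u (m + n) x)) \<partial>\<mu>)"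
  proof (rule gibbs[OF Lm])
    fix w assume w: "?P (m + n) w > 0"
    have 1: "?P (m + n) w \<le> ?P m (take m w)"
      by (intro finite_measure_mono fibre_sets[OF Lm(1)]) (auto simp: split)
    have "?P (m + n) w \<le> measure \<mu> (sh (int m) -` (word shift u n -` {drop m w}))"
      by (intro finite_measure_mono)
        (auto simp: split intro: fibre_sets[OF Lm(1)] measurable_sets_borel[OF measurable_sh labels_sets[OF L]])
    also have "\<dots> = ?P n (drop m w)" by (rule measure_sh[OF labels_sets[OF L]])
    finally show "q w > 0" using 1 w by (simp add: q_def)
  next
    fix w show "q w \<ge> 0" by (simp add: q_def)
  next
    have inj: "inj_on (\<lambda>w. (take m w, drop m w)) (range (word shift u (m + n)))"
      by (intro inj_onI) (metis append_take_drop_id prod.inject)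
    have "(\<Sum>w\<in>range (word shift u (m + n)). q w)
        = (\<Sum>(v, v')\<in>(\<lambda>w. (take m w, drop m w)) ` range (word shift u (m + n)). ?P m v * ?P n v')"
      by (subst sum.reindex[OF inj]) (simp add: q_def)
    also have "\<dots> \<le> (\<Sum>(v, v')\<in>range (word shift u m) \<times> range (word shift u n). ?P m v * ?P n v')"
      by (intro sum_mono2) (auto simp: split finite_range_word u)
    also have "\<dots> = (\<Sum>v\<in>range (word shift u m). ?P m v) * (\<Sum>v\<in>range (word shift u n). ?P n v)"
      by (simp add: sum_product sum.cartesian_product)
    also have "\<dots> = 1" by (simp add: sum_fibres[OF Lm])
    finally show "(\<Sum>w\<in>range (word shift u (m + n)). q w) \<le> 1" .
  qed
  also have "(\<integral>x. - ln (q (word shift u (m + n) x)) \<partial>\<mu>)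
     = (\<integral>x. - ln (?P m (word shift u m x)) + - ln (?P n (word shift u n (sh (int m) x))) \<partial>\<mu>)"
  proof (rule integral_cong_AE)
    have meas: "(\<lambda>x. h (word shift u k (sh j x))) \<in> borel_measurable \<mu>" for h :: "_ \<Rightarrow> real" and k j
      by (rule borel_measurable_integrable[OF label_integrable[OF labels_mu[OF labels_sh[OF L]]]])
    show "(\<lambda>x. - ln (q (word shift u (m + n) x))) \<in> borel_measurable \<mu>" using meas[of _ _ 0] by simp
    show "(\<lambda>x. - ln (?P m (word shift u m x)) + - ln (?P n (word shift u n (sh (int m) x)))) \<in> borel_measurable \<mu>"
      by (intro borel_measurable_add meas) (use meas[of "\<lambda>w. - ln (?P m w)" _ 0] in simp)
    \<comment> \<open>The logarithm of the product splits only where both factors are positive.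
      Words of probability zero are finitely many and are read only on a null set.\<close>
    have pos: "AE x in \<mu>. ?P k (word shift u k (sh j x)) > 0" for k j
    proof -
      let ?Z = "{w \<in> range (word shift u k). ?P k w = 0}"
      have fin: "finite ?Z" using L by simp
      have meas0: "sh j -` (word shift u k -` {w}) \<in> sets \<mu>" for w
        using measurable_sets_borel[OF measurable_sh labels_sets[OF L]] by simp
      have null: "measure \<mu> (sh j -` (word shift u k -` {w})) = 0" if "w \<in> ?Z" for w
        using that measure_sh[OF labels_sets[OF L]] by simp
      have "AE x in \<mu>. x \<notin> sh j -` (word shift u k -` {w})" if "w \<in> ?Z" for w
        using null[OF that] meas0[of w]
        by (intro AE_not_in) (simp add: null_sets_def emeasure_eq_measure)
      then have "AE x in \<mu>. \<forall>w\<in>?Z. x \<notin> sh j -` (word shift u k -` {w})"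
        using fin by (intro AE_finite_allI) auto
      then show ?thesis
        by (rule AE_mp) (auto intro!: AE_I2 simp: order.strict_iff_order)
    qed
    have "AE x in \<mu>. ?P m (word shift u m x) > 0" using pos[of m 0] by simp
    then show "AE x in \<mu>. - ln (q (word shift u (m + n) x))
        = - ln (?P m (word shift u m x)) + - ln (?P n (word shift u n (sh (int m) x)))"
      using pos[of n "int m"] by eventually_elim (simp add: q_def split ln_mult)
  qed
  also have "\<dots> = (\<integral>x. - ln (?P m (word shift u m x)) \<partial>\<mu>) + (\<integral>x. - ln (?P n (word shift u n (sh (int m) x))) \<partial>\<mu>)"
    by (intro Bochner_Integration.integral_add label_integrable[OF Lm]
        label_integrable[OF labels_mu[OF labels_sh[OF L]]])
  also have "(\<integral>x. - ln (?P n (word shift u n (sh (int m) x))) \<partial>\<mu>) = (\<integral>x. - ln (?P n (word shift u n x)) \<partial>\<mu>)"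
    using borel_measurable_integrable[OF label_integrable[OF Lm[of n]]]
    by (intro integral_sh) (simp add: measurable_cong_sets[OF sets_mu refl])
  finally show ?thesis by (simp only: ent_integral[OF Lm])
qed

text \<open>\<open>ks_entropy\<close> is given by \<open>lim\<close>, which says something only once
  convergence is known.\<close>

lemma ks_limit:
  assumes u: "labels u"
  shows "(\<lambda>n. ent \<mu> (word shift u n) / real n) \<longlonglongrightarrow> ks_entropy shift \<mu> (fib u)"
proof -
  have "convergent (\<lambda>n. ent \<mu> (word shift u n) / real n)"
    by (intro fekete ent_word_subadd[OF u] ent_nonneg)
  then show ?thesis
    by (simp add: ks_entropy_def dyn_refinement_fib partition_entropy_fib convergent_LIMSEQ_iff)
qed

lemma ks_nonneg:
  assumes "labels u"
  shows "0 \<le> ks_entropy shift \<mu> (fib u)"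
  by (rule LIMSEQ_le_const[OF ks_limit[OF assms]]) (auto intro!: divide_nonneg_nonneg ent_nonneg)

end

section \<open>Codes with memory and the entropy bounds they give\<close>

text \<open>Kraft's inequality for codes in which the weight of a letter may depend on the entire
  past: summing over the last letter first reduces the length by one.\<close>

lemma kraft:
  fixes \<kappa> :: "'l list \<Rightarrow> 'l \<Rightarrow> real"
  assumes A: "finite A" and nonneg: "\<And>h a. 0 \<le> \<kappa> h a"
    and le1: "\<And>h. set h \<subseteq> A \<Longrightarrow> (\<Sum>a\<in>A. \<kappa> h a) \<le> 1"
  shows "(\<Sum>w\<in>{w. set w \<subseteq> A \<and> length w = n}. \<Prod>t<length w. \<kappa> (take t w) (w ! t)) \<le> 1"
proof (induction n)
  case 0
  have "{w. set w \<subseteq> A \<and> length w = 0} = {[]}" by auto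
  then show ?case by simp
next
  case (Suc n)
  let ?W = "\<lambda>n. {w. set w \<subseteq> A \<and> length w = n}"
  let ?q = "\<lambda>w. \<Prod>t<length w. \<kappa> (take t w) (w ! t)"
  have img: "?W (Suc n) = (\<lambda>(w, a). w @ [a]) ` (?W n \<times> A)"
  proof (intro equalityI subsetI)
    fix w assume w: "w \<in> ?W (Suc n)"
    then obtain v a where "w = v @ [a]" by (cases w rule: rev_cases) auto
    then show "w \<in> (\<lambda>(w, a). w @ [a]) ` (?W n \<times> A)" using w by auto
  qed auto
  have "(\<Sum>w\<in>?W (Suc n). ?q w) = (\<Sum>(w, a)\<in>?W n \<times> A. ?q (w @ [a]))"
    unfolding img
    by (subst sum.reindex, force simp: inj_on_def) (simp only: comp_def case_prod_unfold)
  also have "\<dots> = (\<Sum>w\<in>?W n. \<Sum>a\<in>A. ?q (w @ [a]))"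
    by (rule sum.cartesian_product[symmetric])
  also have "\<dots> = (\<Sum>w\<in>?W n. \<Sum>a\<in>A. ?q w * \<kappa> w a)"
  proof (intro sum.cong refl)
    fix w a
    have "(\<Prod>t<length w. \<kappa> (take t (w @ [a])) ((w @ [a]) ! t)) = ?q w"
      by (rule prod.cong) (auto simp: nth_append)
    then show "?q (w @ [a]) = ?q w * \<kappa> w a" by (simp add: nth_append)
  qed
  also have "\<dots> \<le> (\<Sum>w\<in>?W n. ?q w * 1)"
    unfolding sum_distrib_left[symmetric]
    by (intro sum_mono mult_left_mono le1 prod_nonneg) (auto simp: nonneg)
  finally show ?case using Suc.IH by simp
qed

context invariant_measure
begin

text \<open>A labelling that controls the coordinate 0 is turned by its window into one that
  controls all coordinates up to distance \<open>m\<close>, as needed for cells that are small in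
  \<open>shift_dist\<close>.\<close>

definition window :: "((int \<Rightarrow> 'k) \<Rightarrow> 'l) \<Rightarrow> nat \<Rightarrow> (int \<Rightarrow> 'k) \<Rightarrow> 'l list" where
  "window u m x = map (\<lambda>j. u (sh j x)) [- int m..int m]"

lemma labels_window: "labels u \<Longrightarrow> labels (window u m)"
  unfolding window_def by (rule labels_map) (rule labels_sh)

lemma window_eq_iff: "window u m x = window u m y \<longleftrightarrow> (\<forall>j. \<bar>j\<bar> \<le> int m \<longrightarrow> u (sh j x) = u (sh j y))"
  by (simp add: window_def Ball_def abs_le_iff minus_le_iff conj_commute)

lemma labels_pair:
  assumes u: "labels u"
  shows "labels (\<lambda>x. g (u (sh i x)) (u (sh j x)))"
proof -
  have "labels (\<lambda>x. map (\<lambda>j. u (sh j x)) [i, j])"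
    by (rule labels_map) (rule labels_sh[OF u])
  from labels_compose[OF this, of "\<lambda>w. g (w ! 0) (w ! 1)"] show ?thesis by simp
qed

lemma labels_integrable:
  fixes g :: "_ \<Rightarrow> real"
  assumes "labels g"
  shows "integrable \<mu> g" "g \<in> borel_measurable borel"
  using label_integrable[OF labels_mu[OF assms], of "\<lambda>a. a"]
  by (auto dest: borel_measurable_integrable simp: measurable_cong_sets[OF sets_mu refl])

text \<open>
  A transition kernel supported by the labelling yields a code for its words, whose expected length
  per letter bounds the entropy; passing to windows of the labelling costs nothing in the limit.
\<close>

lemma ks_markov_bound:
  assumes u: "labels u" and nonneg: "\<And>a b. 0 \<le> T a b"
    and le1: "\<And>a. a \<in> range u \<Longrightarrow> (\<Sum>b\<in>range u. T a b) \<le> 1"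
    and pos: "\<And>x. T (u x) (u (sh 1 x)) > 0"
  shows "ks_entropy shift \<mu> (fib (window u m)) \<le> (\<integral>x. - ln (T (u x) (u (sh 1 x))) \<partial>\<mu>)"
proof -
  define G where "G x = - ln (T (u x) (u (sh 1 x)))" for x
  define I where "I = (\<integral>x. G x \<partial>\<mu>)"
  define A where "A = range u"
  define cA where "cA = real (card A)"
  have A: "finite A" "A \<noteq> {}" using u by (auto simp: A_def)
  then have cA: "cA > 0" by (auto simp: cA_def card_gt_0_iff)
  have GL: "labels G" unfolding G_def using labels_pair[OF u, of "\<lambda>a b. - ln (T a b)" 0 1] by simp
  \<comment> \<open>The first letter has no predecessor and is coded uniformly; its cost
    \<open>ln cA\<close> disappears after division by \<open>n\<close>.\<close>
  define \<kappa> where "\<kappa> h a = (if h = [] then 1 / cA else T (last h) a)" for h a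
  define q where "q w = (\<Prod>t<length w. \<kappa> (take t w) (w ! t))" for w
  have bound: "ent \<mu> (word shift (window u m) n) \<le> ln cA + real (n + 2 * m - 1) * I" if n: "n \<ge> 1" for n
  proof -
    \<comment> \<open>The windows at the times from 0 to \<open>n - 1\<close> read the letters at
      the times from \<open>- m\<close> to \<open>n + m - 1\<close>.\<close>
    define N where "N = n + 2 * m"
    define v where "v x = word shift u N (sh (- int m) x)" for x
    have v: "labels v" unfolding v_def by (rule labels_sh[OF labels_word[OF u]])
    have vt: "v x ! t = u (sh (int t - int m) x)" if "t < N" for x t
      using that by (simp add: v_def funpow_shift)
    have vl: "length (v x) = N" for x by (simp add: v_def)
    have \<kappa>v: "\<kappa> (take t (v x)) (v x ! t) = (if t = 0 then 1 / cA else T (v x ! (t - 1)) (v x ! t))" if "t < N" for t x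
    proof (cases t)
      case (Suc s)
      then have "take t (v x) \<noteq> []" "last (take t (v x)) = v x ! s"
        using that vl[of x] by (auto simp: take_Suc_conv_app_nth)
      then show ?thesis by (simp add: \<kappa>_def Suc)
    qed (simp add: \<kappa>_def)
    have Tpos: "T (v x ! s) (v x ! Suc s) > 0" if "Suc s < N" for x s
      using pos[of "sh (int s - int m) x"] that by (simp add: vt algebra_simps)
    have lnq: "- ln (q (v x)) = ln cA + (\<Sum>s<N - 1. G (sh (int s - int m) x))" for x
    proof -
      have "q (v x) = (\<Prod>t<Suc (N - 1). \<kappa> (take t (v x)) (v x ! t))"
        using n by (simp add: q_def vl N_def)
      also have "\<dots> = 1 / cA * (\<Prod>s<N - 1. T (v x ! s) (v x ! Suc s))"
        unfolding prod.lessThan_Suc_shift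
      proof (intro arg_cong2[of _ _ _ _ "(*)"] prod.cong refl)
        show "\<kappa> (take 0 (v x)) (v x ! 0) = 1 / cA" by (simp add: \<kappa>_def)
        fix s assume "s \<in> {..<N - 1}"
        then show "\<kappa> (take (Suc s) (v x)) (v x ! Suc s) = T (v x ! s) (v x ! Suc s)"
          using \<kappa>v[of "Suc s" x] by auto
      qed
      finally have "ln (q (v x)) = ln (1 / cA) + ln (\<Prod>s<N - 1. T (v x ! s) (v x ! Suc s))"
        by (simp only:) (rule ln_mult_pos, use cA in \<open>auto intro!: prod_pos Tpos\<close>)
      also have "ln (\<Prod>s<N - 1. T (v x ! s) (v x ! Suc s)) = (\<Sum>s<N - 1. ln (T (v x ! s) (v x ! Suc s)))"
      proof (rule ln_prod)
        fix i assume "i \<in> {..<N - 1}"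
        then have "Suc i < N" by auto
        then show "T (v x ! i) (v x ! Suc i) \<noteq> 0" using Tpos[of i x] by simp
      qed simp
      also have "\<dots> = (\<Sum>s<N - 1. - G (sh (int s - int m) x))"
        by (rule sum.cong) (auto simp: G_def vt algebra_simps)
      finally show ?thesis using cA by (simp add: sum_negf ln_div)
    qed
    have "ent \<mu> (word shift (window u m) n) \<le> ent \<mu> v"
    proof (rule ent_mono[OF labels_mu[OF v] labels_mu[OF labels_word[OF labels_window[OF u]]]])
      fix x y assume "v x = v y"
      then have eq: "u (sh (int t - int m) x) = u (sh (int t - int m) y)" if "t < N" for t
        using vt[OF that, of x] vt[OF that, of y] by simp
      have "u (sh (j + int i) x) = u (sh (j + int i) y)" if "i < n" "\<bar>j\<bar> \<le> int m" for i j
      proof -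
        have "0 \<le> j + int i + int m" "nat (j + int i + int m) < N" using that by (auto simp: N_def)
        then show ?thesis using eq[of "nat (j + int i + int m)"] by simp
      qed
      then show "word shift (window u m) n x = word shift (window u m) n y"
        unfolding word_eq_iff window_eq_iff by (simp add: funpow_shift)
    qed
    also have "\<dots> \<le> (\<integral>x. - ln (q (v x)) \<partial>\<mu>)"
    proof (rule gibbs[OF labels_mu[OF v]])
      show "q w > 0" if "measure \<mu> (v -` {w}) > 0" for w
      proof -
        have "v -` {w} \<noteq> {}" using that by auto
        then obtain x where "w = v x" by auto
        then show ?thesis unfolding q_def
          by (auto intro!: prod_pos simp: \<kappa>v vl cA Tpos)
             (metis Suc_pred Tpos vl)
      qed
      show qn: "q w \<ge> 0" for w
        unfolding q_def by (intro prod_nonneg) (auto simp: \<kappa>_def nonneg cA less_imp_le)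
      have "(\<Sum>w\<in>range v. q w) \<le> (\<Sum>w\<in>{w. set w \<subseteq> A \<and> length w = N}. q w)"
        using A set_word[of shift u N] by (intro sum_mono2 finite_lists_length_eq qn) (auto simp: v_def A_def)
      also have "\<dots> \<le> 1"
        unfolding q_def
      proof (rule kraft[OF A(1)])
        show "(\<Sum>a\<in>A. \<kappa> h a) \<le> 1" if "set h \<subseteq> A" for h
        proof (cases "h = []")
          case False
          then have "last h \<in> range u" using that by (auto simp: A_def)
          then show ?thesis using le1[of "last h"] False by (simp add: \<kappa>_def A_def)
        qed (use cA in \<open>simp add: \<kappa>_def cA_def\<close>)
      qed (auto simp: \<kappa>_def nonneg cA less_imp_le)
      finally show "(\<Sum>w\<in>range v. q w) \<le> 1" .
    qed
    also have "\<dots> = (\<integral>x. ln cA + (\<Sum>s<N - 1. G (sh (int s - int m) x)) \<partial>\<mu>)"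
      by (simp only: lnq)
    also have "\<dots> = ln cA + (\<Sum>s<N - 1. \<integral>x. G (sh (int s - int m) x) \<partial>\<mu>)"
      by (subst Bochner_Integration.integral_add, simp,
          intro Bochner_Integration.integrable_sum labels_integrable labels_sh[OF GL],
          subst Bochner_Integration.integral_sum, intro labels_integrable labels_sh[OF GL], simp add: prob_space[simplified])
    also have "\<dots> = ln cA + real (N - 1) * I"
      using integral_sh[OF labels_integrable(2)[OF GL]] by (simp add: I_def)
    finally show ?thesis by (simp add: N_def)
  qed
  have "(\<lambda>n. (ln cA + (2 * real m - 1) * I) / real n + I) \<longlonglongrightarrow> 0 + I"
    by (intro tendsto_add tendsto_const tendsto_divide_0[OF tendsto_const] filterlim_at_top_imp_at_infinity filterlim_real_sequentially)
  then have "(\<lambda>n. (ln cA + (2 * real m - 1) * I) / real n + I) \<longlonglongrightarrow> I" by simp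
  moreover have "ent \<mu> (word shift (window u m) n) / real n \<le> (ln cA + (2 * real m - 1) * I) / real n + I" if "n \<ge> 1" for n
  proof -
    have "ent \<mu> (word shift (window u m) n) / real n \<le> (ln cA + real (n + 2 * m - 1) * I) / real n"
      using bound[OF that] by (rule divide_right_mono) simp
    also have "\<dots> = (ln cA + (2 * real m - 1) * I) / real n + I"
      using that by (simp add: of_nat_diff field_simps)
    finally show ?thesis .
  qed
  ultimately have "ks_entropy shift \<mu> (fib (window u m)) \<le> I"
    by (intro LIMSEQ_le[OF ks_limit[OF labels_window[OF u]]]) auto
  then show ?thesis by (simp add: I_def G_def)
qed

section \<open>Markers and towers\<close>

text \<open>The cut-off at \<open>M\<close> gives the points outside a common period,
  \<open>fact M\<close>, which a label with finitely many values can record.\<close>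

definition aperiodic :: "nat \<Rightarrow> (int \<Rightarrow> 'k) set" where
  "aperiodic M = {x. \<forall>p. 0 < p \<and> p < int M \<longrightarrow> sh p x \<noteq> x}"

lemma aperiodic_sh: "x \<in> aperiodic M \<Longrightarrow> sh j x \<in> aperiodic M"
proof -
  assume x: "x \<in> aperiodic M"
  show ?thesis
    unfolding aperiodic_def
  proof (intro CollectI allI impI notI)
    fix p assume p: "0 < p \<and> p < int M" "sh p (sh j x) = sh j x"
    then have "sh (- j) (sh p (sh j x)) = sh (- j) (sh j x)" by (simp only:)
    then have "sh p x = x" by simp
    then show False using x p(1) by (auto simp: aperiodic_def)
  qed
qed

lemma sets_sh_vimage: "A \<in> sets borel \<Longrightarrow> sh j -` A \<in> sets borel" for A :: "(int \<Rightarrow> 'k) set"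
  by (rule measurable_sets_borel[OF measurable_sh])

lemma closed_sh_far: "closed {x :: int \<Rightarrow> 'k. e \<le> dist x (sh p x)}"
  by (intro closed_Collect_le continuous_on_const continuous_on_dist continuous_on_id continuous_sh)

lemma aperiodic_sets: "aperiodic M \<in> sets borel"
proof -
  have "aperiodic M = UNIV - (\<Union>p\<in>{0<..<int M}. {x. dist x (sh p x) \<le> 0})"
    by (auto simp: aperiodic_def)
  moreover have "closed {x :: int \<Rightarrow> 'k. dist x (sh p x) \<le> 0}" for p
    by (intro closed_Collect_le continuous_on_const continuous_on_dist continuous_on_id continuous_sh)
  ultimately show ?thesis by (auto intro!: sets.Diff sets.finite_UN borel_closed)
qed

text \<open>A Borel set that is maximal among those whose visits along an orbit are at least
  \<open>M\<close> apart. The aperiodic part is covered by countably many sets \<open>V n\<close>,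
  each with visits that far apart; at stage \<open>n\<close> those points of \<open>V n\<close> are
  added that do not conflict with earlier choices. A point of \<open>V n\<close> is then either
  added or close to a point chosen before.\<close>

lemma markers:
  obtains F where "F \<in> sets borel"
    "\<And>x p. x \<in> F \<Longrightarrow> 0 < p \<Longrightarrow> p < int M \<Longrightarrow> sh p x \<notin> F"
    "\<And>x. x \<in> aperiodic M \<Longrightarrow> \<exists>j. \<bar>j\<bar> \<le> int M \<and> sh j x \<in> F"
proof -
  define r where "r k = 1 / real (Suc k)" for k
  have "\<exists>C. finite C \<and> UNIV \<subseteq> (\<Union>c\<in>C. ball (c :: int \<Rightarrow> 'k) (r k))" for k
    using compact_fun_UNIV[OF K_compact, where 'i = int] unfolding compact_eq_totally_bounded
    by (auto simp: r_def)
  then obtain C where C: "\<And>k. finite (C k)" "\<And>k. UNIV \<subseteq> (\<Union>c\<in>C k. ball (c :: int \<Rightarrow> 'k) (r k))" by metis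
  \<comment> \<open>Points of \<open>far k\<close> are moved by at least \<open>2 * r k\<close>
    under \<open>sh p\<close> with \<open>0 < p < M\<close>, so a ball of radius \<open>r k\<close>
    inside \<open>far k\<close> contains no two points of one orbit that close in time.\<close>
  define far where "far k = (\<Inter>p\<in>{0<..<int M}. {x :: int \<Rightarrow> 'k. 2 * r k \<le> dist x (sh p x)})" for k
  define \<V> where "\<V> = (\<Union>k. (\<lambda>c. ball c (r k) \<inter> far k) ` C k)"
  define V where "V = from_nat_into \<V>"
  have "countable \<V>" unfolding \<V>_def by (intro countable_UN countable_image) (auto intro: countable_finite C)
  moreover have "\<V> \<noteq> {}" using C(2)[of 0] by (auto simp: \<V>_def intro!: exI[of _ 0])
  ultimately have ranV: "range V = \<V>" by (simp add: V_def range_from_nat_into)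
  have far_sets: "far k \<in> sets borel" for k
    unfolding far_def by (intro borel_closed closed_INT ballI closed_sh_far)
  have V_sets: "V n \<in> sets borel" for n
  proof -
    have "V n \<in> \<V>" using ranV by auto
    then show ?thesis unfolding \<V>_def by (auto intro!: sets.Int far_sets)
  qed
  have V_sep: "sh p x \<notin> V n" if "x \<in> V n" "0 < p" "p < int M" for x p n
  proof
    assume "sh p x \<in> V n"
    moreover have "V n \<in> \<V>" using ranV by auto
    ultimately obtain k c where "dist c (sh p x) < r k" and V: "V n = ball c (r k) \<inter> far k"
      unfolding \<V>_def by auto
    moreover have "dist c x < r k" "x \<in> far k" using \<open>x \<in> V n\<close> V by auto
    moreover have "2 * r k \<le> dist x (sh p x)"
      using \<open>x \<in> far k\<close> that(2,3) by (simp add: far_def)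
    ultimately show False using dist_triangle3[of x "sh p x" c] by linarith
  qed
  have V_cover: "\<exists>n. x \<in> V n" if "x \<in> aperiodic M" for x
  proof -
    obtain d where d: "d > 0" "\<And>p. 0 < p \<Longrightarrow> p < int M \<Longrightarrow> d \<le> dist x (sh p x)"
    proof (cases "M > 1")
      case True
      let ?D = "(\<lambda>p. dist x (sh p x)) ` {0<..<int M}"
      have "1 \<in> {0<..<int M}" using True by simp
      then have ne: "?D \<noteq> {}" by blast
      have "Min ?D > 0" using \<open>x \<in> aperiodic M\<close> ne by (subst Min_gr_iff) (auto simp: aperiodic_def)
      then show ?thesis by (rule that) (auto intro!: Min_le)
    next
      case False then show ?thesis by (intro that[of 1]) auto
    qed
    obtain k where "inverse (real (Suc k)) < d / 2" using reals_Archimedean[of "d/2"] d(1) by auto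
    then have "2 * r k < d" by (simp add: r_def inverse_eq_divide)
    then have "x \<in> far k" using d(2) unfolding far_def by (auto intro: order_trans[OF less_imp_le])
    moreover obtain c where "c \<in> C k" "x \<in> ball c (r k)" using C(2)[of k] by blast
    ultimately have "\<exists>A\<in>\<V>. x \<in> A" unfolding \<V>_def by blast
    then show ?thesis using ranV by auto
  qed
  \<comment> \<open>Conflicts are removed in both time directions, since a new point may precede or
    follow an old one.\<close>
  define Fs where "Fs = rec_nat {} (\<lambda>n Fn. Fn \<union> (V n - (\<Union>p\<in>{0<..<int M}. sh p -` Fn \<union> sh (- p) -` Fn)))"
  have Fs0: "Fs 0 = {}" and FsS: "Fs (Suc n) = Fs n \<union> (V n - (\<Union>p\<in>{0<..<int M}. sh p -` Fs n \<union> sh (- p) -` Fs n))" for n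
    by (simp_all add: Fs_def)
  have Fs_sets: "Fs n \<in> sets borel" for n
    by (induction n) (auto simp: Fs0 FsS intro!: sets.Un sets.Diff sets.finite_UN V_sets sets_sh_vimage)
  have Fs_sep: "x \<in> Fs n \<Longrightarrow> 0 < p \<Longrightarrow> p < int M \<Longrightarrow> sh p x \<notin> Fs n" for n x p
  proof (induction n)
    case (Suc n)
    show ?case
    proof
      assume y: "sh p x \<in> Fs (Suc n)"
      \<comment> \<open>Two old points contradict the induction hypothesis, two new points the
        separation within \<open>V n\<close>, and one old with one new point the removal of
        conflicts.\<close>
      consider "x \<in> Fs n" "sh p x \<in> Fs n" | "x \<in> Fs n" "sh (- p) (sh p x) \<notin> Fs n" |
        "sh p x \<notin> Fs n" "sh p x \<in> Fs n" | "x \<in> V n" "sh p x \<in> V n"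
        using y Suc.prems unfolding FsS by (auto simp del: sh_sh)
      then show False
      proof cases
        case 1 then show False using Suc.IH[OF 1(1) Suc.prems(2,3)] by blast
      next
        case 4 then show False using V_sep[OF 4(1) Suc.prems(2,3)] by blast
      qed auto
    qed
  qed (simp add: Fs0)
  have mono: "Fs m \<subseteq> Fs n" if "m \<le> n" for m n
    using that by (rule lift_Suc_mono_le[of Fs, rotated]) (auto simp: FsS)
  show ?thesis
  proof (rule that[of "\<Union>n. Fs n"])
    show "(\<Union>n. Fs n) \<in> sets borel" using Fs_sets by auto
    show "sh p x \<notin> (\<Union>n. Fs n)" if "x \<in> (\<Union>n. Fs n)" "0 < p" "p < int M" for x p
    proof
      assume "sh p x \<in> (\<Union>n. Fs n)"
      then obtain m n where "x \<in> Fs m" "sh p x \<in> Fs n" using \<open>x \<in> (\<Union>n. Fs n)\<close> by blast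
      then have "x \<in> Fs (max m n)" "sh p x \<in> Fs (max m n)"
        using mono[of m "max m n"] mono[of n "max m n"] by auto
      then show False using Fs_sep that by blast
    qed
    show "\<exists>j. \<bar>j\<bar> \<le> int M \<and> sh j x \<in> (\<Union>n. Fs n)" if x: "x \<in> aperiodic M" for x
    proof -
      obtain n where n: "x \<in> V n" using V_cover[OF x] by blast
      have "x \<in> Fs (Suc n) \<or> (\<exists>p. 0 < p \<and> p < int M \<and> (sh p x \<in> Fs n \<or> sh (- p) x \<in> Fs n))"
        using n by (auto simp: FsS)
      then consider "x \<in> Fs (Suc n)" | p where "0 < p" "p < int M" "sh p x \<in> Fs n \<or> sh (- p) x \<in> Fs n"
        by blast
      then show ?thesis
      proof cases
        case 1 then show ?thesis by (intro exI[of _ 0]) auto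
      next
        case 2
        from 2(3) show ?thesis
        proof
          assume "sh p x \<in> Fs n" then show ?thesis using 2 by (intro exI[of _ p]) auto
        next
          assume "sh (- p) x \<in> Fs n" then show ?thesis using 2 by (intro exI[of _ "- p"]) auto
        qed
      qed
    qed
  qed
qed

text \<open>The first \<open>M\<close> preimages of \<open>F\<close> under the shift are disjoint
  and have equal measure.\<close>

lemma marker_measure:
  assumes F: "F \<in> sets borel" "\<And>x p. x \<in> F \<Longrightarrow> 0 < p \<Longrightarrow> p < int M \<Longrightarrow> sh p x \<notin> F" and M: "M \<ge> 1"
  shows "measure \<mu> F \<le> 1 / real M"
proof -
  have disj: "disjoint_family_on (\<lambda>i. sh (int i) -` F) {..<M}"
    unfolding disjoint_family_on_def
  proof (intro ballI impI)
    have *: "sh (int i) -` F \<inter> sh (int j) -` F = {}" if "i < j" "j < M" for i j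
    proof (rule equals0I)
      fix x assume "x \<in> sh (int i) -` F \<inter> sh (int j) -` F"
      then show False using F(2)[of "sh (int i) x" "int j - int i"] that by simp
    qed
    fix i j assume "i \<in> {..<M}" "j \<in> {..<M}" "i \<noteq> j"
    then show "sh (int i) -` F \<inter> sh (int j) -` F = {}"
      using *[of i j] *[of j i] by (cases "i < j") auto
  qed
  have "real M * measure \<mu> F = (\<Sum>i<M. measure \<mu> (sh (int i) -` F))"
    by (simp add: measure_sh[OF F(1)])
  also have "\<dots> = measure \<mu> (\<Union>i<M. sh (int i) -` F)"
    by (rule finite_measure_finite_Union[symmetric]) (use disj sets_sh_vimage[OF F(1)] in auto)
  also have "\<dots> \<le> 1" by (rule prob_le_1)
  finally show ?thesis using M by (simp add: field_simps)
qed

text \<open>Each stretch between consecutive markers is cut into blocks of length \<open>n\<close>,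
  starting at offset \<open>k\<close> from the marker. The \<open>n\<close> offsets give disjoint
  bases, so for some \<open>k\<close> the base carries at most a fraction \<open>1 / n\<close> of
  the integral of \<open>c\<close>. A point can be missed only within \<open>n\<close> steps of a
  marker, and markers have measure at most \<open>1 / M\<close> with
  \<open>2 * n / M \<le> \<delta>\<close>.\<close>

lemma towers:
  fixes c :: "(int \<Rightarrow> 'k) \<Rightarrow> real"
  assumes c: "integrable \<mu> c" "\<And>x. 0 \<le> c x" and n: "n \<ge> 1" and \<delta>: "\<delta> > 0"
  obtains M S where "M \<ge> 1" "S \<in> sets borel" "S \<subseteq> aperiodic M"
    "\<And>x j. x \<in> S \<Longrightarrow> 0 < j \<Longrightarrow> j < int n \<Longrightarrow> sh j x \<notin> S"
    "measure \<mu> {x \<in> aperiodic M. \<forall>j<n. sh (- int j) x \<notin> S} \<le> \<delta>"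
    "real n * (\<integral>x. indicator S x * c x \<partial>\<mu>) \<le> (\<integral>x. c x \<partial>\<mu>)"
proof -
  obtain M :: nat where "2 * real n / \<delta> < real M" using reals_Archimedean2 by blast
  moreover have "2 * real n / \<delta> > 0" using n \<delta> by simp
  ultimately have "real M > 0" by linarith
  then have M: "M \<ge> 1" "2 * real n / real M \<le> \<delta>"
    using \<delta> \<open>2 * real n / \<delta> < real M\<close> by (auto simp: divide_simps mult.commute split: if_splits)
  obtain F where F: "F \<in> sets borel"
    "\<And>x p. x \<in> F \<Longrightarrow> 0 < p \<Longrightarrow> p < int M \<Longrightarrow> sh p x \<notin> F"
    "\<And>x. x \<in> aperiodic M \<Longrightarrow> \<exists>j. \<bar>j\<bar> \<le> int M \<and> sh j x \<in> F"
    using markers[of M] by blast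
  have Fap: "F \<subseteq> aperiodic M" using F(2) by (fastforce simp: aperiodic_def)
  \<comment> \<open>\<open>i\<close> is the time elapsed since the last marker; excluding markers at
    the times below \<open>n\<close> lets a block of length \<open>n\<close> end before the next
    one.\<close>
  define lastm where "lastm i x \<longleftrightarrow> sh (- int i) x \<in> F \<and> (\<forall>j. - int i < j \<and> j < int n \<longrightarrow> sh j x \<notin> F)" for i x
  define S where "S k = {x. \<exists>i. i mod n = k \<and> lastm i x}" for k
  have uniq: "i = i'" if "lastm i x" "lastm i' x" for i i' x
  proof (rule ccontr)
    assume "i \<noteq> i'"
    moreover have "\<not> (lastm i x \<and> lastm i' x)" if "i < i'" for i i' :: nat
      using that n by (auto simp: lastm_def)
    ultimately show False using that by (metis linorder_neqE_nat)
  qed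
  have lastm_sets: "{x. lastm i x} \<in> sets borel" for i
  proof -
    have "{x. lastm i x} = sh (- int i) -` F - (\<Union>j\<in>{- int i<..<int n}. sh j -` F)"
      by (auto simp: lastm_def)
    then show ?thesis by (auto intro!: sets.Diff sets.finite_UN sets_sh_vimage F(1))
  qed
  have S_sets: "S k \<in> sets borel" for k
  proof -
    have "S k = (\<Union>i\<in>{i. i mod n = k}. {x. lastm i x})" by (auto simp: S_def)
    then show ?thesis by (auto intro!: sets.countable_UN' lastm_sets)
  qed
  have S_ap: "S k \<subseteq> aperiodic M" for k
  proof
    fix x assume "x \<in> S k"
    then obtain i where "sh (- int i) x \<in> aperiodic M" using Fap by (auto simp: S_def lastm_def)
    from aperiodic_sh[OF this, of "int i"] show "x \<in> aperiodic M" by simp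
  qed
  have S_sep: "sh j x \<notin> S k" if "x \<in> S k" "0 < j" "j < int n" for j k x
  proof
    assume "sh j x \<in> S k"
    then obtain i' where i': "i' mod n = k" "lastm i' (sh j x)" by (auto simp: S_def)
    obtain i where i: "i mod n = k" "lastm i x" using \<open>x \<in> S k\<close> by (auto simp: S_def)
    have F': "sh (- int i') (sh j x) \<in> F" using i' by (auto simp: lastm_def)
    \<comment> \<open>Both points have the same last marker, so \<open>i' = i + j\<close>; the
      congruence modulo \<open>n\<close> then rules out \<open>0 < j < n\<close>.\<close>
    have 1: "j - int i' \<le> - int i"
    proof (rule ccontr)
      assume "\<not> j - int i' \<le> - int i"
      then have "sh (j - int i') x \<notin> F" using i(2) that(3) by (auto simp: lastm_def)
      then show False using F' by (simp add: algebra_simps)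
    qed
    have "\<not> - int i' < - int i - j"
    proof
      assume "- int i' < - int i - j"
      then have "sh (- int i - j) (sh j x) \<notin> F" using i'(2) that by (auto simp: lastm_def simp del: sh_sh)
      then show False using i(2) by (simp add: lastm_def)
    qed
    with 1 have "int i' = int i + j" by simp
    then have "int i' mod int n = (int i + j) mod int n" by simp
    moreover have "int i' mod int n = int i mod int n" using i i' by (metis of_nat_mod)
    ultimately have "(int i + j) mod int n = int i mod int n" by simp
    then have "int n dvd j" by (simp add: mod_eq_dvd_iff)
    then show False using that by (auto dest: zdvd_imp_le)
  qed
  have uncovered: "{x \<in> aperiodic M. \<forall>j<n. sh (- int j) x \<notin> S k}
      \<subseteq> (\<Union>i<n. sh (- int i) -` F) \<union> (\<Union>i<n. sh (int i) -` F)" if k: "k < n" for k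
  proof
    fix x assume "x \<in> {x \<in> aperiodic M. \<forall>j<n. sh (- int j) x \<notin> S k}"
    then have x: "x \<in> aperiodic M" "\<And>j. j < n \<Longrightarrow> sh (- int j) x \<notin> S k" by auto
    show "x \<in> (\<Union>i<n. sh (- int i) -` F) \<union> (\<Union>i<n. sh (int i) -` F)"
    proof (rule ccontr)
      assume not: "x \<notin> (\<Union>i<n. sh (- int i) -` F) \<union> (\<Union>i<n. sh (int i) -` F)"
      \<comment> \<open>Looking for a marker around time \<open>- M\<close> yields one at a time
        that is not positive.\<close>
      obtain j where j: "\<bar>j\<bar> \<le> int M" "sh j (sh (- int M) x) \<in> F"
        using F(3)[OF aperiodic_sh[OF x(1)]] by blast
      moreover have "- int (nat (int M - j)) = j - int M" using j(1) by simp
      ultimately have "sh (- int (nat (int M - j))) x \<in> F" by (simp only: sh_sh diff_conv_add_uminus)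
      then have ex: "\<exists>i. sh (- int i) x \<in> F" by blast
      define i where "i = (LEAST i. sh (- int i) x \<in> F)"
      have i: "sh (- int i) x \<in> F" unfolding i_def by (rule LeastI_ex[OF ex])
      have i_min: "sh (- int l) x \<notin> F" if "l < i" for l
        using not_less_Least[of l "\<lambda>i. sh (- int i) x \<in> F"] that by (simp add: i_def)
      have "i \<ge> n" using not i by (auto simp: not_less[symmetric])
      \<comment> \<open>Going back \<open>j\<close> steps makes the elapsed time
        \<open>i - j\<close> congruent to \<open>k\<close>. The subtraction \<open>i - k\<close> is
        exact because \<open>k < n \<le> i\<close>.\<close>
      define j where "j = (i - k) mod n"
      have jn: "j < n" using n by (simp add: j_def)
      have ji: "j \<le> i" using jn \<open>i \<ge> n\<close> by simp
      have "(i - j) mod n = k"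
      proof -
        have "i - j = k + n * ((i - k) div n)"
          using k \<open>i \<ge> n\<close> mult_div_mod_eq[of n "i - k"] unfolding j_def by linarith
        then show ?thesis using k by simp
      qed
      moreover have "lastm (i - j) (sh (- int j) x)"
        unfolding lastm_def
      proof (intro conjI allI impI)
        show "sh (- int (i - j)) (sh (- int j) x) \<in> F" using i ji by simp
        fix l assume l: "- int (i - j) < l \<and> l < int n"
        show "sh l (sh (- int j) x) \<notin> F"
        proof (cases "l - int j \<le> 0")
          case True
          then have "l - int j = - int (nat (int j - l))" "nat (int j - l) < i" using l ji by auto
          then show ?thesis using i_min[of "nat (int j - l)"] by simp
        next
          case False
          then have "l - int j = int (nat (l - int j))" "nat (l - int j) < n" using l by auto
          then have "sh (l - int j) x \<notin> F" using not by (metis UN_I UnI2 lessThan_iff vimageI2)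
          then show ?thesis by simp
        qed
      qed
      ultimately have "sh (- int j) x \<in> S k" by (auto simp: S_def)
      then show False using x(2)[OF jn] by simp
    qed
  qed
  have unc_measure: "measure \<mu> {x \<in> aperiodic M. \<forall>j<n. sh (- int j) x \<notin> S k} \<le> \<delta>" if k: "k < n" for k
  proof -
    have s: "sh j -` F \<in> sets \<mu>" for j using sets_sh_vimage[OF F(1)] by simp
    have UN: "measure \<mu> (\<Union>i<n. sh (h i) -` F) \<le> real n * measure \<mu> F" for h
    proof -
      have "measure \<mu> (\<Union>i<n. sh (h i) -` F) \<le> (\<Sum>i<n. measure \<mu> (sh (h i) -` F))"
        by (rule finite_measure_subadditive_finite) (use s in auto)
      then show ?thesis by (simp add: measure_sh[OF F(1)])
    qed
    have "measure \<mu> {x \<in> aperiodic M. \<forall>j<n. sh (- int j) x \<notin> S k}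
       \<le> measure \<mu> ((\<Union>i<n. sh (- int i) -` F) \<union> (\<Union>i<n. sh (int i) -` F))"
      using s by (intro finite_measure_mono uncovered[OF k]) (auto intro!: sets.Un sets.finite_UN)
    also have "\<dots> \<le> measure \<mu> (\<Union>i<n. sh (- int i) -` F) + measure \<mu> (\<Union>i<n. sh (int i) -` F)"
      using s by (intro measure_Un_le) (auto intro!: sets.finite_UN)
    also have "\<dots> \<le> 2 * real n * measure \<mu> F"
      using UN[of "\<lambda>i. - int i"] UN[of int] by simp
    also have "\<dots> \<le> 2 * real n * (1 / real M)"
      by (intro mult_left_mono marker_measure F M) auto
    finally show ?thesis using M(2) by simp
  qed
  have int: "integrable \<mu> (\<lambda>x. indicator (S k) x * c x)" for k
    using integrable_mult_indicator[OF _ c(1), of "S k"] S_sets by simp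
  \<comment> \<open>The bases for different offsets are disjoint: each point has at most one elapsed
    time.\<close>
  have "(\<Sum>k<n. \<integral>x. indicator (S k) x * c x \<partial>\<mu>) = (\<integral>x. (\<Sum>k<n. indicator (S k) x * c x) \<partial>\<mu>)"
    by (rule Bochner_Integration.integral_sum[symmetric]) (rule int)
  also have "\<dots> \<le> (\<integral>x. c x \<partial>\<mu>)"
  proof (intro integral_mono Bochner_Integration.integrable_sum int c)
    fix x
    have "(\<Sum>k<n. indicator (S k) x :: real) \<le> 1"
    proof (cases "\<exists>i. lastm i x")
      case True
      then obtain i where i: "lastm i x" by blast
      have "(\<Sum>k<n. indicator (S k) x :: real) = (\<Sum>k<n. if k = i mod n then 1 else 0)"
      proof (rule sum.cong[OF refl])
        fix k
        have "x \<in> S k \<longleftrightarrow> k = i mod n" using i uniq[OF i] unfolding S_def by blast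
        then show "indicator (S k) x = (if k = i mod n then 1 else 0 :: real)" by (simp add: indicator_def)
      qed
      then show ?thesis by (simp add: sum.delta)
    next
      case False
      then have "(\<Sum>k<n. indicator (S k) x :: real) = (\<Sum>k<n. 0)"
        unfolding S_def by (intro sum.cong) (simp_all add: indicator_def)
      then show ?thesis by simp
    qed
    then show "(\<Sum>k<n. indicator (S k) x * c x) \<le> c x"
      using mult_right_mono[OF _ c(2)[of x], of "\<Sum>k<n. indicator (S k) x" 1] by (simp add: sum_distrib_right)
  qed
  finally have sum_le: "(\<Sum>k<n. \<integral>x. indicator (S k) x * c x \<partial>\<mu>) \<le> (\<integral>x. c x \<partial>\<mu>)" .
  have "\<exists>k<n. real n * (\<integral>x. indicator (S k) x * c x \<partial>\<mu>) \<le> (\<integral>x. c x \<partial>\<mu>)"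
  proof (rule ccontr)
    assume *: "\<not> (\<exists>k<n. real n * (\<integral>x. indicator (S k) x * c x \<partial>\<mu>) \<le> (\<integral>x. c x \<partial>\<mu>))"
    have "(\<integral>x. c x \<partial>\<mu>) < real n * (\<integral>x. indicator (S k) x * c x \<partial>\<mu>)" if "k < n" for k
      using * that by (auto simp: not_le)
    then have "(\<Sum>k<n. (\<integral>x. c x \<partial>\<mu>)) < (\<Sum>k<n. real n * (\<integral>x. indicator (S k) x * c x \<partial>\<mu>))"
      using n by (intro sum_strict_mono) (auto simp: lessThan_empty_iff)
    then have "real n * (\<integral>x. c x \<partial>\<mu>) < real n * (\<Sum>k<n. \<integral>x. indicator (S k) x * c x \<partial>\<mu>)"
      by (simp add: sum_distrib_left)
    then show False using sum_le n by simp
  qed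
  then obtain k where k: "k < n" "real n * (\<integral>x. indicator (S k) x * c x \<partial>\<mu>) \<le> (\<integral>x. c x \<partial>\<mu>)"
    by blast
  show ?thesis
    using S_sep by (intro that[OF M(1) S_sets S_ap _ unc_measure[OF k(1)] k(2)]) auto
qed

end

section \<open>From block codes to fine partitions\<close>

text \<open>\<open>Blk\<close> carries the level in the tower and the code of the whole block,
  \<open>Free\<close> a single letter, \<open>Cyc\<close> the letters of a full period. With the
  level in the label, the transition from one level to the next is deterministic and costs
  nothing.\<close>

datatype 'b lab = Blk nat 'b | Free nat | Cyc "nat list"

context invariant_measure
begin

lemma fine_fib:
  assumes u: "labels u" and d: "\<And>x y. u x = u y \<Longrightarrow> shift_dist x y \<le> d" "d < \<epsilon>"
  shows "fib u \<in> fine_partitions shift_dist \<epsilon>"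
proof -
  have "partition_on UNIV (fib u)"
    unfolding partition_on_def disjoint_def fib_def by auto
  moreover have "diam_wrt shift_dist C < ereal \<epsilon>" if "C \<in> fib u" for C
  proof -
    have "diam_wrt shift_dist C \<le> ereal d"
      unfolding diam_wrt_def using that by (intro SUP_least) (auto simp: fib_def intro!: d(1))
    then show ?thesis using d(2) by (auto intro: le_less_trans)
  qed
  ultimately show ?thesis
    using u by (auto simp: fine_partitions_def fib_def intro: labels_sets[OF u])
qed

lemma labels_coord:
  assumes "a \<in> borel \<rightarrow>\<^sub>M count_space UNIV" "finite (range a)"
  shows "labels (\<lambda>x :: int \<Rightarrow> 'k. a (x j))"
  using measurable_compose[OF measurable_coord assms(1)] assms(2)
  by (auto intro: finite_subset[of _ "range a"])

lemma sh_period: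
  assumes "sh p x = x"
  shows "sh (int k * p) x = x"
proof (induction k)
  case (Suc k)
  have "sh (int (Suc k) * p) x = sh p (sh (int k * p) x)" by (simp add: algebra_simps)
  then show ?case by (simp only: Suc.IH assms)
qed simp

text \<open>Every period below \<open>M\<close> divides \<open>fact M\<close>.\<close>

lemma sh_fact_period:
  assumes "x \<notin> aperiodic M"
  shows "sh (int (fact M)) x = x"
proof -
  obtain p where p: "0 < p" "p < int M" "sh p x = x" using assms by (auto simp: aperiodic_def)
  have "nat p dvd fact M" using p by (intro dvd_fact) auto
  then obtain k where "fact M = nat p * k" by (auto simp: dvd_def)
  then have "int (fact M) = int k * p" using p(1) by (metis int_nat_eq less_imp_le mult.commute of_nat_mult)
  then show ?thesis using sh_period[OF p(3), of k] by simp
qed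

text \<open>
  The labelling below reads the block code along the towers, the letters of \<open>a\<close> on the remaining
  aperiodic points, and a full period on the periodic points, where the next label is forced.
\<close>

lemma block_code:
  fixes a :: "'k \<Rightarrow> nat" and b :: "(int \<Rightarrow> 'k) \<Rightarrow> 'b" and p :: "'b \<Rightarrow> real"
  assumes a: "a \<in> borel \<rightarrow>\<^sub>M count_space UNIV" "range a \<subseteq> {..<N}" "\<And>x y. a x = a y \<Longrightarrow> dist x y < r"
    and b: "labels b" "\<And>x y t. b x = b y \<Longrightarrow> t < n \<Longrightarrow> dist (x (int t)) (y (int t)) < r"
    and p: "\<And>\<beta>. \<beta> \<in> range b \<Longrightarrow> p \<beta> > 0" "(\<Sum>\<beta>\<in>range b. p \<beta>) \<le> 1"
    and n: "n \<ge> 1" and r: "r > 0" and \<epsilon>: "(wt_sum + 1) * r < \<epsilon>"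
  shows "(INF \<xi>\<in>fine_partitions shift_dist \<epsilon>. ereal (ks_entropy shift \<mu> \<xi>))
       \<le> ereal ((ln 2 + (\<integral>x. - ln (p (b x)) \<partial>\<mu>)) / real n)"
proof -
  define c where "c x = - ln (p (b x))" for x
  have cL: "labels c" unfolding c_def by (rule labels_compose[OF b(1)])
  have c0: "c x \<ge> 0" for x
  proof -
    have "p (b x) \<le> (\<Sum>\<beta>\<in>range b. p \<beta>)"
      using b(1) by (intro member_le_sum) (auto intro: less_imp_le p(1))
    then show ?thesis using p(1)[of "b x"] p(2) by (simp add: c_def ln_le_zero_iff)
  qed
  have afin: "finite (range a)" using a(2) by (auto intro: finite_subset)
  have N: "N > 0" using a(2) by (auto simp: image_subset_iff)
  define I where "I = (\<integral>x. c x \<partial>\<mu>)"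
  have main: "(INF \<xi>\<in>fine_partitions shift_dist \<epsilon>. ereal (ks_entropy shift \<mu> \<xi>))
      \<le> ereal ((ln 2 + I) / real n + \<delta> * ln (2 * real N))" if \<delta>: "\<delta> > 0" for \<delta>
  proof -
    obtain M S where M: "M \<ge> 1" and S: "S \<in> sets borel" "S \<subseteq> aperiodic M"
      "\<And>x j. x \<in> S \<Longrightarrow> 0 < j \<Longrightarrow> j < int n \<Longrightarrow> sh j x \<notin> S"
      "measure \<mu> {x \<in> aperiodic M. \<forall>j<n. sh (- int j) x \<notin> S} \<le> \<delta>"
      "real n * (\<integral>x. indicator S x * c x \<partial>\<mu>) \<le> (\<integral>x. c x \<partial>\<mu>)"
      using towers[OF labels_integrable(1)[OF cL] c0 n \<delta>] by blast
    define q :: nat where "q = fact M"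
    have q: "q > 0" by (simp add: q_def)
    define U where "U = {x \<in> aperiodic M. \<forall>j<n. sh (- int j) x \<notin> S}"
    have uniq: "j = j'" if "j < n" "j' < n" "sh (- int j) x \<in> S" "sh (- int j') x \<in> S" for j j' x
    proof -
      have "\<not> (sh (- int j) x \<in> S \<and> sh (- int j') x \<in> S)" if "j < j'" "j' < n" for j j'
        using S(3)[of "sh (- int j') x" "int j' - int j"] that by auto
      then show ?thesis using that by (metis linorder_neqE_nat)
    qed
    define col where "col x = (THE j. j < n \<and> sh (- int j) x \<in> S)" for x
    have col: "col x = j" if "j < n" "sh (- int j) x \<in> S" for x j
      unfolding col_def by (rule the_equality) (use that uniq in blast)+
    define u where "u x = (if x \<notin> aperiodic M then Cyc (map (\<lambda>i. a (x (int i))) [0..<q])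
       else if x \<in> U then Free (a (x 0)) else Blk (col x) (b (sh (- int (col x)) x)))" for x
    have u1: "u x = Cyc (map (\<lambda>i. a (x (int i))) [0..<q])" if "x \<notin> aperiodic M" for x
      using that by (simp add: u_def)
    have u2: "u x = Blk j (b (sh (- int j) x))" if "x \<in> aperiodic M" "j < n" "sh (- int j) x \<in> S" for x j
      using that col[OF that(2,3)] by (auto simp: u_def U_def)
    have u3: "u x = Free (a (x 0))" if "x \<in> U" for x
      using that by (simp add: u_def U_def)
    have cases: "x \<notin> aperiodic M \<or> x \<in> U \<or> (x \<in> aperiodic M \<and> (\<exists>j<n. sh (- int j) x \<in> S))" for x
      by (auto simp: U_def)
    have U_sets: "U \<in> sets borel"
    proof -
      have "U = aperiodic M - (\<Union>j<n. sh (- int j) -` S)" by (auto simp: U_def)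
      then show ?thesis by (auto intro!: sets.Diff sets.finite_UN aperiodic_sets sets_sh_vimage S(1))
    qed
    have cycL: "labels (\<lambda>x. map (\<lambda>i. a (x (int i))) [0..<q])"
      by (rule labels_map) (rule labels_coord[OF a(1) afin])
    have u: "labels u"
    proof (rule labels_I)
      let ?R = "Cyc ` range (\<lambda>x. map (\<lambda>i. a (x (int i))) [0..<q]) \<union> (\<lambda>(j, \<beta>). Blk j \<beta>) ` ({..<n} \<times> range b)
        \<union> Free ` range a"
      have "finite ?R" using cycL b(1) afin by auto
      moreover have "u x \<in> ?R" for x
        using cases[of x] u1[of x] u2[of x] u3[of x] by (auto simp: image_iff)
      then have "range u \<subseteq> ?R" by blast
      ultimately show "finite (range u)" by (rule rev_finite_subset)
      fix l show "u -` {l} \<in> sets borel"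
      proof (cases l)
        case (Cyc v)
        have "u -` {l} = (\<lambda>x. map (\<lambda>i. a (x (int i))) [0..<q]) -` {v} - aperiodic M"
          unfolding Cyc by (auto simp: u_def split: if_splits)
        then show ?thesis using labels_sets[OF cycL] aperiodic_sets by auto
      next
        case (Free k)
        have "u -` {l} = U \<inter> (\<lambda>x. a (x 0)) -` {k}"
          unfolding Free by (auto simp: u_def U_def split: if_splits)
        then show ?thesis using labels_sets[OF labels_coord[OF a(1) afin]] U_sets by auto
      next
        case (Blk j \<beta>)
        have "u -` {l} = (if j < n then aperiodic M \<inter> sh (- int j) -` S \<inter> sh (- int j) -` (b -` {\<beta>}) else {})"
        proof (intro set_eqI)
          fix x
          show "x \<in> u -` {l} \<longleftrightarrow> x \<in> (if j < n then aperiodic M \<inter> sh (- int j) -` S \<inter> sh (- int j) -` (b -` {\<beta>}) else {})"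
          proof
            assume "x \<in> u -` {l}"
            then have ux: "u x = Blk j \<beta>" by (simp add: Blk)
            then have x: "x \<in> aperiodic M" "x \<notin> U" using u1 u3 by force+
            then obtain i where i: "i < n" "sh (- int i) x \<in> S" using cases by blast
            then show "x \<in> (if j < n then aperiodic M \<inter> sh (- int j) -` S \<inter> sh (- int j) -` (b -` {\<beta>}) else {})"
              using u2[OF x(1) i] ux x(1) by auto
          next
            assume "x \<in> (if j < n then aperiodic M \<inter> sh (- int j) -` S \<inter> sh (- int j) -` (b -` {\<beta>}) else {})"
            then show "x \<in> u -` {l}" using u2[of x j] by (auto simp: Blk split: if_splits)
          qed
        qed
        then show ?thesis
          using aperiodic_sets sets_sh_vimage[OF S(1)] sets_sh_vimage[OF labels_sets[OF b(1)]] by auto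
      qed
    qed
    have u_dist: "dist (x 0) (y 0) < r" if "u x = u y" for x y
    proof -
      consider "x \<notin> aperiodic M" | "x \<in> U" | j where "x \<in> aperiodic M" "j < n" "sh (- int j) x \<in> S"
        using cases[of x] by blast
      then show ?thesis
      proof cases
        case 1
        then have "u y = Cyc (map (\<lambda>i. a (x (int i))) [0..<q])" using that u1 by simp
        then have "map (\<lambda>i. a (y (int i))) [0..<q] = map (\<lambda>i. a (x (int i))) [0..<q]"
          by (auto simp: u_def split: if_splits)
        from arg_cong[OF this, of "\<lambda>v. v ! 0"] have "a (y 0) = a (x 0)" using q by simp
        then show ?thesis using a(3) by metis
      next
        case 2
        then have "u y = Free (a (x 0))" using that u3 by simp
        then have "a (y 0) = a (x 0)" by (auto simp: u_def split: if_splits)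
        then show ?thesis using a(3) by metis
      next
        case 3
        then have uy: "u y = Blk j (b (sh (- int j) x))" using that u2 by simp
        then have "y \<in> aperiodic M" "y \<notin> U" by (auto simp: u_def split: if_splits)
        then obtain j' where "j' < n" "sh (- int j') y \<in> S" using cases by blast
        from u2[OF \<open>y \<in> aperiodic M\<close> this] have "b (sh (- int j) y) = b (sh (- int j) x)"
          using uy by (metis lab.inject(1))
        from b(2)[OF this 3(2)] show ?thesis by (simp add: dist_commute)
      qed
    qed
    \<comment> \<open>When the next label is not forced, half of the weight goes to the code of a
      new block and half to a free letter. This halving is the source of \<open>ln 2\<close> in the
      bound.\<close>
    define fresh where "fresh l = (case l of Blk j \<beta> \<Rightarrow> (if j = 0 \<and> \<beta> \<in> range b then p \<beta> / 2 else 0)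
       | Free k \<Rightarrow> 1 / (2 * real N) | Cyc v \<Rightarrow> 0)" for l
    \<comment> \<open>Within a block the level advances, and on a cycle the recorded period rotates,
      both with weight 1.\<close>
    define T where "T l l' = (case l of Cyc v \<Rightarrow> of_bool (l' = Cyc (rotate1 v))
       | Blk j \<beta> \<Rightarrow> (if Suc j < n then of_bool (l' = Blk (Suc j) \<beta>) else fresh l')
       | Free k \<Rightarrow> fresh l')" for l l'
    have fresh0: "fresh l \<ge> 0" for l
      by (auto simp: fresh_def less_imp_le p(1) split: lab.splits)
    have T0: "T l l' \<ge> 0" for l l'
      using fresh0 by (auto simp: T_def split: lab.splits)
    have fresh1: "(\<Sum>l\<in>range u. fresh l) \<le> 1"
    proof -
      let ?R = "Blk 0 ` range b \<union> Free ` {..<N}"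
      have "(\<Sum>l\<in>range u. fresh l) = (\<Sum>l\<in>range u \<inter> ?R. fresh l)"
      proof (rule sum.mono_neutral_right)
        show "\<forall>l\<in>range u - range u \<inter> ?R. fresh l = 0"
        proof
          fix l assume l: "l \<in> range u - range u \<inter> ?R"
          show "fresh l = 0"
          proof (cases l)
            case (Free k)
            then have "k \<in> range a" using l by (auto simp: u_def split: if_splits)
            then show ?thesis using l Free a(2) by auto
          qed (use l in \<open>auto simp: fresh_def\<close>)
        qed
      qed (use u in auto)
      also have "\<dots> \<le> (\<Sum>l\<in>?R. fresh l)"
        using b(1) by (intro sum_mono2) (auto simp: fresh0)
      also have "\<dots> = (\<Sum>l\<in>Blk 0 ` range b. fresh l) + (\<Sum>l\<in>Free ` {..<N}. fresh l)"
        using b(1) by (intro sum.union_disjoint) auto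
      also have "(\<Sum>l\<in>Blk 0 ` range b. fresh l) = (\<Sum>\<beta>\<in>range b. p \<beta>) / 2"
        by (subst sum.reindex) (auto simp: inj_on_def fresh_def sum_divide_distrib)
      also have "(\<Sum>l\<in>Free ` {..<N}. fresh l) = 1 / 2"
        using N by (subst sum.reindex) (auto simp: inj_on_def fresh_def)
      finally show ?thesis using p(2) by linarith
    qed
    have T1: "(\<Sum>l'\<in>range u. T l l') \<le> 1" for l
    proof -
      have one: "(\<Sum>l'\<in>range u. of_bool (l' = z) :: real) \<le> 1" for z
        using u by (auto simp: of_bool_def sum.delta)
      show ?thesis
      proof (cases l)
        case (Blk j \<beta>)
        then show ?thesis using one fresh1 by (cases "Suc j < n") (simp_all add: T_def)
      qed (use one fresh1 in \<open>simp_all add: T_def\<close>)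
    qed
    \<comment> \<open>A cost arises only when the next point lies in the base \<open>S\<close>,
      where a block code is paid for, or in the uncovered set \<open>U\<close>, where a letter
      is.\<close>
    have step: "T (u x) (u (sh 1 x)) > 0 \<and> - ln (T (u x) (u (sh 1 x)))
        \<le> indicator S (sh 1 x) * (ln 2 + c (sh 1 x)) + indicator U (sh 1 x) * ln (2 * real N)" for x
    proof -
      define y where "y = sh 1 x"
      define rhs where "rhs = indicator S y * (ln 2 + c y) + indicator U y * ln (2 * real N)"
      have rhs0: "rhs \<ge> 0" unfolding rhs_def using c0[of y] N by (intro add_nonneg_nonneg mult_nonneg_nonneg) auto
      have "T (u x) (u y) > 0 \<and> - ln (T (u x) (u y)) \<le> rhs"
      proof (cases "x \<in> aperiodic M")
        case False
        then have y: "y \<notin> aperiodic M" using aperiodic_sh[of y M "-1"] by (auto simp: y_def)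
        have "x (int q) = x 0"
          using fun_cong[OF sh_fact_period[OF False], of 0] by (simp add: q_def)
        \<comment> \<open>As \<open>q\<close> is a period, the letter that enters on the right
          equals the one that leaves on the left.\<close>
        then have "map (\<lambda>i. a (y (int i))) [0..<q] = rotate1 (map (\<lambda>i. a (x (int i))) [0..<q])"
          using q by (intro nth_equalityI) (auto simp: y_def nth_rotate1 add.commute mod_Suc)
        then have "T (u x) (u y) = 1" using u1[OF False] u1[OF y] by (simp add: T_def)
        then show ?thesis using rhs0 by simp
      next
        case True
        then have y: "y \<in> aperiodic M" unfolding y_def by (rule aperiodic_sh)
        show ?thesis
        proof (cases "\<exists>j. Suc j < n \<and> sh (- int j) x \<in> S")
          case True
          then obtain j where j: "Suc j < n" "sh (- int j) x \<in> S" by blast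
          have eq: "sh (- int (Suc j)) y = sh (- int j) x" by (simp add: y_def)
          have "u x = Blk j (b (sh (- int j) x))" using u2[OF \<open>x \<in> aperiodic M\<close> _ j(2)] j(1) by simp
          moreover have "u y = Blk (Suc j) (b (sh (- int j) x))" using u2[OF y j(1)] j(2) by (simp only: eq)
          ultimately have "T (u x) (u y) = 1" using j(1) by (simp add: T_def)
          then show ?thesis using rhs0 by simp
        next
          case no: False
          have Tf: "T (u x) (u y) = fresh (u y)"
          proof -
            consider "x \<in> U" | j where "j < n" "sh (- int j) x \<in> S" using cases[of x] True by blast
            then show ?thesis
            proof cases
              case 1 then show ?thesis using u3 by (simp add: T_def)
            next
              case 2
              then have "\<not> Suc j < n" using no by blast
              then show ?thesis using u2[OF True 2] by (simp add: T_def)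
            qed
          qed
          consider "y \<in> U" | j where "j < n" "sh (- int j) y \<in> S" using cases[of y] y by blast
          then show ?thesis
          proof cases
            case 1
            then have "y \<notin> S" using n by (auto simp: U_def dest: spec[of _ 0])
            then show ?thesis using Tf u3[OF 1] 1 N by (simp add: fresh_def rhs_def ln_div)
          next
            case 2
            have "j = 0"
            proof (rule ccontr)
              assume "j \<noteq> 0"
              then obtain i where "j = Suc i" by (cases j) auto
              then show False using 2 no by (auto simp: y_def)
            qed
            then have "y \<in> S" using 2 by simp
            moreover have "y \<notin> U" using 2 by (auto simp: U_def)
            moreover have "u y = Blk 0 (b y)" using u2[OF y 2] \<open>j = 0\<close> by simp
            moreover from this have "T (u x) (u y) = p (b y) / 2" using Tf by (simp only:) (simp add: fresh_def)
            moreover have "p (b y) > 0" by (rule p(1)) simp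
            moreover from this have "- ln (p (b y) / 2) = ln 2 + c y" by (simp add: c_def ln_div)
            ultimately show ?thesis by (simp only: rhs_def) simp
          qed
        qed
      qed
      then show ?thesis by (simp add: y_def rhs_def)
    qed
    obtain m where m: "\<And>x y :: int \<Rightarrow> 'k. (\<forall>j. \<bar>j\<bar> \<le> int m \<longrightarrow> dist (x j) (y j) \<le> r) \<Longrightarrow> shift_dist x y \<le> (wt_sum + 1) * r"
      using shift_dist_le_coords[OF K_compact r] by blast
    have fine: "fib (window u m) \<in> fine_partitions shift_dist \<epsilon>"
    proof (rule fine_fib[OF labels_window[OF u] _ \<epsilon>])
      fix x y assume "window u m x = window u m y"
      then have "dist (x j) (y j) \<le> r" if "\<bar>j\<bar> \<le> int m" for j
        using u_dist[of "sh j x" "sh j y"] that by (simp add: window_eq_iff)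
      then show "shift_dist x y \<le> (wt_sum + 1) * r" by (intro m) auto
    qed
    let ?g = "\<lambda>x. indicator S x * (ln 2 + c x) + indicator U x * ln (2 * real N)"
    have intS: "integrable \<mu> (\<lambda>x. indicator S x * h x)" if "integrable \<mu> h" for h :: "_ \<Rightarrow> real"
      using integrable_mult_indicator[OF _ that, of S] S(1) by simp
    have intU: "integrable \<mu> (\<lambda>x. indicator U x * ln (2 * real N))"
      using integrable_mult_indicator[of U \<mu> "\<lambda>_. ln (2 * real N)"] U_sets by simp
    have ci: "integrable \<mu> c" by (rule labels_integrable(1)[OF cL])
    have g_int: "integrable \<mu> ?g"
      by (intro Bochner_Integration.integrable_add intS intU ci) simp
    then have g_meas: "?g \<in> borel_measurable borel"
      using borel_measurable_integrable[OF g_int] by (simp add: measurable_cong_sets[OF sets_mu refl])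
    have g_sh: "integrable \<mu> (\<lambda>x. ?g (sh 1 x))"
    proof -
      have "integrable (distr \<mu> borel (sh 1)) ?g" using g_int by (simp add: distr_sh)
      then show ?thesis by (rule integrable_distr[OF measurable_sh_mu])
    qed
    have "ks_entropy shift \<mu> (fib (window u m)) \<le> (\<integral>x. - ln (T (u x) (u (sh 1 x))) \<partial>\<mu>)"
      using step by (intro ks_markov_bound u T0 T1) auto
    also have "\<dots> \<le> (\<integral>x. ?g (sh 1 x) \<partial>\<mu>)"
    proof (rule integral_mono)
      show "integrable \<mu> (\<lambda>x. - ln (T (u x) (u (sh 1 x))))"
        using labels_integrable(1)[OF labels_pair[OF u, of "\<lambda>a b. - ln (T a b)" 0 1]] by simp
    qed (use step g_sh in auto)
    also have "\<dots> = (\<integral>x. ?g x \<partial>\<mu>)" by (rule integral_sh[OF g_meas])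
    also have "\<dots> = (\<integral>x. indicator S x * ln 2 + indicator S x * c x + indicator U x * ln (2 * real N) \<partial>\<mu>)"
      by (simp add: distrib_left)
    also have "\<dots> = measure \<mu> S * ln 2 + (\<integral>x. indicator S x * c x \<partial>\<mu>) + measure \<mu> U * ln (2 * real N)"
    proof -
      have i1: "integrable \<mu> (\<lambda>x. indicator S x * (ln 2 :: real))" by (intro intS) simp
      have i2: "integrable \<mu> (\<lambda>x. indicator S x * c x)" by (intro intS ci)
      show ?thesis
        unfolding Bochner_Integration.integral_add[OF Bochner_Integration.integrable_add[OF i1 i2] intU]
          Bochner_Integration.integral_add[OF i1 i2]
        using S(1) U_sets by simp
    qed
    \<comment> \<open>The base of a tower of height \<open>n\<close> has measure at most
      \<open>1 / n\<close>, it carries at most \<open>I / n\<close> of the cost, and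
      \<open>U\<close> has measure at most \<open>\<delta>\<close>.\<close>
    also have "\<dots> \<le> (1 / real n) * ln 2 + I / real n + \<delta> * ln (2 * real N)"
    proof (intro add_mono mult_right_mono)
      show "measure \<mu> S \<le> 1 / real n"
        by (rule marker_measure) (use S n in auto)
      show "(\<integral>x. indicator S x * c x \<partial>\<mu>) \<le> I / real n"
        using S(5) n by (simp add: field_simps I_def)
      show "measure \<mu> U \<le> \<delta>" using S(4) by (simp add: U_def)
    qed (use N in auto)
    finally have "ks_entropy shift \<mu> (fib (window u m)) \<le> (ln 2 + I) / real n + \<delta> * ln (2 * real N)"
      by (simp add: add_divide_distrib)
    then show ?thesis by (intro INF_lower2[OF fine]) simp
  qed
  show ?thesis
  proof (rule ereal_le_epsilon2)
    fix e :: real assume e: "0 < e"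
    define \<delta> where "\<delta> = e / (ln (2 * real N) + 1)"
    have l0: "ln (2 * real N) \<ge> 0" using N by simp
    then have "\<delta> > 0" using e by (simp add: \<delta>_def)
    from main[OF this] have "(INF \<xi>\<in>fine_partitions shift_dist \<epsilon>. ereal (ks_entropy shift \<mu> \<xi>))
      \<le> ereal ((ln 2 + I) / real n + \<delta> * ln (2 * real N))" .
    also have "\<delta> * ln (2 * real N) \<le> e"
      using l0 e by (simp add: \<delta>_def field_simps)
    finally show "(INF \<xi>\<in>fine_partitions shift_dist \<epsilon>. ereal (ks_entropy shift \<mu> \<xi>))
       \<le> ereal ((ln 2 + (\<integral>x. - ln (p (b x)) \<partial>\<mu>)) / real n) + ereal e"
      by (simp add: I_def c_def)
  qed
qed

end

section \<open>A block code from the measures of neighbourhoods\<close>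

text \<open>A Vitali argument: an element with the largest \<open>m\<close> absorbs all those whose
  neighbourhoods meet its own, and the rest is treated by induction.\<close>

lemma disjoint_neighbourhood_selection:
  fixes m :: "'w \<Rightarrow> real" and nb :: "'w \<Rightarrow> 'v set"
  assumes "finite Y" and ne: "\<And>w. w \<in> Y \<Longrightarrow> nb w \<noteq> {}"
  shows "\<exists>sel. (\<forall>w\<in>Y. sel w \<in> Y \<and> m w \<le> m (sel w) \<and> nb (sel w) \<inter> nb w \<noteq> {}) \<and>
           (\<forall>s\<in>sel ` Y. \<forall>s'\<in>sel ` Y. s \<noteq> s' \<longrightarrow> nb s \<inter> nb s' = {})"
  using assms
proof (induction Y rule: finite_psubset_induct)
  case (psubset Y)
  show ?case
  proof (cases "Y = {}")
    case False
    have "Max (m ` Y) \<in> m ` Y" using False psubset.hyps by (intro Max_in) auto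
    then obtain w0 where w0: "w0 \<in> Y" "m w0 = Max (m ` Y)" by auto
    have w0_max: "m w \<le> m w0" if "w \<in> Y" for w
      unfolding w0(2) using that psubset.hyps by (intro Max_ge) auto
    define Y' where "Y' = {w \<in> Y. nb w \<inter> nb w0 = {}}"
    have "w0 \<notin> Y'" using psubset.prems[OF w0(1)] by (simp add: Y'_def)
    then have "Y' \<subset> Y" using w0(1) by (auto simp: Y'_def)
    then obtain sel where sel: "\<And>w. w \<in> Y' \<Longrightarrow> sel w \<in> Y' \<and> m w \<le> m (sel w) \<and> nb (sel w) \<inter> nb w \<noteq> {}"
      "\<And>s s'. s \<in> sel ` Y' \<Longrightarrow> s' \<in> sel ` Y' \<Longrightarrow> s \<noteq> s' \<Longrightarrow> nb s \<inter> nb s' = {}"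
      using psubset.IH[of Y'] psubset.prems by (metis psubset_imp_subset subsetD)
    define sel' where "sel' w = (if w \<in> Y' then sel w else w0)" for w
    have "sel' w \<in> Y \<and> m w \<le> m (sel' w) \<and> nb (sel' w) \<inter> nb w \<noteq> {}" if "w \<in> Y" for w
    proof (cases "w \<in> Y'")
      case True
      then show ?thesis using sel(1)[OF True] by (auto simp: sel'_def Y'_def)
    next
      case False
      then show ?thesis using that w0 w0_max by (auto simp: sel'_def Y'_def)
    qed
    moreover have "nb s \<inter> nb s' = {}" if "s \<in> sel' ` Y" "s' \<in> sel' ` Y" "s \<noteq> s'" for s s'
    proof -
      have *: "s \<in> sel ` Y' \<or> s = w0" "s' \<in> sel ` Y' \<or> s' = w0"
        using that by (auto simp: sel'_def)
      have **: "nb t \<inter> nb w0 = {}" if "t \<in> sel ` Y'" for t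
        using that sel(1) by (auto simp: Y'_def)
      show ?thesis using * ** sel(2) that(3) by (metis Int_commute)
    qed
    ultimately show ?thesis by blast
  qed auto
qed

locale coded_measure = invariant_measure \<mu> for \<mu> :: "(int \<Rightarrow> 'k::metric_space) measure" +
  fixes a :: "'k \<Rightarrow> nat" and N :: nat and r :: real
  assumes a_meas: "a \<in> borel \<rightarrow>\<^sub>M count_space UNIV" and a_range: "range a \<subseteq> {..<N}"
    and a_dist: "\<And>x y. a x = a y \<Longrightarrow> dist x y < r"
begin

lemma r_pos: "r > 0"
  using a_dist[of undefined undefined] by simp

lemma N_pos: "N > 0"
  using a_range by (auto simp: image_subset_iff)

lemma a_fin: "finite (range a)"
  using a_range by (rule finite_subset) simp

definition cw :: "nat \<Rightarrow> (int \<Rightarrow> 'k) \<Rightarrow> nat list" where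
  "cw n x = map (\<lambda>i. a (x (int i))) [0..<n]"

definition words :: "nat \<Rightarrow> nat list set" where
  "words n = {w. set w \<subseteq> {..<N} \<and> length w = n}"

text \<open>Holds when points at distance below \<open>r\<close> can carry these labels, so that the
  neighbourhood of a word contains the words of all points that stay within \<open>r\<close>. The
  case \<open>k = l\<close> makes the relation reflexive at numbers that are not labels,
  too.\<close>

definition near :: "nat \<Rightarrow> nat \<Rightarrow> bool" where
  "near k l \<longleftrightarrow> k = l \<or> (\<exists>x y. a x = k \<and> a y = l \<and> dist x y < r)"

text \<open>Averaging with the uniform distribution keeps all weights at least exponentially large.\<close>

definition wgt :: "nat \<Rightarrow> nat list \<Rightarrow> real" where
  "wgt n w = (measure \<mu> (cw n -` {w}) + 1 / real N ^ n) / 2"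

definition nbh :: "nat \<Rightarrow> nat list \<Rightarrow> nat list set" where
  "nbh n w = {v \<in> words n. list_all2 near w v}"

definition nwgt :: "nat \<Rightarrow> nat list \<Rightarrow> real" where
  "nwgt n w = (\<Sum>v\<in>nbh n w. wgt n v)"

text \<open>The quantity c(n) of the overview, with the weights \<open>wgt\<close> in place of
  \<open>\<mu>\<close>.\<close>

definition code_cost :: "nat \<Rightarrow> real" where
  "code_cost n = (\<integral>x. - ln (nwgt n (cw n x)) \<partial>\<mu>)"

lemma near_refl [simp]: "near k k"
  by (simp add: near_def)

lemma near_sym: "near k l \<Longrightarrow> near l k"
  unfolding near_def by (metis dist_commute)

text \<open>One \<open>r\<close> for the cell of \<open>z\<close> and one for the pair of points
  that witnesses \<open>near\<close>.\<close>

lemma near_point: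
  assumes "near k l" "a z = k"
  shows "\<exists>z'. a z' = l \<and> dist z z' < 2 * r"
  using assms(1) unfolding near_def
proof (elim disjE exE conjE)
  assume "k = l" then show ?thesis using assms(2) r_pos by (intro exI[of _ z]) auto
next
  fix x y assume "a x = k" "a y = l" "dist x y < r"
  then show ?thesis using a_dist[of z x] assms(2) dist_triangle[of z y x] by (intro exI[of _ y]) auto
qed

lemma labels_cw: "labels (cw n)"
  unfolding cw_def by (rule labels_map) (rule labels_coord[OF a_meas a_fin])

lemma cw_words: "cw n x \<in> words n"
  using a_range by (auto simp: cw_def words_def)

lemma length_cw [simp]: "length (cw n x) = n" and nth_cw [simp]: "t < n \<Longrightarrow> cw n x ! t = a (x (int t))"
  by (simp_all add: cw_def)

lemma finite_words: "finite (words n)" and card_words: "card (words n) = N ^ n"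
  unfolding words_def by (simp_all add: finite_lists_length_eq card_lists_length_eq)

lemma self_nbh: "w \<in> words n \<Longrightarrow> w \<in> nbh n w"
  by (simp add: nbh_def list_all2_refl)

lemma wgt_pos: "wgt n w > 0"
  using N_pos by (auto simp: wgt_def intro!: add_nonneg_pos)

lemma wgt_ge: "wgt n w \<ge> 1 / (2 * real N ^ n)"
  by (simp add: wgt_def field_simps)

lemma sum_wgt: "(\<Sum>w\<in>words n. wgt n w) \<le> 1"
proof -
  have "(\<Sum>w\<in>words n. measure \<mu> (cw n -` {w})) = (\<Sum>w\<in>range (cw n). measure \<mu> (cw n -` {w}))"
  proof (rule sum.mono_neutral_right[OF finite_words])
    show "\<forall>w\<in>words n - range (cw n). measure \<mu> (cw n -` {w}) = 0"
    proof
      fix w assume "w \<in> words n - range (cw n)"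
      then have "cw n -` {w} = {}" by auto
      then show "measure \<mu> (cw n -` {w}) = 0" by simp
    qed
  qed (use cw_words in auto)
  also have "\<dots> = 1" by (rule sum_fibres[OF labels_mu[OF labels_cw]])
  finally have "(\<Sum>w\<in>words n. measure \<mu> (cw n -` {w})) = 1" .
  then show ?thesis using N_pos
    by (simp add: wgt_def sum.distrib card_words flip: sum_divide_distrib)
qed

lemma nwgt_le_1: "nwgt n w \<le> 1"
proof -
  have "nwgt n w \<le> (\<Sum>w\<in>words n. wgt n w)"
    unfolding nwgt_def by (rule sum_mono2[OF finite_words]) (auto simp: nbh_def less_imp_le wgt_pos)
  then show ?thesis using sum_wgt[of n] by linarith
qed

lemma nwgt_ge:
  assumes "w \<in> words n"
  shows "nwgt n w \<ge> 1 / (2 * real N ^ n)"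
proof -
  have "finite (nbh n w)" by (rule finite_subset[OF _ finite_words[of n]]) (auto simp: nbh_def)
  then have "wgt n w \<le> nwgt n w"
    unfolding nwgt_def by (intro member_le_sum self_nbh[OF assms]) (auto simp: less_imp_le wgt_pos)
  then show ?thesis using wgt_ge[of n w] by linarith
qed

lemma nwgt_pos: "w \<in> words n \<Longrightarrow> nwgt n w > 0"
  using nwgt_ge[of w n] N_pos by (auto intro: less_le_trans[rotated])

lemma labels_cost: "labels (\<lambda>x. - ln (nwgt n (cw n x)))"
  by (rule labels_compose[OF labels_cw])

text \<open>The first bound holds because the weights add up to at most 1. The second, linear in the
  length, comes from the uniform half of \<open>wgt\<close>; it is the boundedness that Hoeffding's
  inequality asks for.\<close>

lemma cost_bounds:
  "0 \<le> - ln (nwgt n (cw n x))" "- ln (nwgt n (cw n x)) \<le> real n * ln (real N) + ln 2"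
proof -
  have pos: "nwgt n (cw n x) > 0" by (rule nwgt_pos[OF cw_words])
  then show "0 \<le> - ln (nwgt n (cw n x))" using nwgt_le_1[of n "cw n x"] by (simp add: ln_le_zero_iff)
  have "ln (1 / (2 * real N ^ n)) \<le> ln (nwgt n (cw n x))"
    using nwgt_ge[OF cw_words] N_pos by (intro ln_mono) auto
  moreover have "ln (1 / (2 * real N ^ n)) = - (real n * ln (real N) + ln 2)"
    using N_pos by (simp add: ln_div ln_mult ln_realpow)
  ultimately show "- ln (nwgt n (cw n x)) \<le> real n * ln (real N) + ln 2" by linarith
qed

text \<open>The selected words have disjoint neighbourhoods, so \<open>nwgt\<close> is a
  subprobability on them and can serve as block code. A word is replaced by one of at least the same
  \<open>nwgt\<close>, so the expected cost does not increase.\<close>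

lemma inf_ks_le_code_cost:
  assumes n: "n \<ge> 1" and \<epsilon>: "(wt_sum + 1) * (9 * r) < \<epsilon>"
  shows "(INF \<xi>\<in>fine_partitions shift_dist \<epsilon>. ereal (ks_entropy shift \<mu> \<xi>)) \<le> ereal ((ln 2 + code_cost n) / real n)"
proof -
  obtain sel where sel: "\<And>w. w \<in> words n \<Longrightarrow> sel w \<in> words n \<and> nwgt n w \<le> nwgt n (sel w) \<and> nbh n (sel w) \<inter> nbh n w \<noteq> {}"
      "\<And>s s'. s \<in> sel ` words n \<Longrightarrow> s' \<in> sel ` words n \<Longrightarrow> s \<noteq> s' \<Longrightarrow> nbh n s \<inter> nbh n s' = {}"
  proof -
    have ne: "nbh n w \<noteq> {}" if "w \<in> words n" for w using self_nbh[OF that] by auto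
    have "\<exists>sel. (\<forall>w\<in>words n. sel w \<in> words n \<and> nwgt n w \<le> nwgt n (sel w) \<and> nbh n (sel w) \<inter> nbh n w \<noteq> {}) \<and>
        (\<forall>s\<in>sel ` words n. \<forall>s'\<in>sel ` words n. s \<noteq> s' \<longrightarrow> nbh n s \<inter> nbh n s' = {})"
      by (rule disjoint_neighbourhood_selection[OF finite_words]) (rule ne)
    then obtain sel where s1: "\<forall>w\<in>words n. sel w \<in> words n \<and> nwgt n w \<le> nwgt n (sel w) \<and> nbh n (sel w) \<inter> nbh n w \<noteq> {}"
      and s2: "\<forall>s\<in>sel ` words n. \<forall>s'\<in>sel ` words n. s \<noteq> s' \<longrightarrow> nbh n s \<inter> nbh n s' = {}"
      by (elim exE conjE)
    show ?thesis
    proof (rule that)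
      show "sel w \<in> words n \<and> nwgt n w \<le> nwgt n (sel w) \<and> nbh n (sel w) \<inter> nbh n w \<noteq> {}"
        if "w \<in> words n" for w by (rule bspec[OF s1 that])
      show "nbh n s \<inter> nbh n s' = {}" if "s \<in> sel ` words n" "s' \<in> sel ` words n" "s \<noteq> s'" for s s'
        by (rule mp[OF bspec[OF bspec[OF s2 that(1)] that(2)] that(3)])
    qed
  qed
  define b where "b x = sel (cw n x)" for x
  have bL: "labels b" unfolding b_def by (rule labels_compose[OF labels_cw])
  have b_words: "b x \<in> words n" for x using sel(1)[OF cw_words] by (simp add: b_def)
  have "(INF \<xi>\<in>fine_partitions shift_dist \<epsilon>. ereal (ks_entropy shift \<mu> \<xi>))
      \<le> ereal ((ln 2 + (\<integral>x. - ln (nwgt n (b x)) \<partial>\<mu>)) / real n)"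
  proof (rule block_code[OF a_meas a_range _ bL _ _ _ n _ \<epsilon>])
    show "dist x y < 9 * r" if "a x = a y" for x y using a_dist[OF that] r_pos by simp
    show "9 * r > 0" using r_pos by simp
    show "nwgt n \<beta> > 0" if "\<beta> \<in> range b" for \<beta> using that b_words nwgt_pos by auto
    have "(\<Sum>\<beta>\<in>range b. nwgt n \<beta>) \<le> (\<Sum>s\<in>sel ` words n. nwgt n s)"
    proof (rule sum_mono2)
      show "range b \<subseteq> sel ` words n" using cw_words by (auto simp: b_def)
      show "nwgt n s \<ge> 0" if "s \<in> sel ` words n - range b" for s
        using that sel(1) nwgt_pos by (auto intro: less_imp_le)
    qed (simp add: finite_words)
    also have "\<dots> = (\<Sum>v\<in>(\<Union>s\<in>sel ` words n. nbh n s). wgt n v)"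
      unfolding nwgt_def
    proof (rule sum.UNION_disjoint[symmetric])
      show "\<forall>s\<in>sel ` words n. finite (nbh n s)"
        by (auto intro: finite_subset[OF _ finite_words[of n]] simp: nbh_def)
      show "\<forall>s\<in>sel ` words n. \<forall>s'\<in>sel ` words n. s \<noteq> s' \<longrightarrow> nbh n s \<inter> nbh n s' = {}"
        using sel(2) by blast
    qed (simp add: finite_words)
    also have "\<dots> \<le> (\<Sum>v\<in>words n. wgt n v)"
      by (rule sum_mono2[OF finite_words]) (auto simp: nbh_def less_imp_le wgt_pos)
    also have "\<dots> \<le> 1" by (rule sum_wgt)
    finally show "(\<Sum>\<beta>\<in>range b. nwgt n \<beta>) \<le> 1" .
    show "dist (x (int t)) (y (int t)) < 9 * r" if "b x = b y" "t < n" for x y t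
    proof -
      define s where "s = b x"
      have chain: "\<exists>v. near (a (z (int t))) v \<and> near (s ! t) v" if "b z = s" for z
      proof -
        obtain v where "v \<in> nbh n s" "v \<in> nbh n (cw n z)" using sel(1)[OF cw_words, of z] \<open>b z = s\<close> by (auto simp: b_def)
        then have "near (s ! t) (v ! t)" "near (cw n z ! t) (v ! t)"
          using \<open>t < n\<close> by (auto simp: nbh_def list_all2_conv_all_nth words_def)
        then show ?thesis using \<open>t < n\<close> by auto
      qed
      obtain v where v: "near (a (x (int t))) v" "near (s ! t) v" using chain[of x] s_def by blast
      obtain v' where v': "near (a (y (int t))) v'" "near (s ! t) v'" using chain[of y] s_def \<open>b x = b y\<close> by metis
      obtain z1 where z1: "a z1 = v" "dist (x (int t)) z1 < 2 * r" using near_point[OF v(1) refl] by blast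
      obtain z2 where z2: "a z2 = s ! t" "dist z1 z2 < 2 * r" using near_point[OF near_sym[OF v(2)] z1(1)] by blast
      obtain z3 where z3: "a z3 = v'" "dist z2 z3 < 2 * r" using near_point[OF v'(2) z2(1)] by blast
      obtain z4 where z4: "a z4 = a (y (int t))" "dist z3 z4 < 2 * r" using near_point[OF near_sym[OF v'(1)] z3(1)] by blast
      have "dist z4 (y (int t)) < r" using a_dist[OF z4(1)] .
      then show ?thesis
        using z1 z2 z3 z4 dist_triangle[of "x (int t)" "y (int t)" z1] dist_triangle[of z1 "y (int t)" z2]
          dist_triangle[of z2 "y (int t)" z3] dist_triangle[of z3 "y (int t)" z4] by linarith
    qed
  qed
  also have "(\<integral>x. - ln (nwgt n (b x)) \<partial>\<mu>) \<le> code_cost n"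
    unfolding code_cost_def
  proof (rule integral_mono)
    show "integrable \<mu> (\<lambda>x. - ln (nwgt n (b x)))"
      by (rule labels_integrable(1)[OF labels_compose[OF bL]])
    show "integrable \<mu> (\<lambda>x. - ln (nwgt n (cw n x)))"
      by (rule labels_integrable(1)[OF labels_cost])
    show "- ln (nwgt n (b x)) \<le> - ln (nwgt n (cw n x))" for x
      using sel(1)[OF cw_words, of x] nwgt_pos[OF cw_words, of n x] by (simp add: b_def)
  qed
  finally show ?thesis by (simp add: divide_right_mono)
qed

end

section \<open>Concatenation of independent blocks\<close>

text \<open>The Cantor pairing runs along antidiagonals, so position \<open>triangle j + i\<close>
  with \<open>i \<le> j\<close> decodes to the pair of \<open>i\<close> and \<open>j - i\<close>.
  Hence block \<open>j\<close> occupies \<open>j + 1\<close> positions from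
  \<open>triangle j\<close> on and consists of the coordinates from 0 to \<open>j\<close> of
  \<open>\<omega> j\<close>. At negative times the letter at position 0 is repeated.\<close>

definition concat_pt :: "(nat \<Rightarrow> int \<Rightarrow> 'k) \<Rightarrow> int \<Rightarrow> 'k" where
  "concat_pt \<omega> t = (case prod_decode (nat t) of (i, k) \<Rightarrow> \<omega> (i + k) (int i))"

lemma concat_pt_block:
  assumes "i \<le> j"
  shows "concat_pt \<omega> (int (triangle j + i)) = \<omega> j (int i)"
proof -
  have "prod_encode (i, j - i) = triangle j + i"
    using assms by (simp add: prod_encode_def)
  then have "prod_decode (triangle j + i) = (i, j - i)"
    by (metis prod_encode_inverse)
  moreover have "nat (int (triangle j + i)) = triangle j + i" by (rule nat_int)
  ultimately show ?thesis using assms by (simp only: concat_pt_def) simp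
qed

lemma triangle_block: "\<exists>j i. i \<le> j \<and> t = triangle j + i"
proof -
  obtain i k where "prod_decode t = (i, k)" by fastforce
  then have "t = triangle (i + k) + i" using prod_decode_inverse[of t] by (simp add: prod_encode_def)
  then show ?thesis by (intro exI[of _ "i + k"] exI[of _ i]) auto
qed

lemma triangle_mono: "i \<le> j \<Longrightarrow> triangle i \<le> triangle j"
  by (rule lift_Suc_mono_le[of triangle]) auto

lemma triangle_ge: "real J ^ 2 / 2 \<le> real (triangle J)"
  by (induction J) (auto simp: power2_eq_square field_simps)

text \<open>\<open>blk n\<close> is the block in progress at time \<open>n\<close>. It grows like
  the square root of \<open>n\<close>, so one block is negligible against the past.\<close>

lemma nat_sequence_blocks:
  obtains blk :: "nat \<Rightarrow> nat" where "\<And>n. triangle (blk n) \<le> n" "\<And>n. n \<le> triangle (blk n) + blk n"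
    "filterlim blk at_top sequentially"
proof -
  have "\<forall>n. \<exists>j. triangle j \<le> n \<and> n \<le> triangle j + j"
  proof
    fix n
    obtain j i where "i \<le> j" "n = triangle j + i" using triangle_block[of n] by blast
    then show "\<exists>j. triangle j \<le> n \<and> n \<le> triangle j + j" by (intro exI[of _ j]) auto
  qed
  then obtain blk where blk: "\<And>n. triangle (blk n) \<le> n" "\<And>n. n \<le> triangle (blk n) + blk n" by metis
  have "k \<le> blk n" if "n \<ge> triangle k" for k n
  proof (rule ccontr)
    assume "\<not> k \<le> blk n"
    then have "triangle (Suc (blk n)) \<le> triangle k" by (intro triangle_mono) simp
    then show False using blk(2)[of n] that by simp
  qed
  then have "filterlim blk at_top sequentially"
    unfolding filterlim_at_top eventually_sequentially by blast
  then show ?thesis using that blk by blast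
qed

section \<open>Independent blocks and their law of large numbers\<close>

context invariant_measure
begin

text \<open>Each factor is a complete two-sided sample of \<open>\<mu>\<close>, of which
  \<open>concat_pt\<close> reads an initial segment; this keeps all factors of the product
  equal.\<close>

abbreviation Om :: "(nat \<Rightarrow> int \<Rightarrow> 'k) measure" where
  "Om \<equiv> PiM UNIV (\<lambda>_. \<mu>)"

lemma space_Om [simp]: "space Om = UNIV"
  by (simp add: space_PiM)

lemma product_Om: "product_prob_space (\<lambda>_ :: nat. \<mu>)"
  by (intro product_prob_spaceI prob_space_axioms)

lemma prob_space_Om: "prob_space Om"
  by (intro prob_space_PiM prob_space_axioms)

lemma indep_coords: "prob_space.indep_vars Om (\<lambda>_. \<mu>) (\<lambda>j \<omega>. \<omega> j) UNIV"
proof -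
  interpret P: product_prob_space "\<lambda>_ :: nat. \<mu>" UNIV by (rule product_Om)
  have "distr Om Om (\<lambda>x. \<lambda>i\<in>UNIV. x i) = Om" by (simp add: distr_id restrict_UNIV)
  moreover have "(\<Pi>\<^sub>M i\<in>UNIV. distr Om \<mu> (\<lambda>\<omega>. \<omega> i)) = Om"
    by (intro PiM_cong refl P.PiM_component) auto
  ultimately show ?thesis
    by (subst P.indep_vars_iff_distr_eq_PiM) auto
qed

lemma integral_Om_coord:
  fixes Y :: "_ \<Rightarrow> real"
  assumes "Y \<in> borel_measurable borel"
  shows "(\<integral>\<omega>. Y (\<omega> j) \<partial>Om) = (\<integral>x. Y x \<partial>\<mu>)"
proof -
  interpret P: product_prob_space "\<lambda>_ :: nat. \<mu>" UNIV by (rule product_Om)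
  have "(\<integral>x. Y x \<partial>\<mu>) = (\<integral>x. Y x \<partial>distr Om \<mu> (\<lambda>\<omega>. \<omega> j))" by (subst P.PiM_component) auto
  also have "\<dots> = (\<integral>\<omega>. Y (\<omega> j) \<partial>Om)"
    using assms by (intro integral_distr measurable_component_singleton)
      (auto simp: measurable_cong_sets[OF sets_mu refl])
  finally show ?thesis by simp
qed

text \<open>Hoeffding's inequality makes the deviation probabilities summable.\<close>

lemma block_law_of_large_numbers:
  fixes Y :: "nat \<Rightarrow> (int \<Rightarrow> 'k) \<Rightarrow> real"
  assumes meas: "\<And>j. Y j \<in> borel_measurable borel" and C: "C > 0"
    and bnd: "\<And>j x. 0 \<le> Y j x" "\<And>j x. Y j x \<le> C * real (Suc j)"
  shows "AE \<omega> in Om. (\<lambda>J. (\<Sum>j<J. Y j (\<omega> j) - (\<integral>x. Y j x \<partial>\<mu>)) / real J ^ 2) \<longlonglongrightarrow> 0"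
proof -
  interpret P: prob_space Om by (rule prob_space_Om)
  have meas': "Y j \<in> borel_measurable \<mu>" for j using meas by (simp add: measurable_cong_sets[OF sets_mu refl])
  have indep: "P.indep_vars (\<lambda>_. borel) (\<lambda>j \<omega>. Y j (\<omega> j)) UNIV"
    by (rule P.indep_vars_compose2[OF indep_coords]) (rule meas')
  have cm: "(\<lambda>\<omega>. Y j (\<omega> j)) \<in> borel_measurable Om" for j
    using measurable_compose[OF measurable_component_singleton[of j UNIV "\<lambda>_. \<mu>"] meas'[of j]] by simp
  define D where "D J \<omega> = (\<Sum>j<J. Y j (\<omega> j) - (\<integral>x. Y j x \<partial>\<mu>))" for J \<omega>
  have Dm: "D J \<in> borel_measurable Om" for J
    unfolding D_def by (intro borel_measurable_sum borel_measurable_diff cm) simp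
  have dev: "AE \<omega> in Om. \<forall>\<^sub>F J in sequentially. \<bar>D J \<omega>\<bar> < e * real J ^ 2" if e: "e > 0" for e
  proof -
    define A where "A J = {\<omega>. \<bar>D J \<omega>\<bar> \<ge> e * real J ^ 2}" for J
    have A_sets: "A J \<in> sets Om" for J
    proof -
      have "{\<omega> \<in> space Om. e * real J ^ 2 \<le> \<bar>D J \<omega>\<bar>} \<in> sets Om"
        by (intro borel_measurable_le borel_measurable_const borel_measurable_abs Dm)
      then show ?thesis by (simp add: A_def)
    qed
    define \<rho> where "\<rho> = exp (- 2 * e\<^sup>2 / C\<^sup>2)"
    have \<rho>: "0 < \<rho>" "\<rho> < 1" using e C by (auto simp: \<rho>_def)
    have prob: "P.prob (A J) \<le> 2 * \<rho> ^ J" for J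
    proof (cases "J = 0")
      case True
      have "P.prob (A J) \<le> 2" using P.prob_le_1[of "A J"] by linarith
      then show ?thesis using True by simp
    next
      case False
      interpret H: Hoeffding_ineq Om "{..<J}" "\<lambda>j \<omega>. Y j (\<omega> j)" "\<lambda>_. 0" "\<lambda>j. C * real (Suc j)"
        "\<Sum>j<J. P.expectation (\<lambda>\<omega>. Y j (\<omega> j))"
      proof unfold_locales
        show "P.indep_vars (\<lambda>_. borel) (\<lambda>j \<omega>. Y j (\<omega> j)) {..<J}"
          by (rule P.indep_vars_subset[OF indep]) simp
      qed (use bnd in auto)
      \<comment> \<open>The ranges \<open>C * (j + 1)\<close> give a sum of squares of at most
        \<open>C^2 * J^3\<close>, against the square \<open>e^2 * J^4\<close> of the deviation. The
        exponent is therefore linear in \<open>J\<close> and the probabilities decay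
        geometrically.\<close>
      let ?V = "\<Sum>j<J. (C * real (Suc j) - 0)\<^sup>2"
      have V: "0 < ?V" using False C by (intro sum_pos) (auto simp: lessThan_empty_iff)
      have "?V \<le> (\<Sum>j<J. (C * real J)\<^sup>2)" using C by (intro sum_mono power_mono) auto
      also have "\<dots> = real J * (C * real J)\<^sup>2" by simp
      finally have V': "?V \<le> real J * (C * real J)\<^sup>2" .
      have "A J = {\<omega> \<in> space Om. \<bar>(\<Sum>j<J. Y j (\<omega> j)) - (\<Sum>j<J. P.expectation (\<lambda>\<omega>. Y j (\<omega> j)))\<bar> \<ge> e * real J ^ 2}"
        by (simp add: A_def D_def sum_subtractf integral_Om_coord[OF meas])
      then have "P.prob (A J) \<le> 2 * exp (- 2 * (e * real J ^ 2)\<^sup>2 / ?V)"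
        using H.Hoeffding_ineq_abs_ge[OF _ V, of "e * real J ^ 2"] e by simp
      also have "- 2 * (e * real J ^ 2)\<^sup>2 / ?V \<le> - 2 * (e * real J ^ 2)\<^sup>2 / (real J * (C * real J)\<^sup>2)"
        using V V' False C by (intro divide_left_mono_neg mult_pos_pos) auto
      also have "\<dots> = real J * (- 2 * e\<^sup>2 / C\<^sup>2)"
        using False C by (simp add: field_simps power2_eq_square)
      also have "2 * exp (real J * (- 2 * e\<^sup>2 / C\<^sup>2)) = 2 * \<rho> ^ J"
        by (simp only: \<rho>_def exp_of_nat_mult)
      finally show ?thesis by simp
    qed
    have "summable (\<lambda>J. P.prob (A J))"
    proof (rule summable_comparison_test[of _ "\<lambda>J. 2 * \<rho> ^ J"])
      show "summable (\<lambda>J. 2 * \<rho> ^ J)" using \<rho> by (intro summable_mult summable_geometric) auto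
    qed (use prob in auto)
    then have "AE \<omega> in Om. \<forall>\<^sub>F J in sequentially. \<omega> \<in> space Om - A J"
      using A_sets by (intro borel_cantelli_AE1) (auto simp: P.emeasure_eq_measure)
    then show ?thesis by (rule AE_mp) (auto simp: A_def not_le intro!: AE_I2)
  qed
  \<comment> \<open>Countably many tolerances are handled with one exceptional null set.\<close>
  have "AE \<omega> in Om. \<forall>k. \<forall>\<^sub>F J in sequentially. \<bar>D J \<omega>\<bar> < (1 / real (Suc k)) * real J ^ 2"
    by (subst AE_all_countable) (intro allI dev, simp)
  then show ?thesis
  proof (rule AE_mp, intro AE_I2 impI)
    fix \<omega> assume *: "\<forall>k. \<forall>\<^sub>F J in sequentially. \<bar>D J \<omega>\<bar> < (1 / real (Suc k)) * real J ^ 2"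
    have "(\<lambda>J. D J \<omega> / real J ^ 2) \<longlonglongrightarrow> 0"
    proof (rule tendstoI)
      fix e :: real assume "e > 0"
      then obtain k where k: "inverse (real (Suc k)) < e" using reals_Archimedean by blast
      from *[rule_format, of k] show "\<forall>\<^sub>F J in sequentially. dist (D J \<omega> / real J ^ 2) 0 < e"
      proof (rule eventually_elim2[OF _ eventually_gt_at_top[of 0]])
        fix J :: nat assume J: "\<bar>D J \<omega>\<bar> < 1 / real (Suc k) * real J ^ 2" "J > 0"
        then have "\<bar>D J \<omega>\<bar> / real J ^ 2 < 1 / real (Suc k)" by (subst divide_less_eq) auto
        then show "dist (D J \<omega> / real J ^ 2) 0 < e" using k by (simp add: inverse_eq_divide)
      qed
    qed
    then show "(\<lambda>J. (\<Sum>j<J. Y j (\<omega> j) - (\<integral>x. Y j x \<partial>\<mu>)) / real J ^ 2) \<longlonglongrightarrow> 0"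
      by (simp add: D_def)
  qed
qed

end

section \<open>Generic points\<close>

definition avg :: "((int \<Rightarrow> 'k) \<Rightarrow> real) \<Rightarrow> nat \<Rightarrow> (int \<Rightarrow> 'k) \<Rightarrow> real" where
  "avg \<phi> n x = (\<Sum>i<n. \<phi> (sh (int i) x)) / real n"

text \<open>The empirical measure is the image of the uniform distribution on the times below
  \<open>n\<close>.\<close>

lemma integral_empirical:
  fixes x :: "int \<Rightarrow> 'k::topological_space"
  assumes \<phi>: "\<phi> \<in> borel_measurable borel" and n: "n \<ge> 1"
  shows "(\<integral>y. \<phi> y \<partial>empirical_measure shift n x) = avg \<phi> n x"
proof -
  let ?U = "uniform_count_measure {..<n}"
  have meas: "(\<lambda>i. sh (int i) x) \<in> ?U \<rightarrow>\<^sub>M borel"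
    by (simp add: measurable_def space_uniform_count_measure sets_uniform_count_measure)
  have "empirical_measure shift n x = distr ?U borel (\<lambda>i. sh (int i) x)"
  proof (rule measure_eqI)
    fix A assume "A \<in> sets (empirical_measure shift n x)"
    then have A: "A \<in> sets borel" by simp
    let ?B = "{i \<in> {..<n}. sh (int i) x \<in> A}"
    have "emeasure (empirical_measure shift n x) A = ennreal (1 / real n) * (\<Sum>i<n. indicator A (sh (int i) x))"
      using A by (simp add: emeasure_empirical_measure funpow_shift)
    also have "(\<Sum>i<n. indicator A (sh (int i) x)) = (ennreal (real (card ?B)))"
      by (simp add: indicator_def sum.If_cases Int_def ennreal_of_nat_eq_real_of_nat)
    also have "ennreal (1 / real n) * \<dots> = ennreal (real (card ?B) / real n)"
      by (simp flip: ennreal_mult)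
    also have "\<dots> = emeasure ?U ?B"
      by (subst emeasure_uniform_count_measure) auto
    also have "?B = (\<lambda>i. sh (int i) x) -` A \<inter> space ?U"
      by (auto simp: space_uniform_count_measure)
    also have "emeasure ?U \<dots> = emeasure (distr ?U borel (\<lambda>i. sh (int i) x)) A"
      using emeasure_distr[OF meas A] by simp
    finally show "emeasure (empirical_measure shift n x) A = emeasure (distr ?U borel (\<lambda>i. sh (int i) x)) A" .
  qed simp
  then have "(\<integral>y. \<phi> y \<partial>empirical_measure shift n x) = (\<integral>i. \<phi> (sh (int i) x) \<partial>?U)"
    using integral_distr[OF meas \<phi>] by simp
  then show ?thesis
    by (simp add: integral_uniform_count_measure avg_def)
qed

text \<open>The functions \<open>f k\<close> decrease to the indicator of a closed set, and closed
  sets form a generator that is stable under intersection.\<close>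

lemma borel_probs_eqI:
  fixes \<mu> \<nu> :: "'a::metric_space measure"
  assumes \<mu>: "\<mu> \<in> borel_probs" and \<nu>: "\<nu> \<in> borel_probs"
    and eq: "\<And>\<phi> :: 'a \<Rightarrow> real. continuous_on UNIV \<phi> \<Longrightarrow> (\<integral>x. \<phi> x \<partial>\<mu>) = (\<integral>x. \<phi> x \<partial>\<nu>)"
  shows "\<mu> = \<nu>"
proof (rule measure_eqI_generator_eq[where E = "Collect closed" and \<Omega> = UNIV and A = "\<lambda>_. UNIV"])
  interpret M: prob_space \<mu> using \<mu> by (simp add: borel_probs_def)
  interpret N: prob_space \<nu> using \<nu> by (simp add: borel_probs_def)
  have s: "sets \<mu> = sets borel" "sets \<nu> = sets borel" using \<mu> \<nu> by (simp_all add: borel_probs_def)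
  have closed_sigma: "sets (borel :: 'a measure) = sigma_sets UNIV (Collect closed)"
    by (subst borel_eq_closed) (simp add: sets_measure_of)
  show "sets \<mu> = sigma_sets UNIV (Collect closed)" "sets \<nu> = sigma_sets UNIV (Collect closed)"
    using s closed_sigma by simp_all
  show "Int_stable (Collect closed :: 'a set set)" by (auto simp: Int_stable_def)
  show "emeasure \<mu> UNIV \<noteq> \<infinity>" by simp
  fix C :: "'a set" assume "C \<in> Collect closed"
  then have C: "closed C" by simp
  show "emeasure \<mu> C = emeasure \<nu> C"
  proof (cases "C = {}")
    case False
    define f where "f k x = max 0 (1 - real k * infdist x C)" for k x
    have fc: "continuous_on UNIV (f k)" for k
      unfolding f_def by (intro continuous_intros)
    have lim: "(\<lambda>k. f k x) \<longlonglongrightarrow> indicator C x" for x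
    proof (cases "x \<in> C")
      case True
      then have "f k x = 1" for k by (simp add: f_def)
      then show ?thesis using True by simp
    next
      case False
      then have pos: "infdist x C > 0"
        using C \<open>C \<noteq> {}\<close> by (simp add: in_closed_iff_infdist_zero infdist_nonneg order.strict_iff_order)
      obtain K :: nat where K: "1 / infdist x C < real K" using reals_Archimedean2 by blast
      have "f k x = 0" if "k \<ge> K" for k
      proof -
        have "1 / infdist x C < real k" using K that by linarith
        then have "1 < real k * infdist x C" using pos by (simp add: field_simps)
        then show ?thesis by (simp add: f_def)
      qed
      then show ?thesis using False
        by (intro tendsto_eventually) (auto simp: eventually_sequentially)
    qed
    have conv: "(\<lambda>k. \<integral>x. f k x \<partial>\<rho>) \<longlonglongrightarrow> (\<integral>x. indicator C x \<partial>\<rho>)" if \<rho>: "prob_space \<rho>" "sets \<rho> = sets borel" for \<rho>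
    proof (rule integral_dominated_convergence[where w = "\<lambda>_. 1"])
      interpret prob_space \<rho> by fact
      show "integrable \<rho> (\<lambda>_. 1 :: real)" by simp
      show "f k \<in> borel_measurable \<rho>" for k
        using borel_measurable_continuous_onI[OF fc] by (simp add: measurable_cong_sets[OF \<rho>(2) refl])
      show "(indicator C :: 'a \<Rightarrow> real) \<in> borel_measurable \<rho>"
        using C \<rho>(2) by (intro borel_measurable_indicator) simp
    qed (use lim in \<open>auto simp: f_def infdist_nonneg\<close>)
    have "(\<integral>x. indicator C x \<partial>\<mu>) = (\<integral>x. indicator C x \<partial>\<nu> :: real)"
      using conv[OF M.prob_space_axioms s(1)] conv[OF N.prob_space_axioms s(2)] eq[OF fc]
      by (auto intro: LIMSEQ_unique)
    then show ?thesis using C s sets_eq_imp_space_eq[OF s(1)] sets_eq_imp_space_eq[OF s(2)]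
      by (simp add: M.emeasure_eq_measure N.emeasure_eq_measure)
  qed simp
qed auto

text \<open>Convergent averages leave room for one limit measure only, because a Borel probability
  is determined by its integrals of continuous functions.\<close>

lemma generic_pointI:
  fixes \<mu> :: "(int \<Rightarrow> 'k::metric_space) measure"
  assumes \<mu>: "\<mu> \<in> borel_probs"
    and conv: "\<And>\<phi>. continuous_on UNIV \<phi> \<Longrightarrow> (\<lambda>n. avg \<phi> n x) \<longlonglongrightarrow> (\<integral>y. \<phi> y \<partial>\<mu>)"
  shows "x \<in> generic_points shift \<mu>"
proof -
  have emp: "(\<lambda>n. \<integral>y. \<phi> y \<partial>empirical_measure shift n x) \<longlonglongrightarrow> (\<integral>y. \<phi> y \<partial>\<mu>)"
    if "continuous_on UNIV \<phi>" for \<phi> :: "(int \<Rightarrow> 'k) \<Rightarrow> real"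
  proof (rule Lim_transform_eventually[OF conv[OF that]])
    show "\<forall>\<^sub>F n in sequentially. avg \<phi> n x = (\<integral>y. \<phi> y \<partial>empirical_measure shift n x)"
      using eventually_ge_at_top[of "1::nat"] by eventually_elim
        (simp add: integral_empirical[OF borel_measurable_continuous_onI[OF that]])
  qed
  have "\<mu> \<in> limit_measures shift x"
    using \<mu> emp unfolding limit_measures_def weak_star_limit_def
    by (auto intro!: exI[of _ id] strict_monoI)
  moreover have "\<nu> = \<mu>" if \<nu>: "\<nu> \<in> limit_measures shift x" for \<nu>
  proof -
    obtain r where r: "strict_mono r" "weak_star_limit (\<lambda>k. empirical_measure shift (r k) x) \<nu>"
      and nu: "\<nu> \<in> borel_probs"
      using \<nu> unfolding limit_measures_def by blast
    show ?thesis
    proof (rule borel_probs_eqI[OF nu \<mu>])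
      fix \<phi> :: "(int \<Rightarrow> 'k) \<Rightarrow> real" assume c: "continuous_on UNIV \<phi>"
      have "(\<lambda>k. \<integral>y. \<phi> y \<partial>empirical_measure shift (r k) x) \<longlonglongrightarrow> (\<integral>y. \<phi> y \<partial>\<nu>)"
        using r(2) c unfolding weak_star_limit_def by blast
      moreover have "(\<lambda>k. \<integral>y. \<phi> y \<partial>empirical_measure shift (r k) x) \<longlonglongrightarrow> (\<integral>y. \<phi> y \<partial>\<mu>)"
        using LIMSEQ_subseq_LIMSEQ[OF emp[OF c] r(1)] by (simp add: o_def)
      ultimately show "(\<integral>y. \<phi> y \<partial>\<nu>) = (\<integral>y. \<phi> y \<partial>\<mu>)" by (rule LIMSEQ_unique)
    qed
  qed
  ultimately show ?thesis unfolding generic_points_def by blast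
qed

context invariant_measure
begin

lemma mu_borel_prob: "\<mu> \<in> borel_probs"
  using invariant by (simp add: invariant_probs_def)

text \<open>Until time \<open>n\<close> about \<open>J\<close> blocks are read, where
  \<open>n\<close> is at least of order \<open>J^2\<close>. Inside a block the point agrees with a
  sample of \<open>\<mu>\<close>, except that up to \<open>2 * m\<close> windows reach across the
  ends; together with the unfinished block this is an error of order \<open>J\<close>. The block
  sums themselves obey the law of large numbers.\<close>

lemma concat_frequency:
  fixes \<psi> :: "(int \<Rightarrow> 'k) \<Rightarrow> real"
  assumes meas: "\<psi> \<in> borel_measurable borel" and bnd: "\<And>x. 0 \<le> \<psi> x" "\<And>x. \<psi> x \<le> 1"
    and win: "\<And>x y. (\<forall>l. \<bar>l\<bar> \<le> int m \<longrightarrow> x l = y l) \<Longrightarrow> \<psi> x = \<psi> y"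
  shows "AE \<omega> in Om. (\<lambda>n. avg \<psi> n (concat_pt \<omega>)) \<longlonglongrightarrow> (\<integral>x. \<psi> x \<partial>\<mu>)"
proof -
  define p where "p = (\<integral>x. \<psi> x \<partial>\<mu>)"
  have int: "integrable \<mu> \<psi>"
    by (rule integrable_const_bound[of _ 1]) (use meas bnd in \<open>auto simp: measurable_cong_sets[OF sets_mu refl]\<close>)
  have int_sh: "integrable \<mu> (\<lambda>x. \<psi> (sh j x))" for j
    by (rule integrable_const_bound[of _ 1])
      (use measurable_compose[OF measurable_sh meas] bnd in \<open>auto simp: measurable_cong_sets[OF sets_mu refl]\<close>)
  define Y where "Y j x = (\<Sum>i<Suc j. \<psi> (sh (int i) x))" for j x
  have Y_int: "(\<integral>x. Y j x \<partial>\<mu>) = real (Suc j) * p" for j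
    unfolding Y_def by (subst Bochner_Integration.integral_sum[OF int_sh]) (simp add: integral_sh[OF meas] p_def)
  have p01: "0 \<le> p" "p \<le> 1"
  proof -
    show "0 \<le> p" unfolding p_def by (rule Bochner_Integration.integral_nonneg) (rule bnd)
    have "p \<le> (\<integral>x. 1 \<partial>\<mu>)" unfolding p_def by (rule integral_mono[OF int]) (use bnd in auto)
    then show "p \<le> 1" by (simp add: prob_space[simplified])
  qed
  have "AE \<omega> in Om. (\<lambda>J. (\<Sum>j<J. Y j (\<omega> j) - (\<integral>x. Y j x \<partial>\<mu>)) / real J ^ 2) \<longlonglongrightarrow> 0"
  proof (rule block_law_of_large_numbers[where C = 1])
    show "Y j \<in> borel_measurable borel" for j
      unfolding Y_def by (intro borel_measurable_sum measurable_compose[OF measurable_sh meas])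
    show "0 \<le> Y j x" for j x unfolding Y_def by (intro sum_nonneg bnd)
    show "Y j x \<le> 1 * real (Suc j)" for j x
      unfolding Y_def using sum_bounded_above[of "{..<Suc j}" "\<lambda>i. \<psi> (sh (int i) x)" 1] bnd by simp
  qed simp
  then show ?thesis
  proof (rule AE_mp, intro AE_I2 impI)
    fix \<omega> assume "(\<lambda>J. (\<Sum>j<J. Y j (\<omega> j) - (\<integral>x. Y j x \<partial>\<mu>)) / real J ^ 2) \<longlonglongrightarrow> 0"
    then have E0: "(\<lambda>J. (\<Sum>j<J. Y j (\<omega> j) - real (Suc j) * p) / real J ^ 2) \<longlonglongrightarrow> 0"
      by (simp only: Y_int)
    define E where "E J = (\<Sum>j<J. Y j (\<omega> j) - real (Suc j) * p) / real J ^ 2" for J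
    define S where "S n = (\<Sum>i<n. \<psi> (sh (int i) (concat_pt \<omega>)))" for n
    have S_add: "S (k + l) = S k + (\<Sum>i<l. \<psi> (sh (int (k + i)) (concat_pt \<omega>)))" for k l
      unfolding S_def by (induction l) auto
    have block: "\<bar>(\<Sum>i<Suc J. \<psi> (sh (int (triangle J + i)) (concat_pt \<omega>))) - Y J (\<omega> J)\<bar> \<le> 2 * real m" for J
    proof -
      let ?d = "\<lambda>i. \<psi> (sh (int (triangle J + i)) (concat_pt \<omega>)) - \<psi> (sh (int i) (\<omega> J))"
      \<comment> \<open>The positions whose window of radius \<open>m\<close> may leave the
        block.\<close>
      define bad where "bad = {..<m} \<union> {Suc J - m..<Suc J}"
      have zero: "?d i = 0" if "i < Suc J" "i \<notin> bad" for i
      proof -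
        have i: "m \<le> i" "i + m \<le> J" using that by (auto simp: bad_def)
        have "sh (int (triangle J + i)) (concat_pt \<omega>) l = sh (int i) (\<omega> J) l" if l: "\<bar>l\<bar> \<le> int m" for l
        proof -
          have "l + int (triangle J + i) = int (triangle J + nat (l + int i))" using i l by simp
          moreover have "nat (l + int i) \<le> J" using i l by linarith
          ultimately have "sh (int (triangle J + i)) (concat_pt \<omega>) l = \<omega> J (int (nat (l + int i)))"
            by (simp only: sh_apply concat_pt_block)
          moreover have "0 \<le> l + int i" using i l by linarith
          ultimately show ?thesis by simp
        qed
        then have "\<psi> (sh (int (triangle J + i)) (concat_pt \<omega>)) = \<psi> (sh (int i) (\<omega> J))" by (intro win) blast
        then show ?thesis by simp
      qed
      have "\<bar>\<Sum>i<Suc J. ?d i\<bar> \<le> (\<Sum>i<Suc J. \<bar>?d i\<bar>)" by (rule sum_abs)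
      also have "\<dots> \<le> (\<Sum>i<Suc J. if i \<in> bad then 1 else 0)"
      proof (rule sum_mono)
        fix i assume i: "i \<in> {..<Suc J}"
        show "\<bar>?d i\<bar> \<le> (if i \<in> bad then 1 else 0)"
        proof (cases "i \<in> bad")
          case True
          have "\<bar>?d i\<bar> \<le> 1"
            using bnd[of "sh (int (triangle J + i)) (concat_pt \<omega>)"] bnd[of "sh (int i) (\<omega> J)"] by linarith
          then show ?thesis using True by (simp only: if_True)
        next
          case False
          then show ?thesis using zero[of i] i by simp
        qed
      qed
      also have "\<dots> = real (card ({..<Suc J} \<inter> bad))"
        by (simp add: sum.If_cases del: sum.lessThan_Suc)
      also have "\<dots> \<le> real (card bad)" by (intro of_nat_mono card_mono) (auto simp: bad_def)
      also have "\<dots> \<le> real (m + m)"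
        using card_Un_le[of "{..<m}" "{Suc J - m..<Suc J}"] by (intro of_nat_mono) (simp add: bad_def)
      finally show ?thesis by (simp only: Y_def sum_subtractf)
    qed
    have tri: "\<bar>S (triangle J) - real (triangle J) * p - (\<Sum>j<J. Y j (\<omega> j) - real (Suc j) * p)\<bar> \<le> 2 * real m * real J" for J
    proof (induction J)
      case (Suc J)
      have "S (triangle (Suc J)) = S (triangle J) + (\<Sum>i<Suc J. \<psi> (sh (int (triangle J + i)) (concat_pt \<omega>)))"
        unfolding triangle_Suc by (rule S_add)
      then have "S (triangle (Suc J)) - real (triangle (Suc J)) * p - (\<Sum>j<Suc J. Y j (\<omega> j) - real (Suc j) * p)
        = (S (triangle J) - real (triangle J) * p - (\<Sum>j<J. Y j (\<omega> j) - real (Suc j) * p))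
          + ((\<Sum>i<Suc J. \<psi> (sh (int (triangle J + i)) (concat_pt \<omega>))) - Y J (\<omega> J))"
        by (simp add: algebra_simps)
      then have "\<bar>S (triangle (Suc J)) - real (triangle (Suc J)) * p - (\<Sum>j<Suc J. Y j (\<omega> j) - real (Suc j) * p)\<bar>
          \<le> 2 * real m * real J + 2 * real m"
        using Suc block[of J] by linarith
      then show ?case by (simp add: algebra_simps)
    qed (simp add: S_def)
    obtain blk :: "nat \<Rightarrow> nat" where blk: "\<And>n. triangle (blk n) \<le> n" "\<And>n. n \<le> triangle (blk n) + blk n"
      "filterlim blk at_top sequentially" by (rule nat_sequence_blocks) blast
    \<comment> \<open>\<open>E\<close> is the error of the law of large numbers. Block ends
      contribute \<open>2 * m * J\<close> and the unfinished block at most \<open>J\<close>; all is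
      divided by \<open>n \<ge> J^2 / 2\<close>.\<close>
    have est: "\<bar>avg \<psi> n (concat_pt \<omega>) - p\<bar> \<le> 2 * \<bar>E (blk n)\<bar> + (4 * real m + 2) * (1 / real (blk n))"
      if "blk n > 0" for n
    proof -
      define J where "J = blk n"
      have J: "J > 0" "triangle J \<le> n" "n \<le> triangle J + J" using that blk by (auto simp: J_def)
      have "real (triangle J) \<le> real n" using J(2) by simp
      then have n: "real n \<ge> real J ^ 2 / 2" using triangle_ge[of J] by linarith
      have "real J ^ 2 / 2 > 0" using J(1) by simp
      then have n0: "real n > 0" using n by linarith
      have "S n - S (triangle J) = (\<Sum>i<n - triangle J. \<psi> (sh (int (triangle J + i)) (concat_pt \<omega>)))"
        using S_add[of "triangle J" "n - triangle J"] J(2) by simp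
      moreover have "0 \<le> (\<Sum>i<n - triangle J. \<psi> (sh (int (triangle J + i)) (concat_pt \<omega>)))"
        by (intro sum_nonneg bnd)
      moreover have "(\<Sum>i<n - triangle J. \<psi> (sh (int (triangle J + i)) (concat_pt \<omega>))) \<le> real (n - triangle J)"
        using sum_bounded_above[of "{..<n - triangle J}" "\<lambda>i. \<psi> (sh (int (triangle J + i)) (concat_pt \<omega>))" 1] bnd by simp
      moreover have d: "real (n - triangle J) \<le> real J" "real n = real (triangle J) + real (n - triangle J)" using J by auto
      moreover have "0 \<le> real (n - triangle J) * p" "real (n - triangle J) * p \<le> real (n - triangle J)"
        using p01 by (auto intro: mult_left_le)
      moreover have "real n * p = real (triangle J) * p + real (n - triangle J) * p" by (subst d(2)) (rule distrib_right)
      ultimately have "\<bar>S n - real n * p\<bar> \<le> \<bar>S (triangle J) - real (triangle J) * p\<bar> + real J"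
        by linarith
      also have "\<bar>S (triangle J) - real (triangle J) * p\<bar> \<le> \<bar>\<Sum>j<J. Y j (\<omega> j) - real (Suc j) * p\<bar> + 2 * real m * real J"
        using tri[of J] by linarith
      also have "\<bar>\<Sum>j<J. Y j (\<omega> j) - real (Suc j) * p\<bar> = \<bar>E J\<bar> * real J ^ 2"
        using J(1) by (simp add: E_def abs_divide)
      finally have "\<bar>S n - real n * p\<bar> \<le> \<bar>E J\<bar> * real J ^ 2 + (2 * real m + 1) * real J"
        by (simp add: algebra_simps)
      then have "\<bar>S n - real n * p\<bar> / real n \<le> (\<bar>E J\<bar> * real J ^ 2 + (2 * real m + 1) * real J) / real n"
        using n0 by (intro divide_right_mono) auto
      also have "\<dots> \<le> (\<bar>E J\<bar> * real J ^ 2 + (2 * real m + 1) * real J) / (real J ^ 2 / 2)"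
        using n J(1) n0 by (intro divide_left_mono) auto
      also have "\<dots> = 2 * \<bar>E J\<bar> + (4 * real m + 2) * (1 / real J)"
        using J(1) by (simp add: field_simps power2_eq_square)
      also have "\<bar>S n - real n * p\<bar> / real n = \<bar>avg \<psi> n (concat_pt \<omega>) - p\<bar>"
      proof -
        have "avg \<psi> n (concat_pt \<omega>) - p = (S n - real n * p) / real n"
          using n0 by (simp add: avg_def S_def[symmetric] diff_divide_distrib)
        then show ?thesis by (simp add: abs_divide)
      qed
      finally show ?thesis by (simp add: J_def)
    qed
    have "(\<lambda>J. 2 * \<bar>E J\<bar> + (4 * real m + 2) * (1 / real J)) \<longlonglongrightarrow> 2 * \<bar>0\<bar> + (4 * real m + 2) * 0"
      using E0 unfolding E_def[symmetric] by (intro tendsto_intros lim_1_over_n)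
    then have "(\<lambda>J. 2 * \<bar>E J\<bar> + (4 * real m + 2) * (1 / real J)) \<longlonglongrightarrow> 0" by simp
    from filterlim_compose[OF this blk(3)]
    have lim0: "(\<lambda>n. 2 * \<bar>E (blk n)\<bar> + (4 * real m + 2) * (1 / real (blk n))) \<longlonglongrightarrow> 0" .
    have ev: "\<forall>\<^sub>F n in sequentially. blk n > 0"
      using blk(3)[unfolded filterlim_at_top, rule_format, of 1] by eventually_elim simp
    have "(\<lambda>n. avg \<psi> n (concat_pt \<omega>) - p) \<longlonglongrightarrow> 0"
      by (rule Lim_null_comparison[OF eventually_mono[OF ev] lim0]) (use est in simp)
    then show "(\<lambda>n. avg \<psi> n (concat_pt \<omega>)) \<longlonglongrightarrow> (\<integral>x. \<psi> x \<partial>\<mu>)"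
      by (subst Lim_null) (simp add: p_def)
  qed
qed

text \<open>A continuous function is uniformly close to a function of finitely many labels in a
  window, so the frequencies of cylinder sets decide genericity.\<close>

lemma AE_concat_generic: "AE \<omega> in Om. concat_pt \<omega> \<in> generic_points shift \<mu>"
proof -
  have "\<exists>a :: 'k \<Rightarrow> nat. a \<in> borel \<rightarrow>\<^sub>M count_space UNIV \<and> finite (range a) \<and>
      (\<forall>x y. a x = a y \<longrightarrow> dist x y < 1 / real (Suc k))" for k
  proof -
    obtain N and a :: "'k \<Rightarrow> nat" where "range a \<subseteq> {..<N}" "a \<in> borel \<rightarrow>\<^sub>M count_space UNIV"
      "\<And>x y. a x = a y \<Longrightarrow> dist x y < 1 / real (Suc k)"
      by (rule compact_labelling[OF K_compact, of "1 / real (Suc k)"]) auto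
    then show ?thesis by (intro exI[of _ a]) (auto intro: finite_subset)
  qed
  then obtain a :: "nat \<Rightarrow> 'k \<Rightarrow> nat" where a: "\<And>k. a k \<in> borel \<rightarrow>\<^sub>M count_space UNIV" "\<And>k. finite (range (a k))"
    "\<And>k x y. a k x = a k y \<Longrightarrow> dist x y < 1 / real (Suc k)" by metis
  define v where "v k m x = map (\<lambda>j. a k (x j)) [- int m..int m]" for k m x
  have vL: "labels (v k m)" for k m
    unfolding v_def by (intro labels_map labels_coord a)
  have win: "v k m x = v k m y" if "\<forall>l. \<bar>l\<bar> \<le> int m \<longrightarrow> x l = y l" for k m x y
    using that by (auto simp: v_def)
  \<comment> \<open>There are countably many triples \<open>k\<close>, \<open>m\<close>,
    \<open>w\<close>, so the null set is fixed before any continuous function is chosen.\<close>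
  have "AE \<omega> in Om. \<forall>k m w. (\<lambda>n. avg (indicator (v k m -` {w})) n (concat_pt \<omega>)) \<longlonglongrightarrow> (\<integral>x. indicator (v k m -` {w}) x \<partial>\<mu>)"
  proof (subst AE_all_countable, intro allI, subst AE_all_countable, intro allI, subst AE_all_countable, intro allI)
    fix k m w
    show "AE \<omega> in Om. (\<lambda>n. avg (indicator (v k m -` {w})) n (concat_pt \<omega>)) \<longlonglongrightarrow> (\<integral>x. indicator (v k m -` {w}) x \<partial>\<mu>)"
    proof (rule concat_frequency[where m = m])
      show "indicator (v k m -` {w}) x = (indicator (v k m -` {w}) y :: real)"
        if "\<forall>l. \<bar>l\<bar> \<le> int m \<longrightarrow> x l = y l" for x y
      proof -
        have "v k m x = v k m y" by (rule win[OF that])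
        then show ?thesis by (simp add: indicator_def)
      qed
    qed (auto simp: indicator_def intro!: borel_measurable_indicator labels_sets[OF vL])
  qed
  then show ?thesis
  proof (rule AE_mp, intro AE_I2 impI)
    fix \<omega> assume *: "\<forall>k m w. (\<lambda>n. avg (indicator (v k m -` {w})) n (concat_pt \<omega>)) \<longlonglongrightarrow> (\<integral>x. indicator (v k m -` {w}) x \<partial>\<mu>)"
    define y where "y = concat_pt \<omega>"
    show "concat_pt \<omega> \<in> generic_points shift \<mu>"
    proof (rule generic_pointI[OF mu_borel_prob])
      fix \<phi> :: "(int \<Rightarrow> 'k) \<Rightarrow> real" assume c: "continuous_on UNIV \<phi>"
      have bdd: "integrable \<mu> \<phi>"
      proof -
        have "compact (\<phi> ` UNIV)" by (rule compact_continuous_image[OF c compact_fun_UNIV[OF K_compact]])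
        then have "bounded (range \<phi>)" by (rule compact_imp_bounded)
        then obtain B where "\<forall>x. norm (\<phi> x) \<le> B" unfolding bounded_iff by auto
        then show ?thesis
          using borel_measurable_continuous_onI[OF c]
          by (intro integrable_const_bound[of _ B]) (auto simp: measurable_cong_sets[OF sets_mu refl])
      qed
      have "(\<lambda>n. avg \<phi> n y) \<longlonglongrightarrow> (\<integral>x. \<phi> x \<partial>\<mu>)"
      proof (rule LIMSEQ_I)
        fix e :: real assume e: "e > 0"
        obtain r m where r: "r > 0" "\<And>x y. (\<forall>j. \<bar>j\<bar> \<le> int m \<longrightarrow> dist (x j) (y j) < r) \<Longrightarrow> \<bar>\<phi> x - \<phi> y\<bar> < e / 4"
          using continuous_window[OF K_compact c, of "e / 4"] e by auto
        obtain k where k: "inverse (real (Suc k)) < r" using reals_Archimedean r(1) by blast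
        \<comment> \<open>The value of \<open>\<phi>\<close> at one representative of each
          cylinder.\<close>
        define g where "g w = \<phi> (SOME x. v k m x = w)" for w
        have close: "\<bar>\<phi> x - g (v k m x)\<bar> < e / 4" for x
        proof -
          define x' where "x' = (SOME x'. v k m x' = v k m x)"
          have "v k m x' = v k m x" unfolding x'_def by (rule someI[where P = "\<lambda>x'. v k m x' = v k m x"]) (rule refl)
          then have "\<forall>j\<in>{- int m..int m}. a k (x' j) = a k (x j)" by (simp add: v_def)
          then have "dist (x j) (x' j) < r" if "\<bar>j\<bar> \<le> int m" for j
            using a(3)[of k "x j" "x' j"] k that by (auto simp: inverse_eq_divide abs_le_iff)
          then have "\<bar>\<phi> x - \<phi> x'\<bar> < e / 4" by (intro r(2)) blast
          then show ?thesis by (simp add: g_def x'_def)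
        qed
        let ?R = "range (v k m)"
        have fin: "finite ?R" using vL by blast
        have avg_g: "avg (\<lambda>x. g (v k m x)) n y = (\<Sum>w\<in>?R. g w * avg (indicator (v k m -` {w})) n y)" for n
        proof -
          have "g (v k m x) = (\<Sum>w\<in>?R. g w * indicator (v k m -` {w}) x)" for x
          proof -
            have "(\<Sum>w\<in>?R. g w * indicator (v k m -` {w}) x) = (\<Sum>w\<in>?R. if w = v k m x then g w else 0)"
              by (rule sum.cong) (auto simp: indicator_def)
            also have "\<dots> = g (v k m x)" using fin by (subst sum.delta) auto
            finally show ?thesis by simp
          qed
          then have "(\<Sum>i<n. g (v k m (sh (int i) y))) = (\<Sum>w\<in>?R. g w * (\<Sum>i<n. indicator (v k m -` {w}) (sh (int i) y)))"
            by (simp only: sum_distrib_left) (rule sum.swap)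
          then show ?thesis by (simp only: avg_def times_divide_eq_right sum_divide_distrib[symmetric])
        qed
        have "(\<lambda>n. avg (\<lambda>x. g (v k m x)) n y) \<longlonglongrightarrow> (\<Sum>w\<in>?R. g w * (\<integral>x. indicator (v k m -` {w}) x \<partial>\<mu>))"
          unfolding avg_g using * by (intro tendsto_sum tendsto_mult tendsto_const) (simp add: y_def)
        also have "(\<Sum>w\<in>?R. g w * (\<integral>x. indicator (v k m -` {w}) x \<partial>\<mu>)) = (\<integral>x. g (v k m x) \<partial>\<mu>)"
          using labels_sets[OF vL] by (subst label_integral_eq[OF labels_mu[OF vL]]) (simp add: mult.commute)
        finally obtain n0 where n0: "\<And>n. n \<ge> n0 \<Longrightarrow> \<bar>avg (\<lambda>x. g (v k m x)) n y - (\<integral>x. g (v k m x) \<partial>\<mu>)\<bar> < e / 4"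
          using LIMSEQ_D[of _ _ "e / 4"] e by (metis divide_pos_pos real_norm_def zero_less_numeral)
        have i: "\<bar>(\<integral>x. \<phi> x \<partial>\<mu>) - (\<integral>x. g (v k m x) \<partial>\<mu>)\<bar> \<le> e / 4"
        proof -
          have ig: "integrable \<mu> (\<lambda>x. g (v k m x))" by (rule label_integrable[OF labels_mu[OF vL]])
          have "\<bar>\<integral>x. \<phi> x - g (v k m x) \<partial>\<mu>\<bar> \<le> (\<integral>x. \<bar>\<phi> x - g (v k m x)\<bar> \<partial>\<mu>)" by (rule integral_abs_bound)
          also have "\<dots> \<le> (\<integral>x. e / 4 \<partial>\<mu>)"
            by (rule integral_mono) (use close bdd ig in \<open>auto intro: less_imp_le\<close>)
          finally show ?thesis
            by (simp add: Bochner_Integration.integral_diff[OF bdd ig] prob_space[simplified])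
        qed
        have s: "\<bar>avg \<phi> n y - avg (\<lambda>x. g (v k m x)) n y\<bar> \<le> e / 4" if "n \<ge> 1" for n
        proof -
          have "\<bar>\<Sum>i<n. \<phi> (sh (int i) y) - g (v k m (sh (int i) y))\<bar> \<le> (\<Sum>i<n. e / 4)"
            by (rule order_trans[OF sum_abs sum_mono]) (use close in \<open>auto intro: less_imp_le\<close>)
          then have "\<bar>(\<Sum>i<n. \<phi> (sh (int i) y)) - (\<Sum>i<n. g (v k m (sh (int i) y)))\<bar> / real n \<le> (real n * (e / 4)) / real n"
            by (intro divide_right_mono) (simp_all add: sum_subtractf)
          then show ?thesis using that by (simp add: avg_def abs_divide flip: diff_divide_distrib)
        qed
        show "\<exists>no. \<forall>n\<ge>no. norm (avg \<phi> n y - (\<integral>x. \<phi> x \<partial>\<mu>)) < e"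
        proof (intro exI[of _ "max n0 1"] allI impI)
          fix n assume n: "n \<ge> max n0 1"
          then have "\<bar>avg (\<lambda>x. g (v k m x)) n y - (\<integral>x. g (v k m x) \<partial>\<mu>)\<bar> < e / 4"
            "\<bar>avg \<phi> n y - avg (\<lambda>x. g (v k m x)) n y\<bar> \<le> e / 4" using n0 s by auto
          then show "norm (avg \<phi> n y - (\<integral>x. \<phi> x \<partial>\<mu>)) < e" using i e unfolding real_norm_def by linarith
        qed
      qed
      then show "(\<lambda>n. avg \<phi> n (concat_pt \<omega>)) \<longlonglongrightarrow> (\<integral>x. \<phi> x \<partial>\<mu>)" by (simp add: y_def)
    qed
  qed
qed

end

section \<open>Lower bounds by mass distribution\<close>

lemma bowen_dist_le_iff:
  "n \<ge> 1 \<Longrightarrow> bowen_dist f d n x y \<le> e \<longleftrightarrow> (\<forall>i<n. d ((f ^^ i) x) ((f ^^ i) y) \<le> e)"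
  unfolding bowen_dist_def by (subst Max_le_iff) (auto simp: lessThan_empty_iff)

lemma bowen_dist_less_iff:
  "n \<ge> 1 \<Longrightarrow> bowen_dist f d n x y < e \<longleftrightarrow> (\<forall>i<n. d ((f ^^ i) x) ((f ^^ i) y) < e)"
  unfolding bowen_dist_def by (subst Max_less_iff) (auto simp: lessThan_empty_iff)

lemma bowen_dist_ge: "i < n \<Longrightarrow> d ((f ^^ i) x) ((f ^^ i) y) \<le> bowen_dist f d n x y"
  unfolding bowen_dist_def by (rule Max_ge) auto

lemma packing_P_at_antimono: "N \<le> N' \<Longrightarrow> packing_P_at f d Z s N' \<epsilon> \<le> packing_P_at f d Z s N \<epsilon>"
  unfolding packing_P_at_def by (rule SUP_subset_mono) (auto simp: bowen_packings_def)

lemma packing_P_eq: "packing_P f d Z s \<epsilon> = (INF N. packing_P_at f d Z s N \<epsilon>)"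
  unfolding packing_P_def
  by (intro limI LIMSEQ_INF) (simp add: antimono_def packing_P_at_antimono)

lemma bowen_M_at_mono: "N \<le> N' \<Longrightarrow> bowen_M_at f d Z s N \<epsilon> \<le> bowen_M_at f d Z s N' \<epsilon>"
  unfolding bowen_M_at_def by (rule INF_superset_mono) (auto simp: bowen_covers_def)

lemma bowen_M_eq: "bowen_M f d Z s \<epsilon> = (SUP N. bowen_M_at f d Z s N \<epsilon>)"
  unfolding bowen_M_def
  by (intro limI LIMSEQ_SUP) (simp add: mono_def bowen_M_at_mono)

lemma ennreal_less_add:
  fixes x :: ennreal
  assumes "x \<noteq> \<infinity>" "c > 0"
  shows "x < x + ennreal c"
  using assms by (cases x) (auto simp: ennreal_less_iff simp flip: ennreal_plus)

lemma suminf_le_infsum_ennreal: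
  fixes f g :: "nat \<Rightarrow> ennreal"
  assumes "\<And>i. i \<in> I \<Longrightarrow> g i \<le> f i" "\<And>i. i \<notin> I \<Longrightarrow> g i = 0"
  shows "(\<Sum>i. g i) \<le> infsum f I"
proof (rule suminf_le_const)
  fix n
  have "sum g {..<n} = sum g ({..<n} \<inter> I)"
    by (rule sum.mono_neutral_right) (use assms in auto)
  also have "\<dots> \<le> sum f ({..<n} \<inter> I)" by (rule sum_mono) (use assms in auto)
  also have "\<dots> \<le> infsum f I"
    by (subst nonneg_infsum_complete) (auto intro!: SUP_upper)
  finally show "sum g {..<n} \<le> infsum f I" .
qed auto

section \<open>Bowen metrics and separated sets\<close>

context invariant_measure
begin

lemma bowen_dist_coord:
  assumes "t < n"
  shows "dist (x (int t)) (y (int t)) \<le> bowen_dist shift shift_dist n x (y :: int \<Rightarrow> 'k)"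
proof -
  have "dist (x (int t)) (y (int t)) \<le> shift_dist (sh (int t) x) (sh (int t) y)"
    using dist_coord_le_shift_dist[OF K_compact, of "sh (int t) x" "sh (int t) y"] by simp
  also have "\<dots> \<le> bowen_dist shift shift_dist n x y"
    using bowen_dist_ge[OF assms, of shift_dist shift x y] by (simp add: funpow_shift)
  finally show ?thesis .
qed

lemma bowen_dist_triangle:
  assumes "n \<ge> 1"
  shows "bowen_dist shift shift_dist n x (z :: int \<Rightarrow> 'k) \<le> bowen_dist shift shift_dist n x y + bowen_dist shift shift_dist n y z"
  unfolding bowen_dist_le_iff[OF assms]
proof (intro allI impI)
  fix i assume i: "i < n"
  show "shift_dist ((shift ^^ i) x) ((shift ^^ i) z) \<le> bowen_dist shift shift_dist n x y + bowen_dist shift shift_dist n y z"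
    using shift_dist_triangle[OF K_compact, of "(shift ^^ i) x" "(shift ^^ i) z" "(shift ^^ i) y"]
      bowen_dist_ge[OF i, of shift_dist shift x y] bowen_dist_ge[OF i, of shift_dist shift y z] by linarith
qed

lemma bowen_dist_commute: "bowen_dist shift shift_dist n x y = bowen_dist shift shift_dist n y x"
  by (simp add: bowen_dist_def shift_dist_commute)

text \<open>The labels of the coordinates from \<open>- m\<close> to \<open>n + m - 1\<close>
  determine a point up to \<open>\<epsilon>\<close> in the Bowen metric, so separated points have
  different words.\<close>

lemma separated_card_bound:
  fixes a :: "'k \<Rightarrow> nat" and E :: "(int \<Rightarrow> 'k) set"
  assumes a: "range a \<subseteq> {..<N}" "\<And>x y. a x = a y \<Longrightarrow> dist x y < r"
    and m: "\<And>x y :: int \<Rightarrow> 'k. (\<forall>j. \<bar>j\<bar> \<le> int m \<longrightarrow> dist (x j) (y j) \<le> r) \<Longrightarrow> shift_dist x y \<le> \<epsilon>"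
    and n: "n \<ge> 1" and E: "finite E" "separated shift shift_dist n \<epsilon> E"
  shows "card E \<le> N ^ (n + 2 * m)"
proof -
  define v where "v x = map (\<lambda>i. a (x (int i - int m))) [0..<n + 2 * m]" for x
  have "inj_on v E"
  proof (rule inj_onI)
    fix x y assume xy: "x \<in> E" "y \<in> E" "v x = v y"
    have "a (x (int i - int m)) = a (y (int i - int m))" if "i < n + 2 * m" for i
      using arg_cong[OF xy(3), of "\<lambda>w. w ! i"] that by (simp add: v_def)
    then have *: "dist (x (int i - int m)) (y (int i - int m)) < r" if "i < n + 2 * m" for i
      using a(2) that by blast
    have "bowen_dist shift shift_dist n x y \<le> \<epsilon>"
      unfolding bowen_dist_le_iff[OF n]
    proof (intro allI impI)
      fix i assume i: "i < n"
      show "shift_dist ((shift ^^ i) x) ((shift ^^ i) y) \<le> \<epsilon>"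
        unfolding funpow_shift
      proof (rule m, intro allI impI)
        fix j assume j: "\<bar>j\<bar> \<le> int m"
        define k where "k = nat (j + int i + int m)"
        have "k < n + 2 * m" "int k - int m = j + int i" using i j by (auto simp: k_def)
        then show "dist (sh (int i) x j) (sh (int i) y j) \<le> r" using *[of k] by simp
      qed
    qed
    moreover have "x \<noteq> y \<Longrightarrow> \<epsilon> < bowen_dist shift shift_dist n x y"
      using E(2) xy by (simp add: separated_def)
    ultimately show "x = y" by force
  qed
  then have "card E = card (v ` E)" by (simp add: card_image)
  also have "\<dots> \<le> card {w. set w \<subseteq> {..<N} \<and> length w = n + 2 * m}"
    by (rule card_mono) (use a(1) in \<open>auto simp: v_def finite_lists_length_eq image_subset_iff\<close>)
  also have "\<dots> = N ^ (n + 2 * m)" by (simp add: card_lists_length_eq)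
  finally show ?thesis .
qed

text \<open>The bound gives meaning to the \<open>Max\<close> in \<open>sep_number\<close> and makes
  maximal separated sets exist.\<close>

lemma separated_bounded:
  assumes \<epsilon>: "\<epsilon> > 0" and n: "n \<ge> 1"
  obtains B where "\<And>E :: (int \<Rightarrow> 'k) set. finite E \<Longrightarrow> separated shift shift_dist n \<epsilon> E \<Longrightarrow> card E \<le> B"
proof -
  define r where "r = \<epsilon> / (wt_sum + 1)"
  have r: "r > 0" "(wt_sum + 1) * r = \<epsilon>" using \<epsilon> wt_sum_nonneg by (auto simp: r_def)
  obtain N and a :: "'k \<Rightarrow> nat" where a: "range a \<subseteq> {..<N}" "\<And>x y. a x = a y \<Longrightarrow> dist x y < r"
    by (rule compact_labelling[OF K_compact r(1)]) auto
  obtain m where m: "\<And>x y :: int \<Rightarrow> 'k. (\<forall>j. \<bar>j\<bar> \<le> int m \<longrightarrow> dist (x j) (y j) \<le> r) \<Longrightarrow> shift_dist x y \<le> \<epsilon>"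
    using shift_dist_le_coords[OF K_compact r(1)] r(2) by auto
  show ?thesis
    by (rule that, rule separated_card_bound[OF a m n])
qed

lemma maximal_separated:
  assumes \<epsilon>: "\<epsilon> > 0" and n: "n \<ge> 1"
  obtains E where "E \<subseteq> Z" "finite E" "separated shift shift_dist n \<epsilon> E"
    "\<And>z :: int \<Rightarrow> 'k. z \<in> Z \<Longrightarrow> \<exists>x\<in>E. bowen_dist shift shift_dist n x z \<le> \<epsilon>"
proof -
  obtain B where B: "\<And>E :: (int \<Rightarrow> 'k) set. finite E \<Longrightarrow> separated shift shift_dist n \<epsilon> E \<Longrightarrow> card E \<le> B"
    by (rule separated_bounded[OF \<epsilon> n]) blast
  let ?P = "\<lambda>k. \<exists>E. E \<subseteq> Z \<and> finite E \<and> separated shift shift_dist n \<epsilon> E \<and> card E = k"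
  have "?P 0" by (intro exI[of _ "{}"]) (auto simp: separated_def)
  moreover have "\<forall>k. ?P k \<longrightarrow> k \<le> B" using B by blast
  ultimately obtain k where k: "?P k" "\<forall>k'. ?P k' \<longrightarrow> k' \<le> k"
    using GreatestI_nat[of ?P 0 B] Greatest_le_nat[of ?P _ B] by blast
  then obtain E where E: "E \<subseteq> Z" "finite E" "separated shift shift_dist n \<epsilon> E" "card E = k" by blast
  have "\<exists>x\<in>E. bowen_dist shift shift_dist n x z \<le> \<epsilon>" if z: "z \<in> Z" for z
  proof (rule ccontr)
    assume *: "\<not> (\<exists>x\<in>E. bowen_dist shift shift_dist n x z \<le> \<epsilon>)"
    then have far: "bowen_dist shift shift_dist n x z > \<epsilon>" if "x \<in> E" for x using that by (simp add: not_le)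
    have "bowen_dist shift shift_dist n z z \<le> \<epsilon>"
      unfolding bowen_dist_le_iff[OF n] using \<epsilon> by simp
    then have "z \<notin> E" using * by blast
    have "separated shift shift_dist n \<epsilon> (insert z E)"
    proof -
      have "bowen_dist shift shift_dist n z x > \<epsilon>" if "x \<in> E" for x
        by (subst bowen_dist_commute) (rule far[OF that])
      then show ?thesis using E(3) far unfolding separated_def by blast
    qed
    then have "?P (card (insert z E))" using E z by (intro exI[of _ "insert z E"]) auto
    then have "card (insert z E) \<le> k" using k(2) by blast
    then show False using E \<open>z \<notin> E\<close> by simp
  qed
  then show ?thesis using that E by blast
qed

end

section \<open>Mass distribution on the generic points\<close>

context coded_measure
begin

text \<open>The factor 2 undoes the averaging with the uniform distribution in
  \<open>wgt\<close>.\<close>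

lemma measure_nbh: "measure \<mu> (cw n -` nbh n w) \<le> 2 * nwgt n w"
proof -
  have fin: "finite (nbh n w)" by (rule finite_subset[OF _ finite_words[of n]]) (auto simp: nbh_def)
  have "cw n -` nbh n w = (\<Union>v\<in>nbh n w. cw n -` {v})" by auto
  also have "measure \<mu> \<dots> \<le> (\<Sum>v\<in>nbh n w. measure \<mu> (cw n -` {v}))"
    using fin labels_sets[OF labels_cw] by (intro finite_measure_subadditive_finite) auto
  also have "\<dots> \<le> (\<Sum>v\<in>nbh n w. 2 * wgt n v)"
    by (rule sum_mono) (simp add: wgt_def)
  finally show ?thesis by (simp add: nwgt_def sum_distrib_left)
qed

text \<open>A point that stays within \<open>r\<close> of a given one up to time \<open>n\<close>
  has, in each complete block, a word in the neighbourhood of the given word. By independence the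
  probability of this is a product, exponentially small in the sum of the costs, and that sum is
  controlled by the law of large numbers. On the event \<open>E\<close> the control starts at one
  common index, so that \<open>n0\<close> does not depend on the point. The measurable superset
  \<open>A\<close> avoids the question whether preimages under \<open>concat_pt\<close> are
  events.\<close>

lemma mass_bound:
  assumes LB: "\<And>n. n \<ge> 1 \<Longrightarrow> real n * s1 - ln 2 \<le> code_cost n" and s: "0 \<le> s" "s < s1"
  obtains E n0 where "E \<in> sets Om" "measure Om E \<ge> 1 / 2"
    "\<And>\<omega>. \<omega> \<in> E \<Longrightarrow> concat_pt \<omega> \<in> generic_points shift \<mu>"
    "\<And>\<omega>0 n. \<omega>0 \<in> E \<Longrightarrow> n \<ge> n0 \<Longrightarrow> \<exists>A\<in>sets Om. measure Om A \<le> exp (- (real n * s)) \<and>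
        {\<omega>. \<forall>t<n. dist (concat_pt \<omega> (int t)) (concat_pt \<omega>0 (int t)) < r} \<subseteq> A"
proof -
  interpret P: product_prob_space "\<lambda>_ :: nat. \<mu>" UNIV by (rule product_Om)
  define cst where "cst j x = - ln (nwgt (Suc j) (cw (Suc j) x))" for j x
  have cst_meas: "cst j \<in> borel_measurable borel" for j
    unfolding cst_def by (rule labels_integrable(2)[OF labels_cost])
  have cst_coord: "(\<lambda>\<omega>. cst j (\<omega> j)) \<in> borel_measurable Om" for j
    using measurable_compose[OF measurable_component_singleton[of j UNIV "\<lambda>_. \<mu>"], of "cst j" borel] cst_meas[of j]
    by (simp add: measurable_cong_sets[OF sets_mu refl])
  have "AE \<omega> in Om. (\<lambda>J. (\<Sum>j<J. cst j (\<omega> j) - (\<integral>x. cst j x \<partial>\<mu>)) / real J ^ 2) \<longlonglongrightarrow> 0"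
  proof (rule block_law_of_large_numbers[OF cst_meas])
    show "0 < ln (real N) + ln 2" using N_pos by (intro add_nonneg_pos) auto
    show "0 \<le> cst j x" for j x unfolding cst_def by (rule cost_bounds)
    show "cst j x \<le> (ln (real N) + ln 2) * real (Suc j)" for j x
    proof -
      have "cst j x \<le> real (Suc j) * ln (real N) + ln 2" unfolding cst_def by (rule cost_bounds)
      also have "ln 2 \<le> real (Suc j) * ln (2::real)" by simp
      finally show ?thesis by (simp add: algebra_simps)
    qed
  qed
  then have lln: "AE \<omega> in Om. (\<lambda>J. (\<Sum>j<J. cst j (\<omega> j) - code_cost (Suc j)) / real J ^ 2) \<longlonglongrightarrow> 0"
    by (simp add: cst_def code_cost_def)
  \<comment> \<open>The summand \<open>s * real J\<close> provides for an unfinished block, the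
    summand \<open>real J * ln 2\<close> for the factor 2 per block in
    \<open>measure_nbh\<close>.\<close>
  define F where "F k = {\<omega>. \<forall>J\<ge>k. s * (real (triangle J) + real J) + real J * ln 2 \<le> (\<Sum>j<J. cst j (\<omega> j))}" for k :: nat
  have F_sets: "F k \<in> sets Om" for k
  proof -
    have "F k = (\<Inter>J\<in>{k..}. {\<omega> \<in> space Om. s * (real (triangle J) + real J) + real J * ln 2 \<le> (\<Sum>j<J. cst j (\<omega> j))})"
      by (auto simp: F_def)
    also have "\<dots> \<in> sets Om"
    proof (rule sets.countable_INT')
      have "{\<omega> \<in> space Om. s * (real (triangle J) + real J) + real J * ln 2 \<le> (\<Sum>j<J. cst j (\<omega> j))} \<in> sets Om" for J
        by (intro borel_measurable_le borel_measurable_const borel_measurable_sum cst_coord)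
      then show "(\<lambda>J. {\<omega> \<in> space Om. s * (real (triangle J) + real J) + real J * ln 2 \<le> (\<Sum>j<J. cst j (\<omega> j))}) ` {k..} \<subseteq> sets Om"
        by blast
    qed auto
    finally show ?thesis .
  qed
  have cost_sum: "real (triangle J) * s1 - real J * ln 2 \<le> (\<Sum>j<J. code_cost (Suc j))" for J
  proof (induction J)
    case (Suc J)
    then show ?case using LB[of "Suc J"] by (simp add: algebra_simps)
  qed simp
  \<comment> \<open>Used with \<open>T = triangle J\<close>, \<open>X = J\<close>,
    \<open>Q = J^2\<close>, \<open>l = ln 2\<close>. The gain
    \<open>4 * \<delta> * T = T * (s1 - s)\<close> is at least \<open>2 * \<delta> * Q\<close>: one
    half pays for the deviation \<open>D\<close>, the other for all terms linear in
    \<open>J\<close>.\<close>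
  have combine: "s * (T + X) + X * l \<le> Y"
    if "\<bar>D\<bar> < \<delta> * Q" "Y = D + C" "T * s1 = T * s + 4 * \<delta> * T" "4 * \<delta> * (Q / 2) \<le> 4 * \<delta> * T"
      "(s + 2 * l) * X \<le> \<delta> * Q" "T * s1 - X * l \<le> C" for T X l Y D C \<delta> Q :: real
    using that by (simp add: algebra_simps)
  have "AE \<omega> in Om. \<omega> \<in> (\<Union>k. F k)"
    using lln
  proof (rule AE_mp, intro AE_I2 impI)
    fix \<omega> assume lim: "(\<lambda>J. (\<Sum>j<J. cst j (\<omega> j) - code_cost (Suc j)) / real J ^ 2) \<longlonglongrightarrow> 0"
    define \<delta> where "\<delta> = (s1 - s) / 4"
    have \<delta>: "\<delta> > 0" using s by (simp add: \<delta>_def)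
    obtain J0 where J0: "\<And>J. J \<ge> J0 \<Longrightarrow> \<bar>(\<Sum>j<J. cst j (\<omega> j) - code_cost (Suc j)) / real J ^ 2\<bar> < \<delta>"
      using LIMSEQ_D[OF lim \<delta>] by auto
    obtain J1 :: nat where J1: "(s + 2 * ln 2) / \<delta> < real J1" using reals_Archimedean2 by blast
    have "\<omega> \<in> F (max (max J0 J1) 1)"
      unfolding F_def
    proof (intro CollectI allI impI)
      fix J assume "J \<ge> max (max J0 J1) 1"
      then have J: "J \<ge> J0" "J \<ge> J1" "J \<ge> 1" by auto
      define D where "D = (\<Sum>j<J. cst j (\<omega> j) - code_cost (Suc j))"
      have "\<bar>D\<bar> / real J ^ 2 < \<delta>" using J0[OF J(1)] by (simp add: D_def abs_divide)
      then have "\<bar>D\<bar> < \<delta> * real J ^ 2" using J(3) by (simp add: divide_less_eq)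
      moreover have "(\<Sum>j<J. cst j (\<omega> j)) = D + (\<Sum>j<J. code_cost (Suc j))" by (simp add: D_def sum_subtractf)
      moreover have "real (triangle J) * s1 = real (triangle J) * s + 4 * \<delta> * real (triangle J)"
      proof -
        have "s1 = s + 4 * \<delta>" by (simp add: \<delta>_def diff_divide_distrib)
        then show ?thesis by (simp only: distrib_left mult.commute)
      qed
      moreover have "4 * \<delta> * real (triangle J) \<ge> 4 * \<delta> * (real J ^ 2 / 2)"
        using \<delta> by (intro mult_left_mono triangle_ge) auto
      moreover have "\<delta> * real J ^ 2 \<ge> (s + 2 * ln 2) * real J"
      proof -
        have "(s + 2 * ln 2) / \<delta> \<le> real J" using J1 J(2) by (smt (verit) of_nat_mono)
        then have "s + 2 * ln 2 \<le> \<delta> * real J" using \<delta> by (simp add: field_simps)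
        then have "(s + 2 * ln 2) * real J \<le> (\<delta> * real J) * real J" by (rule mult_right_mono) simp
        then show ?thesis by (simp add: power2_eq_square mult.assoc)
      qed
      moreover have "real (triangle J) * s1 - real J * ln 2 \<le> (\<Sum>j<J. code_cost (Suc j))" by (rule cost_sum)
      ultimately show "s * (real (triangle J) + real J) + real J * ln 2 \<le> (\<Sum>j<J. cst j (\<omega> j))"
        by (rule combine)
    qed
    then show "\<omega> \<in> (\<Union>k. F k)" by blast
  qed
  then have "measure Om (\<Union>k. F k) = 1"
    using F_sets by (subst P.prob_eq_1) auto
  moreover have "(\<lambda>k. measure Om (F k)) \<longlonglongrightarrow> measure Om (\<Union>k. F k)"
    by (rule P.finite_Lim_measure_incseq) (use F_sets in \<open>auto simp: incseq_def F_def\<close>)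
  ultimately have "(\<lambda>k. measure Om (F k)) \<longlonglongrightarrow> 1" by simp
  then have "\<forall>\<^sub>F k in sequentially. 1 / 2 < measure Om (F k)" by (rule order_tendstoD) simp
  then obtain k where k: "1 / 2 < measure Om (F k)" by (auto simp: eventually_sequentially)
  \<comment> \<open>A null event that contains all samples with a non-generic concatenation;
    subtracting it keeps \<open>E\<close> an event.\<close>
  obtain Z where Z: "{\<omega> \<in> space Om. \<not> concat_pt \<omega> \<in> generic_points shift \<mu>} \<subseteq> Z" "emeasure Om Z = 0" "Z \<in> sets Om"
    using AE_E[OF AE_concat_generic] by blast
  obtain blk :: "nat \<Rightarrow> nat" where blk: "\<And>n. triangle (blk n) \<le> n" "\<And>n. n \<le> triangle (blk n) + blk n"
    "filterlim blk at_top sequentially" by (rule nat_sequence_blocks) blast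
  obtain n0 where n0: "\<And>n. n \<ge> n0 \<Longrightarrow> k \<le> blk n"
    using blk(3)[unfolded filterlim_at_top, rule_format, of k] by (auto simp: eventually_sequentially)
  show ?thesis
  proof (rule that[of "F k - Z" n0])
    show "F k - Z \<in> sets Om" using F_sets Z by auto
    have "measure Om (F k - Z) = measure Om (F k)"
      using Z by (intro measure_Diff_null_set F_sets) (auto simp: null_sets_def)
    then show "measure Om (F k - Z) \<ge> 1 / 2" using k by simp
    show "concat_pt \<omega> \<in> generic_points shift \<mu>" if "\<omega> \<in> F k - Z" for \<omega> using Z(1) that by auto
    fix \<omega>0 n assume \<omega>0: "\<omega>0 \<in> F k - Z" and n: "n \<ge> n0"
    \<comment> \<open>Only the blocks below \<open>J\<close> are sure to be complete at time
      \<open>n\<close>; block \<open>J\<close> is left out.\<close>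
    define J where "J = blk n"
    have J: "triangle J \<le> n" "n \<le> triangle J + J" "J \<ge> k" using blk n0[OF n] by (auto simp: J_def)
    define V where "V j = cw (Suc j) -` nbh (Suc j) (cw (Suc j) (\<omega>0 j))" for j
    have V_sets: "V j \<in> sets \<mu>" for j unfolding V_def using labels_sets[OF labels_cw] by simp
    define A where "A = {\<omega> \<in> space Om. \<forall>j\<in>{..<J}. \<omega> j \<in> V j}"
    have A_eq: "A = prod_emb UNIV (\<lambda>_. \<mu>) {..<J} (Pi\<^sub>E {..<J} V)"
      by (auto simp: A_def prod_emb_def PiE_def Pi_def)
    show "\<exists>A\<in>sets Om. measure Om A \<le> exp (- (real n * s)) \<and>
        {\<omega>. \<forall>t<n. dist (concat_pt \<omega> (int t)) (concat_pt \<omega>0 (int t)) < r} \<subseteq> A"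
    proof (intro bexI[of _ A] conjI)
      show "A \<in> sets Om" unfolding A_eq using V_sets by (intro sets_PiM_I) auto
      have "measure Om A = (\<Prod>j<J. measure \<mu> (V j))"
        unfolding A_eq using V_sets by (intro P.measure_PiM_emb) auto
      also have "\<dots> \<le> (\<Prod>j<J. exp (ln 2 - cst j (\<omega>0 j)))"
      proof (rule prod_mono, intro conjI)
        fix j
        have "nwgt (Suc j) (cw (Suc j) (\<omega>0 j)) > 0" by (rule nwgt_pos[OF cw_words])
        then have "exp (ln 2 - cst j (\<omega>0 j)) = 2 * nwgt (Suc j) (cw (Suc j) (\<omega>0 j))"
          by (simp add: cst_def exp_add)
        then show "measure \<mu> (V j) \<le> exp (ln 2 - cst j (\<omega>0 j))"
          using measure_nbh[of "Suc j" "cw (Suc j) (\<omega>0 j)"] by (simp add: V_def)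
      qed simp
      also have "\<dots> = exp (real J * ln 2 - (\<Sum>j<J. cst j (\<omega>0 j)))"
        by (simp add: exp_sum[symmetric] sum_subtractf)
      also have "\<dots> \<le> exp (- (real n * s))"
      proof -
        have "s * (real (triangle J) + real J) + real J * ln 2 \<le> (\<Sum>j<J. cst j (\<omega>0 j))"
          using \<omega>0 J(3) by (simp add: F_def)
        moreover have "real n * s \<le> (real (triangle J) + real J) * s"
          using J(2) s(1) by (intro mult_right_mono) (auto simp flip: of_nat_add)
        ultimately show ?thesis by (simp add: algebra_simps)
      qed
      finally show "measure Om A \<le> exp (- (real n * s))" .
      show "{\<omega>. \<forall>t<n. dist (concat_pt \<omega> (int t)) (concat_pt \<omega>0 (int t)) < r} \<subseteq> A"
      proof
        fix \<omega> assume \<omega>: "\<omega> \<in> {\<omega>. \<forall>t<n. dist (concat_pt \<omega> (int t)) (concat_pt \<omega>0 (int t)) < r}"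
        have "\<omega> j \<in> V j" if "j < J" for j
        proof -
          have "near (a (\<omega>0 j (int i))) (a (\<omega> j (int i)))" if "i \<le> j" for i
          proof -
            have "triangle j + i < triangle (Suc j)" using that by simp
            also have "\<dots> \<le> triangle J" using \<open>j < J\<close> by (intro triangle_mono) simp
            finally have "triangle j + i < n" using J(1) by simp
            then have "dist (concat_pt \<omega> (int (triangle j + i))) (concat_pt \<omega>0 (int (triangle j + i))) < r"
              using \<omega> by blast
            then have "dist (\<omega> j (int i)) (\<omega>0 j (int i)) < r"
              by (simp only: concat_pt_block[OF that])
            then show ?thesis unfolding near_def by (metis dist_commute)
          qed
          then have "list_all2 near (cw (Suc j) (\<omega>0 j)) (cw (Suc j) (\<omega> j))"
            by (intro list_all2_all_nthI) (simp_all del: upt_Suc)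
          then show ?thesis using cw_words[of "Suc j" "\<omega> j"] by (simp add: V_def nbh_def)
        qed
        then show "\<omega> \<in> A" by (simp add: A_def)
      qed
    qed
  qed
qed

text \<open>The centres of covering balls need not come from \<open>E\<close>. A ball is therefore
  compared with one of its points in \<open>E\<close>, which doubles the radius and explains
  \<open>2 * \<epsilon> \<le> r\<close>. Each ball has mass at most its own weight, so every cover
  has total weight at least 1/2.\<close>

lemma h_B_lower:
  assumes LB: "\<And>n. n \<ge> 1 \<Longrightarrow> real n * s1 - ln 2 \<le> code_cost n" and \<epsilon>: "\<epsilon> > 0" "2 * \<epsilon> \<le> r"
  shows "ereal s1 \<le> h_B shift shift_dist (generic_points shift \<mu>) \<epsilon>"
  unfolding h_B_def
proof (rule INF_greatest, rule ccontr)
  interpret P: prob_space Om by (rule prob_space_Om)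
  fix s assume s: "s \<in> {s. 0 < s \<and> bowen_M shift shift_dist (generic_points shift \<mu>) s \<epsilon> = 0}"
    and "\<not> ereal s1 \<le> ereal s"
  then have "0 \<le> s" "s < s1" by auto
  from mass_bound[OF LB this] obtain E n0 where E: "E \<in> sets Om" "measure Om E \<ge> 1 / 2"
    "\<And>\<omega>. \<omega> \<in> E \<Longrightarrow> concat_pt \<omega> \<in> generic_points shift \<mu>"
    "\<And>\<omega>0 n. \<omega>0 \<in> E \<Longrightarrow> n \<ge> n0 \<Longrightarrow> \<exists>A\<in>sets Om. measure Om A \<le> exp (- (real n * s)) \<and>
        {\<omega>. \<forall>t<n. dist (concat_pt \<omega> (int t)) (concat_pt \<omega>0 (int t)) < r} \<subseteq> A" by blast
  have "ennreal (1 / 2) \<le> bowen_M_at shift shift_dist (generic_points shift \<mu>) s (max n0 1) \<epsilon>"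
    unfolding bowen_M_at_def
  proof (rule INF_greatest, clarify)
    fix I x n assume "(I, x, n) \<in> bowen_covers shift shift_dist (generic_points shift \<mu>) (max n0 1) \<epsilon>"
    then have cov: "\<And>i. i \<in> I \<Longrightarrow> max n0 1 \<le> n i"
      "generic_points shift \<mu> \<subseteq> (\<Union>i\<in>I. bowen_ball shift shift_dist (n i) (x i) \<epsilon>)"
      by (auto simp: bowen_covers_def)
    have "\<exists>A\<in>sets Om. measure Om A \<le> exp (- (real (n i) * s)) \<and> {\<omega> \<in> E. concat_pt \<omega> \<in> bowen_ball shift shift_dist (n i) (x i) \<epsilon>} \<subseteq> A"
      if i: "i \<in> I" for i
    proof (cases "\<exists>\<omega>0\<in>E. concat_pt \<omega>0 \<in> bowen_ball shift shift_dist (n i) (x i) \<epsilon>")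
      case True
      then obtain \<omega>0 where w0: "\<omega>0 \<in> E" "bowen_dist shift shift_dist (n i) (x i) (concat_pt \<omega>0) < \<epsilon>"
        by (auto simp: bowen_ball_def)
      have "n i \<ge> n0" using cov(1)[OF i] by simp
      from E(4)[OF w0(1) this] obtain A where A: "A \<in> sets Om" "measure Om A \<le> exp (- (real (n i) * s))"
        "{\<omega>. \<forall>t<n i. dist (concat_pt \<omega> (int t)) (concat_pt \<omega>0 (int t)) < r} \<subseteq> A" by blast
      have "\<omega> \<in> A" if "bowen_dist shift shift_dist (n i) (x i) (concat_pt \<omega>) < \<epsilon>" for \<omega>
      proof -
        have "dist (concat_pt \<omega> (int t)) (concat_pt \<omega>0 (int t)) < r" if "t < n i" for t
          using bowen_dist_coord[OF that, of "x i" "concat_pt \<omega>"] bowen_dist_coord[OF that, of "x i" "concat_pt \<omega>0"]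
            w0(2) \<open>bowen_dist shift shift_dist (n i) (x i) (concat_pt \<omega>) < \<epsilon>\<close> \<epsilon>(2)
            dist_triangle3[of "concat_pt \<omega> (int t)" "concat_pt \<omega>0 (int t)" "x i (int t)"] by linarith
        then show ?thesis using A(3) by blast
      qed
      then have "{\<omega> \<in> E. concat_pt \<omega> \<in> bowen_ball shift shift_dist (n i) (x i) \<epsilon>} \<subseteq> A"
        unfolding bowen_ball_def by blast
      then show ?thesis using A(1,2) by blast
    next
      case False
      then have "{\<omega> \<in> E. concat_pt \<omega> \<in> bowen_ball shift shift_dist (n i) (x i) \<epsilon>} \<subseteq> {}" by blast
      moreover have "measure Om {} \<le> exp (- (real (n i) * s))" by simp
      ultimately show ?thesis by blast
    qed
    then have "\<forall>i\<in>I. \<exists>A. A \<in> sets Om \<and> measure Om A \<le> exp (- (real (n i) * s)) \<and> {\<omega> \<in> E. concat_pt \<omega> \<in> bowen_ball shift shift_dist (n i) (x i) \<epsilon>} \<subseteq> A"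
      by blast
    from bchoice[OF this] obtain A where A: "\<And>i. i \<in> I \<Longrightarrow> A i \<in> sets Om" "\<And>i. i \<in> I \<Longrightarrow> measure Om (A i) \<le> exp (- (real (n i) * s))"
      "\<And>i. i \<in> I \<Longrightarrow> {\<omega> \<in> E. concat_pt \<omega> \<in> bowen_ball shift shift_dist (n i) (x i) \<epsilon>} \<subseteq> A i" by blast
    define A' where "A' i = (if i \<in> I then A i else {})" for i
    have A'_sets: "range A' \<subseteq> sets Om" using A(1) by (auto simp: A'_def)
    have "E \<subseteq> (\<Union>i. A' i)"
    proof
      fix \<omega> assume "\<omega> \<in> E"
      then obtain i where "i \<in> I" "concat_pt \<omega> \<in> bowen_ball shift shift_dist (n i) (x i) \<epsilon>" using E(3) cov(2) by blast
      then show "\<omega> \<in> (\<Union>i. A' i)" using A(3) \<open>\<omega> \<in> E\<close> by (auto simp: A'_def intro!: exI[of _ i])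
    qed
    have "ennreal (1 / 2) \<le> emeasure Om E"
      unfolding P.emeasure_eq_measure by (rule ennreal_leI[OF E(2)])
    also have "\<dots> \<le> emeasure Om (\<Union>i. A' i)"
      using \<open>E \<subseteq> (\<Union>i. A' i)\<close> A'_sets by (intro emeasure_mono) auto
    also have "\<dots> \<le> (\<Sum>i. emeasure Om (A' i))" by (rule emeasure_subadditive_countably[OF A'_sets])
    also have "\<dots> \<le> (\<Sum>\<^sub>\<infinity>i\<in>I. ennreal (exp (- real (n i) * s)))"
    proof (rule suminf_le_infsum_ennreal)
      show "emeasure Om (A' i) \<le> ennreal (exp (- real (n i) * s))" if "i \<in> I" for i
        using A(2)[OF that] that by (simp add: A'_def P.emeasure_eq_measure)
    qed (simp add: A'_def)
    finally show "ennreal (1 / 2) \<le> (\<Sum>\<^sub>\<infinity>i\<in>I. ennreal (exp (- real (n i) * s)))" .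
  qed
  also have "\<dots> \<le> bowen_M shift shift_dist (generic_points shift \<mu>) s \<epsilon>"
    unfolding bowen_M_eq by (rule SUP_upper) simp
  also have "\<dots> = 0" using s by simp
  finally show False by simp
qed

text \<open>In each piece of a countable decomposition some packing has total weight at least the
  mass of the piece. The inequality \<open>2 * \<epsilon> < r\<close> is strict because the balls of
  radius \<open>2 * \<epsilon>\<close> that appear here are closed.\<close>

lemma h_P_lower:
  assumes LB: "\<And>n. n \<ge> 1 \<Longrightarrow> real n * s1 - ln 2 \<le> code_cost n" and \<epsilon>: "\<epsilon> > 0" "2 * \<epsilon> < r"
  shows "ereal s1 \<le> h_P shift shift_dist (generic_points shift \<mu>) \<epsilon>"
  unfolding h_P_def
proof (rule INF_greatest, rule ccontr)
  interpret P: prob_space Om by (rule prob_space_Om)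
  fix s assume s: "s \<in> {s. 0 < s \<and> packing_outer shift shift_dist (generic_points shift \<mu>) s \<epsilon> = 0}"
    and "\<not> ereal s1 \<le> ereal s"
  then have "0 \<le> s" "s < s1" by auto
  from mass_bound[OF LB this] obtain E n0 where E: "E \<in> sets Om" "measure Om E \<ge> 1 / 2"
    "\<And>\<omega>. \<omega> \<in> E \<Longrightarrow> concat_pt \<omega> \<in> generic_points shift \<mu>"
    "\<And>\<omega>0 n. \<omega>0 \<in> E \<Longrightarrow> n \<ge> n0 \<Longrightarrow> \<exists>A\<in>sets Om. measure Om A \<le> exp (- (real n * s)) \<and>
        {\<omega>. \<forall>t<n. dist (concat_pt \<omega> (int t)) (concat_pt \<omega>0 (int t)) < r} \<subseteq> A" by blast
  \<comment> \<open>A maximal set with separation \<open>2 * \<epsilon>\<close> is a packing for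
    radius \<open>\<epsilon>\<close> and a cover for radius \<open>2 * \<epsilon>\<close>. All balls
    have the same length \<open>n\<close>, so comparing masses and weights amounts to
    counting.\<close>
  have pack: "\<exists>A\<in>sets Om. {\<omega> \<in> E. concat_pt \<omega> \<in> Y} \<subseteq> A \<and> emeasure Om A \<le> packing_P_at shift shift_dist Y s n \<epsilon>"
    if n: "n \<ge> n0" "n \<ge> 1" for Y n
  proof -
    define Z where "Z = concat_pt ` E \<inter> Y"
    obtain S where S: "S \<subseteq> Z" "finite S" "separated shift shift_dist n (2 * \<epsilon>) S"
      "\<And>z. z \<in> Z \<Longrightarrow> \<exists>x\<in>S. bowen_dist shift shift_dist n x z \<le> 2 * \<epsilon>"
      using maximal_separated[of "2 * \<epsilon>" n Z] \<epsilon>(1) n(2) by auto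
    have "\<exists>A\<in>sets Om. measure Om A \<le> exp (- (real n * s)) \<and>
        {\<omega>. bowen_dist shift shift_dist n z (concat_pt \<omega>) \<le> 2 * \<epsilon>} \<subseteq> A" if "z \<in> S" for z
    proof -
      obtain \<omega>0 where w0: "\<omega>0 \<in> E" "z = concat_pt \<omega>0" using S(1) \<open>z \<in> S\<close> by (auto simp: Z_def)
      from E(4)[OF w0(1) n(1)] obtain A where A: "A \<in> sets Om" "measure Om A \<le> exp (- (real n * s))"
        "{\<omega>. \<forall>t<n. dist (concat_pt \<omega> (int t)) (concat_pt \<omega>0 (int t)) < r} \<subseteq> A" by blast
      have "\<omega> \<in> A" if "bowen_dist shift shift_dist n z (concat_pt \<omega>) \<le> 2 * \<epsilon>" for \<omega>
      proof -
        have "dist (concat_pt \<omega> (int t)) (concat_pt \<omega>0 (int t)) < r" if "t < n" for t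
          using bowen_dist_coord[OF that, of z "concat_pt \<omega>"] \<epsilon>(2)
            \<open>bowen_dist shift shift_dist n z (concat_pt \<omega>) \<le> 2 * \<epsilon>\<close> unfolding w0(2)
          by (simp add: dist_commute)
        then show ?thesis using A(3) by blast
      qed
      then show ?thesis using A by blast
    qed
    then obtain A where A: "\<And>z. z \<in> S \<Longrightarrow> A z \<in> sets Om" "\<And>z. z \<in> S \<Longrightarrow> measure Om (A z) \<le> exp (- (real n * s))"
      "\<And>z. z \<in> S \<Longrightarrow> {\<omega>. bowen_dist shift shift_dist n z (concat_pt \<omega>) \<le> 2 * \<epsilon>} \<subseteq> A z" by metis
    obtain e where e: "bij_betw e {..<card S} S"
      using ex_bij_betw_nat_finite[OF S(2)] by (auto simp: atLeast0LessThan)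
    have "({..<card S}, e, \<lambda>_. n) \<in> bowen_packings shift shift_dist Y n \<epsilon>"
    proof -
      have "e i \<in> Y" if "i < card S" for i
        using e that S(1) by (auto simp: bij_betw_def Z_def)
      moreover have "bowen_cball shift shift_dist n (e i) \<epsilon> \<inter> bowen_cball shift shift_dist n (e j) \<epsilon> = {}"
        if ij: "i < card S" "j < card S" "i \<noteq> j" for i j
      proof (rule equals0I)
        fix z assume "z \<in> bowen_cball shift shift_dist n (e i) \<epsilon> \<inter> bowen_cball shift shift_dist n (e j) \<epsilon>"
        then have "bowen_dist shift shift_dist n (e i) z \<le> \<epsilon>" "bowen_dist shift shift_dist n z (e j) \<le> \<epsilon>"
          by (auto simp: bowen_cball_def bowen_dist_commute)
        then have "bowen_dist shift shift_dist n (e i) (e j) \<le> 2 * \<epsilon>"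
          using bowen_dist_triangle[OF n(2), of "e i" "e j" z] by linarith
        moreover have "e i \<in> S" "e j \<in> S" "e i \<noteq> e j"
          using e ij by (auto simp: bij_betw_def inj_on_def)
        ultimately show False using S(3) by (force simp: separated_def)
      qed
      ultimately show ?thesis by (auto simp: bowen_packings_def disjoint_family_on_def)
    qed
    then have le: "(\<Sum>\<^sub>\<infinity>i\<in>{..<card S}. ennreal (exp (- s * real n))) \<le> packing_P_at shift shift_dist Y s n \<epsilon>"
      using SUP_upper[of _ _ "\<lambda>(I, x, n). \<Sum>\<^sub>\<infinity>i\<in>I. ennreal (exp (- s * real (n i)))"]
      unfolding packing_P_at_def by fastforce
    have "emeasure Om (\<Union>z\<in>S. A z) \<le> (\<Sum>z\<in>S. emeasure Om (A z))"
      using A(1) S(2) by (intro emeasure_subadditive_finite) auto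
    also have "\<dots> \<le> (\<Sum>z\<in>S. ennreal (exp (- s * real n)))"
      using A(2) by (intro sum_mono) (simp add: P.emeasure_eq_measure mult.commute)
    also have "\<dots> = (\<Sum>\<^sub>\<infinity>i\<in>{..<card S}. ennreal (exp (- s * real n)))"
      by (simp only: sum_constant infsum_finite finite_lessThan card_lessThan)
    finally have "emeasure Om (\<Union>z\<in>S. A z) \<le> packing_P_at shift shift_dist Y s n \<epsilon>" using le by (rule order_trans)
    moreover have "{\<omega> \<in> E. concat_pt \<omega> \<in> Y} \<subseteq> (\<Union>z\<in>S. A z)"
      using S(4) A(3) by (fastforce simp: Z_def)
    ultimately show ?thesis using A(1) S(2) by (intro bexI[of _ "\<Union>z\<in>S. A z"]) auto
  qed
  have "ennreal (1 / 4) \<le> packing_outer shift shift_dist (generic_points shift \<mu>) s \<epsilon>"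
    unfolding packing_outer_def
  proof (rule INF_greatest, clarify)
    fix Y :: "nat \<Rightarrow> (int \<Rightarrow> 'k) set" assume Y: "generic_points shift \<mu> \<subseteq> (\<Union>i. Y i)"
    \<comment> \<open>The errors add up to 1/4, which leaves 1/4 of the mass of
      \<open>E\<close>.\<close>
    have "\<exists>A\<in>sets Om. {\<omega> \<in> E. concat_pt \<omega> \<in> Y i} \<subseteq> A \<and>
        emeasure Om A \<le> packing_P shift shift_dist (Y i) s \<epsilon> + ennreal ((1 / 2) ^ i / 8)" for i
    proof (cases "packing_P shift shift_dist (Y i) s \<epsilon> = \<infinity>")
      case True
      then show ?thesis using E(1) by (intro bexI[of _ E]) auto
    next
      case False
      then have "packing_P shift shift_dist (Y i) s \<epsilon> < packing_P shift shift_dist (Y i) s \<epsilon> + ennreal ((1 / 2) ^ i / 8)"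
        by (rule ennreal_less_add) simp
      then obtain n where n: "packing_P_at shift shift_dist (Y i) s n \<epsilon> < packing_P shift shift_dist (Y i) s \<epsilon> + ennreal ((1 / 2) ^ i / 8)"
        using packing_P_eq[of shift shift_dist "Y i" s \<epsilon>] by (auto simp: INF_less_iff)
      have "max n (max n0 1) \<ge> n0" "max n (max n0 1) \<ge> 1" by auto
      from pack[OF this, of "Y i"] obtain A where "A \<in> sets Om" "{\<omega> \<in> E. concat_pt \<omega> \<in> Y i} \<subseteq> A"
        "emeasure Om A \<le> packing_P_at shift shift_dist (Y i) s (max n (max n0 1)) \<epsilon>"
        by blast
      moreover have "packing_P_at shift shift_dist (Y i) s (max n (max n0 1)) \<epsilon> \<le> packing_P_at shift shift_dist (Y i) s n \<epsilon>"
        by (rule packing_P_at_antimono) simp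
      ultimately show ?thesis using n by (intro bexI[of _ A] conjI) (auto simp del: One_nat_def)
    qed
    then have "\<forall>i. \<exists>A. A \<in> sets Om \<and> {\<omega> \<in> E. concat_pt \<omega> \<in> Y i} \<subseteq> A \<and>
        emeasure Om A \<le> packing_P shift shift_dist (Y i) s \<epsilon> + ennreal ((1 / 2) ^ i / 8)" by blast
    from choice[OF this] obtain A where A: "\<And>i. A i \<in> sets Om" "\<And>i. {\<omega> \<in> E. concat_pt \<omega> \<in> Y i} \<subseteq> A i"
      "\<And>i. emeasure Om (A i) \<le> packing_P shift shift_dist (Y i) s \<epsilon> + ennreal ((1 / 2) ^ i / 8)" by blast
    have EA: "E \<subseteq> (\<Union>i. A i)"
    proof
      fix \<omega> assume "\<omega> \<in> E"
      then obtain i where "concat_pt \<omega> \<in> Y i" using E(3) Y by blast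
      then show "\<omega> \<in> (\<Union>i. A i)" using A(2)[of i] \<open>\<omega> \<in> E\<close> by blast
    qed
    have geo: "(\<Sum>i. ennreal ((1 / 2) ^ i / 8)) = ennreal (1 / 4)"
    proof -
      have "(\<lambda>i. (1 / 2 :: real) ^ i / 8) sums (2 / 8)"
        using sums_divide[OF geometric_sums[of "1/2 :: real"], of 8] by simp
      then show ?thesis by (intro suminf_ennreal_eq) auto
    qed
    have "ennreal (1 / 2) \<le> emeasure Om E"
      unfolding P.emeasure_eq_measure by (rule ennreal_leI[OF E(2)])
    also have "\<dots> \<le> emeasure Om (\<Union>i. A i)" using EA A(1) by (intro emeasure_mono) auto
    also have "\<dots> \<le> (\<Sum>i. emeasure Om (A i))" using A(1) by (intro emeasure_subadditive_countably) auto
    also have "\<dots> \<le> (\<Sum>i. packing_P shift shift_dist (Y i) s \<epsilon> + ennreal ((1 / 2) ^ i / 8))"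
      using A(3) by (intro suminf_le) auto
    also have "\<dots> = (\<Sum>i. packing_P shift shift_dist (Y i) s \<epsilon>) + ennreal (1 / 4)"
      by (subst suminf_add[symmetric]) (auto simp: geo)
    finally have le: "ennreal (1 / 4) + ennreal (1 / 4) \<le> (\<Sum>i. packing_P shift shift_dist (Y i) s \<epsilon>) + ennreal (1 / 4)"
      by (simp flip: ennreal_plus)
    have "ennreal (1 / 4) + ennreal (1 / 4) \<le> ennreal (1 / 4) + (\<Sum>i. packing_P shift shift_dist (Y i) s \<epsilon>)"
      using le by (subst (2) add.commute)
    then have "ennreal (1 / 4) = \<infinity> \<or> ennreal (1 / 4) \<le> (\<Sum>i. packing_P shift shift_dist (Y i) s \<epsilon>)"
      by (simp only: ennreal_add_left_cancel_le)
    moreover have "ennreal (1 / 4) \<noteq> \<infinity>" by (rule ennreal_neq_top[folded infinity_ennreal_def])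
    ultimately show "ennreal (1 / 4) \<le> (\<Sum>i. packing_P shift shift_dist (Y i) s \<epsilon>)" by blast
  qed
  then show False using s by simp
qed

end

section \<open>Sequential compactness of Borel probability measures\<close>

text \<open>Digits 0 and 1 in base 4 leave gaps: at the first place \<open>l\<close> where the
  sequences differ, the difference is \<open>(1/4)^l\<close>, and all later places together
  contribute at most a third of that.\<close>

lemma weighted_digits_gap:
  fixes s s' :: "nat \<Rightarrow> bool"
  assumes "s k \<noteq> s' k"
  shows "(1 / 4) ^ k / 2 \<le> \<bar>(\<Sum>j. of_bool (s j) * (1 / 4 :: real) ^ j) - (\<Sum>j. of_bool (s' j) * (1 / 4) ^ j)\<bar>"
proof -
  define d where "d j = (of_bool (s j) - of_bool (s' j)) * (1 / 4 :: real) ^ j" for j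
  have sm: "summable (\<lambda>j. of_bool (b j) * (1 / 4 :: real) ^ j)" for b
    by (rule summable_comparison_test'[of "\<lambda>j. (1 / 4) ^ j" 0]) (auto simp: summable_geometric_iff)
  have d_le: "\<bar>d j\<bar> \<le> (1 / 4) ^ j" for j by (auto simp: d_def abs_mult)
  have sd: "summable d"
    unfolding d_def left_diff_distrib by (intro summable_diff sm)
  have eq: "(\<Sum>j. of_bool (s j) * (1 / 4 :: real) ^ j) - (\<Sum>j. of_bool (s' j) * (1 / 4) ^ j) = suminf d"
    unfolding d_def left_diff_distrib by (rule suminf_diff[OF sm sm])
  define l where "l = (LEAST l. s l \<noteq> s' l)"
  have l: "s l \<noteq> s' l" unfolding l_def by (rule LeastI[of _ k]) (rule assms)
  have "l \<le> k" unfolding l_def by (rule Least_le) (rule assms)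
  have d0: "d j = 0" if "j < l" for j
    using not_less_Least[of j "\<lambda>l. s l \<noteq> s' l"] that by (simp add: l_def d_def)
  have "suminf d = (\<Sum>j. d (j + Suc l)) + (\<Sum>j<Suc l. d j)"
    by (rule suminf_split_initial_segment[OF sd])
  also have "(\<Sum>j<Suc l. d j) = d l" using d0 by simp
  finally have split: "suminf d = (\<Sum>j. d (j + Suc l)) + d l" .
  have geo: "(\<lambda>j. (1 / 4 :: real) ^ (j + Suc l)) sums ((1 / 4) ^ l / 3)"
    using sums_mult[OF geometric_sums[of "1 / 4 :: real"], of "(1 / 4) ^ Suc l"]
    by (simp add: power_add mult_ac)
  have "\<bar>\<Sum>j. d (j + Suc l)\<bar> \<le> (\<Sum>j. \<bar>d (j + Suc l)\<bar>)"
    by (rule summable_rabs, rule summable_comparison_test'[OF sums_summable[OF geo], of 0]) (simp only: real_norm_def abs_abs d_le)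
  also have "\<dots> \<le> (\<Sum>j. (1 / 4) ^ (j + Suc l))"
    by (rule suminf_le[OF d_le _ sums_summable[OF geo]], rule summable_comparison_test'[OF sums_summable[OF geo], of 0])
      (simp only: real_norm_def abs_abs d_le)
  also have "\<dots> = (1 / 4) ^ l / 3" using geo by (rule sums_unique[symmetric])
  finally have "\<bar>\<Sum>j. d (j + Suc l)\<bar> \<le> (1 / 4) ^ l / 3" .
  moreover have "\<bar>d l\<bar> = (1 / 4) ^ l" using l by (auto simp: d_def)
  moreover have "(1 / 4 :: real) ^ k \<le> (1 / 4) ^ l" using \<open>l \<le> k\<close> by (intro power_decreasing) auto
  moreover have "(1 / 4 :: real) ^ k > 0" by simp
  ultimately have "(1 / 4) ^ k / 2 \<le> \<bar>suminf d\<bar>" using split by linarith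
  then show ?thesis by (simp only: eq)
qed

text \<open>
  A compact metric space is a continuous image of a compact set of reals, with a Borel right inverse:
  points are coded by the digits telling which balls of a countable family contain them. This reduces
  the compactness of the space of measures to Helly's theorem.
\<close>

lemma compact_real_coding:
  assumes K: "compact (UNIV :: 'a::metric_space set)"
  obtains \<tau> :: "'a::metric_space \<Rightarrow> real" and C :: "real set" and g where
    "\<tau> \<in> borel_measurable borel" "compact C" "continuous_on C g" "\<And>x. \<tau> x \<in> C" "\<And>x. g (\<tau> x) = x"
    "\<And>x. 0 \<le> \<tau> x" "\<And>x. \<tau> x \<le> 2"
proof -
  have "\<exists>C. finite C \<and> UNIV \<subseteq> (\<Union>c\<in>C. ball (c :: 'a) (1 / real (Suc j)))" for j
    using K unfolding compact_eq_totally_bounded by (auto simp del: of_nat_Suc)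
  then obtain N where N: "\<And>j. finite (N j)" "\<And>j. UNIV \<subseteq> (\<Union>c\<in>N j. ball (c :: 'a) (1 / real (Suc j)))"
    using choice[of "\<lambda>j C. finite C \<and> UNIV \<subseteq> (\<Union>c\<in>C. ball (c :: 'a) (1 / real (Suc j)))"] by blast
  define \<P> where "\<P> = (\<Union>j. (\<lambda>c. (c, 1 / real (Suc j))) ` N j)"
  have cP: "countable \<P>" unfolding \<P>_def by (intro countable_UN countable_image) (auto intro: countable_finite N)
  have "\<P> \<noteq> {}" using N(2)[of 0] by (auto simp: \<P>_def intro!: exI[of _ 0])
  define c \<rho> where "c k = fst (from_nat_into \<P> k)" and "\<rho> k = snd (from_nat_into \<P> k)" for k
  \<comment> \<open>Both inequalities are strict, so they survive small perturbations of
    \<open>x\<close> and \<open>y\<close>; this is used for points in the closure of the graph of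
    the coding.\<close>
  have sep: "\<exists>k. dist (c k) x < \<rho> k \<and> \<rho> k < dist (c k) y" if "x \<noteq> y" for x y
  proof -
    obtain j where j: "inverse (real (Suc j)) < dist x y / 2"
      using reals_Archimedean[of "dist x y / 2"] \<open>x \<noteq> y\<close> by auto
    have "x \<in> (\<Union>c\<in>N j. ball c (1 / real (Suc j)))" using N(2)[of j] by blast
    then obtain b where b: "b \<in> N j" "dist b x < 1 / real (Suc j)" by (auto simp del: of_nat_Suc)
    have "(b, 1 / real (Suc j)) \<in> \<P>" using b(1) by (auto simp: \<P>_def)
    then obtain k where "from_nat_into \<P> k = (b, 1 / real (Suc j))"
      using from_nat_into_surj[OF cP] by blast
    moreover have "1 / real (Suc j) < dist b y"
      using b(2) j dist_triangle3[of x y b] by (simp add: inverse_eq_divide)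
    ultimately show ?thesis using b(2) by (intro exI[of _ k]) (simp add: c_def \<rho>_def)
  qed
  define s where "s x k \<longleftrightarrow> dist (c k) x < \<rho> k" for x k
  define \<tau> where "\<tau> x = (\<Sum>j. of_bool (s x j) * (1 / 4 :: real) ^ j)" for x
  have sm: "summable (\<lambda>j. of_bool (s x j) * (1 / 4 :: real) ^ j)" for x
    by (rule summable_comparison_test'[of "\<lambda>j. (1 / 4) ^ j" 0]) (auto simp: summable_geometric_iff)
  have \<tau>0: "0 \<le> \<tau> x" for x unfolding \<tau>_def by (rule suminf_nonneg[OF sm]) auto
  have \<tau>2: "\<tau> x \<le> 2" for x
  proof -
    have "\<tau> x \<le> (\<Sum>j. (1 / 4 :: real) ^ j)"
      unfolding \<tau>_def by (rule suminf_le[OF _ sm]) (auto simp: summable_geometric_iff)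
    also have "\<dots> = 4 / 3" using suminf_geometric[of "1 / 4 :: real"] by simp
    finally show ?thesis by simp
  qed
  have \<tau>_meas: "\<tau> \<in> borel_measurable borel"
  proof -
    have "of_bool (s x j) = (indicator (ball (c j) (\<rho> j)) x :: real)" for x j
      by (simp add: s_def indicator_def)
    then have "\<tau> = (\<lambda>x. \<Sum>j. indicator (ball (c j) (\<rho> j)) x * (1 / 4 :: real) ^ j)"
      by (simp add: \<tau>_def fun_eq_iff)
    also have "\<dots> \<in> borel_measurable borel"
      by (intro borel_measurable_suminf borel_measurable_times borel_measurable_indicator borel_measurable_const) auto
    finally show ?thesis .
  qed
  \<comment> \<open>The coding \<open>\<tau>\<close> is only Borel, but the closure of its graph is
    compact. Once the projection to the reals is injective on it, its inverse is continuous.\<close>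
  define \<Gamma> where "\<Gamma> = closure (range (\<lambda>x. (\<tau> x, x)))"
  have "compact \<Gamma>"
  proof -
    have "compact (({0..2 :: real} \<times> (UNIV :: 'a set)) \<inter> \<Gamma>)"
      unfolding \<Gamma>_def by (intro compact_Int_closed compact_Times compact_Icc K closed_closure)
    moreover have "\<Gamma> \<subseteq> {0..2} \<times> UNIV"
      unfolding \<Gamma>_def using \<tau>0 \<tau>2 by (intro closure_minimal closed_Times) auto
    ultimately show ?thesis by (simp only: Int_absorb1)
  qed
  have inj: "inj_on fst \<Gamma>"
  proof (rule inj_onI)
    fix p q assume pq: "p \<in> \<Gamma>" "q \<in> \<Gamma>" "fst p = fst q"
    obtain t x y where p: "p = (t, x)" and q: "q = (t, y)" using pq(3) by (cases p, cases q) auto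
    have "x = y"
    proof (rule ccontr)
      assume "x \<noteq> y"
      then obtain k where k: "dist (c k) x < \<rho> k" "\<rho> k < dist (c k) y" using sep by blast
      \<comment> \<open>Within \<open>e\<close> the digit \<open>k\<close> of the approximating
        points is still 1 for the one and 0 for the other, while \<open>2 * e\<close> is less than
        the gap \<open>(1/4)^k / 2\<close> which that forces.\<close>
      define e where "e = min ((1 / 4) ^ k / 8) (min (\<rho> k - dist (c k) x) (dist (c k) y - \<rho> k))"
      have e: "e > 0" using k by (simp add: e_def)
      have "\<exists>z\<in>range (\<lambda>x. (\<tau> x, x)). dist z p < e" "\<exists>z\<in>range (\<lambda>x. (\<tau> x, x)). dist z q < e"
        using pq e unfolding \<Gamma>_def closure_approachable by blast+
      then obtain x' y' where x': "dist (\<tau> x', x') (t, x) < e" and y': "dist (\<tau> y', y') (t, y) < e"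
        unfolding p q by auto
      have d: "dist (\<tau> x') t < e" "dist x' x < e" "dist (\<tau> y') t < e" "dist y' y < e"
        using x' y' dist_fst_le[of "(\<tau> x', x')" "(t, x)"] dist_snd_le[of "(\<tau> x', x')" "(t, x)"]
          dist_fst_le[of "(\<tau> y', y')" "(t, y)"] dist_snd_le[of "(\<tau> y', y')" "(t, y)"] by auto
      have "s x' k" using d(2) dist_triangle[of "c k" x' x] by (auto simp: s_def e_def dist_commute)
      moreover have "\<not> s y' k" using d(4) dist_triangle[of "c k" y y'] by (auto simp: s_def e_def)
      ultimately have "(1 / 4) ^ k / 2 \<le> \<bar>\<tau> x' - \<tau> y'\<bar>"
        unfolding \<tau>_def by (intro weighted_digits_gap) auto
      moreover have "\<bar>\<tau> x' - \<tau> y'\<bar> < 2 * e" using d(1,3) by (auto simp: dist_real_def)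
      moreover have "e \<le> (1 / 4) ^ k / 8" unfolding e_def by (rule min.cobounded1)
      moreover have "(1 / 4 :: real) ^ k > 0" by simp
      ultimately show False by linarith
    qed
    then show "p = q" by (simp add: p q)
  qed
  have in\<Gamma>: "(\<tau> x, x) \<in> \<Gamma>" for x
    unfolding \<Gamma>_def by (rule subsetD[OF closure_subset]) simp
  show ?thesis
  proof (rule that[OF \<tau>_meas _ _ _ _ \<tau>0 \<tau>2])
    show "compact (fst ` \<Gamma>)" by (intro compact_continuous_image continuous_on_fst continuous_on_id \<open>compact \<Gamma>\<close>)
    show "continuous_on (fst ` \<Gamma>) (\<lambda>t. snd (the_inv_into \<Gamma> fst t))"
      by (intro continuous_on_snd continuous_on_inv_into continuous_on_fst continuous_on_id \<open>compact \<Gamma>\<close> inj)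
    show "\<tau> x \<in> fst ` \<Gamma>" for x using in\<Gamma>[of x] by force
    show "snd (the_inv_into \<Gamma> fst (\<tau> x)) = x" for x
      using the_inv_into_f_f[OF inj in\<Gamma>[of x]] by simp
  qed
qed

text \<open>The images under the real coding live on one bounded interval and are tight, so Helly's
  theorem provides a limit on the line. It is concentrated on the compact set \<open>C\<close> and
  is brought back by the continuous inverse of the coding.\<close>

lemma borel_probs_seq_compact:
  fixes m :: "nat \<Rightarrow> 'a::metric_space measure"
  assumes K: "compact (UNIV :: 'a set)" and m: "\<And>k. m k \<in> borel_probs"
  shows "\<exists>r \<nu>. strict_mono r \<and> \<nu> \<in> borel_probs \<and> weak_star_limit (\<lambda>k. m (r k)) \<nu>"
proof -
  have mp: "prob_space (m k)" and ms: "sets (m k) = sets borel" for k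
    using m by (auto simp: borel_probs_def)
  obtain \<tau> :: "'a \<Rightarrow> real" and C :: "real set" and g where C:
    "\<tau> \<in> borel_measurable borel" "compact C" "continuous_on C g" "\<And>x. \<tau> x \<in> C" "\<And>x. g (\<tau> x) = x"
    "\<And>x. 0 \<le> \<tau> x" "\<And>x. \<tau> x \<le> 2" by (rule compact_real_coding[OF K]) blast
  have \<tau>m: "\<tau> \<in> borel_measurable (m k)" for k using C(1) by (simp add: measurable_cong_sets[OF ms refl])
  define D where "D k = distr (m k) borel \<tau>" for k
  have Dp: "prob_space (D k)" for k unfolding D_def by (rule prob_space.prob_space_distr[OF mp \<tau>m])
  have Dr: "real_distribution (D k)" for k
    unfolding real_distribution_def real_distribution_axioms_def using Dp by (simp add: D_def)
  have Dint: "(\<integral>t. f t \<partial>D k) = (\<integral>x. f (\<tau> x) \<partial>m k)" if "f \<in> borel_measurable borel" for f :: "real \<Rightarrow> real" and k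
    unfolding D_def by (rule integral_distr[OF \<tau>m that])
  have "tight D"
    unfolding tight_def
  proof (intro conjI allI impI Dr)
    fix \<epsilon> :: real assume "\<epsilon> > 0"
    have "measure (D k) {-1<..3} = 1" for k
    proof -
      have "measure (D k) {-1<..3} = measure (m k) (\<tau> -` {-1<..3} \<inter> space (m k))"
        unfolding D_def by (rule measure_distr[OF \<tau>m]) simp
      also have "\<tau> -` {-1<..3} \<inter> space (m k) = space (m k)"
      proof -
        have "-1 < \<tau> x" "\<tau> x \<le> 3" for x using C(6)[of x] C(7)[of x] by linarith+
        then show ?thesis by auto
      qed
      finally show ?thesis using prob_space.prob_space[OF mp] by simp
    qed
    then show "\<exists>a b. a < b \<and> (\<forall>n. measure (D n) {a<..b} > 1 - \<epsilon>)"
      using \<open>\<epsilon> > 0\<close> by (intro exI[of _ "-1"] exI[of _ 3]) simp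
  qed
  then obtain r M where r: "strict_mono r" "real_distribution M" "weak_conv_m (D \<circ> id \<circ> r) M"
    using tight_imp_convergent_subsubsequence[of D id] strict_mono_id by blast
  interpret M: real_distribution M by fact
  have conv: "(\<lambda>k. \<integral>t. f t \<partial>D (r k)) \<longlonglongrightarrow> (\<integral>t. f t \<partial>M)"
    if "continuous_on UNIV f" "\<And>t. norm (f t) \<le> B" for f :: "real \<Rightarrow> real" and B
  proof (rule weak_conv_imp_integral_bdd_continuous_conv[of "\<lambda>k. D (r k)"])
    show "weak_conv_m (\<lambda>k. D (r k)) M" using r(3) by (simp add: o_def)
    show "isCont f t" for t using that(1) by (simp add: continuous_on_eq_continuous_at)
  qed (use that Dr r(2) in auto)
  have "closed C" using C(2) by (rule compact_imp_closed)
  have Cne: "C \<noteq> {}" using C(4) by auto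
  \<comment> \<open>The truncated distance to \<open>C\<close> is a bounded continuous function with
    integral 0 along the sequence, hence also in the limit.\<close>
  have "AE t in M. t \<in> C"
  proof -
    define f where "f t = min 1 (infdist t C)" for t
    have fc: "continuous_on UNIV f" unfolding f_def by (intro continuous_intros)
    have fm: "f \<in> borel_measurable borel" by (rule borel_measurable_continuous_onI[OF fc])
    have f01: "0 \<le> f t" "f t \<le> 1" for t by (auto simp: f_def infdist_nonneg)
    have "(\<integral>t. f t \<partial>D k) = 0" for k
      unfolding Dint[OF fm] using C(4) by (simp add: f_def)
    moreover have "(\<lambda>k. \<integral>t. f t \<partial>D (r k)) \<longlonglongrightarrow> (\<integral>t. f t \<partial>M)"
      by (rule conv[OF fc, of 1]) (use f01 in simp)
    ultimately have "(\<integral>t. f t \<partial>M) = 0" by (simp add: LIMSEQ_const_iff)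
    moreover have "integrable M f"
      by (rule M.integrable_const_bound[of _ 1]) (use f01 fm in \<open>auto simp: measurable_cong_sets[OF M.events_eq_borel refl]\<close>)
    ultimately have "AE t in M. f t = 0"
      using integral_nonneg_eq_0_iff_AE[of M f] f01 by simp
    then show ?thesis
      by (rule AE_mp) (use \<open>closed C\<close> Cne in \<open>auto simp: f_def in_closed_iff_infdist_zero min_def split: if_splits intro!: AE_I2\<close>)
  qed
  \<comment> \<open>An arbitrary value off \<open>C\<close>, a null set of the limit, gives a Borel
    map on the whole line.\<close>
  define g' where "g' t = (if t \<in> C then g t else undefined)" for t
  have g'm: "g' \<in> borel_measurable borel"
    unfolding g'_def using \<open>closed C\<close> C(3) by (intro borel_measurable_continuous_on_if) auto
  then have g'M: "g' \<in> borel_measurable M" by (simp add: measurable_cong_sets[OF M.events_eq_borel refl])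
  define \<nu> where "\<nu> = distr M borel g'"
  have "\<nu> \<in> borel_probs"
    unfolding borel_probs_def \<nu>_def using M.prob_space_distr[OF g'M] by simp
  moreover have "weak_star_limit (\<lambda>k. m (r k)) \<nu>"
    unfolding weak_star_limit_def
  proof (intro allI impI)
    fix \<phi> :: "'a \<Rightarrow> real" assume \<phi>: "continuous_on UNIV \<phi>"
    have "compact (range \<phi>)" by (rule compact_continuous_image[OF \<phi> K])
    then have "bounded (range \<phi>)" by (rule compact_imp_bounded)
    then obtain B where B: "\<And>x. norm (\<phi> x) \<le> B" unfolding bounded_iff by auto
    have B0: "0 \<le> B" using B[of undefined] by (meson norm_ge_zero order_trans)
    have \<phi>g: "continuous_on C (\<lambda>t. \<phi> (g t))"
      by (rule continuous_on_compose2[OF \<phi> C(3)]) simp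
    have cl: "closedin (top_of_set UNIV) C" using \<open>closed C\<close> by simp
    \<comment> \<open>Weak convergence on the line is tested with functions on all reals, so
      \<open>\<phi>\<close> composed with \<open>g\<close> is first extended by Tietze's
      theorem.\<close>
    obtain h where h: "continuous_on UNIV h" "\<And>t. t \<in> C \<Longrightarrow> h t = \<phi> (g t)" and h': "\<And>t. t \<in> UNIV \<Longrightarrow> norm (h t) \<le> B"
      by (rule Tietze[OF \<phi>g cl B0 B]) (rule that; assumption)
    have h3: "norm (h t) \<le> B" for t by (rule h') simp
    have hm: "h \<in> borel_measurable borel" by (rule borel_measurable_continuous_onI[OF h(1)])
    have "(\<lambda>k. \<integral>t. h t \<partial>D (r k)) \<longlonglongrightarrow> (\<integral>t. h t \<partial>M)" by (rule conv[OF h(1) h3])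
    moreover have "(\<integral>t. h t \<partial>D (r k)) = (\<integral>x. \<phi> x \<partial>m (r k))" for k
      by (simp add: Dint[OF hm] h(2) C(4,5))
    moreover have "(\<integral>t. h t \<partial>M) = (\<integral>x. \<phi> x \<partial>\<nu>)"
    proof -
      have \<phi>m: "\<phi> \<in> borel_measurable borel" by (rule borel_measurable_continuous_onI[OF \<phi>])
      have "(\<integral>x. \<phi> x \<partial>\<nu>) = (\<integral>t. \<phi> (g' t) \<partial>M)" unfolding \<nu>_def by (rule integral_distr[OF g'M \<phi>m])
      also have "\<dots> = (\<integral>t. h t \<partial>M)"
      proof (rule integral_cong_AE)
        show "(\<lambda>t. \<phi> (g' t)) \<in> borel_measurable M" by (rule measurable_compose[OF g'M \<phi>m])
        show "h \<in> borel_measurable M" using hm by (simp add: measurable_cong_sets[OF M.events_eq_borel refl])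
        show "AE t in M. \<phi> (g' t) = h t"
          using \<open>AE t in M. t \<in> C\<close> by (rule AE_mp) (simp add: h(2) g'_def)
      qed
      finally show ?thesis by simp
    qed
    ultimately show "(\<lambda>k. \<integral>x. \<phi> x \<partial>m (r k)) \<longlonglongrightarrow> (\<integral>x. \<phi> x \<partial>\<nu>)" by simp
  qed
  ultimately show ?thesis using r(1) by blast
qed

lemma empirical_measure_prob:
  fixes x :: "'a::topological_space"
  assumes "n \<ge> 1"
  shows "empirical_measure f n x \<in> borel_probs"
proof -
  have sp: "space (empirical_measure f n x) = UNIV"
    using sets_eq_imp_space_eq[OF sets_empirical_measure[of f n x]] by simp
  have "emeasure (empirical_measure f n x) UNIV = ennreal (1 / real n) * of_nat n"
    by (simp add: emeasure_empirical_measure)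
  also have "\<dots> = 1" using assms by (simp add: ennreal_of_nat_eq_real_of_nat flip: ennreal_mult)
  finally show ?thesis unfolding borel_probs_def by (auto intro!: prob_spaceI simp: sp)
qed

section \<open>Averages along generic orbits\<close>

context invariant_measure
begin

text \<open>Converse of \<open>generic_pointI\<close>, and the place where compactness enters: if
  the averages stayed away from the integral along a subsequence, a further subsequence would have a
  weak limit. Genericity forces this limit to be \<open>\<mu>\<close>, a contradiction.\<close>

lemma generic_avg:
  assumes x: "x \<in> generic_points shift \<mu>" and \<phi>: "continuous_on UNIV \<phi>"
  shows "(\<lambda>n. avg \<phi> n x) \<longlonglongrightarrow> (\<integral>y. \<phi> y \<partial>\<mu>)"
proof (rule ccontr)
  assume "\<not> (\<lambda>n. avg \<phi> n x) \<longlonglongrightarrow> (\<integral>y. \<phi> y \<partial>\<mu>)"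
  then obtain e where e: "e > 0" "\<And>N. \<exists>n\<ge>N. \<bar>avg \<phi> n x - (\<integral>y. \<phi> y \<partial>\<mu>)\<bar> \<ge> e"
    unfolding LIMSEQ_iff by (auto simp: not_less)
  \<comment> \<open>At \<open>n = 0\<close> the empirical measure is the zero measure, not a
    probability.\<close>
  define S where "S = {n. n \<ge> 1 \<and> \<bar>avg \<phi> n x - (\<integral>y. \<phi> y \<partial>\<mu>)\<bar> \<ge> e}"
  have "infinite S"
  proof
    assume "finite S"
    then obtain B where B: "\<And>n. n \<in> S \<Longrightarrow> n \<le> B" using finite_nat_set_iff_bounded_le by auto
    obtain n where "n \<ge> Suc B" "\<bar>avg \<phi> n x - (\<integral>y. \<phi> y \<partial>\<mu>)\<bar> \<ge> e" using e(2) by blast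
    then show False using B[of n] by (auto simp: S_def)
  qed
  from infinite_enumerate[OF this] obtain q :: "nat \<Rightarrow> nat" where q: "strict_mono q" and q': "\<forall>k. q k \<in> S"
    by blast
  have "q k \<ge> 1" for k using q' by (simp add: S_def)
  then have emp: "empirical_measure shift (q k) x \<in> borel_probs" for k
    by (rule empirical_measure_prob)
  have "\<exists>r \<nu>. strict_mono r \<and> \<nu> \<in> borel_probs \<and> weak_star_limit (\<lambda>k. empirical_measure shift (q (r k)) x) \<nu>"
    by (rule borel_probs_seq_compact[OF compact_fun_UNIV[OF K_compact] emp])
  then obtain r :: "nat \<Rightarrow> nat" and \<nu> where r: "strict_mono r" "\<nu> \<in> borel_probs" "weak_star_limit (\<lambda>k. empirical_measure shift (q (r k)) x) \<nu>"
    by blast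
  have "strict_mono (q \<circ> r)" using q r(1) by (rule strict_mono_o)
  then have "\<nu> \<in> limit_measures shift x"
    unfolding limit_measures_def using r(2,3) by (auto intro!: exI[of _ "q \<circ> r"])
  then have "\<nu> = \<mu>" using x by (simp add: generic_points_def)
  then have "(\<lambda>k. \<integral>y. \<phi> y \<partial>empirical_measure shift (q (r k)) x) \<longlonglongrightarrow> (\<integral>y. \<phi> y \<partial>\<mu>)"
    using r(3) \<phi> unfolding weak_star_limit_def by blast
  moreover have "(\<integral>y. \<phi> y \<partial>empirical_measure shift (q (r k)) x) = avg \<phi> (q (r k)) x" for k
    using q'[rule_format, of "r k"]
    by (intro integral_empirical borel_measurable_continuous_onI[OF \<phi>]) (simp add: S_def)
  ultimately have "(\<lambda>k. avg \<phi> (q (r k)) x) \<longlonglongrightarrow> (\<integral>y. \<phi> y \<partial>\<mu>)" by (simp only:)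
  from LIMSEQ_D[OF this e(1)] obtain k where "\<bar>avg \<phi> (q (r k)) x - (\<integral>y. \<phi> y \<partial>\<mu>)\<bar> < e"
    unfolding real_norm_def by blast
  then show False using q'[rule_format, of "r k"] by (simp add: S_def)
qed

end

section \<open>Upper bounds by counting words\<close>

text \<open>Regularity of finite Borel measures on metric spaces, by induction over the generated
  sigma-algebra. Inner and outer approximation are carried along together because complements
  exchange them.\<close>

lemma closed_open_approx:
  fixes \<mu> :: "'a::metric_space measure"
  assumes fin: "finite_measure \<mu>" and s: "sets \<mu> = sets borel" and A: "A \<in> sets borel" and e: "e > 0"
  shows "\<exists>C U. closed C \<and> open U \<and> C \<subseteq> A \<and> A \<subseteq> U \<and> measure \<mu> (U - C) < e"
proof -
  interpret finite_measure \<mu> by fact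
  have "A \<in> sigma_sets UNIV (Collect closed)"
    using A by (subst (asm) borel_eq_closed) (simp add: sets_measure_of)
  then have "\<forall>e>0. \<exists>C U. closed C \<and> open U \<and> C \<subseteq> A \<and> A \<subseteq> U \<and> measure \<mu> (U - C) < e"
  proof (induction A rule: sigma_sets.induct)
    case (Basic a)
    then have a: "closed a" by simp
    show ?case
    proof (intro allI impI)
      fix e :: real assume e: "e > 0"
      show "\<exists>C U. closed C \<and> open U \<and> C \<subseteq> a \<and> a \<subseteq> U \<and> measure \<mu> (U - C) < e"
      proof (cases "a = {}")
        case True
        then show ?thesis using e by (intro exI[of _ "{}"]) simp
      next
        case False
        define U where "U k = {x. infdist x a < 1 / real (Suc k)}" for k
        have Uo: "open (U k)" for k
          unfolding U_def by (intro open_Collect_less continuous_on_infdist continuous_on_id continuous_on_const)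
        have aU: "a \<subseteq> U k" for k by (auto simp: U_def)
        have "(\<lambda>k. measure \<mu> (U k - a)) \<longlonglongrightarrow> measure \<mu> (\<Inter>k. U k - a)"
        proof (rule finite_Lim_measure_decseq)
          show "range (\<lambda>k. U k - a) \<subseteq> sets \<mu>" using Uo a s by auto
          show "decseq (\<lambda>k. U k - a)"
            unfolding decseq_def
          proof (intro allI impI subsetI)
            fix m n :: nat and x assume "m \<le> n" "x \<in> U n - a"
            moreover have "1 / real (Suc n) \<le> 1 / real (Suc m)" using \<open>m \<le> n\<close> by (intro divide_left_mono) auto
            ultimately show "x \<in> U m - a" unfolding U_def by auto
          qed
        qed
        also have "(\<Inter>k. U k - a) = {}"
        proof (rule equals0I)
          fix x assume x: "x \<in> (\<Inter>k. U k - a)"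
          then have "infdist x a > 0"
            using a False by (auto simp: in_closed_iff_infdist_zero infdist_nonneg order.strict_iff_order)
          then obtain k where "inverse (real (Suc k)) < infdist x a" using reals_Archimedean by blast
          moreover have "infdist x a < 1 / real (Suc k)" using x unfolding U_def by blast
          ultimately show False by (simp add: inverse_eq_divide)
        qed
        finally have "(\<lambda>k. measure \<mu> (U k - a)) \<longlonglongrightarrow> 0" by simp
        then have "\<forall>\<^sub>F k in sequentially. measure \<mu> (U k - a) < e" by (rule order_tendstoD) (rule e)
        then obtain k where "measure \<mu> (U k - a) < e" by (auto simp: eventually_sequentially)
        then show ?thesis by (intro exI[of _ a] exI[of _ "U k"] conjI a Uo aU subset_refl)
      qed
    qed
  next
    case Empty
    have "closed {} \<and> open {} \<and> {} \<subseteq> ({} :: 'a set) \<and> {} \<subseteq> ({} :: 'a set) \<and> measure \<mu> ({} - {}) < e" if "e > 0" for e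
      using that by simp
    then show ?case by blast
  next
    case (Compl a)
    show ?case
    proof (intro allI impI)
      fix e :: real assume "e > 0"
      from Compl.IH[rule_format, OF this] obtain C U
        where CU: "closed C" "open U" "C \<subseteq> a" "a \<subseteq> U" "measure \<mu> (U - C) < e" by (elim exE conjE)
      have "(UNIV - C) - (UNIV - U) = U - C" by blast
      then show "\<exists>C U. closed C \<and> open U \<and> C \<subseteq> UNIV - a \<and> UNIV - a \<subseteq> U \<and> measure \<mu> (U - C) < e"
        using CU by (intro exI[of _ "UNIV - U"] exI[of _ "UNIV - C"]) (auto intro: open_Diff closed_Diff)
    qed
  next
    case (Union a)
    show ?case
    proof (intro allI impI)
      fix e :: real assume e: "e > 0"
      \<comment> \<open>These errors add up to \<open>e / 2\<close>; the other half is spent on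
        replacing a countable union of closed sets by a finite one.\<close>
      have "\<forall>i. \<exists>CU. closed (fst CU) \<and> open (snd CU) \<and> fst CU \<subseteq> a i \<and> a i \<subseteq> snd CU
          \<and> measure \<mu> (snd CU - fst CU) < (1 / 2) ^ i * (e / 4)"
      proof
        fix i
        have "(1 / 2) ^ i * (e / 4) > 0" using e by simp
        from Union.IH[of i, rule_format, OF this] obtain C U
          where "closed C" "open U" "C \<subseteq> a i" "a i \<subseteq> U" "measure \<mu> (U - C) < (1 / 2) ^ i * (e / 4)"
          by (elim exE conjE)
        then show "\<exists>CU. closed (fst CU) \<and> open (snd CU) \<and> fst CU \<subseteq> a i \<and> a i \<subseteq> snd CU
          \<and> measure \<mu> (snd CU - fst CU) < (1 / 2) ^ i * (e / 4)" by (intro exI[of _ "(C, U)"]) simp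
      qed
      from choice[OF this] obtain CU where CU: "\<And>i. closed (fst (CU i))" "\<And>i. open (snd (CU i))"
        "\<And>i. fst (CU i) \<subseteq> a i" "\<And>i. a i \<subseteq> snd (CU i)"
        "\<And>i. measure \<mu> (snd (CU i) - fst (CU i)) < (1 / 2) ^ i * (e / 4)" by blast
      define C U where "C i = fst (CU i)" and "U i = snd (CU i)" for i
      have CUs: "C i \<in> sets \<mu>" "U i \<in> sets \<mu>" for i using CU(1,2)[of i] s by (auto simp: C_def U_def)
      have geo: "(\<lambda>i. (1 / 2 :: real) ^ i * (e / 4)) sums (e / 2)"
        using sums_mult2[OF geometric_sums[of "1 / 2 :: real"], of "e / 4"] by simp
      have sm: "summable (\<lambda>i. measure \<mu> (U i - C i))"
        by (rule summable_comparison_test'[OF sums_summable[OF geo], of 0])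
          (use CU(5) in \<open>auto simp: C_def U_def intro: less_imp_le\<close>)
      have "measure \<mu> ((\<Union>i. U i) - (\<Union>i. C i)) \<le> measure \<mu> (\<Union>i. U i - C i)"
        using CUs by (intro finite_measure_mono) auto
      also have "\<dots> \<le> (\<Sum>i. measure \<mu> (U i - C i))"
        using CUs by (intro finite_measure_subadditive_countably sm) auto
      also have "\<dots> \<le> (\<Sum>i. (1 / 2) ^ i * (e / 4))"
        by (rule suminf_le[OF _ sm sums_summable[OF geo]]) (use CU(5) in \<open>auto simp: C_def U_def intro: less_imp_le\<close>)
      also have "\<dots> = e / 2" using geo by (rule sums_unique[symmetric])
      finally have small: "measure \<mu> ((\<Union>i. U i) - (\<Union>i. C i)) \<le> e / 2" .
      \<comment> \<open>The countable union of the closed sets need not be closed; finite unions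
        exhaust it, and the loss is controlled by continuity from above.\<close>
      have "(\<lambda>n. measure \<mu> ((\<Union>i. U i) - (\<Union>i<n. C i))) \<longlonglongrightarrow> measure \<mu> (\<Inter>n. (\<Union>i. U i) - (\<Union>i<n. C i))"
      proof (rule finite_Lim_measure_decseq)
        show "range (\<lambda>n. (\<Union>i. U i) - (\<Union>i<n. C i)) \<subseteq> sets \<mu>"
          using CUs by (auto intro!: sets.Diff sets.countable_UN sets.finite_UN)
        show "decseq (\<lambda>n. (\<Union>i. U i) - (\<Union>i<n. C i))"
          unfolding decseq_def by (auto dest: less_le_trans)
      qed
      also have "(\<Inter>n. (\<Union>i. U i) - (\<Union>i<n. C i)) = (\<Union>i. U i) - (\<Union>i. C i)" by auto
      finally have lim: "(\<lambda>n. measure \<mu> ((\<Union>i. U i) - (\<Union>i<n. C i))) \<longlonglongrightarrow> measure \<mu> ((\<Union>i. U i) - (\<Union>i. C i))" .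
      have "\<forall>\<^sub>F n in sequentially. measure \<mu> ((\<Union>i. U i) - (\<Union>i<n. C i)) < e"
        by (rule order_tendstoD(2)[OF lim]) (use small e in linarith)
      then obtain n where n: "measure \<mu> ((\<Union>i. U i) - (\<Union>i<n. C i)) < e" by (auto simp: eventually_sequentially)
      show "\<exists>C U. closed C \<and> open U \<and> C \<subseteq> (\<Union>i. a i) \<and> (\<Union>i. a i) \<subseteq> U \<and> measure \<mu> (U - C) < e"
      proof (intro exI conjI)
        show "closed (\<Union>i<n. C i)" using CU(1) by (intro closed_UN) (auto simp: C_def)
        show "open (\<Union>i. U i)" using CU(2) by (auto simp: U_def)
        show "(\<Union>i<n. C i) \<subseteq> (\<Union>i. a i)" using CU(3) by (fastforce simp: C_def)
        show "(\<Union>i. a i) \<subseteq> (\<Union>i. U i)" using CU(4) by (fastforce simp: U_def)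
      qed (rule n)
    qed
  qed
  from this[rule_format, OF e] show ?thesis .
qed

section \<open>Counting words with prescribed frequencies\<close>

context invariant_measure
begin

text \<open>The entropies of words grow by the entropy rate per letter on average, so not all
  increments can exceed the rate by \<open>\<delta>\<close>.\<close>

lemma small_entropy_increment:
  assumes u: "labels u" and \<delta>: "\<delta> > 0"
  shows "\<exists>q. ent \<mu> (word shift u (Suc q)) - ent \<mu> (word shift u q) \<le> ks_entropy shift \<mu> (fib u) + \<delta>"
proof (rule ccontr)
  let ?h = "ks_entropy shift \<mu> (fib u)"
  assume "\<not> ?thesis"
  then have inc: "?h + \<delta> \<le> ent \<mu> (word shift u (Suc q)) - ent \<mu> (word shift u q)" for q
    by (auto simp: not_le intro: less_imp_le)
  have "real n * (?h + \<delta>) \<le> ent \<mu> (word shift u n)" for n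
  proof (induction n)
    case (Suc n)
    then show ?case using inc[of n] by (simp add: algebra_simps)
  qed (simp add: ent_nonneg)
  then have "?h + \<delta> \<le> ent \<mu> (word shift u n) / real n" if "n \<ge> 1" for n
    using that by (simp add: field_simps)
  then have "?h + \<delta> \<le> ?h"
    by (intro LIMSEQ_le_const[OF ks_limit[OF u]]) auto
  then show False using \<delta> by simp
qed

text \<open>
  Words whose window frequencies are close to the distribution of \<open>\<mu>\<close> have large weight for the
  Markov chain with memory \<open>k - 1\<close> fitted to \<open>\<mu>\<close>, hence are few.
\<close>

lemma word_count:
  assumes u: "labels u" and A: "finite A" "range u \<subseteq> A" and \<delta>: "\<delta> > 0"
  shows "\<exists>k \<eta> n0. k \<ge> 1 \<and> \<eta> > 0 \<and> (\<forall>n\<ge>n0. real (card {w. set w \<subseteq> A \<and> length w = n \<and>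
      (\<forall>v. set v \<subseteq> A \<and> length v = k \<longrightarrow>
         real n * (measure \<mu> (word shift u k -` {v}) - \<eta>) \<le> real (card {s. s + k \<le> n \<and> take k (drop s w) = v}))})
    \<le> exp (real n * (ks_entropy shift \<mu> (fib u) + \<delta>)))"
proof -
  define h where "h = ks_entropy shift \<mu> (fib u)"
  obtain q where q: "ent \<mu> (word shift u (Suc q)) - ent \<mu> (word shift u q) \<le> h + \<delta> / 4"
    using small_entropy_increment[OF u, of "\<delta> / 4"] \<delta> unfolding h_def by auto
  define k where "k = Suc q"
  define \<alpha> where "\<alpha> = real (card A)"
  have "A \<noteq> {}" using A(2) by auto
  then have "card A \<ge> 1" using A(1) by (simp add: Suc_le_eq card_gt_0_iff)
  then have \<alpha>: "\<alpha> \<ge> 1" by (simp add: \<alpha>_def)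
  \<comment> \<open>Mixing in a uniform part makes all weights positive; with this proportion it
    adds at most \<open>\<delta> / 4\<close> to the cost of a word of length
    \<open>k\<close>.\<close>
  define \<theta> where "\<theta> = 1 - exp (- (\<delta> / 4))"
  have \<theta>: "0 < \<theta>" "\<theta> < 1" using \<delta> by (auto simp: \<theta>_def)
  have ln\<theta>: "- ln (1 - \<theta>) = \<delta> / 4" by (simp add: \<theta>_def)
  define P where "P j v = measure \<mu> (word shift u j -` {v})" for j v
  \<comment> \<open>Dividing by \<open>\<alpha> ^ j\<close> makes the uniform parts fit together:
    summing over the last letter turns the one for length \<open>k\<close> into the one for length
    \<open>q\<close>.\<close>
  define Q where "Q j v = (1 - \<theta>) * P j v + \<theta> / \<alpha> ^ j" for j v
  define AW where "AW j = {v. set v \<subseteq> A \<and> length v = j}" for j :: nat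
  have AW: "finite (AW j)" "card (AW j) = card A ^ j" for j
    unfolding AW_def using A(1) by (simp_all add: finite_lists_length_eq card_lists_length_eq)
  have L: "labels (word shift u j)" for j by (rule labels_word[OF u])
  have rng: "range (word shift u j) \<subseteq> AW j" for j
    using set_word[of shift u j] A(2) by (auto simp: AW_def)
  have P01: "0 \<le> P j v" "P j v \<le> 1" for j v by (simp_all add: P_def prob_le_1)
  have P0: "P j v = 0" if "v \<notin> range (word shift u j)" for j v
  proof -
    have "word shift u j -` {v} = {}" using that by auto
    then show ?thesis by (simp add: P_def)
  qed
  have sumP: "(\<Sum>v\<in>AW j. P j v) = 1" for j
  proof -
    have "(\<Sum>v\<in>AW j. P j v) = (\<Sum>v\<in>range (word shift u j). P j v)"
      by (rule sum.mono_neutral_right[OF AW(1) rng]) (use P0 in blast)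
    then show ?thesis using sum_fibres[OF labels_mu[OF L]] by (simp add: P_def)
  qed
  have Qpos: "Q j v > 0" and Qge: "Q j v \<ge> \<theta> / \<alpha> ^ j" for j v
  proof -
    have "(1 - \<theta>) * P j v \<ge> 0" "\<theta> / \<alpha> ^ j > 0" using \<theta> \<alpha> P01 by auto
    then show "Q j v > 0" "Q j v \<ge> \<theta> / \<alpha> ^ j" unfolding Q_def by linarith+
  qed
  have Qle: "Q j v \<le> 1" for j v
  proof -
    have "(1 - \<theta>) * P j v \<le> 1 - \<theta>" using mult_left_mono[of "P j v" 1 "1 - \<theta>"] \<theta> P01 by simp
    moreover have "\<theta> / \<alpha> ^ j \<le> \<theta>" using \<theta> \<alpha> by (simp add: divide_le_eq one_le_power)
    ultimately show ?thesis unfolding Q_def by linarith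
  qed
  have sumQ: "(\<Sum>v\<in>AW j. Q j v) = 1" for j
    unfolding Q_def sum.distrib sum_distrib_left[symmetric] sumP
    using \<alpha> AW(2)[of j] by (simp add: \<alpha>_def)
  have take_word: "take q (word shift u k x) = word shift u q x" for x
    by (rule nth_equalityI) (auto simp: k_def)
  have Psub: "P k v \<le> P q (take q v)" for v
  proof -
    have "word shift u k -` {v} \<subseteq> word shift u q -` {take q v}" using take_word by auto
    then show ?thesis
      unfolding P_def by (intro finite_measure_mono) (use labels_sets[OF L] in auto)
  qed
  have Psum: "(\<Sum>b\<in>A. P k (v @ [b])) \<le> P q v" if "length v = q" for v
  proof -
    have "(\<Sum>b\<in>A. P k (v @ [b])) = measure \<mu> (\<Union>b\<in>A. word shift u k -` {v @ [b]})"
      unfolding P_def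
      by (rule finite_measure_finite_Union[symmetric])
        (use A(1) labels_sets[OF L] in \<open>auto simp: disjoint_family_on_def\<close>)
    also have "\<dots> \<le> P q v"
    proof -
      have "(\<Union>b\<in>A. word shift u k -` {v @ [b]}) \<subseteq> word shift u q -` {v}"
      proof
        fix x assume "x \<in> (\<Union>b\<in>A. word shift u k -` {v @ [b]})"
        then obtain b where "word shift u k x = v @ [b]" by auto
        then have "word shift u q x = v" using take_word[of x] that by simp
        then show "x \<in> word shift u q -` {v}" by simp
      qed
      then show ?thesis unfolding P_def by (intro finite_measure_mono) (use labels_sets[OF L] in auto)
    qed
    finally show ?thesis .
  qed
  \<comment> \<open>The code length of the last letter of \<open>v\<close>, given the
    \<open>q\<close> letters before it.\<close>
  define G where "G v = ln (Q q (take q v)) - ln (Q k v)" for v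
  have G0: "G v \<ge> 0" for v
  proof -
    have "\<theta> / \<alpha> ^ k \<le> \<theta> / \<alpha> ^ q" using \<theta> \<alpha> by (intro divide_left_mono power_increasing) (auto simp: k_def)
    moreover have "(1 - \<theta>) * P k v \<le> (1 - \<theta>) * P q (take q v)" using \<theta> by (intro mult_left_mono Psub) auto
    ultimately have "Q k v \<le> Q q (take q v)" unfolding Q_def by linarith
    then show ?thesis unfolding G_def using Qpos by simp
  qed
  define B where "B = - ln (\<theta> / \<alpha> ^ k)"
  have GB: "G v \<le> B" for v
  proof -
    have "ln (Q q (take q v)) \<le> 0" using Qpos Qle by (simp add: ln_le_zero_iff)
    moreover have "ln (\<theta> / \<alpha> ^ k) \<le> ln (Q k v)" using Qge \<theta> \<alpha> by (intro ln_mono) auto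
    ultimately show ?thesis unfolding G_def B_def by linarith
  qed
  have B0: "B \<ge> 0" using G0[of "[]"] GB[of "[]"] by linarith
  \<comment> \<open>The expected code length is a difference of two cross entropies. Mixing costs at
    most \<open>\<delta> / 4\<close> in the first, Gibbs' inequality bounds the second from below,
    and the increment from \<open>q\<close> to \<open>k\<close> was chosen close to
    \<open>h\<close>.\<close>
  have sumG: "(\<Sum>v\<in>AW k. P k v * G v) \<le> h + \<delta> / 2"
  proof -
    have "(\<Sum>v\<in>AW k. P k v * G v) = (\<Sum>v\<in>range (word shift u k). P k v * G v)"
      by (rule sum.mono_neutral_right[OF AW(1) rng]) (use P0 in auto)
    also have "\<dots> = (\<integral>x. G (word shift u k x) \<partial>\<mu>)"
      unfolding P_def by (rule label_integral_eq[OF labels_mu[OF L], symmetric])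
    also have "\<dots> = (\<integral>x. - ln (Q k (word shift u k x)) - - ln (Q q (word shift u q x)) \<partial>\<mu>)"
      unfolding G_def take_word by (intro Bochner_Integration.integral_cong refl) simp
    also have "\<dots> = (\<integral>x. - ln (Q k (word shift u k x)) \<partial>\<mu>) - (\<integral>x. - ln (Q q (word shift u q x)) \<partial>\<mu>)"
      using label_integrable[OF labels_mu[OF L[of k]], of "\<lambda>w. - ln (Q k w)"]
        label_integrable[OF labels_mu[OF L[of q]], of "\<lambda>w. - ln (Q q w)"]
      by (rule Bochner_Integration.integral_diff)
    also have "(\<integral>x. - ln (Q k (word shift u k x)) \<partial>\<mu>) = (\<Sum>v\<in>range (word shift u k). P k v * - ln (Q k v))"
      unfolding P_def by (rule label_integral_eq[OF labels_mu[OF L], of "\<lambda>w. - ln (Q k w)"])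
    also have "\<dots> \<le> (\<Sum>v\<in>range (word shift u k). - (P k v * ln (P k v)) + P k v * (\<delta> / 4))"
    proof (rule sum_mono)
      fix v
      show "P k v * - ln (Q k v) \<le> - (P k v * ln (P k v)) + P k v * (\<delta> / 4)"
      proof (cases "P k v = 0")
        case False
        then have pos: "P k v > 0" using P01(1)[of k v] by linarith
        have "(1 - \<theta>) * P k v \<le> Q k v" unfolding Q_def using \<theta> \<alpha> by simp
        then have "ln ((1 - \<theta>) * P k v) \<le> ln (Q k v)" using \<theta> pos by (intro ln_mono) auto
        then have "- ln (Q k v) \<le> - ln (P k v) + \<delta> / 4"
          using ln\<theta> \<theta> pos by (simp add: ln_mult_pos)
        then have "P k v * - ln (Q k v) \<le> P k v * (- ln (P k v) + \<delta> / 4)" using pos by (intro mult_left_mono) auto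
        then show ?thesis by (simp add: algebra_simps)
      qed simp
    qed
    also have "\<dots> = ent \<mu> (word shift u k) + \<delta> / 4"
      using sum_fibres[OF labels_mu[OF L[of k]]]
      by (simp only: sum.distrib sum_distrib_right[symmetric] ent_def P_def mult_1_left)
    finally have "(\<Sum>v\<in>AW k. P k v * G v) \<le> ent \<mu> (word shift u k) + \<delta> / 4 - (\<integral>x. - ln (Q q (word shift u q x)) \<partial>\<mu>)"
      by simp
    moreover have "(\<integral>x. - ln (Q q (word shift u q x)) \<partial>\<mu>) \<ge> ent \<mu> (word shift u q)"
    proof (rule gibbs[OF labels_mu[OF L]])
      have "(\<Sum>v\<in>range (word shift u q). Q q v) \<le> (\<Sum>v\<in>AW q. Q q v)"
        by (rule sum_mono2[OF AW(1) rng]) (rule less_imp_le[OF Qpos])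
      then show "(\<Sum>v\<in>range (word shift u q). Q q v) \<le> 1" by (simp only: sumQ)
    qed (auto intro: Qpos less_imp_le)
    ultimately have "(\<Sum>v\<in>AW k. P k v * G v) \<le> ent \<mu> (word shift u k) + \<delta> / 4 - ent \<mu> (word shift u q)" by linarith
    then show ?thesis using q unfolding k_def by linarith
  qed
  define \<kappa> where "\<kappa> w b = (if length w < q then 1 / \<alpha>
      else Q k (drop (length w - q) w @ [b]) / Q q (drop (length w - q) w))" for w b
  have \<kappa>0: "0 \<le> \<kappa> w b" for w b unfolding \<kappa>_def using \<alpha> Qpos by (auto intro!: divide_nonneg_nonneg less_imp_le)
  have \<kappa>1: "(\<Sum>b\<in>A. \<kappa> w b) \<le> 1" if "set w \<subseteq> A" for w
  proof (cases "length w < q")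
    case True
    then show ?thesis using \<alpha> by (simp add: \<kappa>_def \<alpha>_def)
  next
    case False
    define v where "v = drop (length w - q) w"
    have lv: "length v = q" using False by (simp add: v_def)
    have "(\<Sum>b\<in>A. Q k (v @ [b])) = (1 - \<theta>) * (\<Sum>b\<in>A. P k (v @ [b])) + \<theta> / \<alpha> ^ q"
      using \<alpha> by (simp add: Q_def sum.distrib sum_distrib_left k_def \<alpha>_def)
    also have "\<dots> \<le> Q q v"
      unfolding Q_def using \<theta> Psum[OF lv] by (intro add_mono mult_left_mono) auto
    finally have "(\<Sum>b\<in>A. Q k (v @ [b])) / Q q v \<le> 1" using Qpos[of q v] by (simp add: divide_le_eq)
    then show ?thesis using False by (simp add: \<kappa>_def v_def sum_divide_distrib)
  qed
  define W where "W w = (\<Prod>t<length w. \<kappa> (take t w) (w ! t))" for w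
  have kr: "(\<Sum>w\<in>AW n. W w) \<le> 1" for n
    unfolding W_def AW_def by (rule kraft[OF A(1) \<kappa>0 \<kappa>1])
  have lnW: "W w > 0 \<and> - ln (W w) = real q * ln \<alpha> + (\<Sum>s<n - q. G (take k (drop s w)))"
    if w: "length w = n" and n: "n \<ge> k" for w n
  proof -
    have split: "(\<Prod>t<q + m. f t) = (\<Prod>t<q. f t) * (\<Prod>s<m. f (q + s))" for m and f :: "nat \<Rightarrow> real"
      by (induction m) auto
    have nq: "n = q + (n - q)" using n by (simp add: k_def)
    have "W w = (\<Prod>t<q + (n - q). \<kappa> (take t w) (w ! t))" unfolding W_def w using nq by simp
    also have "\<dots> = (\<Prod>t<q. \<kappa> (take t w) (w ! t)) * (\<Prod>s<n - q. \<kappa> (take (q + s) w) (w ! (q + s)))" by (rule split)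
    also have "(\<Prod>t<q. \<kappa> (take t w) (w ! t)) = (1 / \<alpha>) ^ q"
    proof -
      have "(\<Prod>t<q. \<kappa> (take t w) (w ! t)) = (\<Prod>t<q. 1 / \<alpha>)"
        using w n by (intro prod.cong) (auto simp: \<kappa>_def k_def)
      then show ?thesis by simp
    qed
    also have "(\<Prod>s<n - q. \<kappa> (take (q + s) w) (w ! (q + s))) = (\<Prod>s<n - q. exp (- G (take k (drop s w))))"
    proof (intro prod.cong refl)
      fix s assume "s \<in> {..<n - q}"
      then have s: "q + s < n" by auto
      have len: "length (take (q + s) w) = q + s" using s w by simp
      have "drop (length (take (q + s) w) - q) (take (q + s) w) = take q (drop s w)"
        unfolding len by (simp add: drop_take)
      then have "\<kappa> (take (q + s) w) (w ! (q + s)) = Q k (take q (drop s w) @ [w ! (q + s)]) / Q q (take q (drop s w))"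
        unfolding \<kappa>_def using len by simp
      moreover have "take k (drop s w) = take q (drop s w) @ [w ! (q + s)]"
        using s w by (simp add: k_def take_Suc_conv_app_nth add.commute)
      moreover have "take q (take k (drop s w)) = take q (drop s w)" by (simp add: k_def min_def)
      ultimately have "\<kappa> (take (q + s) w) (w ! (q + s)) = Q k (take k (drop s w)) / Q q (take q (take k (drop s w)))"
        by simp
      also have "\<dots> = exp (- G (take k (drop s w)))"
        unfolding G_def using Qpos by (simp add: exp_diff)
      finally show "\<kappa> (take (q + s) w) (w ! (q + s)) = exp (- G (take k (drop s w)))" .
    qed
    also have "\<dots> = exp (- (\<Sum>s<n - q. G (take k (drop s w))))" by (simp add: exp_sum[symmetric] sum_negf)
    finally have W: "W w = (1 / \<alpha>) ^ q * exp (- (\<Sum>s<n - q. G (take k (drop s w))))" .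
    have "ln (W w) = ln ((1 / \<alpha>) ^ q) + - (\<Sum>s<n - q. G (take k (drop s w)))"
      unfolding W using \<alpha> by (subst ln_mult_pos) auto
    moreover have "ln ((1 / \<alpha>) ^ q) = - (real q * ln \<alpha>)" using \<alpha> by (simp add: ln_realpow ln_div)
    ultimately show ?thesis unfolding W using \<alpha> by simp
  qed
  \<comment> \<open>A deficit of \<open>\<eta>\<close> in each of the \<open>card (AW k)\<close>
    frequencies, at code lengths of at most \<open>B\<close>, adds up to at most
    \<open>\<delta> / 4\<close>. The summand 1 keeps the denominator positive.\<close>
  define \<eta> where "\<eta> = \<delta> / 4 / (B * real (card (AW k)) + 1)"
  have den: "B * real (card (AW k)) + 1 > 0" using B0 by (intro add_nonneg_pos) auto
  have \<eta>: "\<eta> > 0" using \<delta> den by (simp add: \<eta>_def)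
  have \<eta>B: "B * (real (card (AW k)) * \<eta>) \<le> \<delta> / 4"
  proof -
    have "B * (real (card (AW k)) * \<eta>) \<le> (B * real (card (AW k)) + 1) * \<eta>" using \<eta> by (simp add: algebra_simps)
    also have "\<dots> = \<delta> / 4" unfolding \<eta>_def using den by (intro nonzero_mult_div_cancel_left[of _ "\<delta> / 4", unfolded times_divide_eq_right[symmetric]]) linarith
    finally show ?thesis .
  qed
  \<comment> \<open>From here on the uniformly coded first \<open>q\<close> letters cost at most
    \<open>\<delta> / 4\<close> per letter of the word.\<close>
  obtain n1 :: nat where n1: "real q * ln \<alpha> / (\<delta> / 4) < real n1" using reals_Archimedean2 by blast
  define n0 where "n0 = max n1 k"
  define good where "good n = {w. set w \<subseteq> A \<and> length w = n \<and> (\<forall>v. set v \<subseteq> A \<and> length v = k \<longrightarrow>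
         real n * (P k v - \<eta>) \<le> real (card {s. s + k \<le> n \<and> take k (drop s w) = v}))}" for n
  have "real (card (good n)) \<le> exp (real n * (h + \<delta>))" if n: "n \<ge> n0" for n
  proof -
    have nk: "n \<ge> k" "n \<ge> n1" using n by (auto simp: n0_def)
    have Wge: "exp (- (real n * (h + \<delta>))) \<le> W w" if w: "w \<in> good n" for w
    proof -
      have wl: "length w = n" "set w \<subseteq> A" using w by (auto simp: good_def)
      define c where "c v = real (card {s \<in> {..<n - q}. take k (drop s w) = v})" for v
      have ceq: "{s. s + k \<le> n \<and> take k (drop s w) = v} = {s \<in> {..<n - q}. take k (drop s w) = v}" for v
        using nk by (auto simp: k_def)
      have cge: "real n * (P k v - \<eta>) \<le> c v" if "v \<in> AW k" for v
      proof -
        have "\<forall>v. set v \<subseteq> A \<and> length v = k \<longrightarrow>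
            real n * (P k v - \<eta>) \<le> real (card {s. s + k \<le> n \<and> take k (drop s w) = v})"
          using w unfolding good_def mem_Collect_eq by (elim conjE)
        from this[rule_format, of v] that show ?thesis unfolding c_def AW_def mem_Collect_eq ceq by fast
      qed
      have win: "(\<lambda>s. take k (drop s w)) ` {..<n - q} \<subseteq> AW k"
        using wl by (auto simp: AW_def k_def dest!: in_set_takeD in_set_dropD)
      have grp: "(\<Sum>s<n - q. f (take k (drop s w))) = (\<Sum>v\<in>AW k. c v * f v)" for f :: "_ \<Rightarrow> real"
      proof -
        have "(\<Sum>s<n - q. f (take k (drop s w)))
            = (\<Sum>v\<in>AW k. \<Sum>s\<in>{s \<in> {..<n - q}. take k (drop s w) = v}. f (take k (drop s w)))"
          by (rule sum.group[symmetric, OF _ AW(1) win]) simp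
        also have "\<dots> = (\<Sum>v\<in>AW k. c v * f v)"
        proof (rule sum.cong[OF refl])
          fix v
          have "(\<Sum>s\<in>{s \<in> {..<n - q}. take k (drop s w) = v}. f (take k (drop s w)))
             = (\<Sum>s\<in>{s \<in> {..<n - q}. take k (drop s w) = v}. f v)" by (rule sum.cong) auto
          then show "(\<Sum>s\<in>{s \<in> {..<n - q}. take k (drop s w) = v}. f (take k (drop s w))) = c v * f v"
            by (simp add: c_def)
        qed
        finally show ?thesis .
      qed
      have csum: "(\<Sum>v\<in>AW k. c v) \<le> real n" using grp[of "\<lambda>_. 1"] by simp
      \<comment> \<open>The frequencies are bounded from below only. As they add up to at most 1 and
        the lower bounds \<open>l\<close> nearly to 1, the total excess is small, and it costs at
        most \<open>B\<close> per unit.\<close>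
      define l where "l v = max 0 (P k v - \<eta>)" for v
      have cl: "real n * l v \<le> c v" if "v \<in> AW k" for v
        using cge[OF that] by (auto simp: l_def max_def c_def)
      have lP: "l v \<le> P k v" for v using \<eta> P01(1)[of k v] by (auto simp: l_def)
      have lsum: "1 - real (card (AW k)) * \<eta> \<le> (\<Sum>v\<in>AW k. l v)"
      proof -
        have "(\<Sum>v\<in>AW k. P k v - \<eta>) \<le> (\<Sum>v\<in>AW k. l v)" by (rule sum_mono) (simp add: l_def)
        then show ?thesis by (simp add: sum_subtractf sumP)
      qed
      have "(\<Sum>v\<in>AW k. c v * G v) = (\<Sum>v\<in>AW k. (c v - real n * l v) * G v) + real n * (\<Sum>v\<in>AW k. l v * G v)"
        by (simp add: sum_distrib_left sum.distrib[symmetric] algebra_simps)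
      also have "(\<Sum>v\<in>AW k. (c v - real n * l v) * G v) \<le> (\<Sum>v\<in>AW k. (c v - real n * l v) * B)"
        by (intro sum_mono mult_left_mono GB) (use cl in auto)
      also have "\<dots> = ((\<Sum>v\<in>AW k. c v) - real n * (\<Sum>v\<in>AW k. l v)) * B"
        by (simp add: sum_distrib_right[symmetric] sum_subtractf sum_distrib_left)
      also have "\<dots> \<le> (real n - real n * (1 - real (card (AW k)) * \<eta>)) * B"
        using csum lsum B0 by (intro mult_right_mono diff_mono mult_left_mono) auto
      also have "\<dots> = real n * (B * (real (card (AW k)) * \<eta>))" by (simp add: algebra_simps)
      also have "\<dots> \<le> real n * (\<delta> / 4)" using \<eta>B by (intro mult_left_mono) auto
      also have "(\<Sum>v\<in>AW k. l v * G v) \<le> (\<Sum>v\<in>AW k. P k v * G v)"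
        by (intro sum_mono mult_right_mono lP G0)
      also have "\<dots> \<le> h + \<delta> / 2" by (rule sumG)
      finally have GS: "(\<Sum>v\<in>AW k. c v * G v) \<le> real n * (\<delta> / 4) + real n * (h + \<delta> / 2)"
        by (simp add: mult_left_mono)
      have "real q * ln \<alpha> \<le> real n * (\<delta> / 4)"
      proof -
        have "real q * ln \<alpha> / (\<delta> / 4) \<le> real n" using n1 nk(2) by simp
        then show ?thesis using \<delta> by (simp add: field_simps)
      qed
      moreover have "W w > 0" "- ln (W w) = real q * ln \<alpha> + (\<Sum>v\<in>AW k. c v * G v)"
        using lnW[OF wl(1) nk(1)] grp[of G] by auto
      ultimately have "- ln (W w) \<le> real n * (h + \<delta>)" using GS by (simp add: algebra_simps)
      then have "- (real n * (h + \<delta>)) \<le> ln (W w)" by linarith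
      then show ?thesis using \<open>W w > 0\<close> by (metis exp_le_cancel_iff exp_ln)
    qed
    have gsub: "good n \<subseteq> AW n" by (auto simp: good_def AW_def)
    have "real (card (good n)) * exp (- (real n * (h + \<delta>))) = (\<Sum>w\<in>good n. exp (- (real n * (h + \<delta>))))" by simp
    also have "\<dots> \<le> (\<Sum>w\<in>good n. W w)" by (rule sum_mono) (rule Wge)
    also have "\<dots> \<le> (\<Sum>w\<in>AW n. W w)"
      by (rule sum_mono2[OF AW(1) gsub]) (auto simp: W_def intro!: prod_nonneg \<kappa>0)
    also have "\<dots> \<le> 1" by (rule kr)
    finally show ?thesis by (simp only: exp_minus divide_inverse[symmetric] pos_divide_le_eq[OF exp_gt_zero] mult_1_left)
  qed
  then show ?thesis
    by (intro exI[of _ k] exI[of _ \<eta>] exI[of _ n0] conjI allI impI \<eta>) (auto simp: good_def P_def h_def k_def)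
qed

end

section \<open>Continuous substitutes for the cells of a partition\<close>

lemma infsum_ennreal_le:
  fixes f :: "'a \<Rightarrow> ennreal"
  assumes "\<And>J. finite J \<Longrightarrow> J \<subseteq> A \<Longrightarrow> sum f J \<le> b"
  shows "infsum f A \<le> b"
  by (subst nonneg_infsum_complete) (auto intro!: SUP_least assms)

lemma uniform_positive:
  fixes Q :: "'a \<Rightarrow> real \<Rightarrow> bool"
  assumes fin: "finite S" and ex: "\<forall>s\<in>S. \<exists>d>0. Q s d" and mono: "\<And>s d d'. Q s d \<Longrightarrow> d' \<le> d \<Longrightarrow> Q s d'"
  shows "\<exists>d>0. \<forall>s\<in>S. Q s d"
proof -
  from bchoice[OF ex] obtain f where f: "\<forall>s\<in>S. f s > 0 \<and> Q s (f s)" by (elim exE)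
  show ?thesis
  proof (intro exI[of _ "Min (insert 1 (f ` S))"] conjI ballI)
    show "Min (insert 1 (f ` S)) > 0" using fin f by (subst Min_gr_iff) auto
    fix s assume s: "s \<in> S"
    have "Min (insert 1 (f ` S)) \<le> f s" using fin s by (intro Min_le) auto
    then show "Q s (Min (insert 1 (f ` S)))" using mono f s by blast
  qed
qed

lemma infdist_less_point:
  assumes "infdist x A < d" "A \<noteq> {}"
  shows "\<exists>y\<in>A. dist x y < d"
proof (rule ccontr)
  assume "\<not> ?thesis"
  then have "d \<le> infdist x A"
    unfolding infdist_notempty[OF assms(2)] by (intro cINF_greatest assms(2)) (auto simp: not_less)
  then show False using assms(1) by simp
qed

text \<open>In a compact space the smallest distance between finitely many disjoint closed sets is
  positive; by the triangle inequality half of it will do.\<close>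

lemma disjoint_closed_gap:
  fixes F :: "'i \<Rightarrow> 'a::metric_space set"
  assumes K: "compact (UNIV :: 'a set)" and I: "finite I"
    and F: "\<And>i. i \<in> I \<Longrightarrow> closed (F i)" "\<And>i. i \<in> I \<Longrightarrow> F i \<noteq> {}"
      "\<And>i j. i \<in> I \<Longrightarrow> j \<in> I \<Longrightarrow> i \<noteq> j \<Longrightarrow> F i \<inter> F j = {}"
  shows "\<exists>\<rho>>0. \<forall>i\<in>I. \<forall>j\<in>I. \<forall>x. infdist x (F i) < \<rho> \<and> infdist x (F j) < \<rho> \<longrightarrow> i = j"
proof -
  have "\<exists>d>0. \<forall>p\<in>I \<times> I. fst p \<noteq> snd p \<longrightarrow> (\<forall>x\<in>F (fst p). d \<le> infdist x (F (snd p)))"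
  proof (rule uniform_positive)
    show "\<forall>p\<in>I \<times> I. \<exists>d>0. fst p \<noteq> snd p \<longrightarrow> (\<forall>x\<in>F (fst p). d \<le> infdist x (F (snd p)))"
    proof
      fix p assume "p \<in> I \<times> I"
      then obtain i j where p: "p = (i, j)" and ij: "i \<in> I" "j \<in> I" by auto
      show "\<exists>d>0. fst p \<noteq> snd p \<longrightarrow> (\<forall>x\<in>F (fst p). d \<le> infdist x (F (snd p)))"
      proof (cases "i = j")
        case True
        then show ?thesis using p by (intro exI[of _ 1]) simp
      next
        case False
        have "compact (F i)"
          using closed_Int_compact[OF F(1)[OF ij(1)] K] by simp
        then obtain x where x: "x \<in> F i" "\<forall>y\<in>F i. infdist x (F j) \<le> infdist y (F j)"
          using continuous_attains_inf[OF \<open>compact (F i)\<close> F(2)[OF ij(1)] continuous_on_infdist[OF continuous_on_id, of _ "F j"]]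
          by blast
        have "x \<notin> F j" using F(3)[OF ij False] x(1) by blast
        then have "infdist x (F j) > 0"
          using F(1,2)[OF ij(2)] by (auto simp: in_closed_iff_infdist_zero infdist_nonneg order.strict_iff_order)
        then show ?thesis using x p by (intro exI[of _ "infdist x (F j)"]) auto
      qed
    qed
  qed (use I in \<open>auto intro: order_trans\<close>)
  then obtain d where d: "d > 0"
    "\<forall>p\<in>I \<times> I. fst p \<noteq> snd p \<longrightarrow> (\<forall>x\<in>F (fst p). d \<le> infdist x (F (snd p)))" by (elim exE conjE)
  have "i = j" if ij: "i \<in> I" "j \<in> I" and x: "infdist x (F i) < d / 2" "infdist x (F j) < d / 2" for i j x
  proof (rule ccontr)
    assume "i \<noteq> j"
    obtain y where y: "y \<in> F i" "dist x y < d / 2"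
      using infdist_less_point[OF x(1) F(2)[OF ij(1)]] by blast
    have "d \<le> infdist y (F j)" using d(2)[rule_format, of "(i, j)"] ij \<open>i \<noteq> j\<close> y by simp
    also have "\<dots> \<le> infdist x (F j) + dist y x" by (rule infdist_triangle)
    finally show False using x y by (simp add: dist_commute)
  qed
  then show ?thesis using d(1) by (intro exI[of _ "d / 2"]) auto
qed

context invariant_measure
begin

text \<open>
  The cells of a fine partition need not be \<open>\<mu>\<close>-continuity sets. They are replaced by neighbourhoods of
  closed subsets of almost full measure: visits to these are bounded below along generic orbits.
\<close>

lemma generic_code:
  assumes u: "labels u" and D: "\<forall>x y. u x = u y \<longrightarrow> shift_dist x y \<le> D" "D < \<epsilon>"
    and k: "k \<ge> 1" and \<eta>: "\<eta> > 0"
  shows "\<exists>c. range c \<subseteq> range u \<and> (\<forall>x y. c x = c y \<longrightarrow> shift_dist x y < \<epsilon>) \<and>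
    (\<forall>x\<in>generic_points shift \<mu>. \<exists>n0. \<forall>n\<ge>n0. \<forall>v. set v \<subseteq> range u \<and> length v = k \<longrightarrow>
       real n * (measure \<mu> (word shift u k -` {v}) - \<eta>)
         \<le> real (card {s. s + k \<le> n \<and> take k (drop s (word shift c n x)) = v}))"
proof -
  have "\<exists>F. closed F \<and> F \<noteq> {} \<and> F \<subseteq> u -` {i} \<and> measure \<mu> (u -` {i} - F) < \<eta> / (4 * real k)"
    if i: "i \<in> range u" for i
  proof -
    \<comment> \<open>A point of the cell is added to the closed set because \<open>infdist\<close>
      to the empty set is 0, so every point would count as close to it.\<close>
    from i obtain p where p: "u p = i" by auto
    have e: "\<eta> / (4 * real k) > 0" using \<eta> k by simp
    from closed_open_approx[OF finite_measure_axioms sets_mu labels_sets[OF u, of "{i}"] e]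
    obtain C U where C: "closed C" "open U" "C \<subseteq> u -` {i}" "u -` {i} \<subseteq> U"
      "measure \<mu> (U - C) < \<eta> / (4 * real k)" by (elim exE conjE)
    have "measure \<mu> (u -` {i} - insert p C) \<le> measure \<mu> (U - C)"
      using C by (intro finite_measure_mono) auto
    then show ?thesis using C p by (intro exI[of _ "insert p C"]) auto
  qed
  then have "\<forall>i\<in>range u. \<exists>F. closed F \<and> F \<noteq> {} \<and> F \<subseteq> u -` {i} \<and> measure \<mu> (u -` {i} - F) < \<eta> / (4 * real k)"
    by (rule ballI)
  from bchoice[OF this] obtain F where F: "\<forall>i\<in>range u. closed (F i) \<and> F i \<noteq> {} \<and> F i \<subseteq> u -` {i}
      \<and> measure \<mu> (u -` {i} - F i) < \<eta> / (4 * real k)" by (elim exE)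
  have "\<exists>\<rho>>0. \<forall>i\<in>range u. \<forall>j\<in>range u. \<forall>x. infdist x (F i) < \<rho> \<and> infdist x (F j) < \<rho> \<longrightarrow> i = j"
  proof (rule disjoint_closed_gap)
    show "compact (UNIV :: (int \<Rightarrow> 'k) set)" by (rule compact_fun_UNIV[OF K_compact])
    fix i j assume "i \<in> range u" "j \<in> range u" "i \<noteq> j"
    then have "F i \<subseteq> u -` {i}" "F j \<subseteq> u -` {j}" using F by auto
    then show "F i \<inter> F j = {}" using \<open>i \<noteq> j\<close> by auto
  qed (use u F in auto)
  then obtain \<rho>1 where \<rho>1: "\<rho>1 > 0"
    "\<forall>i\<in>range u. \<forall>j\<in>range u. \<forall>x. infdist x (F i) < \<rho>1 \<and> infdist x (F j) < \<rho>1 \<longrightarrow> i = j" by (elim exE conjE)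
  \<comment> \<open>Moving each of two points by less than \<open>e1\<close> into a cell of
    \<open>u\<close> gives a distance below \<open>D + 2 * e1\<close>, which is less than
    \<open>\<epsilon>\<close>.\<close>
  define e1 where "e1 = (\<epsilon> - D) / 3"
  have e1: "e1 > 0" using D(2) by (simp add: e1_def)
  from shift_dist_uniform[OF K_compact e1] obtain \<rho>2
    where \<rho>2: "\<rho>2 > 0" "\<forall>x y :: int \<Rightarrow> 'k. dist x y < \<rho>2 \<longrightarrow> shift_dist x y < e1" by (elim exE conjE)
  define \<rho> where "\<rho> = min \<rho>1 \<rho>2"
  have \<rho>: "\<rho> > 0" using \<rho>1 \<rho>2 by (simp add: \<rho>_def)
  have uniq: "i = j" if "i \<in> range u" "j \<in> range u" "infdist x (F i) < \<rho>" "infdist x (F j) < \<rho>" for i j x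
    using \<rho>1(2)[rule_format, OF that(1,2), of x] that(3,4) by (simp add: \<rho>_def)
  \<comment> \<open>Near a closed core \<open>F i\<close> the label is \<open>i\<close>; elsewhere
    the old label \<open>u x\<close> keeps the mesh small.\<close>
  define c where "c x = (if \<exists>i\<in>range u. infdist x (F i) < \<rho> then SOME i. i \<in> range u \<and> infdist x (F i) < \<rho> else u x)" for x
  have c1: "c x = i" if "i \<in> range u" "infdist x (F i) < \<rho>" for x i
  proof -
    have "(SOME i. i \<in> range u \<and> infdist x (F i) < \<rho>) = i"
      by (rule some_equality) (use that uniq in auto)
    then show ?thesis using that by (auto simp: c_def)
  qed
  have near: "\<exists>x'. u x' = c x \<and> shift_dist x x' < e1" for x
  proof (cases "\<exists>i\<in>range u. infdist x (F i) < \<rho>")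
    case True
    then obtain i where i: "i \<in> range u" "infdist x (F i) < \<rho>" by blast
    have Fi: "F i \<noteq> {}" "F i \<subseteq> u -` {i}" using F i(1) by auto
    obtain y where y: "y \<in> F i" "dist x y < \<rho>"
      using infdist_less_point[OF i(2) Fi(1)] by blast
    have "shift_dist x y < e1" using \<rho>2(2)[rule_format, of x y] y(2) by (simp add: \<rho>_def)
    moreover have "u y = c x" using y(1) Fi(2) c1[OF i] by auto
    ultimately show ?thesis by blast
  next
    case False
    then show ?thesis using e1 by (intro exI[of _ x]) (simp add: c_def)
  qed
  show ?thesis
  proof (intro exI[of _ c] conjI allI impI ballI)
    show "range c \<subseteq> range u"
    proof
      fix i assume "i \<in> range c"
      then obtain x where "i = c x" by blast
      then show "i \<in> range u" using near[of x] by (metis rangeI)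
    qed
    fix x y assume cxy: "c x = c y"
    from near[of x] obtain x' where x': "u x' = c x" "shift_dist x x' < e1" by (elim exE conjE)
    from near[of y] obtain y' where y': "u y' = c y" "shift_dist y y' < e1" by (elim exE conjE)
    have "shift_dist x' y' \<le> D" using x' y' cxy by (intro D(1)[rule_format]) simp
    moreover have "shift_dist x y \<le> shift_dist x x' + (shift_dist x' y' + shift_dist y' y)"
      using shift_dist_triangle[OF K_compact, of x y x'] shift_dist_triangle[OF K_compact, of x' y y'] by linarith
    moreover have "shift_dist y' y = shift_dist y y'" by (rule shift_dist_commute)
    ultimately show "shift_dist x y < \<epsilon>" using x' y' D(2) by (simp add: e1_def field_simps)
  next
    fix x assume x: "x \<in> generic_points shift \<mu>"
    let ?AK = "{v. set v \<subseteq> range u \<and> length v = k}"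
    have fin: "finite ?AK" using u by (intro finite_lists_length_eq) auto
    have "\<forall>\<^sub>F n in sequentially. real n * (measure \<mu> (word shift u k -` {v}) - \<eta>)
        \<le> real (card {s. s + k \<le> n \<and> take k (drop s (word shift c n x)) = v})" if v: "v \<in> ?AK" for v
    proof -
      have vr: "v ! t \<in> range u" if "t < k" for t using v that by auto
      \<comment> \<open>Continuous, equal to 1 when the successive points lie in the cores
        \<open>F\<close> prescribed by \<open>v\<close>, and nonzero only where \<open>c\<close>
        reads \<open>v\<close>. Its averages therefore bound the visits from below.\<close>
      define \<Psi> where "\<Psi> y = (\<Prod>t<k. max 0 (1 - infdist (sh (int t) y) (F (v ! t)) / \<rho>))" for y
      have fac: "0 \<le> max 0 (1 - infdist (sh (int t) y) (F (v ! t)) / \<rho>)"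
        "max 0 (1 - infdist (sh (int t) y) (F (v ! t)) / \<rho>) \<le> 1" for t y
        using \<rho> by (auto simp: infdist_nonneg)
      have \<Psi>01: "0 \<le> \<Psi> y" "\<Psi> y \<le> 1" for y
        unfolding \<Psi>_def using fac by (auto intro!: prod_nonneg prod_le_1)
      have \<Psi>c: "continuous_on UNIV \<Psi>"
        unfolding \<Psi>_def
        by (intro continuous_on_prod continuous_on_max continuous_on_const continuous_on_diff
            continuous_on_divide continuous_on_infdist continuous_sh) (use \<rho> in auto)
      have \<Psi>pos: "c (sh (int t) y) = v ! t" if "\<Psi> y \<noteq> 0" "t < k" for y t
      proof -
        have "max 0 (1 - infdist (sh (int t) y) (F (v ! t)) / \<rho>) \<noteq> 0"
          using that unfolding \<Psi>_def by (auto simp: prod_zero_iff)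
        then have "infdist (sh (int t) y) (F (v ! t)) < \<rho>" using \<rho> by (auto simp: max_def field_simps split: if_splits)
        then show ?thesis by (rule c1[OF vr[OF that(2)]])
      qed
      define p where "p = measure \<mu> (word shift u k -` {v})"
      \<comment> \<open>Passing from cells to cores loses \<open>\<eta> / (4 * k)\<close> for each
        of the \<open>k\<close> letters.\<close>
      have int: "p - \<eta> / 4 \<le> (\<integral>y. \<Psi> y \<partial>\<mu>)"
      proof -
        define S where "S = (\<Inter>t\<in>{..<k}. sh (int t) -` F (v ! t))"
        define N where "N t = sh (int t) -` (u -` {v ! t} - F (v ! t))" for t
        have Fb: "F (v ! t) \<in> sets borel" if "t < k" for t using F vr[OF that] by auto
        have Sb: "S \<in> sets \<mu>" unfolding S_def sets_mu
          using k by (intro sets.finite_INT measurable_sets_borel[OF measurable_sh] Fb) (auto simp: lessThan_empty_iff)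
        have Nb: "N t \<in> sets \<mu>" if "t < k" for t unfolding N_def sets_mu
          by (intro measurable_sets_borel[OF measurable_sh] sets.Diff labels_sets[OF u] Fb that)
        have Nm: "measure \<mu> (N t) \<le> \<eta> / (4 * real k)" if "t < k" for t
        proof -
          have "measure \<mu> (N t) = measure \<mu> (u -` {v ! t} - F (v ! t))"
            unfolding N_def by (intro measure_sh sets.Diff labels_sets[OF u] Fb that)
          then show ?thesis using F vr[OF that] by (auto intro: less_imp_le)
        qed
        have UN: "(\<Union>t<k. N t) \<in> sets \<mu>" using Nb by (intro sets.finite_UN) auto
        have sub: "word shift u k -` {v} \<subseteq> S \<union> (\<Union>t<k. N t)"
        proof
          fix y assume "y \<in> word shift u k -` {v}"
          then have "u (sh (int t) y) = v ! t" if "t < k" for t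
            using that nth_word[of t k shift u y] by (simp add: funpow_shift)
          then show "y \<in> S \<union> (\<Union>t<k. N t)" unfolding S_def N_def by auto
        qed
        have "p \<le> measure \<mu> (S \<union> (\<Union>t<k. N t))"
          unfolding p_def using Sb UN by (intro finite_measure_mono sub) auto
        also have "\<dots> \<le> measure \<mu> S + measure \<mu> (\<Union>t<k. N t)" using Sb UN by (rule measure_Un_le)
        also have "measure \<mu> (\<Union>t<k. N t) \<le> (\<Sum>t<k. measure \<mu> (N t))"
          using Nb by (intro finite_measure_subadditive_finite) auto
        also have "\<dots> \<le> (\<Sum>t<k. \<eta> / (4 * real k))" by (intro sum_mono Nm) simp
        also have "\<dots> = \<eta> / 4" using k by simp
        also have "measure \<mu> S = (\<integral>y. indicator S y \<partial>\<mu>)" using Sb by (simp add: Int_absorb2 space_mu)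
        also have "\<dots> \<le> (\<integral>y. \<Psi> y \<partial>\<mu>)"
        proof (rule integral_mono)
          show "integrable \<mu> (\<lambda>y. indicator S y :: real)" using Sb by (simp add: emeasure_eq_measure)
          show "integrable \<mu> \<Psi>"
            by (rule integrable_const_bound[of _ 1])
              (use \<Psi>01 borel_measurable_continuous_onI[OF \<Psi>c] in \<open>auto simp: measurable_cong_sets[OF sets_mu refl]\<close>)
          fix y
          show "indicator S y \<le> \<Psi> y"
          proof (cases "y \<in> S")
            case True
            then have "\<Psi> y = 1" unfolding \<Psi>_def S_def by (intro prod.neutral) auto
            then show ?thesis by (simp add: indicator_def)
          qed (simp add: \<Psi>01)
        qed
        finally show ?thesis by linarith
      qed
      have "\<forall>\<^sub>F n in sequentially. (\<integral>y. \<Psi> y \<partial>\<mu>) - \<eta> / 4 < avg \<Psi> n x"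
        using order_tendstoD(1)[OF generic_avg[OF x \<Psi>c], of "(\<integral>y. \<Psi> y \<partial>\<mu>) - \<eta> / 4"] \<eta> by simp
      moreover obtain n1 :: nat where n1: "real k / (\<eta> / 2) < real n1" using reals_Archimedean2 by blast
      ultimately have "\<forall>\<^sub>F n in sequentially. (\<integral>y. \<Psi> y \<partial>\<mu>) - \<eta> / 4 < avg \<Psi> n x \<and> n \<ge> max 1 n1"
        using eventually_ge_at_top[of "max 1 n1"] by (intro eventually_conj)
      then show ?thesis
      proof eventually_elim
        case (elim n)
        define T where "T = {s. s + k \<le> n \<and> take k (drop s (word shift c n x)) = v}"
        have Tf: "finite T" by (rule finite_subset[of _ "{..n}"]) (auto simp: T_def)
        \<comment> \<open>The last \<open>k\<close> starting times, which include all those without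
          a full window, are counted in full; for large \<open>n\<close> they amount to at most
          \<open>n * \<eta> / 2\<close>. The cores and the convergence of averages account for
          \<open>\<eta> / 4\<close> each.\<close>
        have "(\<Sum>i<n. \<Psi> (sh (int i) x)) \<le> (\<Sum>i<n. indicator (T \<union> {n - k..<n}) i)"
        proof (rule sum_mono)
          fix i assume i: "i \<in> {..<n}"
          show "\<Psi> (sh (int i) x) \<le> indicator (T \<union> {n - k..<n}) i"
          proof (cases "\<Psi> (sh (int i) x) = 0 \<or> i + k > n")
            case True
            then show ?thesis using i \<Psi>01(2)[of "sh (int i) x"] by (auto simp: indicator_def)
          next
            case False
            have "take k (drop i (word shift c n x)) = v"
            proof (rule nth_equalityI)
              show "length (take k (drop i (word shift c n x))) = length v" using False v by auto
              fix t assume "t < length (take k (drop i (word shift c n x)))"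
              then have t: "t < k" by simp
              then have "take k (drop i (word shift c n x)) ! t = c (sh (int t) (sh (int i) x))"
                using False by (simp add: funpow_shift sh_sh add.commute)
              then show "take k (drop i (word shift c n x)) ! t = v ! t" using \<Psi>pos[of "sh (int i) x" t] False t by simp
            qed
            then have "i \<in> T" using False by (simp add: T_def)
            then show ?thesis using \<Psi>01(2) by simp
          qed
        qed
        also have "\<dots> = real (card ({..<n} \<inter> (T \<union> {n - k..<n})))"
          unfolding real_of_card by (subst sum.inter_restrict) (auto simp: indicator_def intro!: sum.cong)
        also have "\<dots> \<le> real (card (T \<union> {n - k..<n}))" using Tf by (intro of_nat_mono card_mono) auto
        also have "\<dots> \<le> real (card T) + real k"
        proof -
          have "card (T \<union> {n - k..<n}) \<le> card T + card {n - k..<n}" by (rule card_Un_le)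
          then show ?thesis by simp
        qed
        finally have up: "(\<Sum>i<n. \<Psi> (sh (int i) x)) \<le> real (card T) + real k" .
        have npos: "real n > 0" using elim by simp
        have "real n * (p - \<eta> / 2) \<le> real n * avg \<Psi> n x" using elim int npos by (intro mult_left_mono) linarith+
        also have "\<dots> = (\<Sum>i<n. \<Psi> (sh (int i) x))" using npos by (simp add: avg_def)
        finally have lo: "real n * (p - \<eta> / 2) \<le> real (card T) + real k" using up by linarith
        have "real k / (\<eta> / 2) \<le> real n" using n1 elim by simp
        then have "real k \<le> real n * (\<eta> / 2)" using \<eta> by (simp add: field_simps)
        then show ?case using lo unfolding T_def[symmetric] p_def[symmetric] by (simp add: algebra_simps)
      qed
    qed
    then have "\<forall>\<^sub>F n in sequentially. \<forall>v\<in>?AK. real n * (measure \<mu> (word shift u k -` {v}) - \<eta>)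
        \<le> real (card {s. s + k \<le> n \<and> take k (drop s (word shift c n x)) = v})"
      by (intro eventually_ball_finite fin ballI)
    then show "\<exists>n0. \<forall>n\<ge>n0. \<forall>v. set v \<subseteq> range u \<and> length v = k \<longrightarrow>
       real n * (measure \<mu> (word shift u k -` {v}) - \<eta>)
         \<le> real (card {s. s + k \<le> n \<and> take k (drop s (word shift c n x)) = v})"
      unfolding eventually_sequentially by simp
  qed
qed

end

context invariant_measure
begin

text \<open>Joins the lower bounds on window frequencies along generic orbits with the count of
  words that satisfy them. The time from which the words of a generic point belong to
  \<open>W\<close> depends on the point.\<close>

lemma generic_words:
  fixes u :: "(int \<Rightarrow> 'k) \<Rightarrow> 'l"
  assumes u: "labels u" and D: "\<forall>x y. u x = u y \<longrightarrow> shift_dist x y \<le> D" "D < \<epsilon>" and \<delta>: "\<delta> > 0"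
  shows "\<exists>(c :: (int \<Rightarrow> 'k) \<Rightarrow> 'l) W n0. (\<forall>x y. c x = c y \<longrightarrow> shift_dist x y < \<epsilon>) \<and> (\<forall>n. finite (W n)) \<and>
    (\<forall>n\<ge>n0. real (card (W n)) \<le> exp (real n * (ks_entropy shift \<mu> (fib u) + \<delta>))) \<and>
    (\<forall>x\<in>generic_points shift \<mu>. \<exists>m. \<forall>n\<ge>m. word shift c n x \<in> W n)"
proof -
  have fin: "finite (range u)" using u by simp
  from word_count[OF u fin subset_refl \<delta>] obtain k \<eta> n0 where k: "k \<ge> 1" "\<eta> > 0" and
    cnt: "\<forall>n\<ge>n0. real (card {w. set w \<subseteq> range u \<and> length w = n \<and>
      (\<forall>v. set v \<subseteq> range u \<and> length v = k \<longrightarrow>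
         real n * (measure \<mu> (word shift u k -` {v}) - \<eta>) \<le> real (card {s. s + k \<le> n \<and> take k (drop s w) = v}))})
    \<le> exp (real n * (ks_entropy shift \<mu> (fib u) + \<delta>))" by (elim exE conjE)
  define W where "W n = {w. set w \<subseteq> range u \<and> length w = n \<and>
      (\<forall>v. set v \<subseteq> range u \<and> length v = k \<longrightarrow>
         real n * (measure \<mu> (word shift u k -` {v}) - \<eta>) \<le> real (card {s. s + k \<le> n \<and> take k (drop s w) = v}))}" for n
  from generic_code[OF u D k] obtain c where c: "range c \<subseteq> range u" "\<forall>x y. c x = c y \<longrightarrow> shift_dist x y < \<epsilon>"
    and gen: "\<forall>x\<in>generic_points shift \<mu>. \<exists>n0. \<forall>n\<ge>n0. \<forall>v. set v \<subseteq> range u \<and> length v = k \<longrightarrow>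
       real n * (measure \<mu> (word shift u k -` {v}) - \<eta>)
         \<le> real (card {s. s + k \<le> n \<and> take k (drop s (word shift c n x)) = v})" by (elim exE conjE)
  show ?thesis
  proof (rule exI[of _ c], rule exI[of _ W], rule exI[of _ n0], intro conjI allI impI ballI)
    show "shift_dist x y < \<epsilon>" if "c x = c y" for x y by (rule c(2)[rule_format, OF that])
    show "finite (W n)" for n
      by (rule finite_subset[OF _ finite_lists_length_eq[OF fin, of n]]) (auto simp: W_def)
    show "real (card (W n)) \<le> exp (real n * (ks_entropy shift \<mu> (fib u) + \<delta>))" if "n \<ge> n0" for n
      using cnt[rule_format, OF that] unfolding W_def .
    fix x assume "x \<in> generic_points shift \<mu>"
    from bspec[OF gen this] obtain m where m: "\<forall>n\<ge>m. \<forall>v. set v \<subseteq> range u \<and> length v = k \<longrightarrow>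
       real n * (measure \<mu> (word shift u k -` {v}) - \<eta>)
         \<le> real (card {s. s + k \<le> n \<and> take k (drop s (word shift c n x)) = v})" by (elim exE)
    show "\<exists>m. \<forall>n\<ge>m. word shift c n x \<in> W n"
    proof (intro exI[of _ m] allI impI)
      fix n assume "n \<ge> m"
      have "set (word shift c n x) \<subseteq> range u" using set_word[of shift c n x] c(1) by (rule subset_trans)
      then show "word shift c n x \<in> W n"
        unfolding W_def mem_Collect_eq using m[rule_format, OF \<open>n \<ge> m\<close>] by (intro conjI allI impI) auto
    qed
  qed
qed

end

section \<open>From word counts to packing and Bowen entropy\<close>

text \<open>At most \<open>exp (n * g)\<close> words of length \<open>n\<close>, each of weight
  \<open>exp (- s * n)\<close>, lead to a geometric series.\<close>

lemma word_family_sum: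
  fixes W :: "nat \<Rightarrow> 'w set"
  assumes W: "\<And>n. finite (W n)" "\<And>n. n \<ge> N \<Longrightarrow> real (card (W n)) \<le> exp (real n * g)"
    and s: "g < s" and J: "finite J" "\<And>n w. (n, w) \<in> J \<Longrightarrow> N \<le> n \<and> w \<in> W n"
  shows "(\<Sum>(n, w)\<in>J. exp (- s * real n)) \<le> exp (g - s) ^ N / (1 - exp (g - s))"
proof -
  define q where "q = exp (g - s)"
  have q: "0 < q" "q < 1" using s by (auto simp: q_def)
  define M where "M = Max (insert N (fst ` J))"
  have M: "fst p \<le> M" if "p \<in> J" for p unfolding M_def using J(1) that by (intro Max_ge) auto
  have sub: "J \<subseteq> Sigma {N..M} W" using J(2) M by fastforce
  have "(\<Sum>(n, w)\<in>J. exp (- s * real n)) \<le> (\<Sum>(n, w)\<in>Sigma {N..M} W. exp (- s * real n))"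
    by (rule sum_mono2[OF _ sub]) (use W(1) in auto)
  also have "\<dots> = (\<Sum>n=N..M. \<Sum>w\<in>W n. exp (- s * real n))"
    by (rule sum.Sigma[symmetric]) (use W(1) in auto)
  also have "\<dots> \<le> (\<Sum>n=N..M. q ^ n)"
  proof (rule sum_mono)
    fix n assume n: "n \<in> {N..M}"
    have "(\<Sum>w\<in>W n. exp (- s * real n)) = real (card (W n)) * exp (- s * real n)" by simp
    also have "\<dots> \<le> exp (real n * g) * exp (- s * real n)" using W(2)[of n] n by (intro mult_right_mono) auto
    also have "\<dots> = q ^ n" unfolding q_def by (simp add: exp_add[symmetric] exp_of_nat_mult[symmetric] algebra_simps)
    finally show "(\<Sum>w\<in>W n. exp (- s * real n)) \<le> q ^ n" .
  qed
  also have "\<dots> \<le> q ^ N / (1 - q)"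
  proof (cases "N \<le> M")
    case True
    then have "(\<Sum>n=N..M. q ^ n) = (q ^ N - q ^ Suc M) / (1 - q)" using q by (simp add: sum_gp)
    also have "\<dots> \<le> q ^ N / (1 - q)" using q by (intro divide_right_mono) auto
    finally show ?thesis .
  qed (use q in simp)
  finally show ?thesis unfolding q_def .
qed

lemma vanishing_tail:
  fixes g s :: real and b :: ennreal
  assumes g: "g < s" and le: "\<And>N. N \<ge> N0 \<Longrightarrow> b \<le> ennreal (exp (g - s) ^ N / (1 - exp (g - s)))"
  shows "b = 0"
proof -
  have "exp (g - s) < 1" using g by simp
  then have "(\<lambda>N. exp (g - s) ^ N) \<longlonglongrightarrow> 0" by (intro LIMSEQ_power_zero) simp
  from tendsto_ennrealI[OF tendsto_mult_left_zero[OF this, of "inverse (1 - exp (g - s))"]]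
  have lim: "(\<lambda>N. ennreal (exp (g - s) ^ N / (1 - exp (g - s)))) \<longlonglongrightarrow> 0"
    by (simp only: divide_inverse ennreal_0)
  have "b \<le> 0"
  proof (rule LIMSEQ_le_const[OF lim])
    show "\<exists>N. \<forall>n\<ge>N. b \<le> ennreal (exp (g - s) ^ n / (1 - exp (g - s)))"
      by (intro exI[of _ N0] allI impI le)
  qed
  then show ?thesis by simp
qed

context invariant_measure
begin

text \<open>Points with the same word of length \<open>n\<close> lie in one Bowen ball, so a
  disjoint family contains at most one ball for each length and word, and one ball for each length
  and good word suffices for covering. Both sums are tails of a convergent geometric series.\<close>

lemma entropies_le_fib:
  fixes u :: "(int \<Rightarrow> 'k) \<Rightarrow> 'l"
  assumes u: "labels u" and D: "\<forall>x y. u x = u y \<longrightarrow> shift_dist x y \<le> D" "D < \<epsilon>" and \<epsilon>: "\<epsilon> > 0"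
    and s: "ks_entropy shift \<mu> (fib u) < s"
  shows "packing_outer shift shift_dist (generic_points shift \<mu>) s \<epsilon> = 0"
    and "bowen_M shift shift_dist (generic_points shift \<mu>) s \<epsilon> = 0"
proof -
  define \<delta> where "\<delta> = (s - ks_entropy shift \<mu> (fib u)) / 2"
  have \<delta>: "\<delta> > 0" using s by (simp add: \<delta>_def)
  define g where "g = ks_entropy shift \<mu> (fib u) + \<delta>"
  have g: "g < s" using s by (simp add: g_def \<delta>_def field_simps)
  from generic_words[OF u D \<delta>, folded g_def] obtain c :: "(int \<Rightarrow> 'k) \<Rightarrow> 'l" and W n0
    where *: "\<forall>x y. c x = c y \<longrightarrow> shift_dist x y < \<epsilon>" "\<forall>n. finite (W n)" "\<forall>n\<ge>n0. real (card (W n)) \<le> exp (real n * g)"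
      "\<forall>x\<in>generic_points shift \<mu>. \<exists>m. \<forall>n\<ge>m. word shift c n x \<in> W n" by (elim exE conjE)
  note c = *(1)[rule_format] and W = *(2,3)[rule_format] and gen = *(4)[rule_format]
  have close: "bowen_dist shift shift_dist n x y < \<epsilon>" if "n \<ge> 1" "word shift c n x = word shift c n y" for n x y
    using that(2) unfolding bowen_dist_less_iff[OF that(1)] word_eq_iff by (blast intro: c)
  show "packing_outer shift shift_dist (generic_points shift \<mu>) s \<epsilon> = 0"
  proof -
    \<comment> \<open>Fixing the time from which words are good splits the generic points into
      countably many pieces, as the outer packing measure permits.\<close>
    define Y where "Y j = {x \<in> generic_points shift \<mu>. \<forall>n\<ge>j. word shift c n x \<in> W n}" for j :: nat
    have cover: "generic_points shift \<mu> \<subseteq> (\<Union>j. Y j)" using gen unfolding Y_def by blast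
    have "packing_P shift shift_dist (Y j) s \<epsilon> = 0" for j
    proof (rule vanishing_tail[OF g, of "max 1 (max n0 j)"])
      fix N assume N: "N \<ge> max 1 (max n0 j)"
      have "packing_P shift shift_dist (Y j) s \<epsilon> \<le> packing_P_at shift shift_dist (Y j) s N \<epsilon>"
        unfolding packing_P_eq by (rule INF_lower) simp
      also have "\<dots> \<le> ennreal (exp (g - s) ^ N / (1 - exp (g - s)))"
        unfolding packing_P_at_def
      proof (rule SUP_least)
        fix p assume "p \<in> bowen_packings shift shift_dist (Y j) N \<epsilon>"
        then obtain I x n where p: "p = (I, x, n)" and I: "\<forall>i\<in>I. x i \<in> Y j \<and> N \<le> n i"
          and disj: "disjoint_family_on (\<lambda>i. bowen_cball shift shift_dist (n i) (x i) \<epsilon>) I"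
          by (auto simp: bowen_packings_def)
        have "(\<Sum>\<^sub>\<infinity>i\<in>I. ennreal (exp (- s * real (n i)))) \<le> ennreal (exp (g - s) ^ N / (1 - exp (g - s)))"
        proof (rule infsum_ennreal_le)
          fix J assume J: "finite J" "J \<subseteq> I"
          \<comment> \<open>Two balls with the same length and word both contain the centre of the
            second, so disjointness makes this map injective.\<close>
          define \<beta> where "\<beta> i = (n i, word shift c (n i) (x i))" for i
          have inj: "inj_on \<beta> J"
          proof (rule inj_onI, rule ccontr)
            fix i i' assume i: "i \<in> J" "i' \<in> J" "\<beta> i = \<beta> i'" "i \<noteq> i'"
            have n: "n i = n i'" using i(3) by (simp add: \<beta>_def)
            have "i \<in> I" using i(1) J(2) by blast
            then have n1: "n i \<ge> 1" using I N by (meson le_trans max.cobounded1)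
            have "x i' \<in> bowen_cball shift shift_dist (n i) (x i) \<epsilon>"
            proof -
              have "word shift c (n i) (x i) = word shift c (n i) (x i')" using i(3) n by (simp add: \<beta>_def)
              from close[OF n1 this] show ?thesis by (simp add: bowen_cball_def)
            qed
            moreover have "x i' \<in> bowen_cball shift shift_dist (n i') (x i') \<epsilon>"
              using \<epsilon> n n1 by (simp add: bowen_cball_def bowen_dist_le_iff)
            ultimately show False using disj i J unfolding disjoint_family_on_def by blast
          qed
          have "(\<Sum>i\<in>J. exp (- s * real (n i))) = (\<Sum>(m, w)\<in>\<beta> ` J. exp (- s * real m))"
            by (subst sum.reindex[OF inj]) (simp add: \<beta>_def)
          also have "\<dots> \<le> exp (g - s) ^ N / (1 - exp (g - s))"
          proof (rule word_family_sum[OF W(1) _ g])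
            show "real (card (W m)) \<le> exp (real m * g)" if "m \<ge> N" for m using W(2) that N by simp
            show "finite (\<beta> ` J)" using J by simp
            fix m w assume "(m, w) \<in> \<beta> ` J"
            then obtain i where i: "i \<in> J" "m = n i" "w = word shift c (n i) (x i)" by (auto simp: \<beta>_def)
            then have "x i \<in> Y j" "N \<le> n i" using I J by auto
            then show "N \<le> m \<and> w \<in> W m" using i N by (auto simp: Y_def)
          qed
          finally show "(\<Sum>i\<in>J. ennreal (exp (- s * real (n i)))) \<le> ennreal (exp (g - s) ^ N / (1 - exp (g - s)))"
            by (subst sum_ennreal) (auto intro: ennreal_leI)
        qed
        then show "(case p of (I, x, n) \<Rightarrow> \<Sum>\<^sub>\<infinity>i\<in>I. ennreal (exp (- s * real (n i))))
          \<le> ennreal (exp (g - s) ^ N / (1 - exp (g - s)))" by (simp add: p)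
      qed
      finally show "packing_P shift shift_dist (Y j) s \<epsilon> \<le> ennreal (exp (g - s) ^ N / (1 - exp (g - s)))" .
    qed
    then have "packing_outer shift shift_dist (generic_points shift \<mu>) s \<epsilon> \<le> (\<Sum>j::nat. 0)"
      unfolding packing_outer_def using cover by (intro INF_lower2[of Y]) auto
    then show ?thesis by simp
  qed
  have "bowen_M_at shift shift_dist (generic_points shift \<mu>) s N1 \<epsilon> = 0" for N1
  proof (rule vanishing_tail[OF g, of "max 1 (max n0 N1)"])
    fix N assume N: "N \<ge> max 1 (max n0 N1)"
    define R where "R = {p. fst p \<ge> N \<and> snd p \<in> W (fst p) \<and> (\<exists>y. word shift c (fst p) y = snd p)}"
    \<comment> \<open>Covers are indexed by natural numbers, so pairs of a length and a word are
      encoded as such.\<close>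
    define \<iota> where "\<iota> p = prod_encode (fst p, to_nat_on (W (fst p)) (snd p))" for p
    have inj: "inj_on \<iota> R"
    proof (rule inj_onI)
      fix p p' assume p: "p \<in> R" "p' \<in> R" "\<iota> p = \<iota> p'"
      then have "fst p = fst p'" "to_nat_on (W (fst p)) (snd p) = to_nat_on (W (fst p)) (snd p')" by (auto simp: \<iota>_def)
      moreover have "snd p \<in> W (fst p)" "snd p' \<in> W (fst p)" using p \<open>fst p = fst p'\<close> by (auto simp: R_def)
      ultimately have "snd p = snd p'" using countable_finite[OF W(1)] by simp
      then show "p = p'" using \<open>fst p = fst p'\<close> by (simp add: prod_eq_iff)
    qed
    define y where "y i = (SOME z. word shift c (fst (the_inv_into R \<iota> i)) z = snd (the_inv_into R \<iota> i))" for i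
    define m where "m i = fst (the_inv_into R \<iota> i)" for i
    have my: "m (\<iota> p) = fst p" "word shift c (fst p) (y (\<iota> p)) = snd p" if "p \<in> R" for p
    proof -
      show "m (\<iota> p) = fst p" using the_inv_into_f_f[OF inj that] by (simp add: m_def)
      have "\<exists>z. word shift c (fst p) z = snd p" using that by (simp add: R_def)
      then have "word shift c (fst p) (SOME z. word shift c (fst p) z = snd p) = snd p" by (rule someI_ex)
      then show "word shift c (fst p) (y (\<iota> p)) = snd p" using the_inv_into_f_f[OF inj that] by (simp add: y_def)
    qed
    have "(\<iota> ` R, y, m) \<in> bowen_covers shift shift_dist (generic_points shift \<mu>) N1 \<epsilon>"
      unfolding bowen_covers_def
    proof (intro CollectI case_prodI conjI ballI subsetI)
      fix i assume "i \<in> \<iota> ` R"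
      then obtain p where p: "p \<in> R" "i = \<iota> p" by blast
      then have "fst p \<ge> N" by (simp add: R_def)
      then show "N1 \<le> m i" using my(1)[OF p(1)] p(2) N by simp
    next
      fix x assume "x \<in> generic_points shift \<mu>"
      from gen[OF this] obtain j where j: "\<forall>n\<ge>j. word shift c n x \<in> W n" by (elim exE)
      define p where "p = (max j N, word shift c (max j N) x)"
      have p: "p \<in> R" using j unfolding R_def p_def by auto
      have "bowen_dist shift shift_dist (max j N) (y (\<iota> p)) x < \<epsilon>"
        using my(2)[OF p] N by (intro close) (auto simp: p_def)
      then have "x \<in> bowen_ball shift shift_dist (m (\<iota> p)) (y (\<iota> p)) \<epsilon>"
        using my(1)[OF p] by (simp add: bowen_ball_def p_def)
      then show "x \<in> (\<Union>i\<in>\<iota> ` R. bowen_ball shift shift_dist (m i) (y i) \<epsilon>)" using p by blast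
    qed
    then have "bowen_M_at shift shift_dist (generic_points shift \<mu>) s N1 \<epsilon>
        \<le> (\<Sum>\<^sub>\<infinity>i\<in>\<iota> ` R. ennreal (exp (- real (m i) * s)))"
      unfolding bowen_M_at_def by (intro INF_lower2[of "(\<iota> ` R, y, m)"]) auto
    also have "\<dots> = (\<Sum>\<^sub>\<infinity>p\<in>R. ennreal (exp (- real (m (\<iota> p)) * s)))"
      by (subst infsum_reindex[OF inj]) (simp add: o_def)
    also have "\<dots> \<le> ennreal (exp (g - s) ^ N / (1 - exp (g - s)))"
    proof (rule infsum_ennreal_le)
      fix J assume J: "finite J" "J \<subseteq> R"
      have "(\<Sum>p\<in>J. exp (- real (m (\<iota> p)) * s)) = (\<Sum>(n, w)\<in>J. exp (- s * real n))"
        using my(1) J by (intro sum.cong) (auto simp: mult.commute)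
      also have "\<dots> \<le> exp (g - s) ^ N / (1 - exp (g - s))"
      proof (rule word_family_sum[OF W(1) _ g J(1)])
        show "real (card (W n)) \<le> exp (real n * g)" if "n \<ge> N" for n using W(2) that N by simp
        show "N \<le> n \<and> w \<in> W n" if "(n, w) \<in> J" for n w using that J(2) by (auto simp: R_def)
      qed
      finally show "(\<Sum>p\<in>J. ennreal (exp (- real (m (\<iota> p)) * s))) \<le> ennreal (exp (g - s) ^ N / (1 - exp (g - s)))"
        by (subst sum_ennreal) (auto intro: ennreal_leI)
    qed
    finally show "bowen_M_at shift shift_dist (generic_points shift \<mu>) s N1 \<epsilon>
        \<le> ennreal (exp (g - s) ^ N / (1 - exp (g - s)))" .
  qed
  then show "bowen_M shift shift_dist (generic_points shift \<mu>) s \<epsilon> = 0"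
    unfolding bowen_M_eq by simp
qed

text \<open>There are finitely many cells, so diameters that are each below
  \<open>\<epsilon>\<close> have a common bound \<open>D < \<epsilon>\<close>. This slack is what
  allows the cells to be thickened.\<close>

lemma fine_partition_labels:
  assumes \<xi>: "\<xi> \<in> fine_partitions shift_dist \<epsilon>" and \<epsilon>: "\<epsilon> > 0"
  obtains u :: "(int \<Rightarrow> 'k) \<Rightarrow> (int \<Rightarrow> 'k) set" and D where "labels u" "fib u = \<xi>" "\<forall>x y. u x = u y \<longrightarrow> shift_dist x y \<le> D" "D < \<epsilon>"
proof -
  have \<xi>': "finite \<xi>" "partition_on UNIV \<xi>" "\<xi> \<subseteq> sets borel" "\<forall>C\<in>\<xi>. diam_wrt shift_dist C < ereal \<epsilon>"
    using \<xi> by (auto simp: fine_partitions_def)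
  obtain u where u: "fib u = \<xi>" "range u = \<xi>" "\<And>C. C \<in> \<xi> \<Longrightarrow> u -` {C} = C"
    by (rule partition_as_fib[OF \<xi>'(2)]) (rule that)
  have fibre: "u -` {C} = (if C \<in> \<xi> then C else {})" for C
  proof (cases "C \<in> \<xi>")
    case False
    then show ?thesis using u(2) by auto
  qed (simp add: u(3))
  have lab: "labels u"
  proof (rule labels_I)
    show "finite (range u)" using u \<xi>' by simp
    show "u -` {C} \<in> sets borel" for C using \<xi>'(3) by (auto simp: fibre)
  qed
  have "\<exists>D<\<epsilon>. \<forall>C\<in>\<xi>. diam_wrt shift_dist C \<le> ereal D"
  proof -
    \<comment> \<open>Inserting 0 bounds the maximum from below, so that it is a real
      number.\<close>
    define m where "m = Max (insert (ereal 0) (diam_wrt shift_dist ` \<xi>))"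
    have m: "m < ereal \<epsilon>" "ereal 0 \<le> m" "\<And>C. C \<in> \<xi> \<Longrightarrow> diam_wrt shift_dist C \<le> m"
      unfolding m_def using \<xi>'(1,4) \<epsilon> by (auto simp: Max_less_iff)
    then obtain D where "m = ereal D" by (cases m) auto
    then show ?thesis using m by auto
  qed
  then obtain D where D: "D < \<epsilon>" "\<forall>C\<in>\<xi>. diam_wrt shift_dist C \<le> ereal D" by (elim exE conjE)
  have "shift_dist x y \<le> D" if "u x = u y" for x y
  proof -
    have C: "u x \<in> \<xi>" using u(2) by auto
    have "x \<in> u x" "y \<in> u x" using u(3)[OF C] that by auto
    then have "ereal (shift_dist x y) \<le> diam_wrt shift_dist (u x)"
      unfolding diam_wrt_def by (intro SUP_upper2[of "(x, y)"]) auto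
    also have "\<dots> \<le> ereal D" using D(2) C by blast
    finally show ?thesis by simp
  qed
  then show thesis by (intro that[OF lab u(1) _ D(1)] allI impI)
qed

text \<open>Every number above the entropy of a fine partition belongs to the sets that define
  \<open>h_P\<close> and \<open>h_B\<close>; it is positive because that entropy is
  nonnegative.\<close>

lemma entropies_le:
  assumes \<epsilon>: "\<epsilon> > 0"
  defines "E \<equiv> INF \<xi>\<in>fine_partitions shift_dist \<epsilon>. ereal (ks_entropy shift \<mu> \<xi>)"
  shows "h_P shift shift_dist (generic_points shift \<mu>) \<epsilon> \<le> E"
    and "h_B shift shift_dist (generic_points shift \<mu>) \<epsilon> \<le> E"
proof -
  have *: "h_P shift shift_dist (generic_points shift \<mu>) \<epsilon> \<le> ereal s
      \<and> h_B shift shift_dist (generic_points shift \<mu>) \<epsilon> \<le> ereal s"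
    if \<xi>: "\<xi> \<in> fine_partitions shift_dist \<epsilon>" and s: "ks_entropy shift \<mu> \<xi> < s" for \<xi> s
  proof -
    obtain u :: "(int \<Rightarrow> 'k) \<Rightarrow> (int \<Rightarrow> 'k) set" and D where u: "labels u" "fib u = \<xi>" "\<forall>x y. u x = u y \<longrightarrow> shift_dist x y \<le> D" "D < \<epsilon>"
      by (rule fine_partition_labels[OF \<xi> \<epsilon>]) (rule that)
    have "0 \<le> ks_entropy shift \<mu> \<xi>" using ks_nonneg[OF u(1)] u(2) by simp
    then have "s > 0" using s by simp
    moreover have "ks_entropy shift \<mu> (fib u) < s" using s u(2) by simp
    note entropies_le_fib[OF u(1) u(3) u(4) \<epsilon> this]
    ultimately show ?thesis unfolding h_P_def h_B_def by (intro conjI INF_lower) auto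
  qed
  have hP: "h_P shift shift_dist (generic_points shift \<mu>) \<epsilon> \<le> ereal (ks_entropy shift \<mu> \<xi>)"
    if \<xi>: "\<xi> \<in> fine_partitions shift_dist \<epsilon>" for \<xi>
  proof (rule ereal_le_epsilon2)
    fix e :: real assume "0 < e"
    then show "h_P shift shift_dist (generic_points shift \<mu>) \<epsilon> \<le> ereal (ks_entropy shift \<mu> \<xi>) + ereal e"
      using *[OF \<xi>, of "ks_entropy shift \<mu> \<xi> + e", THEN conjunct1] by simp
  qed
  have hB: "h_B shift shift_dist (generic_points shift \<mu>) \<epsilon> \<le> ereal (ks_entropy shift \<mu> \<xi>)"
    if \<xi>: "\<xi> \<in> fine_partitions shift_dist \<epsilon>" for \<xi>
  proof (rule ereal_le_epsilon2)
    fix e :: real assume "0 < e"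
    then show "h_B shift shift_dist (generic_points shift \<mu>) \<epsilon> \<le> ereal (ks_entropy shift \<mu> \<xi>) + ereal e"
      using *[OF \<xi>, of "ks_entropy shift \<mu> \<xi> + e", THEN conjunct2] by simp
  qed
  show "h_P shift shift_dist (generic_points shift \<mu>) \<epsilon> \<le> E"
    unfolding E_def by (rule INF_greatest) (rule hP)
  show "h_B shift shift_dist (generic_points shift \<mu>) \<epsilon> \<le> E"
    unfolding E_def by (rule INF_greatest) (rule hB)
qed

end

section \<open>Upper capacity entropy and box dimension\<close>

lemma covering_number_attained:
  assumes K: "compact (UNIV :: 'k::metric_space set)" and r: "r > 0"
  obtains C :: "'k::metric_space set" where "finite C" "card C = covering_number (UNIV :: 'k::metric_space set) r" "UNIV = (\<Union>c\<in>C. ball c r)"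
proof -
  obtain C where C: "finite C" "UNIV \<subseteq> (\<Union>c\<in>C. ball (c::'k) r)"
    using K r unfolding compact_eq_totally_bounded by (auto dest: spec[of _ r])
  then have "\<exists>m C. C \<subseteq> (UNIV :: 'k set) \<and> finite C \<and> card C = m \<and> UNIV \<subseteq> (\<Union>c\<in>C. ball c r)" by blast
  from LeastI_ex[OF this] show thesis using that unfolding covering_number_def by blast
qed

lemma covering_number_pos:
  assumes "compact (UNIV :: 'k::metric_space set)" "r > 0"
  shows "covering_number (UNIV :: 'k::metric_space set) r \<ge> 1"
proof -
  obtain C :: "'k set" where C: "finite C" "card C = covering_number (UNIV :: 'k set) r" "UNIV = (\<Union>c\<in>C. ball c r)"
    by (rule covering_number_attained[OF assms])
  then have "C \<noteq> {}" by auto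
  then show ?thesis using C(1) C(2)[symmetric] by (simp add: Suc_le_eq card_gt_0_iff)
qed

text \<open>For a separated set of largest cardinality the closed balls of radius \<open>e\<close>
  cover; the covering number uses open balls, hence \<open>2 * e\<close>.\<close>

lemma separated_points:
  assumes K: "compact (UNIV :: 'k::metric_space set)" and e: "e > 0"
  obtains S :: "'k::metric_space set" where "finite S" "\<And>x y. x \<in> S \<Longrightarrow> y \<in> S \<Longrightarrow> x \<noteq> y \<Longrightarrow> dist x y > e"
    "covering_number (UNIV :: 'k::metric_space set) (2 * e) \<le> card S"
proof -
  let ?P = "\<lambda>S :: 'k set. finite S \<and> (\<forall>x\<in>S. \<forall>y\<in>S. x \<noteq> y \<longrightarrow> dist x y > e)"
  obtain N and a :: "'k \<Rightarrow> nat" where a: "range a \<subseteq> {..<N}" "\<And>x y. a x = a y \<Longrightarrow> dist x y < e"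
    by (rule compact_labelling[OF K e]) auto
  have "\<forall>S. ?P S \<longrightarrow> card S < Suc N"
  proof (intro allI impI)
    fix S assume S: "?P S"
    have "inj_on a S" using S a(2) by (intro inj_onI) (metis less_asym')
    then have "card S \<le> card {..<N}" using a(1) by (intro card_inj_on_le) auto
    then show "card S < Suc N" by simp
  qed
  from ex_has_greatest_nat[OF _ this, of "{}"] have "\<exists>S. ?P S \<and> (\<forall>T. ?P T \<longrightarrow> card T \<le> card S)" by simp
  then obtain S where S': "?P S \<and> (\<forall>T. ?P T \<longrightarrow> card T \<le> card S)" by (elim exE)
  note S = conjunct1[OF S'] conjunct2[OF S']
  have "UNIV \<subseteq> (\<Union>c\<in>S. ball c (2 * e))"
  proof
    fix z :: 'k
    show "z \<in> (\<Union>c\<in>S. ball c (2 * e))"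
    proof (rule ccontr)
      assume z: "z \<notin> (\<Union>c\<in>S. ball c (2 * e))"
      then have far: "dist c z > e" "dist z c > e" if "c \<in> S" for c
        using that e by (auto simp: not_less dist_commute dest!: bspec)
      have "z \<notin> S" using far(1)[of z] e by auto
      have "?P (insert z S)" using S(1) far by auto
      then have "card (insert z S) \<le> card S" by (rule S(2)[rule_format, of "insert z S"])
      then show False using \<open>z \<notin> S\<close> S(1) by simp
    qed
  qed
  then have "covering_number (UNIV :: 'k set) (2 * e) \<le> card S"
    unfolding covering_number_def using S(1) by (intro Least_le) auto
  with S(1) show thesis by (intro that[of S]) auto
qed

context invariant_measure
begin

lemma generic_exists: "\<exists>x. x \<in> generic_points shift \<mu>"
proof (rule ccontr)
  interpret P: prob_space Om by (rule prob_space_Om)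
  assume no: "\<not> ?thesis"
  have "AE \<omega> in Om. False" by (rule AE_mp[OF AE_concat_generic]) (use no in auto)
  then show False by simp
qed

text \<open>At times \<open>i \<ge> n0 + m\<close> the window of radius \<open>m\<close> around
  \<open>i\<close> sees no changed coordinate. The finitely many earlier times disappear from the
  averages, even when all negative coordinates are changed.\<close>

lemma generic_tail:
  assumes x: "x \<in> generic_points shift \<mu>" and xy: "\<And>t. t \<ge> int n0 \<Longrightarrow> y t = x t"
  shows "y \<in> generic_points shift \<mu>"
proof (rule generic_pointI[OF mu_borel_prob])
  fix \<phi> :: "(int \<Rightarrow> 'k) \<Rightarrow> real" assume \<phi>: "continuous_on UNIV \<phi>"
  have "(\<lambda>n. avg \<phi> n y - avg \<phi> n x) \<longlonglongrightarrow> 0"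
  proof (rule LIMSEQ_I)
    fix e :: real assume e: "e > 0"
    have e2: "e / 2 > 0" using e by simp
    from continuous_window[OF K_compact \<phi> e2] obtain r m where r: "r > 0"
      "\<forall>x y. (\<forall>j. \<bar>j\<bar> \<le> int m \<longrightarrow> dist (x j) (y j) < r) \<longrightarrow> \<bar>\<phi> x - \<phi> y\<bar> < e / 2" by (elim exE conjE)
    define \<Delta> where "\<Delta> i = \<bar>\<phi> (sh (int i) y) - \<phi> (sh (int i) x)\<bar>" for i
    define M where "M = (\<Sum>i<n0 + m. \<Delta> i)"
    have late: "\<Delta> i \<le> e / 2" if "i \<ge> n0 + m" for i
    proof -
      have "dist (sh (int i) y j) (sh (int i) x j) < r" if "\<bar>j\<bar> \<le> int m" for j
        using xy[of "j + int i"] \<open>i \<ge> n0 + m\<close> that r(1) by (simp add: sh_apply add.commute)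
      then show ?thesis using r(2)[rule_format, of "sh (int i) y" "sh (int i) x"] by (simp add: \<Delta>_def)
    qed
    have bound: "(\<Sum>i<n. \<Delta> i) \<le> M + real n * (e / 2)" for n
    proof (induction n)
      case 0
      show ?case by (simp add: M_def \<Delta>_def sum_nonneg)
    next
      case (Suc n)
      show ?case
      proof (cases "n \<ge> n0 + m")
        case True
        then show ?thesis using Suc late[of n] by (simp add: algebra_simps add_divide_distrib)
      next
        case False
        then have "(\<Sum>i<Suc n. \<Delta> i) \<le> M" unfolding M_def by (intro sum_mono2) (auto simp: \<Delta>_def)
        moreover have "0 \<le> real (Suc n) * (e / 2)" using e by simp
        ultimately show ?thesis by linarith
      qed
    qed
    obtain N :: nat where N: "M / (e / 2) < real N" using reals_Archimedean2 by blast
    show "\<exists>no. \<forall>n\<ge>no. norm (avg \<phi> n y - avg \<phi> n x - 0) < e"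
    proof (intro exI[of _ "max 1 N"] allI impI)
      fix n assume n: "max 1 N \<le> n"
      then have np: "real n > 0" by simp
      have "M / (e / 2) < real n" using N n by simp
      then have Mn: "M < real n * (e / 2)" using e2 by (simp only: pos_divide_less_eq)
      have "\<bar>avg \<phi> n y - avg \<phi> n x\<bar> = \<bar>\<Sum>i<n. \<phi> (sh (int i) y) - \<phi> (sh (int i) x)\<bar> / real n"
        using np by (simp add: avg_def sum_subtractf diff_divide_distrib[symmetric])
      also have "\<dots> \<le> (\<Sum>i<n. \<Delta> i) / real n"
        unfolding \<Delta>_def by (intro divide_right_mono sum_abs) simp
      also have "\<dots> < e"
      proof -
        have "(\<Sum>i<n. \<Delta> i) < real n * (e / 2) + real n * (e / 2)" using bound[of n] Mn by linarith
        also have "\<dots> = e * real n" by simp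
        finally show ?thesis using np by (simp only: pos_divide_less_eq)
      qed
      finally show "norm (avg \<phi> n y - avg \<phi> n x - 0) < e" by simp
    qed
  qed
  from tendsto_add[OF this generic_avg[OF x \<phi>]]
  show "(\<lambda>n. avg \<phi> n y) \<longlonglongrightarrow> (\<integral>y. \<phi> y \<partial>\<mu>)" by simp
qed

lemma sep_number_bounds:
  fixes E Z :: "(int \<Rightarrow> 'k) set"
  assumes \<epsilon>: "\<epsilon> > 0" and n: "n \<ge> 1"
  shows "E \<subseteq> Z \<Longrightarrow> finite E \<Longrightarrow> separated shift shift_dist n \<epsilon> E \<Longrightarrow> card E \<le> sep_number shift shift_dist Z n \<epsilon>"
    and "(\<And>E :: (int \<Rightarrow> 'k) set. finite E \<Longrightarrow> separated shift shift_dist n \<epsilon> E \<Longrightarrow> card E \<le> b)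
      \<Longrightarrow> sep_number shift shift_dist Z n \<epsilon> \<le> b"
proof -
  let ?F = "{E :: (int \<Rightarrow> 'k) set. E \<subseteq> Z \<and> finite E \<and> separated shift shift_dist n \<epsilon> E}"
  obtain B where B: "\<And>E :: (int \<Rightarrow> 'k) set. finite E \<Longrightarrow> separated shift shift_dist n \<epsilon> E \<Longrightarrow> card E \<le> B"
    by (rule separated_bounded[OF \<epsilon> n]) auto
  have fin: "finite (card ` ?F)" by (rule finite_subset[of _ "{..B}"]) (auto intro: B)
  have "{} \<in> ?F" by (simp add: separated_def)
  then have ne: "card ` ?F \<noteq> {}" by blast
  show "card E \<le> sep_number shift shift_dist Z n \<epsilon>" if "E \<subseteq> Z" "finite E" "separated shift shift_dist n \<epsilon> E"
    unfolding sep_number_def by (rule Max_ge[OF fin]) (use that in blast)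
  show "sep_number shift shift_dist Z n \<epsilon> \<le> b"
    if "\<And>E :: (int \<Rightarrow> 'k) set. finite E \<Longrightarrow> separated shift shift_dist n \<epsilon> E \<Longrightarrow> card E \<le> b"
    unfolding sep_number_def by (rule Max.boundedI[OF fin ne]) (use that in auto)
qed

text \<open>Balls of radius \<open>r / 2\<close> with \<open>r = \<epsilon> / (wt_sum + 1)\<close>
  give an alphabet of \<open>c\<close> letters whose cells have diameter below \<open>r\<close>. The
  extra \<open>2 * m\<close> letters in the word count vanish in the limit.\<close>

lemma h_UC_upper:
  fixes Z :: "(int \<Rightarrow> 'k) set"
  assumes \<epsilon>: "\<epsilon> > 0"
  shows "h_UC shift shift_dist Z \<epsilon> \<le> ereal (ln (real (covering_number (UNIV :: 'k set) (1 / (2 * (wt_sum + 1)) * \<epsilon>))))"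
proof -
  define r where "r = \<epsilon> / (wt_sum + 1)"
  have r: "r > 0" "(wt_sum + 1) * r = \<epsilon>" using \<epsilon> wt_sum_nonneg by (auto simp: r_def)
  have r2: "1 / (2 * (wt_sum + 1)) * \<epsilon> = r / 2" by (simp add: r_def)
  define c where "c = covering_number (UNIV :: 'k set) (r / 2)"
  have c1: "c \<ge> 1" unfolding c_def using r by (intro covering_number_pos K_compact) simp
  obtain C :: "'k set" where C: "finite C" "card C = c" "UNIV = (\<Union>c\<in>C. ball c (r / 2))"
    unfolding c_def by (rule covering_number_attained[OF K_compact, of "r / 2"]) (use r in auto)
  from ball_labelling[OF C(1,3)] obtain a :: "'k \<Rightarrow> nat"
    where a: "range a \<subseteq> {..<c}" "\<forall>x y. a x = a y \<longrightarrow> dist x y < 2 * (r / 2)" unfolding C(2) by (elim exE conjE)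
  have a2: "dist x y < r" if "a x = a y" for x y using a(2) that by auto
  from shift_dist_le_coords[OF K_compact r(1)] obtain m :: nat where
    m: "\<forall>x y :: int \<Rightarrow> 'k. (\<forall>j. \<bar>j\<bar> \<le> int m \<longrightarrow> dist (x j) (y j) \<le> r) \<longrightarrow> shift_dist x y \<le> \<epsilon>"
    unfolding r(2) by (elim exE)
  have sep: "sep_number shift shift_dist Z n \<epsilon> \<le> c ^ (n + 2 * m)" if n: "n \<ge> 1" for n
    by (rule sep_number_bounds(2)[OF \<epsilon> n], rule separated_card_bound[OF a(1) a2 m[THEN spec, THEN spec, THEN mp] n])
  have "ln (real (sep_number shift shift_dist Z n \<epsilon>)) / real n \<le> ln (real c) + 2 * real m * ln (real c) / real n"
    if n: "n \<ge> 1" for n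
  proof -
    have "ln (real (sep_number shift shift_dist Z n \<epsilon>)) \<le> real (n + 2 * m) * ln (real c)"
    proof (cases "sep_number shift shift_dist Z n \<epsilon> = 0")
      case True
      then show ?thesis using c1 by simp
    next
      case False
      have "real (sep_number shift shift_dist Z n \<epsilon>) \<le> real c ^ (n + 2 * m)"
        using sep[OF n] by (simp only: of_nat_power[symmetric] of_nat_le_iff)
      then have "ln (real (sep_number shift shift_dist Z n \<epsilon>)) \<le> ln (real c ^ (n + 2 * m))"
        using False by (intro ln_mono) auto
      also have "\<dots> = real (n + 2 * m) * ln (real c)" by (rule ln_realpow)
      finally show ?thesis .
    qed
    then have "ln (real (sep_number shift shift_dist Z n \<epsilon>)) / real n \<le> real (n + 2 * m) * ln (real c) / real n"
      by (rule divide_right_mono) simp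
    also have "\<dots> = ln (real c) + 2 * real m * ln (real c) / real n" using n by (simp add: field_simps)
    finally show ?thesis .
  qed
  then have "h_UC shift shift_dist Z \<epsilon> \<le> limsup (\<lambda>n. ereal (ln (real c) + 2 * real m * ln (real c) / real n))"
    unfolding h_UC_def by (intro Limsup_mono eventually_sequentiallyI[of 1]) simp
  also have "\<dots> = ereal (ln (real c))"
  proof (rule lim_imp_Limsup)
    have "(\<lambda>n. ln (real c) + 2 * real m * ln (real c) / real n) \<longlonglongrightarrow> ln (real c) + 0"
      by (intro tendsto_add tendsto_const lim_const_over_n)
    then show "(\<lambda>n. ereal (ln (real c) + 2 * real m * ln (real c) / real n)) \<longlonglongrightarrow> ereal (ln (real c))" by simp
  qed simp
  finally show ?thesis unfolding r2 c_def .
qed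

text \<open>Genericity is insensitive to the coordinates in \<open>{0..<n}\<close>, which can be prescribed freely.\<close>

lemma h_UC_lower:
  assumes \<epsilon>: "\<epsilon> > 0"
  shows "ereal (ln (real (covering_number (UNIV :: 'k set) (2 * \<epsilon>)))) \<le> h_UC shift shift_dist (generic_points shift \<mu>) \<epsilon>"
proof -
  define c where "c = covering_number (UNIV :: 'k set) (2 * \<epsilon>)"
  have c1: "c \<ge> 1" unfolding c_def using \<epsilon> by (intro covering_number_pos K_compact) simp
  obtain S :: "'k set" where S: "finite S" "\<And>x y. x \<in> S \<Longrightarrow> y \<in> S \<Longrightarrow> x \<noteq> y \<Longrightarrow> dist x y > \<epsilon>"
    "covering_number (UNIV :: 'k set) (2 * \<epsilon>) \<le> card S"
    by (rule separated_points[OF K_compact \<epsilon>]) (rule that)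
  from generic_exists obtain z where z: "z \<in> generic_points shift \<mu>" by (elim exE)
  have sep: "c ^ n \<le> sep_number shift shift_dist (generic_points shift \<mu>) n \<epsilon>" if n: "n \<ge> 1" for n
  proof -
    define y where "y w t = (if 0 \<le> t \<and> t < int n then w (nat t) else z t)" for w :: "nat \<Rightarrow> 'k" and t
    define E where "E = y ` (PiE {..<n} (\<lambda>_. S))"
    have fin: "finite (PiE {..<n} (\<lambda>_. S))" using S(1) by (intro finite_PiE) auto
    have yt: "y w (int t) = w t" if "t < n" for w t using that by (simp add: y_def)
    have inj: "inj_on y (PiE {..<n} (\<lambda>_. S))"
    proof (rule inj_onI)
      fix w w' assume w: "w \<in> PiE {..<n} (\<lambda>_. S)" "w' \<in> PiE {..<n} (\<lambda>_. S)" "y w = y w'"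
      show "w = w'"
      proof (rule PiE_ext[OF w(1,2)])
        fix t assume "t \<in> {..<n}"
        then show "w t = w' t" using yt[of t w] yt[of t w'] w(3) by simp
      qed
    qed
    have "c ^ n \<le> card S ^ n" by (rule power_mono[OF S(3)[folded c_def]]) simp
    also have "\<dots> = card E" unfolding E_def card_image[OF inj] by (simp add: card_PiE)
    also have "\<dots> \<le> sep_number shift shift_dist (generic_points shift \<mu>) n \<epsilon>"
    proof (rule sep_number_bounds(1)[OF \<epsilon> n])
      show "E \<subseteq> generic_points shift \<mu>"
        unfolding E_def by (rule image_subsetI, rule generic_tail[OF z, of n]) (simp add: y_def)
      show "finite E" unfolding E_def using fin by simp
      show "separated shift shift_dist n \<epsilon> E"
        unfolding separated_def
      proof (intro ballI impI)
        fix p p' assume p: "p \<in> E" "p' \<in> E" "p \<noteq> p'"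
        then obtain w w' where w: "w \<in> PiE {..<n} (\<lambda>_. S)" "p = y w" "w' \<in> PiE {..<n} (\<lambda>_. S)" "p' = y w'"
          unfolding E_def by blast
        have "\<exists>t<n. w t \<noteq> w' t"
        proof (rule ccontr)
          assume "\<not> ?thesis"
          then have "w = w'" by (intro PiE_ext[OF w(1,3)]) auto
          then show False using p w by simp
        qed
        then obtain t where t: "t < n" "w t \<noteq> w' t" by blast
        have "dist (w t) (w' t) > \<epsilon>" using w t by (intro S(2)) auto
        also have "dist (w t) (w' t) \<le> bowen_dist shift shift_dist n p p'"
          using bowen_dist_coord[OF t(1), of p p'] w yt[OF t(1)] by simp
        finally show "bowen_dist shift shift_dist n p p' > \<epsilon>" .
      qed
    qed
    finally show ?thesis .
  qed
  have "ln (real c) \<le> ln (real (sep_number shift shift_dist (generic_points shift \<mu>) n \<epsilon>)) / real n" if n: "n \<ge> 1" for n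
  proof -
    have "real n * ln (real c) = ln (real c ^ n)" by (rule ln_realpow[symmetric])
    also have "\<dots> \<le> ln (real (sep_number shift shift_dist (generic_points shift \<mu>) n \<epsilon>))"
      using sep[OF n] c1 by (intro ln_mono) (simp_all only: of_nat_power[symmetric] of_nat_le_iff of_nat_0_less_iff, simp)
    finally show ?thesis using n by (simp add: pos_le_divide_eq mult.commute)
  qed
  then show ?thesis
    unfolding h_UC_def c_def[symmetric]
    by (intro le_Limsup eventually_sequentiallyI[of 1]) auto
qed

section \<open>Comparison of scales\<close>

text \<open>A labelling of mesh \<open>r = 3 * \<epsilon>\<close> meets the requirement
  \<open>2 * \<epsilon> < r\<close>. The block code then has mesh
  \<open>9 * r = 27 * \<epsilon>\<close>, and 28 makes the inequality strict;
  \<open>wt_sum + 1\<close> passes from coordinates to \<open>shift_dist\<close>.\<close>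

lemma entropies_ge:
  assumes \<epsilon>: "\<epsilon> > 0"
  defines "E \<equiv> INF \<xi>\<in>fine_partitions shift_dist ((wt_sum + 1) * 28 * \<epsilon>). ereal (ks_entropy shift \<mu> \<xi>)"
  shows "E \<le> h_P shift shift_dist (generic_points shift \<mu>) \<epsilon>"
    and "E \<le> h_B shift shift_dist (generic_points shift \<mu>) \<epsilon>"
proof -
  have r: "3 * \<epsilon> > 0" using \<epsilon> by simp
  obtain N and a :: "'k \<Rightarrow> nat" where a: "range a \<subseteq> {..<N}" "a \<in> borel \<rightarrow>\<^sub>M count_space UNIV"
    "\<And>x y. a x = a y \<Longrightarrow> dist x y < 3 * \<epsilon>"
    by (rule compact_labelling[OF K_compact r]) auto
  interpret coded_measure \<mu> a N "3 * \<epsilon>"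
    by unfold_locales (use a in auto)
  have sc: "(wt_sum + 1) * (9 * (3 * \<epsilon>)) < (wt_sum + 1) * 28 * \<epsilon>"
    using \<epsilon> wt_sum_nonneg by (simp add: mult.assoc mult_strict_left_mono)
  have LB: "real n * s1 - ln 2 \<le> code_cost n" if s1: "ereal s1 < E" and n: "n \<ge> 1" for s1 n
  proof -
    have "ereal s1 < ereal ((ln 2 + code_cost n) / real n)"
      using s1 inf_ks_le_code_cost[OF n sc] unfolding E_def by (rule less_le_trans)
    then have "s1 < (ln 2 + code_cost n) / real n" by simp
    then show ?thesis using n by (simp add: pos_less_divide_eq mult.commute)
  qed
  have *: "z \<le> h_P shift shift_dist (generic_points shift \<mu>) \<epsilon> \<and> z \<le> h_B shift shift_dist (generic_points shift \<mu>) \<epsilon>"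
    if z: "z < E" for z
  proof -
    from ereal_dense2[OF z] obtain s1 where s1: "z < ereal s1" "ereal s1 < E" by blast
    have "ereal s1 \<le> h_P shift shift_dist (generic_points shift \<mu>) \<epsilon>"
      by (rule h_P_lower[OF LB[OF s1(2)]]) (use \<epsilon> in auto)
    moreover have "ereal s1 \<le> h_B shift shift_dist (generic_points shift \<mu>) \<epsilon>"
      by (rule h_B_lower[OF LB[OF s1(2)]]) (use \<epsilon> in auto)
    ultimately show ?thesis using s1(1) by auto
  qed
  show "E \<le> h_P shift shift_dist (generic_points shift \<mu>) \<epsilon>" by (rule dense_le) (use * in blast)
  show "E \<le> h_B shift shift_dist (generic_points shift \<mu>) \<epsilon>" by (rule dense_le) (use * in blast)
qed

end

text \<open>The logarithms of \<open>C * \<epsilon>\<close> and of \<open>\<epsilon>\<close> differ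
  by a constant while both tend to minus infinity, so their quotient tends to 1.\<close>

lemma Limsup_rescale:
  fixes f g :: "real \<Rightarrow> ereal"
  assumes C: "C > 0" and fg: "\<And>\<epsilon>. \<epsilon> > 0 \<Longrightarrow> f \<epsilon> \<le> g (C * \<epsilon>)"
  shows "Limsup (at_right 0) (\<lambda>\<epsilon>. f \<epsilon> / ereal \<bar>ln \<epsilon>\<bar>) \<le> Limsup (at_right 0) (\<lambda>\<epsilon>. g \<epsilon> / ereal \<bar>ln \<epsilon>\<bar>)"
    (is "?F \<le> ?G")
proof (rule dense_ge)
  fix x assume "?G < x"
  \<comment> \<open>\<open>y1\<close> bounds the quotient at the scale
    \<open>C * \<epsilon>\<close>; the gap between \<open>y1\<close> and \<open>x1\<close> absorbs
    the quotient of the logarithms.\<close>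
  then obtain y1 where y1: "?G < ereal y1" "ereal y1 < x" using ereal_dense2 by blast
  then obtain x1 where x1: "ereal y1 < ereal x1" "ereal x1 < x" using ereal_dense2 by blast
  have lim0: "filterlim (\<lambda>\<epsilon>. C * \<epsilon>) (at_right 0) (at_right (0 :: real))"
  proof (rule filterlim_at_withinI)
    show "((\<lambda>\<epsilon>. C * \<epsilon>) \<longlongrightarrow> 0) (at_right 0)" by (rule tendsto_eq_intros refl | simp)+
    show "\<forall>\<^sub>F \<epsilon> in at_right 0. C * \<epsilon> \<in> {0<..} - {0}"
      by (rule eventually_mono[OF eventually_at_right_less[of "0::real"]]) (use C in simp)
  qed
  have ev1: "\<forall>\<^sub>F \<epsilon> in at_right 0. g (C * \<epsilon>) / ereal \<bar>ln (C * \<epsilon>)\<bar> < ereal y1"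
    by (rule eventually_compose_filterlim[OF Limsup_lessD[OF y1(1)] lim0])
  have ln_inf: "filterlim (ln :: real \<Rightarrow> real) at_infinity (at_right 0)"
    by (rule filterlim_mono[OF ln_at_0 at_bot_le_at_infinity order_refl])
  have "((\<lambda>\<epsilon>. y1 * \<bar>ln C / ln \<epsilon> + 1\<bar>) \<longlongrightarrow> y1 * \<bar>0 + 1\<bar>) (at_right 0)"
    by (intro tendsto_intros tendsto_divide_0[OF tendsto_const ln_inf])
  then have ev2: "\<forall>\<^sub>F \<epsilon> in at_right 0. y1 * \<bar>ln C / ln \<epsilon> + 1\<bar> < x1"
    by (rule order_tendstoD(2)) (use x1 in simp)
  have small: "\<forall>\<^sub>F \<epsilon> in at_right 0. 0 < \<epsilon> \<and> \<epsilon> < min 1 (1 / C)"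
    using eventually_at_right_real[of 0 "min 1 (1 / C)"] C by (simp add: greaterThanLessThan_iff)
  have "\<forall>\<^sub>F \<epsilon> in at_right 0. f \<epsilon> / ereal \<bar>ln \<epsilon>\<bar> \<le> ereal x1"
    using ev1 ev2 small
  proof eventually_elim
    case (elim \<epsilon>)
    have Ce: "0 < C * \<epsilon>" "C * \<epsilon> < 1" using elim C by (auto simp: field_simps)
    have l1: "\<bar>ln (C * \<epsilon>)\<bar> > 0" using Ce ln_less_zero[OF Ce] by simp
    have l2: "ln \<epsilon> < 0" using elim by (intro ln_less_zero) auto
    have "f \<epsilon> \<le> g (C * \<epsilon>)" using elim by (intro fg) simp
    also have "\<dots> \<le> ereal \<bar>ln (C * \<epsilon>)\<bar> * ereal y1"
      using less_imp_le[OF elim(1)] l1 by (subst (asm) ereal_divide_le_pos) auto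
    also have "\<dots> \<le> ereal \<bar>ln \<epsilon>\<bar> * ereal x1"
    proof -
      have "ln (C * \<epsilon>) = ln \<epsilon> * (ln C / ln \<epsilon> + 1)" using l2 C elim by (simp add: ln_mult_pos field_simps)
      then have "\<bar>ln (C * \<epsilon>)\<bar> * y1 = \<bar>ln \<epsilon>\<bar> * (y1 * \<bar>ln C / ln \<epsilon> + 1\<bar>)" by (simp add: abs_mult)
      also have "\<dots> \<le> \<bar>ln \<epsilon>\<bar> * x1" using elim by (intro mult_left_mono) auto
      finally show ?thesis by simp
    qed
    finally show ?case using l2 by (subst ereal_divide_le_pos) auto
  qed
  then have "?F \<le> ereal x1" by (intro Limsup_bounded)
  then show "?F \<le> x" using x1(2) by simp
qed

theorem theorem4p4:
  fixes \<mu> :: "(int \<Rightarrow> 'k::metric_space) measure"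
  assumes "compact (UNIV :: 'k set)"
    and "\<mu> \<in> invariant_probs shift"
  shows "upper_mdim_UC shift (generic_points shift \<mu>) shift_dist = upper_box_dim (UNIV :: 'k set)
    \<and> upper_mdim_B shift (generic_points shift \<mu>) shift_dist
        = upper_mdim_P shift (generic_points shift \<mu>) shift_dist
    \<and> upper_mdim_P shift (generic_points shift \<mu>) shift_dist
        = Limsup (at_right 0) (\<lambda>\<epsilon>. 1 / ereal \<bar>ln \<epsilon>\<bar> *
            (INF \<xi>\<in>fine_partitions shift_dist \<epsilon>. ereal (ks_entropy shift \<mu> \<xi>)))"
proof -
  interpret invariant_measure \<mu> using assms by unfold_locales
  let ?G = "generic_points shift \<mu>"
  define E where "E \<epsilon> = (INF \<xi>\<in>fine_partitions shift_dist \<epsilon>. ereal (ks_entropy shift \<mu> \<xi>))" for \<epsilon>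
  define L where "L = Limsup (at_right 0) (\<lambda>\<epsilon>. E \<epsilon> / ereal \<bar>ln \<epsilon>\<bar>)"
  have C: "1 / ((wt_sum + 1) * 28) > 0" "(wt_sum + 1) * 28 > 0" "1 / (2 * (wt_sum + 1)) > 0"
    using wt_sum_nonneg by (simp_all add: add_nonneg_pos)
  have inv: "(wt_sum + 1) * 28 * (1 / ((wt_sum + 1) * 28) * \<epsilon>) = \<epsilon>" for \<epsilon> using C by simp
  have pos: "1 / ((wt_sum + 1) * 28) * \<epsilon> > 0" if "\<epsilon> > 0" for \<epsilon> using C(1) that by (rule mult_pos_pos)
  have P: "upper_mdim_P shift ?G shift_dist = L"
    unfolding upper_mdim_P_def L_def
  proof (rule antisym)
    show "Limsup (at_right 0) (\<lambda>\<epsilon>. h_P shift shift_dist ?G \<epsilon> / ereal \<bar>ln \<epsilon>\<bar>) \<le> Limsup (at_right 0) (\<lambda>\<epsilon>. E \<epsilon> / ereal \<bar>ln \<epsilon>\<bar>)"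
      by (rule Limsup_rescale[of 1]) (simp_all add: E_def entropies_le)
    show "Limsup (at_right 0) (\<lambda>\<epsilon>. E \<epsilon> / ereal \<bar>ln \<epsilon>\<bar>) \<le> Limsup (at_right 0) (\<lambda>\<epsilon>. h_P shift shift_dist ?G \<epsilon> / ereal \<bar>ln \<epsilon>\<bar>)"
    proof (rule Limsup_rescale[OF C(1)])
      fix \<epsilon> :: real assume "\<epsilon> > 0"
      from entropies_ge(1)[OF pos[OF this]]
      show "E \<epsilon> \<le> h_P shift shift_dist ?G (1 / ((wt_sum + 1) * 28) * \<epsilon>)" unfolding inv E_def .
    qed
  qed
  have B: "upper_mdim_B shift ?G shift_dist = L"
    unfolding upper_mdim_B_def L_def
  proof (rule antisym)
    show "Limsup (at_right 0) (\<lambda>\<epsilon>. h_B shift shift_dist ?G \<epsilon> / ereal \<bar>ln \<epsilon>\<bar>) \<le> Limsup (at_right 0) (\<lambda>\<epsilon>. E \<epsilon> / ereal \<bar>ln \<epsilon>\<bar>)"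
      by (rule Limsup_rescale[of 1]) (simp_all add: E_def entropies_le)
    show "Limsup (at_right 0) (\<lambda>\<epsilon>. E \<epsilon> / ereal \<bar>ln \<epsilon>\<bar>) \<le> Limsup (at_right 0) (\<lambda>\<epsilon>. h_B shift shift_dist ?G \<epsilon> / ereal \<bar>ln \<epsilon>\<bar>)"
    proof (rule Limsup_rescale[OF C(1)])
      fix \<epsilon> :: real assume "\<epsilon> > 0"
      from entropies_ge(2)[OF pos[OF this]]
      show "E \<epsilon> \<le> h_B shift shift_dist ?G (1 / ((wt_sum + 1) * 28) * \<epsilon>)" unfolding inv E_def .
    qed
  qed
  have UC: "upper_mdim_UC shift ?G shift_dist = upper_box_dim (UNIV :: 'k set)"
    unfolding upper_mdim_UC_def upper_box_dim_def
  proof (rule antisym)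
    show "Limsup (at_right 0) (\<lambda>\<epsilon>. h_UC shift shift_dist ?G \<epsilon> / ereal \<bar>ln \<epsilon>\<bar>)
        \<le> Limsup (at_right 0) (\<lambda>\<epsilon>. ereal (ln (real (covering_number (UNIV :: 'k set) \<epsilon>))) / ereal \<bar>ln \<epsilon>\<bar>)"
      by (rule Limsup_rescale[OF C(3)]) (rule h_UC_upper)
    show "Limsup (at_right 0) (\<lambda>\<epsilon>. ereal (ln (real (covering_number (UNIV :: 'k set) \<epsilon>))) / ereal \<bar>ln \<epsilon>\<bar>)
        \<le> Limsup (at_right 0) (\<lambda>\<epsilon>. h_UC shift shift_dist ?G \<epsilon> / ereal \<bar>ln \<epsilon>\<bar>)"
    proof (rule Limsup_rescale[of "1 / 2"])
      fix \<epsilon> :: real assume "\<epsilon> > 0"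
      then show "ereal (ln (real (covering_number (UNIV :: 'k set) \<epsilon>))) \<le> h_UC shift shift_dist ?G (1 / 2 * \<epsilon>)"
        using h_UC_lower[of "1 / 2 * \<epsilon>"] by simp
    qed simp
  qed
  have "L = Limsup (at_right 0) (\<lambda>\<epsilon>. 1 / ereal \<bar>ln \<epsilon>\<bar> * E \<epsilon>)"
    unfolding L_def by (simp add: divide_ereal_def mult.commute)
  then show ?thesis using P B UC unfolding E_def by simp
qed

end
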